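(* Let $\kappa\in\mathbb R$ and let $X=H^1(\mathbb R)\cap W^{1,\infty}(\mathbb R)$. There exist a nonincreasing function $T=T(\|u_0\|_X)>0$ of $\|u_0\|_X$ and a universal constant $c>0$ such that, for every $u_0\in X$, the initial value problem for the Camassa--Holm equation $$\partial_tu+\kappa\,\partial_xu+3u\,\partial_xu-\partial_t\partial_x^2u=2\,\partial_xu\,\partial_x^2u+u\,\partial_x^3u,\qquad u(x,0)=u_0(x),$$ has a unique solution $u=u(x,t)$, with $T=T(\|u_0\|_X)$, in the class $$Z_T=C([-T,T]:H^1(\mathbb R))\cap L^\infty([-T,T]:W^{1,\infty}(\mathbb R))\cap C^1((-T,T):L^2(\mathbb R)),$$ and this solution satisfies $$\sup_{t\in[-T,T]}\|u(\cdot,t)\|_X=\sup_{t\in[-T,T]}\bigl(\|u(\cdot,t)\|_{H^1}+\|u(\cdot,t)\|_{W^{1,\infty}}\bigr)\le c\,\|u_0\|_X .$$ Moreover, given $B>0$, the map $u_0\mapsto u$ taking the data to the solution is continuous from the ball $\{u_0\in X:\|u_0\|_X\le B\}$ (with the $X$-norm) into $Z_{T(B)}$, where $Z_{T(B)}$ is given the topology of $C([-T(B),T(B)]:H^1(\mathbb R))\cap C^1((-T(B),T(B)):L^2(\mathbb R))$, i.e. convergence means convergence to $0$ of $\sup_t\|u_1(\cdot,t)-u_2(\cdot,t)\|_{H^1}+\sup_t\|\partial_tu_1(\cdot,t)-\partial_tu_2(\cdot,t)\|_{L^2}$.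
   Context: $W^{1,\infty}(\mathbb R)=\{f\in L^\infty(\mathbb R): f'\in L^\infty(\mathbb R)\}$ (distributional derivative), i.e. bounded Lipschitz functions. $\|f\|_X=\|f\|_{H^1}+\|f\|_{W^{1,\infty}}$. For functions in $Z_T$ the equation is understood in its nonlocal form $\partial_tu+u\,\partial_xu=-\partial_x(1-\partial_x^2)^{-1}\bigl(\kappa u+u^2+\tfrac12(\partial_xu)^2\bigr)$, as an identity in $L^2(\mathbb R)$, where $(1-\partial_x^2)^{-1}$ is convolution with $G(x)=\tfrac12e^{-|x|}$. *)

theory Defs
  imports "HOL-Analysis.Analysis" "HOL-Probability.Essential_Supremum"
begin

text \<open>
  Elements of the function spaces below are represented by Borel functions on the real line;
  two functions represent the same element iff they agree almost everywhere. (Every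
  Lebesgue measurable function agrees almost everywhere with a Borel one.)
\<close>

definition L2_space :: "(real \<Rightarrow> real) set" where
  "L2_space = {f \<in> borel_measurable lborel. integrable lborel (\<lambda>x. (f x)\<^sup>2)}"

definition L2_norm :: "(real \<Rightarrow> real) \<Rightarrow> real" where
  "L2_norm f = sqrt (LINT x|lborel. (f x)\<^sup>2)"

definition Linf_space :: "(real \<Rightarrow> real) set" where
  "Linf_space = {f \<in> borel_measurable lborel. \<exists>C. AE x in lborel. \<bar>f x\<bar> \<le> C}"

definition Linf_norm :: "(real \<Rightarrow> real) \<Rightarrow> real" where
  "Linf_norm f = real_of_ereal (esssup lborel (\<lambda>x. ereal \<bar>f x\<bar>))"

definition locally_integrable :: "(real \<Rightarrow> real) \<Rightarrow> bool" where
  "locally_integrable f \<longleftrightarrow>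
     f \<in> borel_measurable lborel \<and> (\<forall>a b. set_integrable lborel {a..b} f)"

definition test_function :: "(real \<Rightarrow> real) \<Rightarrow> bool" where
  "test_function \<phi> \<longleftrightarrow>
     (\<forall>n. (deriv ^^ n) \<phi> differentiable_on UNIV) \<and> compact (closure {x. \<phi> x \<noteq> 0})"

definition has_weak_deriv :: "(real \<Rightarrow> real) \<Rightarrow> (real \<Rightarrow> real) \<Rightarrow> bool" where
  "has_weak_deriv f g \<longleftrightarrow>
     locally_integrable f \<and> locally_integrable g \<and>
     (\<forall>\<phi>. test_function \<phi> \<longrightarrow>
        (LINT x|lborel. f x * deriv \<phi> x) = - (LINT x|lborel. g x * \<phi> x))"

text \<open>
  The distributional derivative, when it is a function; it is unique up to null sets, and
  \<open>weak_deriv\<close> picks a representative.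
\<close>

definition weak_deriv :: "(real \<Rightarrow> real) \<Rightarrow> real \<Rightarrow> real" where
  "weak_deriv f = (SOME g. has_weak_deriv f g)"

definition H1_space :: "(real \<Rightarrow> real) set" where
  "H1_space = {f \<in> L2_space. \<exists>g \<in> L2_space. has_weak_deriv f g}"

definition H1_norm :: "(real \<Rightarrow> real) \<Rightarrow> real" where
  "H1_norm f = sqrt ((L2_norm f)\<^sup>2 + (L2_norm (weak_deriv f))\<^sup>2)"

definition W1inf_space :: "(real \<Rightarrow> real) set" where
  "W1inf_space = {f \<in> Linf_space. \<exists>g \<in> Linf_space. has_weak_deriv f g}"

definition W1inf_norm :: "(real \<Rightarrow> real) \<Rightarrow> real" where
  "W1inf_norm f = Linf_norm f + Linf_norm (weak_deriv f)"

definition X_space :: "(real \<Rightarrow> real) set" where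
  "X_space = H1_space \<inter> W1inf_space"

definition X_norm :: "(real \<Rightarrow> real) \<Rightarrow> real" where
  "X_norm f = H1_norm f + W1inf_norm f"

text \<open>
  A space-time function is written with the time variable first: \<open>u t x\<close> stands for
  $u(x,t)$, so that \<open>u t\<close> is the profile $u(\cdot,t)$.
\<close>

definition has_L2_time_deriv ::
    "(real \<Rightarrow> real \<Rightarrow> real) \<Rightarrow> (real \<Rightarrow> real) \<Rightarrow> real \<Rightarrow> bool" where
  "has_L2_time_deriv u v t \<longleftrightarrow> v \<in> L2_space \<and>
     ((\<lambda>h. L2_norm (\<lambda>x. (u (t + h) x - u t x) / h - v x)) \<longlongrightarrow> 0) (at 0)"

text \<open>Again unique up to null sets (for curves in \<open>L2_space\<close>).\<close>

definition time_deriv :: "(real \<Rightarrow> real \<Rightarrow> real) \<Rightarrow> real \<Rightarrow> real \<Rightarrow> real" where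
  "time_deriv u t = (SOME v. has_L2_time_deriv u v t)"

definition C_H1 :: "real \<Rightarrow> (real \<Rightarrow> real \<Rightarrow> real) set" where
  "C_H1 T = {u. (\<forall>t\<in>{-T..T}. u t \<in> H1_space) \<and>
     (\<forall>s\<in>{-T..T}. ((\<lambda>t. H1_norm (\<lambda>x. u t x - u s x)) \<longlongrightarrow> 0) (at s within {-T..T}))}"

text \<open>
  Measurability in time is not imposed separately: $W^{1,\infty}$ is not separable, so only
  weak-* measurability is meaningful here, and it is automatic for the curves in \<open>C_H1 T\<close> with
  which this class is intersected.
\<close>

definition Linf_W1inf :: "real \<Rightarrow> (real \<Rightarrow> real \<Rightarrow> real) set" where
  "Linf_W1inf T =
     {u. \<exists>M. AE t in lborel. t \<in> {-T..T} \<longrightarrow> u t \<in> W1inf_space \<and> W1inf_norm (u t) \<le> M}"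

definition C1_L2 :: "real \<Rightarrow> (real \<Rightarrow> real \<Rightarrow> real) set" where
  "C1_L2 T = {u. (\<forall>t\<in>{-T<..<T}. u t \<in> L2_space) \<and>
     (\<forall>t\<in>{-T<..<T}. \<exists>v. has_L2_time_deriv u v t) \<and>
     (\<forall>s\<in>{-T<..<T}.
        ((\<lambda>t. L2_norm (\<lambda>x. time_deriv u t x - time_deriv u s x)) \<longlongrightarrow> 0) (at s))}"

definition Z_space :: "real \<Rightarrow> (real \<Rightarrow> real \<Rightarrow> real) set" where
  "Z_space T = C_H1 T \<inter> Linf_W1inf T \<inter> C1_L2 T"

definition Z_dist ::
    "real \<Rightarrow> (real \<Rightarrow> real \<Rightarrow> real) \<Rightarrow> (real \<Rightarrow> real \<Rightarrow> real) \<Rightarrow> ennreal" where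
  "Z_dist T u v =
     (SUP t\<in>{-T..T}. ennreal (H1_norm (\<lambda>x. u t x - v t x))) +
     (SUP t\<in>{-T<..<T}. ennreal (L2_norm (\<lambda>x. time_deriv u t x - time_deriv v t x)))"

text \<open>The operator $(1-\partial_x^2)^{-1}$, i.e. convolution with $\frac12 e^{-|x|}$.\<close>

definition inv_Helmholtz :: "(real \<Rightarrow> real) \<Rightarrow> real \<Rightarrow> real" where
  "inv_Helmholtz f x = (LINT y|lborel. exp (- \<bar>x - y\<bar>) / 2 * f y)"

definition CH_solution ::
    "real \<Rightarrow> real \<Rightarrow> (real \<Rightarrow> real) \<Rightarrow> (real \<Rightarrow> real \<Rightarrow> real) \<Rightarrow> bool" where
  "CH_solution \<kappa> T u0 u \<longleftrightarrow>
     u \<in> Z_space T \<and> (AE x in lborel. u 0 x = u0 x) \<and>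
     (\<forall>t\<in>{-T<..<T}. AE x in lborel.
        time_deriv u t x + u t x * weak_deriv (u t) x =
        - weak_deriv (inv_Helmholtz
             (\<lambda>y. \<kappa> * u t y + (u t y)\<^sup>2 + (weak_deriv (u t) y)\<^sup>2 / 2)) x)"

text \<open>
  The data-to-solution map: the solution is unique in \<open>Z_space T\<close> up to null sets at each time,
  and a representative is chosen.
\<close>

definition CH_flow ::
    "real \<Rightarrow> real \<Rightarrow> (real \<Rightarrow> real) \<Rightarrow> real \<Rightarrow> real \<Rightarrow> real" where
  "CH_flow \<kappa> T u0 = (SOME u. CH_solution \<kappa> T u0 u)"

end

theory Submission
  imports Defs
begin

text \<open>
  The equation loses no derivative along characteristics. Let \<open>q\<close> be the flow of \<open>u\<close>, so that
  \<open>\<partial>\<^sub>t q = u \<circ> q\<close>, and let \<open>U = u \<circ> q\<close>. Then the nonlocal form reads \<open>\<partial>\<^sub>t U = - Q(q, U)\<close>, where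
  \<open>Q = \<partial>\<^sub>x G * (\<kappa> u + u\<^sup>2 + u\<^sub>x\<^sup>2 / 2)\<close> is evaluated at \<open>q\<close>. After the change of variables \<open>y = q(\<eta>)\<close> the
  force \<open>Q\<close> is an integral over \<open>\<eta>\<close> in which only \<open>U\<close>, \<open>q\<close> and their first derivatives occur, and it
  is a Lipschitz function of \<open>(q, U)\<close> as long as the slopes of \<open>q\<close> stay between two positive
  constants \<open>\<alpha>\<close> and \<open>\<beta>\<close>. The problem is thus an ordinary differential equation, which Picard
  iteration solves.

  One argument serves the supremum norms and the square integrals together. A function \<open>h\<close> is
  measured by a pointwise bound \<open>|h| \<le> k E\<close>, \<open>|h'| \<le> k E\<close> with a nonnegative bounded weight
  \<open>E\<close> (\<open>wbd\<close>). The force has exponentially decaying kernel, so it respects such bounds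
  whenever \<open>E\<close> dominates its own convolution with an exponential up to a constant
  (\<open>lag_Q_wbd\<close>, \<open>lag_Q_diff_wbd\<close>). Every datum in \<open>X\<close> is dominated by such a weight: if \<open>N\<close> is the
  larger of \<open>|u\<^sub>0|\<close> and \<open>|u\<^sub>0'|\<close>, then \<open>N\<close> plus its convolution with \<open>exp (- |x| / 8)\<close>
  will do (\<open>amp\<close>), and both its supremum and its \<open>L2\<close> norm are at most a multiple of the norm
  of \<open>u\<^sub>0\<close> in \<open>X\<close>. A constant weight is admissible as well; it yields convergence of the iteration
  and uniqueness in Lagrangian variables (\<open>lag_exists\<close>, \<open>lag_unique\<close>).

  The Lagrangian solution is carried back by \<open>u = U \<circ> q\<^sup>-\<^sup>1\<close>. The derivative \<open>u\<^sub>x\<close> is merely bounded and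
  may jump, so continuity in time fails in \<open>W\<^sup>1\<^sup>,\<^sup>\<infinity>\<close>; continuity in \<open>H1\<close> and differentiability in \<open>L2\<close> rest on the
  continuity in \<open>L2\<close> of the composition with bi-Lipschitz maps (\<open>N2_compose_continuous\<close>).

  For uniqueness, a solution in the class is Lipschitz in \<open>x\<close>, so its characteristics exist, but it
  has a time derivative only in \<open>L2\<close> and cannot be differentiated along a single characteristic.
  Instead its integral over the short interval between \<open>q\<close> and \<open>q + \<epsilon>\<close> is differentiated; divided by
  \<open>\<epsilon>\<close>, this gives the Lagrangian equation with an error of order \<open>\<epsilon>\<close>
  (\<open>Lagrangian_momentum\<close>). Uniqueness in Lagrangian variables then applies.

  For continuous dependence, two Lagrangian solutions whose data differ by at most a small weight
  \<open>E\<^sub>0\<close> differ for all times by at most a multiple of \<open>E\<^sub>0 + d (D + D')\<close>, where \<open>D\<close> and \<open>D'\<close> are their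
  weights and \<open>d\<close> bounds \<open>E\<^sub>0\<close> (\<open>difference_weight\<close>). This is small in \<open>L2\<close>, and the continuity of
  compositions turns it into a bound for the Eulerian difference; compactness of the time interval
  makes the bound uniform in time (\<open>continuous_dependence\<close>).
\<close>

section \<open>Integrals over intervals\<close>

abbreviation Borel :: "('a::topological_space \<Rightarrow> 'b::topological_space) set"
  where "Borel \<equiv> borel_measurable borel"

abbreviation wd :: "(real \<Rightarrow> real) \<Rightarrow> real \<Rightarrow> real"
  where "wd \<equiv> weak_deriv"

abbreviation loc_int :: "(real \<Rightarrow> real) \<Rightarrow> bool"
  where "loc_int \<equiv> locally_integrable"

abbreviation seg_int :: "(real => real) => real => real => real" where
 "seg_int g a b \<equiv> set_lebesgue_integral lborel {a..b} g"

lemma loc_int_borel [measurable_dest]: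
 "loc_int g ==> g \<in> Borel"
 by (simp add: locally_integrable_def)

lemma loc_int_seg: "loc_int g ==> set_integrable lborel {a..b} g"
 by (simp add: locally_integrable_def)

lemma loc_int_hk:
 assumes "loc_int g"
 shows "g integrable_on {a..b}" "seg_int g a b = integral {a..b} g"
 using set_borel_integral_eq_integral[OF loc_int_seg[OF assms]] by auto

lemma seg_int_combine:
 assumes "loc_int g" "a <= b" "b <= c"
 shows "seg_int g a c = seg_int g a b + seg_int g b c"
 unfolding loc_int_hk(2)[OF assms(1)]
 using Henstock_Kurzweil_Integration.integral_combine[OF assms(2,3)] loc_int_hk(1)[OF assms(1)]
 by metis

lemma seg_int_self [simp]: "seg_int g a a = 0" "set_lebesgue_integral lborel {a} g = (0::real)" for g :: "real => real"
proof -
 have "AE x in lborel. indicator {a..a} x *\<^sub>R g x = 0"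
  using AE_lborel_singleton[of a] by eventually_elim (auto simp: indicator_def)
 then have "(LINT x|lborel. indicator {a..a} x *\<^sub>R g x) = 0"
  by (rule integral_eq_zero_AE)
 then show "seg_int g a a = 0" "set_lebesgue_integral lborel {a} g = 0"
  by (simp_all add: set_lebesgue_integral_def)
qed

lemma loc_int_bounded:
 assumes "g \<in> Borel" "AE x in lborel. abs (g x) <= B"
 shows "loc_int g"
 unfolding locally_integrable_def set_integrable_def
proof (intro conjI allI)
 show "g \<in> borel_measurable lborel" using assms by simp
 fix a b :: real
 have "integrable lborel (%x. indicator {a..b} x * B)"
  by (intro integrable_mult_left integrable_real_indicator) (auto simp: emeasure_lborel_Icc_eq)
 then show "integrable lborel (%x. indicator {a..b} x *\<^sub>R g x)"
 proof (rule Bochner_Integration.integrable_bound)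
  show "(%x. indicator {a..b} x *\<^sub>R g x) \<in> borel_measurable lborel" using assms by simp
  show "AE x in lborel. norm (indicator {a..b} x *\<^sub>R g x) <= norm (indicator {a..b} x * B)"
   using assms(2) by eventually_elim (auto simp: indicator_def)
 qed
qed

lemma loc_int_const: "loc_int (%_. c)"
 by (rule loc_int_bounded[of _ "abs c"]) auto

lemma loc_int_add:
 "loc_int f ==> loc_int g ==> loc_int (%x. f x + g x)"
 by (auto simp: locally_integrable_def)

lemma loc_int_diff:
 "loc_int f ==> loc_int g ==> loc_int (%x. f x - g x)"
 by (auto simp: locally_integrable_def)

lemma loc_int_cmult:
 "loc_int f ==> loc_int (%x. c * f x)"
 by (auto simp: locally_integrable_def)

lemma seg_int_add: "loc_int f ==> loc_int g ==>
  seg_int (%x. f x + g x) a b = seg_int f a b + seg_int g a b"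
 by (intro set_integral_add loc_int_seg)

lemma seg_int_diff: "loc_int f ==> loc_int g ==>
  seg_int (%x. f x - g x) a b = seg_int f a b - seg_int g a b"
 by (intro set_integral_diff loc_int_seg)

lemma seg_int_cmult: "seg_int (%x. c * f x) a b = c * seg_int f a b"
 by simp

lemma seg_int_const: "a <= b ==> seg_int (%_. c) a b = c * (b - a)"
 by (simp add: set_lebesgue_integral_def)

lemma seg_int_mono_AE:
 assumes "loc_int f" "loc_int g" "AE x in lborel. f x <= g x"
 shows "seg_int f a b <= seg_int g a b"
 unfolding set_lebesgue_integral_def
proof (rule integral_mono_AE)
 show "integrable lborel (%x. indicator {a..b} x *\<^sub>R f x)" "integrable lborel (%x. indicator {a..b} x *\<^sub>R g x)"
  using assms(1,2) by (auto simp: locally_integrable_def set_integrable_def)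
 show "AE x in lborel. indicator {a..b} x *\<^sub>R f x <= indicator {a..b} x *\<^sub>R g x"
  using assms(3) by eventually_elim (auto simp: indicator_def)
qed

lemma seg_int_cong_AE:
 assumes "f \<in> Borel" "g \<in> Borel" "AE x in lborel. f x = g x"
 shows "seg_int f a b = seg_int g a b"
 unfolding set_lebesgue_integral_def
 by (rule integral_cong_AE) (use assms in auto)

lemma seg_int_abs_le:
 assumes "loc_int f" "loc_int D" "AE x in lborel. abs (f x) <= D x"
 shows "abs (seg_int f a b) <= seg_int D a b"
proof -
 have "seg_int f a b <= seg_int D a b"
  by (rule seg_int_mono_AE) (use assms in \<open>auto elim: AE_mp\<close>)
 moreover have "seg_int (%x. (-1) * f x) a b <= seg_int D a b"
  by (rule seg_int_mono_AE) (use assms in \<open>auto intro: loc_int_cmult[where f=f and c="-1", simplified] elim: AE_mp\<close>)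
 ultimately show ?thesis by (simp add: seg_int_cmult[where f=f and c="-1", simplified])
qed

lemma AE_seg_average_tendsto:
 assumes "loc_int g"
 shows "AE x in lborel. ((%h. seg_int g x (x + h) / h) \<longlongrightarrow> g x) (at_right 0)"
proof -
 have "!!a b::real. g integrable_on cbox a b"
  using loc_int_hk(1)[OF assms] by (simp add: box_real)
 from integrable_ccontinuous_explicit[OF this] obtain N where N: "negligible N"
  and *: "!!x e. x \<notin> N ==> 0 < e ==>
       \<exists>d>0. \<forall>h. 0 < h & h < d -->
            norm (integral (cbox x (x + h *\<^sub>R One)) g /\<^sub>R h ^ DIM(real) - g x) < e"
  by blast
 have "AE x in lebesgue. x \<notin> N"
  using N by (simp add: negligible_iff_null_sets AE_not_in)
 then have "AE x in lborel. x \<notin> N"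
  by (simp add: AE_completion_iff)
 then show ?thesis
 proof eventually_elim
  case (elim x)
  show ?case
  proof (rule tendstoI)
   fix e :: real assume "0 < e"
   from *[OF elim this] obtain d where d: "d > 0"
    "!!h. 0 < h ==> h < d ==> norm (integral (cbox x (x + h *\<^sub>R One)) g /\<^sub>R h ^ DIM(real) - g x) < e"
    by auto
   have "\<forall>\<^sub>F h in at_right 0. h < d" "\<forall>\<^sub>F h in at_right (0::real). 0 < h"
    using d(1) eventually_at_right_real[of 0 d] by (auto simp: eventually_at_right_less elim: eventually_mono)
   then show "\<forall>\<^sub>F h in at_right 0. dist (seg_int g x (x + h) / h) (g x) < e"
   proof eventually_elim
    case (elim h)
    with d(2)[of h] show ?case
     by (simp add: loc_int_hk(2)[OF assms] dist_norm divide_inverse mult.commute)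
   qed
  qed
 qed
qed

text \<open>Lebesgue differentiation turns comparison of all integrals into comparison almost everywhere.\<close>

lemma AE_le_of_seg_int:
 assumes "loc_int f" "loc_int g"
  and le: "!!a b. a <= b ==> seg_int f a b <= seg_int g a b"
 shows "AE x in lborel. f x <= g x"
 using AE_seg_average_tendsto[OF assms(1)] AE_seg_average_tendsto[OF assms(2)]
proof eventually_elim
 case (elim x)
 have "\<forall>\<^sub>F h in at_right (0::real). 0 < h" by (simp add: eventually_at_right_less)
 then have "\<forall>\<^sub>F h in at_right 0. seg_int f x (x + h) / h <= seg_int g x (x + h) / h"
  by eventually_elim (intro divide_right_mono le, auto)
 with elim show ?case
  by (intro tendsto_le[OF _ elim(2) elim(1)]) auto
qed

lemma AE_eq_of_seg_int:
 assumes "loc_int f" "loc_int g"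
  and "!!a b. a <= b ==> seg_int f a b = seg_int g a b"
 shows "AE x in lborel. f x = g x"
 using AE_le_of_seg_int[OF assms(1,2)] AE_le_of_seg_int[OF assms(2,1)] assms(3)
 by (force elim: AE_mp)

lemma AE_abs_le_of_seg_int:
 assumes "loc_int f" "loc_int D"
  and le: "!!a b. a <= b ==> abs (seg_int f a b) <= seg_int D a b"
 shows "AE x in lborel. abs (f x) <= D x"
proof -
 have 1: "AE x in lborel. f x <= D x"
  by (rule AE_le_of_seg_int) (use assms abs_le_D1 in blast)+
 have 2: "AE x in lborel. (-1) * f x <= D x"
  by (rule AE_le_of_seg_int) (use assms loc_int_cmult[where f=f and c="-1"] in \<open>auto dest: le[THEN abs_le_D2] simp: seg_int_cmult[where f=f and c="-1", simplified]\<close>)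
 from 1 2 show ?thesis by eventually_elim auto
qed

subsection \<open>Primitives\<close>

definition primitive :: "(real => real) => (real => real) => bool" where
 "primitive f g \<longleftrightarrow> loc_int g & (\<forall>a b. a <= b --> f b - f a = seg_int g a b)"

lemma primitiveD: "primitive f g ==> a <= b ==> f b - f a = seg_int g a b"
 and primitive_loc: "primitive f g ==> loc_int g"
 by (auto simp: primitive_def)

lemma primitive_unique:
 assumes "primitive f g" "primitive f g'"
 shows "AE x in lborel. g x = g' x"
 using assms by (intro AE_eq_of_seg_int) (auto simp: primitive_def)

lemma primitive_add:
 "primitive f g ==> primitive f' g' ==> primitive (%x. f x + f' x) (%x. g x + g' x)"
 by (simp add: primitive_def loc_int_add seg_int_add) (smt (verit))

lemma primitive_cmult:
 "primitive f g ==> primitive (%x. c * f x) (%x. c * g x)"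
 by (auto simp: primitive_def loc_int_cmult right_diff_distrib[symmetric])

lemma primitive_diff:
 assumes "primitive f g" "primitive f' g'"
 shows "primitive (%x. f x - f' x) (%x. g x - g' x)"
 using primitive_add[OF assms(1) primitive_cmult[where c="-1", OF assms(2)]] by simp

lemma primitive_exists:
 assumes "loc_int g"
 shows "\<exists>f. primitive f g & f c = 0"
proof -
 define f where "f x = (if c <= x then seg_int g c x else - seg_int g x c)" for x
 have "f b - f a = seg_int g a b" if "a <= b" for a b
  using that seg_int_combine[OF assms, of c a b] seg_int_combine[OF assms, of a c b]
   seg_int_combine[OF assms, of a b c] by (auto simp: f_def)
 moreover have "f c = 0" by (simp add: f_def)
 ultimately show ?thesis using assms by (auto simp: primitive_def)
qed

lemma primitive_continuous:
 assumes "primitive f g"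
 shows "continuous_on UNIV f"
proof -
 have g: "loc_int g" using assms by (rule primitive_loc)
 have "isCont f x" for x
 proof -
  have "continuous_on {x-1..x+1} (%y. integral {x-1..y} g)"
   by (rule indefinite_integral_continuous_1) (rule loc_int_hk(1)[OF g])
  then have "continuous_on {x-1..x+1} (%y. f (x-1) + integral {x-1..y} g)"
   by (intro continuous_intros)
  moreover have "f (x-1) + integral {x-1..y} g = f y" if "y \<in> {x-1..x+1}" for y
   using primitiveD[OF assms, of "x-1" y] that by (simp add: loc_int_hk(2)[OF g])
  ultimately have "continuous_on {x-1..x+1} f"
   by (metis (no_types, lifting) continuous_on_cong)
  then show "isCont f x"
   by (rule continuous_on_interior) simp
 qed
 then show ?thesis by (simp add: continuous_on_eq_continuous_at)
qed

lemma primitive_borel: "primitive f g ==> f \<in> Borel"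
 by (intro borel_measurable_continuous_onI primitive_continuous)

lemma continuous_loc_int:
 assumes "continuous_on UNIV (f::real => real)"
 shows "loc_int f"
 unfolding locally_integrable_def
 using assms
 by (auto intro!: borel_measurable_continuous_onI borel_integrable_atLeastAtMost'
   intro: continuous_on_subset)

lemma continuous_primitive:
 assumes "!!x. (f has_real_derivative f' x) (at x)" "continuous_on UNIV f'"
 shows "primitive f f'"
proof -
 have l: "loc_int f'" by (rule continuous_loc_int[OF assms(2)])
 have "(f' has_integral f b - f a) {a..b}" if "a <= b" for a b
  by (rule fundamental_theorem_of_calculus[OF that])
   (auto simp: has_real_derivative_iff_has_vector_derivative[symmetric] intro: assms(1) DERIV_subset)
 then show ?thesis
  unfolding primitive_def loc_int_hk(2)[OF l] using l by (metis integral_unique)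
qed

lemma continuous_AE_eq_imp_eq:
 assumes "continuous_on UNIV (f::real=>real)" "continuous_on UNIV g" "AE x in lborel. f x = g x"
 shows "f = g"
proof -
 have "AE x in lebesgue. f x - g x = 0"
  using assms(3) by (auto simp: AE_completion_iff elim: AE_mp)
 then have n: "negligible {x. f x - g x ~= 0}"
  by (simp add: eventually_ae_filter_negligible) (metis (mono_tags, lifting) negligible_subset)
 have "open {x. f x - g x ~= 0}"
  by (intro open_Collect_neq continuous_intros assms)
 with n have "{x. f x - g x ~= 0} = {}" using open_not_negligible by blast
 then show ?thesis by auto
qed

subsection \<open>Products\<close>

lemma loc_int_mult:
 assumes "loc_int g" "continuous_on UNIV h"
 shows "loc_int (%x. g x * h x)"
 unfolding locally_integrable_def set_integrable_def
proof (intro conjI allI)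
 have [measurable]: "g \<in> Borel" "h \<in> Borel"
  using assms by (auto simp: loc_int_borel intro: borel_measurable_continuous_onI)
 show "(%x. g x * h x) \<in> borel_measurable lborel" by simp
 fix a b :: real
 have "compact (h ` {a..b})"
  by (intro compact_continuous_image) (auto intro: continuous_on_subset[OF assms(2)])
 then obtain B where B: "!!x. x \<in> {a..b} ==> abs (h x) <= B"
  by (meson bounded_real compact_imp_bounded image_eqI)
 have "integrable lborel (%x. B * (indicator {a..b} x *\<^sub>R g x))"
  using loc_int_seg[OF assms(1), of a b] by (auto simp: set_integrable_def)
 then show "integrable lborel (%x. indicator {a..b} x *\<^sub>R (g x * h x))"
 proof (rule Bochner_Integration.integrable_bound)
  show "AE x in lborel. norm (indicator {a..b} x *\<^sub>R (g x * h x)) <= norm (B * (indicator {a..b} x *\<^sub>R g x))"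
  proof (rule AE_I2)
   fix x
   show "norm (indicator {a..b} x *\<^sub>R (g x * h x)) <= norm (B * (indicator {a..b} x *\<^sub>R g x))"
   proof (cases "x \<in> {a..b}")
    case True
    then have "abs (h x) <= abs B" using B[of x] by linarith
    then show ?thesis using True mult_mono[of "abs (h x)" "abs B" "abs (g x)" "abs (g x)"]
     by (simp add: abs_mult mult.commute)
   qed simp
  qed
 qed simp
qed

lemma loc_int_abs: "loc_int g ==> loc_int (%x. abs (g x))"
 by (auto simp: locally_integrable_def intro: set_integrable_abs)

lemma primitive_abs_le:
 assumes "primitive f g" "AE x in lborel. abs (g x) <= L"
 shows "abs (f y - f x) <= L * abs (y - x)"
proof -
 have *: "abs (f y - f x) <= L * (y - x)" if "x <= y" for x y
  using seg_int_abs_le[OF primitive_loc[OF assms(1)] loc_int_const[of L] assms(2), of x y] that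
  by (simp add: primitiveD[OF assms(1)] seg_int_const)
 show ?thesis using *[of x y] *[of y x] by (cases "x <= y") (auto simp: abs_minus_commute)
qed

text \<open>By Fubini, both sides are integrals of \<open>g \<otimes> k\<close>: the square over an interval splits into two triangles.\<close>

lemma primitive_mult:
 assumes f: "primitive f g" and h: "primitive h k"
 shows "primitive (%x. f x * h x) (%x. f x * k x + g x * h x)"
proof -
 have fc: "continuous_on UNIV f" and hc: "continuous_on UNIV h"
  using f h primitive_continuous by auto
 have gl: "loc_int g" and kl: "loc_int k"
  using f h by (auto intro: primitive_loc)
 note [measurable] = loc_int_borel[OF gl] loc_int_borel[OF kl]
 note kf = loc_int_mult[OF kl fc] and gh = loc_int_mult[OF gl hc]
 have "f b * h b - f a * h a = seg_int (%x. k x * f x + g x * h x) a b" if ab: "a <= b" for a b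
 proof -
  define g' k' where "g' y = indicator {a..b} y * g y" and "k' x = indicator {a..b} x * k x" for x y
  have [measurable]: "g' \<in> Borel" "k' \<in> Borel" unfolding g'_def[abs_def] k'_def[abs_def] by measurable
  have int: "integrable lborel g'" "integrable lborel k'"
   using loc_int_seg[OF gl, of a b] loc_int_seg[OF kl, of a b] by (auto simp: g'_def[abs_def] k'_def[abs_def] set_integrable_def)
  let ?F = "%(x, y). if y <= x then k' x * g' y else 0"
  have "integrable (lborel \<Otimes>\<^sub>M lborel) ?F"
  proof (rule lborel_pair.Fubini_integrable)
   have i: "integrable lborel (%y. if y <= x then k' x * g' y else 0)" for x
    by (rule Bochner_Integration.integrable_bound[OF integrable_mult_right[OF int(1), of "k' x"]]) auto
   then show "AE x in lborel. integrable lborel (%y. ?F (x, y))" by simp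
   show "integrable lborel (%x. LINT y|lborel. norm (?F (x, y)))"
   proof (rule Bochner_Integration.integrable_bound[OF integrable_mult_left[OF integrable_norm[OF int(2)], of "LINT y|lborel. norm (g' y)"]])
    have "(LINT y|lborel. norm (?F (x, y))) <= (LINT y|lborel. norm (k' x) * norm (g' y))" for x
     by (rule integral_mono[OF integrable_norm]) (use i[of x] int in \<open>auto simp: indicator_def abs_mult\<close>)
    then show "AE x in lborel. norm (LINT y|lborel. norm (?F (x, y))) <= norm (norm (k' x) * (LINT y|lborel. norm (g' y)))"
     by (simp add: integral_nonneg_AE)
   qed measurable
  qed measurable
  then have "(LINT y|lborel. LINT x|lborel. ?F (x, y)) = (LINT x|lborel. LINT y|lborel. ?F (x, y))"
   by (intro lborel_pair.Fubini_integral) simp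
  moreover have "(LINT x|lborel. ?F (x, y)) = indicator {a..b} y *\<^sub>R (g y * (h b - h y))" for y
  proof (cases "y \<in> {a..b}")
   case True
   have "(LINT x|lborel. ?F (x, y)) = (LINT x|lborel. g y * (indicator {y..b} x *\<^sub>R k x))"
    using True by (intro Bochner_Integration.integral_cong) (auto simp: g'_def k'_def indicator_def)
   then show ?thesis using True primitiveD[OF h, of y b] by (simp add: set_lebesgue_integral_def)
  next
   case False
   then have "g' y = 0" by (simp add: g'_def)
   then show ?thesis using False by (simp cong: if_cong)
  qed
  moreover have "(LINT y|lborel. ?F (x, y)) = indicator {a..b} x *\<^sub>R (k x * (f x - f a))" for x
  proof (cases "x \<in> {a..b}")
   case True
   have "(LINT y|lborel. ?F (x, y)) = (LINT y|lborel. k x * (indicator {a..x} y *\<^sub>R g y))"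
    using True by (intro Bochner_Integration.integral_cong) (auto simp: g'_def k'_def indicator_def)
   then show ?thesis using True primitiveD[OF f, of a x] by (simp add: set_lebesgue_integral_def)
  next
   case False
   then have "k' x = 0" by (simp add: k'_def)
   then show ?thesis using False by (simp cong: if_cong)
  qed
  ultimately have "seg_int (%y. g y * (h b - h y)) a b = seg_int (%x. k x * (f x - f a)) a b"
   by (simp add: set_lebesgue_integral_def)
  moreover have "seg_int (%y. g y * (h b - h y)) a b = h b * (f b - f a) - seg_int (%x. g x * h x) a b"
   unfolding primitiveD[OF f ab] seg_int_cmult[symmetric] seg_int_diff[OF loc_int_cmult[OF gl] gh, symmetric] by (simp add: algebra_simps)
  moreover have "seg_int (%x. k x * (f x - f a)) a b = seg_int (%x. k x * f x) a b - f a * (h b - h a)"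
   unfolding primitiveD[OF h ab] seg_int_cmult[symmetric] seg_int_diff[OF kf loc_int_cmult[OF kl], symmetric] by (simp add: algebra_simps)
  ultimately show ?thesis unfolding seg_int_add[OF kf gh] by (simp add: algebra_simps)
 qed
 then show ?thesis using loc_int_add[OF kf gh] by (simp add: primitive_def mult.commute)
qed

subsection \<open>Test functions\<close>

definition flat_exp :: "real => real poly => real => real" where
 "flat_exp c p x = (if 0 < x then poly p (1 / x) * exp (- c / x) else 0)"

lemma poly_times_exp_tendsto_0:
 fixes c :: real assumes "c > 0"
 shows "((%y. poly p y * exp (- c * y)) \<longlongrightarrow> 0) at_top"
proof -
 have 1: "((%y. y ^ k * exp (- c * y)) \<longlongrightarrow> 0) at_top" for k
 proof -
  have "filterlim (%y. c * y) at_top at_top"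
   using assms by (intro filterlim_tendsto_pos_mult_at_top[OF tendsto_const _ filterlim_ident])
  from filterlim_compose[OF tendsto_power_div_exp_0[of k] this]
  have "((%y. (c * y) ^ k / exp (c * y)) \<longlongrightarrow> 0) at_top" .
  from tendsto_mult_left[OF this, of "1 / c ^ k"] show ?thesis
   using assms by (simp add: power_mult_distrib exp_minus divide_inverse mult.assoc[symmetric])
 qed
 have "((%y. \<Sum>i\<le>degree p. coeff p i * (y ^ i * exp (- c * y))) \<longlongrightarrow> (\<Sum>i\<le>degree p. coeff p i * 0)) at_top"
  by (intro tendsto_sum tendsto_mult tendsto_const 1)
 then show ?thesis by (simp add: poly_altdef sum_distrib_right mult.assoc)
qed

lemma flat_exp_deriv:
 assumes "c > 0"
 shows "(flat_exp c p has_real_derivative flat_exp c ([:0,0,1:] * (smult c p - pderiv p)) x) (at x)"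
proof -
 consider "x > 0" | "x < 0" | "x = 0" by linarith
 then show ?thesis
 proof cases
  case 1
  have "((%x. poly p (1 / x) * exp (- c / x)) has_real_derivative
    flat_exp c ([:0,0,1:] * (smult c p - pderiv p)) x) (at x)"
   using 1 by (auto intro!: derivative_eq_intros DERIV_chain'[where g="poly p"] poly_DERIV
     simp: flat_exp_def field_simps power2_eq_square)
  moreover have "\<forall>\<^sub>F y in nhds x. y \<in> {0<..}"
   by (rule eventually_nhds_in_open) (use 1 in auto)
  then have "\<forall>\<^sub>F y in nhds x. poly p (1 / y) * exp (- c / y) = flat_exp c p y"
   by eventually_elim (simp add: flat_exp_def)
  ultimately show ?thesis using DERIV_cong_ev[OF refl _ refl, of "%x. poly p (1 / x) * exp (- c / x)" "flat_exp c p" x] by blast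
 next
  case 2
  have "\<forall>\<^sub>F y in nhds x. y \<in> {..<0}"
   by (rule eventually_nhds_in_open) (use 2 in auto)
  then have "\<forall>\<^sub>F y in nhds x. 0 = flat_exp c p y"
   by eventually_elim (simp add: flat_exp_def)
  then have "((%y. 0) has_real_derivative 0) (at x) = (flat_exp c p has_real_derivative 0) (at x)"
   by (intro DERIV_cong_ev) auto
  with 2 show ?thesis by (simp add: flat_exp_def)
 next
  case 3
  have "((%y. (flat_exp c p y - flat_exp c p 0) / (y - 0)) \<longlongrightarrow> 0) (at 0)"
  proof (rule filterlim_split_at)
   have "\<forall>\<^sub>F y in at_left 0. 0 = (flat_exp c p y - flat_exp c p 0) / (y - 0)"
    by (auto simp: eventually_at_filter flat_exp_def)
   then show "((%y. (flat_exp c p y - flat_exp c p 0) / (y - 0)) \<longlongrightarrow> 0) (at_left 0)"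
    by (rule Lim_transform_eventually[OF tendsto_const])
   have "((%y. poly ([:0,1:] * p) (inverse y) * exp (- c * inverse y)) \<longlongrightarrow> 0) (at_right 0)"
    by (rule filterlim_compose[OF poly_times_exp_tendsto_0[OF assms] filterlim_inverse_at_top_right])
   moreover have "\<forall>\<^sub>F y in at_right 0. poly ([:0,1:] * p) (inverse y) * exp (- c * inverse y) =
     (flat_exp c p y - flat_exp c p 0) / (y - 0)"
    by (auto simp: eventually_at_filter flat_exp_def field_simps)
   ultimately show "((%y. (flat_exp c p y - flat_exp c p 0) / (y - 0)) \<longlongrightarrow> 0) (at_right 0)"
    by (rule Lim_transform_eventually)
  qed
  with 3 show ?thesis by (simp add: has_field_derivative_iff flat_exp_def)
 qed
qed

inductive_set bumps :: "(real => real) set" where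
 prod: "c > 0 ==> (%x. flat_exp c p (x - a) * flat_exp c q (b - x)) \<in> bumps"
| add: "f \<in> bumps ==> g \<in> bumps ==> (%x. f x + g x) \<in> bumps"

lemma flat_exp_minus: "flat_exp c (- p) x = - flat_exp c p x"
 by (simp add: flat_exp_def)

lemma bumps_deriv:
 "f \<in> bumps ==> \<exists>f'\<in>bumps. \<forall>x. (f has_real_derivative f' x) (at x)"
proof (induction rule: bumps.induct)
 case (prod c p a q b)
 let ?d = "%p. [:0,0,1:] * (smult c p - pderiv p)"
 have "((%x. flat_exp c p (x - a) * flat_exp c q (b - x)) has_real_derivative
  flat_exp c (?d p) (x - a) * flat_exp c q (b - x) + flat_exp c p (x - a) * flat_exp c (- (?d q)) (b - x)) (at x)" for x
 proof -
  have 1: "((%x. flat_exp c p (x - a)) has_real_derivative flat_exp c (?d p) (x - a) * 1) (at x)"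
   by (rule DERIV_chain2[OF flat_exp_deriv[OF prod]]) (auto intro!: derivative_eq_intros)
  have 2: "((%x. flat_exp c q (b - x)) has_real_derivative flat_exp c (?d q) (b - x) * (-1)) (at x)"
   by (rule DERIV_chain2[OF flat_exp_deriv[OF prod]]) (auto intro!: derivative_eq_intros)
  show ?thesis
   using DERIV_mult[OF 1 2] by (simp add: flat_exp_minus minus_mult_right[symmetric] mult.commute add.commute del: mult_pCons_left mult_pCons_right mult_minus_right minus_mult_right)
 qed
 note d = this
 have m: "(%x. flat_exp c (?d p) (x - a) * flat_exp c q (b - x) + flat_exp c p (x - a) * flat_exp c (- (?d q)) (b - x)) \<in> bumps"
  by (rule bumps.add[OF bumps.prod[OF prod] bumps.prod[OF prod]])
 show ?case by (rule bexI[OF _ m]) (rule allI, rule d)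
next
 case (add f g)
 then obtain f' g' where fg: "f' \<in> bumps" "g' \<in> bumps"
  and d: "!!x. (f has_real_derivative f' x) (at x)" "!!x. (g has_real_derivative g' x) (at x)" by blast
 show ?case by (rule bexI[OF _ bumps.add[OF fg]]) (rule allI, rule DERIV_add[OF d])
qed

lemma bumps_support: "f \<in> bumps ==> \<exists>R\<ge>0. \<forall>x. abs x > R --> f x = 0"
proof (induction rule: bumps.induct)
 case (prod c p a q b)
 show ?case by (rule exI[of _ "abs a + abs b"]) (auto simp: flat_exp_def)
next
 case (add f g)
 then obtain R S where "R \<ge> 0" "\<forall>x. abs x > R --> f x = 0" "S \<ge> 0" "\<forall>x. abs x > S --> g x = 0" by auto
 then show ?case by (intro exI[of _ "max R S"]) auto
qed

lemma bumps_deriv_eq: assumes "f \<in> bumps" shows "deriv f \<in> bumps"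
proof -
 obtain f' where "f' \<in> bumps" "!!x. (f has_real_derivative f' x) (at x)" using bumps_deriv[OF assms] by auto
 moreover from this(2) have "deriv f = f'" by (intro ext DERIV_imp_deriv)
 ultimately show ?thesis by simp
qed

lemma bumps_funpow_deriv: "f \<in> bumps ==> (deriv ^^ n) f \<in> bumps"
 by (induction n) (auto intro: bumps_deriv_eq)

lemma bumps_differentiable: assumes "f \<in> bumps" shows "f differentiable_on UNIV"
proof -
 have "f differentiable at x" for x
  using bumps_deriv[OF assms] real_differentiable_def by blast
 then show ?thesis by (auto intro: differentiable_at_imp_differentiable_on)
qed

lemma bumps_continuous: "f \<in> bumps ==> continuous_on UNIV f"
 by (rule differentiable_imp_continuous_on[OF bumps_differentiable])

lemma test_function_of_deriv_bump:
 assumes "g \<in> bumps" "!!x. (f has_real_derivative g x) (at x)" "!!x. abs x > R ==> f x = 0"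
 shows "test_function f"
 unfolding test_function_def
proof (intro conjI allI)
 have d: "deriv f = g" using assms(2) by (auto intro: DERIV_imp_deriv)
 fix n
 show "(deriv ^^ n) f differentiable_on UNIV"
 proof (cases n)
  case 0
  have "f differentiable at x" for x using assms(2) real_differentiable_def by blast
  then show ?thesis using 0 by (auto intro: differentiable_at_imp_differentiable_on)
 next
  case (Suc m)
  then have "(deriv ^^ n) f = (deriv ^^ m) g" by (simp add: funpow_Suc_right d del: funpow.simps)
  then show ?thesis using bumps_differentiable[OF bumps_funpow_deriv[OF assms(1)]] by simp
 qed
next
 have "{x. f x ~= 0} \<subseteq> {-R..R}" using assms(3) by force
 then have "bounded {x. f x ~= 0}" using bounded_closed_interval bounded_subset by blast
 then show "compact (closure {x. f x ~= 0})" by (simp add: compact_closure)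
qed

lemma test_function_DERIV:
 assumes "test_function \<phi>"
 shows "(\<phi> has_real_derivative deriv \<phi> x) (at x)" "continuous_on UNIV (deriv \<phi>)"
proof -
 have d: "(deriv ^^ n) \<phi> differentiable_on UNIV" for n using assms by (simp add: test_function_def)
 from d[of 0] show "(\<phi> has_real_derivative deriv \<phi> x) (at x)"
  by (metis DERIV_deriv_iff_real_differentiable UNIV_I differentiable_on_eq_differentiable_at funpow_0 open_UNIV)
 from d[of 1] show "continuous_on UNIV (deriv \<phi>)" by (simp add: differentiable_imp_continuous_on)
qed

lemma test_functionE:
 assumes "test_function \<phi>"
 obtains R B where "0 <= R" "0 <= B" "!!x. (\<phi> has_real_derivative deriv \<phi> x) (at x)" "continuous_on UNIV (deriv \<phi>)"
  "!!x. abs x > R ==> \<phi> x = 0" "!!x. abs x > R ==> deriv \<phi> x = 0"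
  "!!x. abs (deriv \<phi> x) <= B" "!!x. abs (\<phi> x) <= B"
proof -
 have d: "(deriv ^^ n) \<phi> differentiable_on UNIV" for n using assms by (simp add: test_function_def)
 have 1: "(\<phi> has_real_derivative deriv \<phi> x) (at x)" for x using test_function_DERIV(1)[OF assms] .
 have 2: "continuous_on UNIV (deriv \<phi>)" by (rule test_function_DERIV(2)[OF assms])
 have "bounded {x. \<phi> x ~= 0}" using assms by (simp add: test_function_def)
 then obtain R where R: "!!x. \<phi> x ~= 0 ==> abs x <= R" by (auto simp: bounded_real)
 define R' where "R' = abs R"
 have R': "\<phi> x = 0" if "abs x > R'" for x using R[of x] that unfolding R'_def by linarith
 have R'd: "deriv \<phi> x = 0" if "abs x > R'" for x
 proof -
  have "open {x::real. abs x > R'}" by (intro open_Collect_less continuous_intros)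
  then have "\<forall>\<^sub>F y in nhds x. y \<in> {x. abs x > R'}" using that by (intro eventually_nhds_in_open) auto
  then have "\<forall>\<^sub>F y in nhds x. \<phi> y = 0" by eventually_elim (use R' in auto)
  then have "(\<phi> has_real_derivative 0) (at x) = ((%_. 0) has_real_derivative 0) (at x)"
   by (intro DERIV_cong_ev) auto
  then show ?thesis using DERIV_imp_deriv by auto
 qed
 have bd: "\<exists>B. \<forall>x\<in>{-R'..R'}. abs (f x) <= B" if "continuous_on UNIV f" for f :: "real => real"
 proof -
  have "compact (f ` {-R'..R'})" by (intro compact_continuous_image continuous_on_subset[OF that]) auto
  then show ?thesis by (meson bounded_real compact_imp_bounded image_eqI)
 qed
 have "continuous_on UNIV \<phi>" using d[of 0] by (simp add: differentiable_imp_continuous_on)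
 from bd[OF this] bd[OF 2] obtain B B' where B: "!!x. x\<in>{-R'..R'} ==> abs (\<phi> x) <= B" "!!x. x\<in>{-R'..R'} ==> abs (deriv \<phi> x) <= B'" by blast
 show ?thesis
 proof (rule that[of R' "max 0 (max B B')"])
  show "abs (deriv \<phi> x) <= max 0 (max B B')" for x using B(2)[of x] R'd[of x] by (cases "abs x > R'") fastforce+
  show "abs (\<phi> x) <= max 0 (max B B')" for x using B(1)[of x] R'[of x] by (cases "abs x > R'") fastforce+
 qed (use 1 2 R' R'd in \<open>auto simp: R'_def\<close>)
qed

lemma seg_int_eq_LINT:
 assumes "!!x. abs x > R ==> f x = 0"
 shows "(LINT x|lborel. f x) = seg_int f (-R) R"
 unfolding set_lebesgue_integral_def
proof (intro Bochner_Integration.integral_cong refl)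
 fix x show "f x = indicator {-R..R} x *\<^sub>R f x"
  using assms[of x] by (cases "abs x > R") (auto simp: indicator_def abs_le_iff not_less)
qed

lemma integrable_loc_int_support:
 assumes "loc_int f" "!!x. abs x > R ==> f x = 0"
 shows "integrable lborel f"
proof -
 have "integrable lborel (%x. indicator {-R..R} x *\<^sub>R f x)"
  using assms(1) by (simp add: locally_integrable_def set_integrable_def)
 moreover have "(%x. indicator {-R..R} x *\<^sub>R f x) = f"
 proof
  fix x show "indicator {-R..R} x *\<^sub>R f x = f x"
   using assms(2)[of x] by (cases "abs x > R") (auto simp: indicator_def abs_le_iff not_less)
 qed
 ultimately show ?thesis by simp
qed

text \<open>Integration by parts against a test function.\<close>

lemma has_weak_deriv_primitive:
 assumes f: "primitive f g"
 shows "has_weak_deriv f g"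
 unfolding has_weak_deriv_def
proof (intro conjI allI impI)
 have fc: "continuous_on UNIV f" by (rule primitive_continuous[OF f])
 show fl: "loc_int f" by (rule continuous_loc_int[OF fc])
 show gl: "loc_int g" by (rule primitive_loc[OF f])
 fix \<phi> assume "test_function \<phi>"
 then obtain R B where R: "0 <= R" "0 <= B" "!!x. (\<phi> has_real_derivative deriv \<phi> x) (at x)" "continuous_on UNIV (deriv \<phi>)"
  "!!x. abs x > R ==> \<phi> x = 0" "!!x. abs x > R ==> deriv \<phi> x = 0"
  "!!x. abs (deriv \<phi> x) <= B" "!!x. abs (\<phi> x) <= B" using test_functionE by blast
 have p: "primitive \<phi> (deriv \<phi>)" by (rule continuous_primitive[OF R(3,4)])
 have "primitive (%x. f x * \<phi> x) (%x. f x * deriv \<phi> x + g x * \<phi> x)"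
  by (rule primitive_mult[OF f p])
 from primitiveD[OF this, of "-(R+1)" "R+1"]
 have "seg_int (%x. f x * deriv \<phi> x + g x * \<phi> x) (-(R+1)) (R+1) = 0"
  using R(1,5) by simp
 moreover have l1: "loc_int (%x. f x * deriv \<phi> x)"
  by (rule loc_int_mult[OF fl R(4)])
 moreover have l2: "loc_int (%x. g x * \<phi> x)"
  by (rule loc_int_mult[OF gl primitive_continuous[OF p]])
 ultimately show "(LINT x|lborel. f x * deriv \<phi> x) = - (LINT x|lborel. g x * \<phi> x)"
  using R(5,6) seg_int_eq_LINT[of "R+1" "%x. f x * deriv \<phi> x"] seg_int_eq_LINT[of "R+1" "%x. g x * \<phi> x"]
  by (simp add: seg_int_add)
qed

definition std_bump :: "real => real => nat => real => real" where
 "std_bump a b n x = flat_exp (1 / Suc n) 1 (x - a) * flat_exp (1 / Suc n) 1 (b - x)"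

lemma std_bump_in: "std_bump a b n \<in> bumps"
proof -
 have "std_bump a b n = (%x. flat_exp (1 / Suc n) 1 (x - a) * flat_exp (1 / Suc n) 1 (b - x))"
  by (rule ext) (rule std_bump_def)
 moreover have "(%x. flat_exp (1 / Suc n) 1 (x - a) * flat_exp (1 / Suc n) 1 (b - x)) \<in> bumps"
  by (rule bumps.prod[where c="1 / Suc n" and p=1 and q=1 and a=a and b=b]) (rule divide_pos_pos, auto)
 ultimately show ?thesis by simp
qed

lemma std_bump_bounds: "0 <= std_bump a b n x" "std_bump a b n x <= indicator {a<..<b} x"
proof -
 have f: "0 <= flat_exp (1 / Suc n) 1 y" "flat_exp (1 / Suc n) 1 y <= (if y > 0 then 1 else 0)" for y
 proof -
  have "exp (- (1 / Suc n) / y) <= 1" if "y > 0"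
  proof -
   have "- (1 / Suc n) / y <= 0" using that by (intro divide_nonpos_pos) auto
   then show ?thesis by (simp only: exp_le_one_iff)
  qed
  then show "0 <= flat_exp (1 / Suc n) 1 y" "flat_exp (1 / Suc n) 1 y <= (if y > 0 then 1 else 0)"
   unfolding flat_exp_def poly_1 by (simp_all only: mult_1_left if_splits exp_ge_zero split: if_split) auto
 qed
 show "0 <= std_bump a b n x" using f by (simp add: std_bump_def)
 show "std_bump a b n x <= indicator {a<..<b} x"
  unfolding std_bump_def
  using mult_mono[OF f(2)[of "x - a"] f(2)[of "b - x"]] f(1) by (auto simp: indicator_def split: if_splits)
qed

lemma std_bump_tendsto: "(%n. std_bump a b n x) \<longlonglongrightarrow> indicator {a<..<b} x"
proof -
 have 0: "(%n. 1 / real (Suc n)) \<longlonglongrightarrow> 0" using LIMSEQ_inverse_real_of_nat by (simp add: inverse_eq_divide)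
 have "(%n. flat_exp (1 / Suc n) 1 y) \<longlonglongrightarrow> (if y > 0 then 1 else 0)" for y
 proof (cases "y > 0")
  case True
  have "(%n. exp (- (1 / real (Suc n)) / y)) \<longlonglongrightarrow> exp (- 0 / y)"
   by (intro tendsto_intros 0) (use True in auto)
  then show ?thesis using True by (simp add: flat_exp_def)
 qed (simp add: flat_exp_def)
 from tendsto_mult[OF this this, of "x - a" "b - x"] show ?thesis
  unfolding std_bump_def by (auto simp: indicator_def split: if_splits)
qed

text \<open>Bumps increase to the indicator of an interval, so they determine a locally integrable function.\<close>

lemma AE_zero_of_bumps:
 assumes F: "loc_int F" and z: "!!\<psi>. \<psi> \<in> bumps ==> (LINT x|lborel. F x * \<psi> x) = 0"
 shows "AE x in lborel. F x = 0"
proof (rule AE_eq_of_seg_int[OF F loc_int_const])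
 fix a b :: real assume "a <= b"
 have [measurable]: "F \<in> Borel" using F by (rule loc_int_borel)
 have [measurable]: "std_bump a b n \<in> Borel" for n
  by (rule borel_measurable_continuous_onI[OF bumps_continuous[OF std_bump_in]])
 have "(%n. LINT x|lborel. F x * std_bump a b n x) \<longlonglongrightarrow> (LINT x|lborel. F x * indicator {a<..<b} x)"
 proof (rule integral_dominated_convergence[where w="%x. indicator {a..b} x *\<^sub>R (abs (F x))"])
  show "integrable lborel (%x. indicator {a..b} x *\<^sub>R (abs (F x)))"
   using loc_int_seg[OF loc_int_abs[OF F], of a b] by (simp add: set_integrable_def)
  show "AE x in lborel. (%n. F x * std_bump a b n x) \<longlonglongrightarrow> F x * indicator {a<..<b} x"
   by (intro AE_I2 tendsto_mult tendsto_const std_bump_tendsto)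
  show "AE x in lborel. norm (F x * std_bump a b n x) <= indicator {a..b} x *\<^sub>R (abs (F x))" for n
  proof (rule AE_I2)
   fix x
   have "abs (std_bump a b n x) <= indicator {a..b} x"
    using std_bump_bounds[of a b n x] by (cases "a < x & x < b") (auto simp: indicator_def)
   then show "norm (F x * std_bump a b n x) <= indicator {a..b} x *\<^sub>R (abs (F x))"
    using mult_right_mono[of "abs (std_bump a b n x)" "indicator {a..b} x" "abs (F x)"] by (simp add: abs_mult mult.commute)
  qed
 qed auto
 then have "(LINT x|lborel. F x * indicator {a<..<b} x) = 0"
  using z[OF std_bump_in] LIMSEQ_unique[OF tendsto_const] by fastforce
 moreover have "seg_int F a b = (LINT x|lborel. F x * indicator {a<..<b} x)"
  unfolding set_lebesgue_integral_def
 proof (rule integral_cong_AE)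
  show "AE x in lborel. indicator {a..b} x *\<^sub>R F x = F x * indicator {a<..<b} x"
   using AE_lborel_singleton[of a] AE_lborel_singleton[of b] by eventually_elim (auto simp: indicator_def)
 qed auto
 ultimately show "seg_int F a b = seg_int (%_. 0) a b" by simp
qed

lemma AE_const_of_weak_deriv_zero:
 assumes F: "loc_int F"
  and z: "!!\<phi>. test_function \<phi> ==> (LINT x|lborel. F x * deriv \<phi> x) = 0"
 shows "\<exists>c. AE x in lborel. F x = c"
proof -
 define \<rho> where "\<rho> = std_bump 0 1 0"
 have \<rho>: "\<rho> \<in> bumps" by (simp add: \<rho>_def std_bump_in)
 have loc: "loc_int \<psi>" and int: "integrable lborel \<psi>" "integrable lborel (%x. F x * \<psi> x)" if "\<psi> \<in> bumps" for \<psi>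
 proof -
  show l: "loc_int \<psi>" by (rule continuous_loc_int[OF bumps_continuous[OF that]])
  obtain R where "!!x. abs x > R ==> \<psi> x = 0" using bumps_support[OF \<open>\<psi> \<in> bumps\<close>] by blast
  then show "integrable lborel \<psi>" "integrable lborel (%x. F x * \<psi> x)"
   by (auto intro!: integrable_loc_int_support[of _ R] l
     loc_int_mult F bumps_continuous that)
 qed
 have "(LINT x|lborel. \<rho> x) ~= 0"
 proof
  assume "(LINT x|lborel. \<rho> x) = 0"
  then have "AE x in lborel. \<rho> x = 0"
   using integral_nonneg_eq_0_iff_AE[OF int(1)[OF \<rho>]] std_bump_bounds by (auto simp: \<rho>_def)
  then have "\<rho> = (%_. 0)"
   by (intro continuous_AE_eq_imp_eq bumps_continuous[OF \<rho>]) auto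
  from fun_cong[OF this, of "1/2"] show False by (simp add: \<rho>_def std_bump_def flat_exp_def)
 qed
 define m where "m \<psi> = (LINT x|lborel. \<psi> x) / (LINT x|lborel. \<rho> x)" for \<psi> :: "real => real"
 have m: "(LINT x|lborel. \<psi> x) = m \<psi> * (LINT x|lborel. \<rho> x)" for \<psi>
  using \<open>(LINT x|lborel. \<rho> x) \<noteq> 0\<close> by (simp add: m_def)
 define c where "c = (LINT x|lborel. F x * \<rho> x) / (LINT x|lborel. \<rho> x)"
 have "AE x in lborel. F x - c = 0"
 proof (rule AE_zero_of_bumps)
  show "loc_int (%x. F x - c)" by (intro loc_int_diff F loc_int_const)
  fix \<psi> assume \<psi>: "\<psi> \<in> bumps"
  define \<eta> where "\<eta> x = \<psi> x + std_bump 0 1 0 x * (- m \<psi>)" for x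
  have "(%x. flat_exp 1 1 (x - 0) * flat_exp 1 [:- m \<psi>:] (1 - x)) \<in> bumps" by (rule bumps.prod) simp
  moreover have "(%x. flat_exp 1 1 (x - 0) * flat_exp 1 [:- m \<psi>:] (1 - x)) = (%x. std_bump 0 1 0 x * (- m \<psi>))"
   by (auto simp: std_bump_def flat_exp_def)
  ultimately have \<eta>: "\<eta> \<in> bumps" unfolding \<eta>_def[abs_def] using bumps.add[OF \<psi>, of "%x. std_bump 0 1 0 x * (- m \<psi>)"] by argo
  have i\<eta>: "(LINT x|lborel. \<eta> x) = 0"
   using int(1)[OF \<psi>] int(1)[OF \<rho>] m[of \<psi>] unfolding \<eta>_def \<rho>_def by simp
  obtain R where R: "R \<ge> 0" "!!x. abs x > R ==> \<eta> x = 0" using bumps_support[OF \<eta>] by auto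
  obtain \<phi> where \<phi>: "primitive \<phi> \<eta>" "\<phi> (-(R+1)) = 0"
   using primitive_exists[OF loc[OF \<eta>]] by blast
  have z1: "\<phi> x = 0" if "x < - R" for x
  proof -
   have s0: "seg_int \<eta> a b = 0" if "a < - R" "b < - R" for a b
   proof -
    have "seg_int \<eta> a b = (LINT x:{a..b}|lborel. 0)"
     using that R by (intro set_lebesgue_integral_cong) auto
    then show ?thesis by simp
   qed
   show ?thesis
    using primitiveD[OF \<phi>(1), of x "-(R+1)"] primitiveD[OF \<phi>(1), of "-(R+1)" x] s0 that \<phi>(2) R(1)
    by (cases "x <= -(R+1)") auto
  qed
  have z2: "\<phi> x = 0" if "x > R" for x
   using primitiveD[OF \<phi>(1), of "- x" x] seg_int_eq_LINT[of x \<eta>] i\<eta> that R z1[of "- x"] by auto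
  have "(\<phi> has_real_derivative \<eta> x) (at x)" for x
  proof -
   have "((%u. integral {x-1..u} \<eta>) has_real_derivative \<eta> x) (at x within {x-1..x+1})"
    by (rule integral_has_real_derivative)
     (auto intro: continuous_on_subset[OF bumps_continuous[OF \<eta>]])
   then have "((%u. \<phi> (x-1) + integral {x-1..u} \<eta>) has_real_derivative 0 + \<eta> x) (at x within {x-1..x+1})"
    by (intro DERIV_add DERIV_const)
   then have "(\<phi> has_real_derivative 0 + \<eta> x) (at x within {x-1..x+1})"
    by (rule has_field_derivative_transform_within[of _ _ _ _ 1])
     (use primitiveD[OF \<phi>(1)] in \<open>auto simp: loc_int_hk(2)[OF loc[OF \<eta>], symmetric]\<close>, smt (verit))
   moreover have "at x within {x-1..x+1} = at x" by (rule at_within_interior) simp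
   ultimately show ?thesis by simp
  qed
  moreover have "\<phi> x = 0" if "abs x > R" for x using z1[of x] z2[of x] that by linarith
  ultimately have t: "test_function \<phi>" and d: "deriv \<phi> = \<eta>"
   using test_function_of_deriv_bump[OF \<eta>] DERIV_imp_deriv by blast+
  have "0 = (LINT x|lborel. F x * \<psi> x + (- m \<psi>) * (F x * \<rho> x))"
   using z[OF t] unfolding d \<eta>_def \<rho>_def by (simp add: algebra_simps)
  also have "... = (LINT x|lborel. F x * \<psi> x) - m \<psi> * (LINT x|lborel. F x * \<rho> x)"
   using int(2)[OF \<psi>] int(2)[OF \<rho>] by (subst Bochner_Integration.integral_add) auto
  finally have "(LINT x|lborel. F x * \<psi> x) = m \<psi> * (LINT x|lborel. F x * \<rho> x)" by simp
  also have "... = c * (LINT x|lborel. \<psi> x)" by (simp add: m_def c_def)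
  finally show "(LINT x|lborel. (F x - c) * \<psi> x) = 0"
   using int[OF \<psi>] by (simp add: left_diff_distrib)
 qed
 then show ?thesis by (auto intro!: exI[of _ c])
qed

lemma has_weak_deriv_imp_primitive:
 assumes "has_weak_deriv f g"
 shows "\<exists>F. primitive F g & (AE x in lborel. f x = F x)"
proof -
 have fl: "loc_int f" and gl: "loc_int g" using assms by (auto simp: has_weak_deriv_def)
 obtain G where G: "primitive G g" using primitive_exists[OF gl] by auto
 have Gw: "has_weak_deriv G g" by (rule has_weak_deriv_primitive[OF G])
 have Gl: "loc_int G" using Gw by (simp add: has_weak_deriv_def)
 have "\<exists>c. AE x in lborel. f x - G x = c"
 proof (rule AE_const_of_weak_deriv_zero)
  show "loc_int (%x. f x - G x)" by (rule loc_int_diff[OF fl Gl])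
  fix \<phi> assume t: "test_function \<phi>"
  then obtain R B where R: "0 <= R" "continuous_on UNIV (deriv \<phi>)" "!!x. abs x > R ==> deriv \<phi> x = 0" using test_functionE by metis
  have "integrable lborel (%x. h x * deriv \<phi> x)" if "loc_int h" for h
   using R by (intro integrable_loc_int_support[of _ R] loc_int_mult that) auto
  from this[OF fl] this[OF Gl] show "(LINT x|lborel. (f x - G x) * deriv \<phi> x) = 0"
   using assms Gw t by (simp add: left_diff_distrib has_weak_deriv_def)
 qed
 then obtain c where c: "AE x in lborel. f x - G x = c" by blast
 have "primitive (%x. G x + c) g" using G by (simp add: primitive_def)
 moreover have "AE x in lborel. f x = G x + c" using c by eventually_elim simp
 ultimately show ?thesis by blast
qed

lemma has_weak_deriv_cong_AE:
 assumes "has_weak_deriv f g" "f' \<in> Borel" "AE x in lborel. f x = f' x"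
  and "g' \<in> Borel" "AE x in lborel. g x = g' x"
 shows "has_weak_deriv f' g'"
proof -
 have loc: "loc_int h'" if "loc_int h" "h' \<in> Borel" "AE x in lborel. h x = h' x" for h h'
  unfolding locally_integrable_def set_integrable_def
 proof (intro conjI allI)
  show "h' \<in> borel_measurable lborel" using that by simp
  fix a b
  have "h \<in> Borel" using that(1) by (rule loc_int_borel)
  then show "integrable lborel (%x. indicator {a..b} x *\<^sub>R h' x)"
   using that by (subst integrable_cong_AE[where g="%x. indicator {a..b} x *\<^sub>R h x"])
    (auto simp: locally_integrable_def set_integrable_def elim!: eventually_mono)
 qed
 have b: "f \<in> Borel" "g \<in> Borel"
  using assms(1) by (auto simp: has_weak_deriv_def loc_int_borel)
 show ?thesis
  unfolding has_weak_deriv_def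
 proof (intro conjI allI impI)
  have fg: "loc_int f" "loc_int g" using assms(1) by (simp_all add: has_weak_deriv_def)
  show "loc_int f'" "loc_int g'"
   by (rule loc[OF fg(1) assms(2,3)], rule loc[OF fg(2) assms(4,5)])
  fix \<phi> assume t: "test_function \<phi>"
  have R: "!!x. (\<phi> has_real_derivative deriv \<phi> x) (at x)" "continuous_on UNIV (deriv \<phi>)"
   using test_function_DERIV[OF t] by auto
  have [measurable]: "deriv \<phi> \<in> Borel" "\<phi> \<in> Borel"
   by (rule borel_measurable_continuous_onI[OF R(2)])
    (rule primitive_borel[OF continuous_primitive[OF R(1,2)]])
  have "(LINT x|lborel. f' x * deriv \<phi> x) = (LINT x|lborel. f x * deriv \<phi> x)"
   using assms(2,3) b by (intro integral_cong_AE) (auto elim!: eventually_mono)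
  moreover have "(LINT x|lborel. g' x * \<phi> x) = (LINT x|lborel. g x * \<phi> x)"
   using assms(4,5) b by (intro integral_cong_AE) (auto elim!: eventually_mono)
  ultimately show "(LINT x|lborel. f' x * deriv \<phi> x) = - (LINT x|lborel. g' x * \<phi> x)"
   using assms(1) t by (simp add: has_weak_deriv_def)
 qed
qed

lemma has_weak_deriv_weak_deriv: "has_weak_deriv f g ==> has_weak_deriv f (wd f)"
 unfolding weak_deriv_def by (rule someI[of "has_weak_deriv f"])

lemma weak_deriv_AE_primitive:
 assumes F: "primitive F g" and f: "f \<in> Borel" "AE x in lborel. f x = F x"
 shows "has_weak_deriv f g" "has_weak_deriv f (wd f)" "primitive F (wd f)"
  "AE x in lborel. wd f x = g x"
proof -
 have "AE x in lborel. F x = f x" using f(2) by eventually_elim simp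
 then show 1: "has_weak_deriv f g"
  using primitive_loc[OF F] f
  by (intro has_weak_deriv_cong_AE[OF has_weak_deriv_primitive[OF F]]) (auto simp: loc_int_borel)
 show 2: "has_weak_deriv f (wd f)" by (rule has_weak_deriv_weak_deriv[OF 1])
 obtain F' where F': "primitive F' (wd f)" "AE x in lborel. f x = F' x"
  using has_weak_deriv_imp_primitive[OF 2] by auto
 have "AE x in lborel. F x = F' x" using f(2) F'(2) by eventually_elim simp
 then have "F = F'"
  by (intro continuous_AE_eq_imp_eq primitive_continuous[OF F] primitive_continuous[OF F'(1)])
 with F' show 3: "primitive F (wd f)" by simp
 show "AE x in lborel. wd f x = g x" by (rule primitive_unique[OF 3 F])
qed

lemmas weak_deriv_primitive = weak_deriv_AE_primitive[OF _ primitive_borel AE_I2[OF refl]]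

section \<open>Lipschitz functions and bi-Lipschitz changes of variables\<close>

definition slopes :: "real => real => (real => real) => bool" where
 "slopes \<alpha> \<beta> q \<longleftrightarrow> (\<forall>a b. a <= b --> \<alpha> * (b - a) <= q b - q a & q b - q a <= \<beta> * (b - a))"

lemma slopesD:
 assumes "slopes \<alpha> \<beta> q" "a <= b"
 shows "\<alpha> * (b - a) <= q b - q a" "q b - q a <= \<beta> * (b - a)"
 using assms by (auto simp: slopes_def)

lemma slopes_abs:
 assumes "slopes \<alpha> \<beta> q" "0 < \<alpha>"
 shows "\<alpha> * abs (a - b) <= abs (q a - q b)" "abs (q a - q b) <= \<beta> * abs (a - b)"
proof -
 have *: "\<alpha> * abs (a - b) <= abs (q a - q b) & abs (q a - q b) <= \<beta> * abs (a - b)" if "a <= b" for a b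
 proof -
  have "0 <= \<alpha> * (b - a)" using that assms(2) by simp
  with slopesD[OF assms(1) that] that show ?thesis
   by (simp add: abs_real_def)
 qed
 show "\<alpha> * abs (a - b) <= abs (q a - q b)" "abs (q a - q b) <= \<beta> * abs (a - b)"
  using *[of a b] *[of b a] by (cases "a <= b"; simp add: abs_minus_commute)+
qed

lemma slopes_strict_mono: "slopes \<alpha> \<beta> q ==> 0 < \<alpha> ==> a < b ==> q a < q b"
 using slopesD(1)[of \<alpha> \<beta> q a b] mult_pos_pos[of \<alpha> "b - a"] by linarith

lemma slopes_less_iff: "slopes \<alpha> \<beta> q ==> 0 < \<alpha> ==> q a < q b \<longleftrightarrow> a < b"
 by (metis less_asym linorder_cases slopes_strict_mono)

lemma slopes_le_iff: "slopes \<alpha> \<beta> q ==> 0 < \<alpha> ==> q a <= q b \<longleftrightarrow> a <= b"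
 using slopes_less_iff[of \<alpha> \<beta> q b a] by linarith

lemma slopes_le: "slopes \<alpha> \<beta> q ==> \<alpha> <= \<beta>"
 using slopesD[of \<alpha> \<beta> q 0 1] by simp

lemma Lipschitz_continuous:
 fixes f :: "real => real"
 assumes "!!a b. abs (f b - f a) <= L * abs (b - a)"
 shows "continuous_on UNIV f"
proof -
 have "isCont f x" for x
  unfolding isCont_def
 proof (rule LIM_zero_cancel, rule Lim_null_comparison)
  show "\<forall>\<^sub>F y in at x. norm (f y - f x) <= L * abs (y - x)"
   using assms by (intro always_eventually) auto
  show "((%y. L * abs (y - x)) \<longlongrightarrow> 0) (at x)"
   by (auto intro!: tendsto_eq_intros)
 qed
 then show ?thesis by (simp add: continuous_on_eq_continuous_at)
qed

lemma slopes_continuous: "slopes \<alpha> \<beta> q ==> 0 < \<alpha> ==> continuous_on UNIV q"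
 by (rule Lipschitz_continuous[of q \<beta>]) (rule slopes_abs(2))

lemma slopes_surj:
 assumes "slopes \<alpha> \<beta> q" "0 < \<alpha>"
 shows "\<exists>x. q x = y"
proof -
 define r where "r = abs (y - q 0) / \<alpha>"
 have r: "0 <= r" "\<alpha> * r = abs (y - q 0)" using assms(2) by (auto simp: r_def)
 have 1: "q (- r) <= y" using slopesD(1)[OF assms(1), of "- r" 0] r by (simp; linarith?)
 have 2: "y <= q r" using slopesD(1)[OF assms(1), of 0 r] r by (simp; linarith?)
 have "\<exists>x\<ge>-r. x <= r & q x = y"
  by (rule IVT'[of q "- r" y r, OF 1 2]) (use r slopes_continuous[OF assms] in \<open>auto intro: continuous_on_subset\<close>)
 then show ?thesis by blast
qed

lemma slopes_inv:
 assumes "slopes \<alpha> \<beta> q" "0 < \<alpha>"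
 shows "q (inv q x) = x" "inv q (q x) = x" "slopes (1 / \<beta>) (1 / \<alpha>) (inv q)" "0 < 1 / \<beta>"
proof -
 have 1: "q (inv q x) = x" for x
  using slopes_surj[OF assms, of x] by (auto intro: f_inv_into_f)
 have "inj q" using slopes_less_iff[OF assms] by (auto simp: inj_def) (metis less_irrefl linorder_neqE)
 then have 2: "inv q (q x) = x" for x by simp
 have b: "0 < \<beta>" using slopes_le[OF assms(1)] assms(2) by linarith
 have "1 / \<beta> * (b - a) <= inv q b - inv q a & inv q b - inv q a <= 1 / \<alpha> * (b - a)" if "a <= b" for a b
 proof -
  have le: "inv q a <= inv q b" using slopes_le_iff[OF assms, of "inv q a" "inv q b"] that by (simp add: 1)
  from slopesD[OF assms(1) le] show ?thesis
   using assms(2) b by (simp add: 1 field_simps)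
 qed
 then show "slopes (1 / \<beta>) (1 / \<alpha>) (inv q)" by (simp add: slopes_def)
 show "q (inv q x) = x" "inv q (q x) = x" "0 < 1 / \<beta>" using 1 2 b by auto
qed

lemma slopes_borel: "slopes \<alpha> \<beta> q ==> 0 < \<alpha> ==> q \<in> Borel"
 by (intro borel_measurable_continuous_onI slopes_continuous)

lemma slopes_inv_vimage:
 assumes "slopes \<alpha> \<beta> q" "0 < \<alpha>"
 shows "inv q -` {a..b} = {q a..q b}"
proof -
 have "a <= inv q x \<longleftrightarrow> q a <= x" "inv q x <= b \<longleftrightarrow> x <= q b" for x
  using slopes_le_iff[OF assms, of a "inv q x"] slopes_le_iff[OF assms, of "inv q x" b] slopes_inv(1)[OF assms]
  by auto
 then show ?thesis by auto
qed

text \<open>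
 The image of Lebesgue measure under the inverse is absolutely continuous because Lipschitz
 maps preserve null sets; its Radon--Nikodym density is the derivative.
\<close>

lemma slopes_imp_primitive:
 assumes q: "slopes \<alpha> \<beta> q" "0 < \<alpha>"
 shows "\<exists>k. primitive q k"
proof -
 have [measurable]: "inv q \<in> Borel"
  using slopes_inv(3,4)[OF q] by (rule slopes_borel)
 define \<mu> where "\<mu> = distr lborel borel (inv q)"
 have "absolutely_continuous lborel \<mu>"
  unfolding absolutely_continuous_def
 proof
  fix N :: "real set" assume N: "N \<in> null_sets lborel"
  then have Nb: "N \<in> sets borel" by auto
  have "negligible N" using N null_sets_completionI negligible_iff_null_sets by blast
  then have "negligible (q ` N)"
  proof (rule negligible_locally_Lipschitz_image[rotated])
   fix x assume "x \<in> N"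
   show "\<exists>T B. open T & x \<in> T & (\<forall>y\<in>N \<inter> T. norm (q y - q x) <= B * norm (y - x))"
    using slopes_abs(2)[OF q] by (intro exI[of _ UNIV] exI[of _ \<beta>]) auto
  qed simp
  moreover have "inv q -` N = q ` N"
   using slopes_inv(1,2)[OF q] by (auto simp: image_iff) metis
  ultimately have "negligible (inv q -` N)" by simp
  moreover have s: "inv q -` N \<in> sets borel"
   using measurable_sets[OF \<open>inv q \<in> Borel\<close> Nb] by simp
  ultimately have "emeasure lborel (inv q -` N) = 0"
   by (simp add: negligible_iff_null_sets null_sets_def)
  then show "N \<in> null_sets \<mu>"
   using Nb by (auto simp: null_sets_def \<mu>_def emeasure_distr)
 qed
 then obtain f where f[measurable]: "f \<in> borel_measurable lborel" and d: "density lborel f = \<mu>"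
  using sigma_finite_measure.Radon_Nikodym[OF sigma_finite_lborel, of \<mu>] by (auto simp: \<mu>_def)
 define k where "k x = enn2real (f x)" for x
 have int: "(\<integral>\<^sup>+x. f x * indicator {a..b} x \<partial>lborel) = ennreal (q b - q a)" if "a <= b" for a b
 proof -
  have "(\<integral>\<^sup>+x. f x * indicator {a..b} x \<partial>lborel) = emeasure (density lborel f) {a..b}"
   by (simp add: emeasure_density)
  also have "... = emeasure lborel {q a..q b}"
   unfolding d \<mu>_def by (simp add: emeasure_distr slopes_inv_vimage[OF q])
  also have "... = ennreal (q b - q a)"
   using slopes_le_iff[OF q, of a b] that by simp
  finally show ?thesis .
 qed
 have k[measurable]: "k \<in> Borel" unfolding k_def[abs_def] by measurable
 have hbi: "has_bochner_integral lborel (%x. indicator {a..b} x *\<^sub>R k x) (q b - q a)" if "a <= b" for a b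
 proof (rule has_bochner_integral_nn_integral)
  show "(%x. indicator {a..b} x *\<^sub>R k x) \<in> borel_measurable lborel" by measurable
  show "AE x in lborel. 0 <= indicator {a..b} x *\<^sub>R k x" by (simp add: k_def indicator_def)
  show "0 <= q b - q a" using slopes_le_iff[OF q, of a b] that by simp
  have "AE x in lborel. f x * indicator {a..b} x ~= \<infinity>"
   by (rule nn_integral_PInf_AE) (use int[OF that] in auto)
  then have "AE x in lborel. ennreal (indicator {a..b} x *\<^sub>R k x) = f x * indicator {a..b} x"
   by eventually_elim (auto simp: k_def indicator_def ennreal_enn2real_if)
  then show "(\<integral>\<^sup>+ x. ennreal (indicator {a..b} x *\<^sub>R k x) \<partial>lborel) = ennreal (q b - q a)"
   unfolding int[OF that, symmetric] by (rule nn_integral_cong_AE)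
 qed
 have "set_integrable lborel {a..b} k" for a b
 proof (cases "a <= b")
  case True then show ?thesis using hbi[OF True] by (auto simp: set_integrable_def dest: integrable.intros)
 next
  case False then show ?thesis by (simp add: set_integrable_def)
 qed
 moreover have "q b - q a = seg_int k a b" if "a <= b" for a b
  using has_bochner_integral_integral_eq[OF hbi[OF that]] by (simp add: set_lebesgue_integral_def)
 ultimately have "primitive q k" using k by (simp add: primitive_def locally_integrable_def)
 then show ?thesis by blast
qed

lemma Lipschitz_nonneg:
 fixes f :: "real => real"
 assumes "!!a b. abs (f b - f a) <= L * abs (b - a)"
 shows "0 <= L"
 using assms[of 1 0] by simp

lemma primitive_ident: "primitive (%x. c * x) (%_. c)"
 by (simp add: primitive_def loc_int_const seg_int_const algebra_simps)

lemma Lipschitz_weak_deriv: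
 fixes f :: "real => real"
 assumes L: "!!a b. abs (f b - f a) <= L * abs (b - a)"
 shows "primitive f (wd f)" "AE x in lborel. abs (wd f x) <= L"
  "wd f \<in> Borel" "f \<in> Borel"
proof -
 have s: "slopes 1 (2 * L + 1) (%x. f x + (L + 1) * x)"
  unfolding slopes_def
 proof (intro allI impI)
  fix a b :: real assume "a <= b"
  then have "f b - f a <= L * (b - a)" "- (f b - f a) <= L * (b - a)"
   using L[of b a] by (auto simp: abs_le_iff)
  then show "1 * (b - a) <= f b + (L + 1) * b - (f a + (L + 1) * a) &
    f b + (L + 1) * b - (f a + (L + 1) * a) <= (2 * L + 1) * (b - a)"
   by (simp add: algebra_simps)
 qed
 from slopes_imp_primitive[OF s] obtain k where "primitive (%x. f x + (L + 1) * x) k" by auto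
 from primitive_diff[OF this primitive_ident[of "L + 1"]]
 have p: "primitive f (%x. k x - (L + 1))" by simp
 show 1: "primitive f (wd f)" by (rule weak_deriv_primitive(3)[OF p p])
 show "wd f \<in> Borel"
  by (rule loc_int_borel[OF primitive_loc[OF 1]])
 show "f \<in> Borel" by (rule primitive_borel[OF 1])
 show "AE x in lborel. abs (wd f x) <= L"
 proof (rule AE_abs_le_of_seg_int[OF primitive_loc[OF 1] loc_int_const])
  fix a b :: real assume "a <= b"
  with L[of b a] primitiveD[OF 1, of a b] show "abs (seg_int (wd f) a b) <= seg_int (%_. L) a b"
   by (simp add: seg_int_const)
 qed
qed

lemma slopes_weak_deriv:
 assumes q: "slopes \<alpha> \<beta> q" "0 < \<alpha>"
 shows "primitive q (wd q)" "AE x in lborel. \<alpha> <= wd q x & wd q x <= \<beta>"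
  "wd q \<in> Borel" "q \<in> Borel"
proof -
 have L: "!!a b. abs (q b - q a) <= \<beta> * abs (b - a)" using slopes_abs(2)[OF q] .
 note * = Lipschitz_weak_deriv[OF L]
 show p: "primitive q (wd q)" "wd q \<in> Borel" "q \<in> Borel"
  using * by auto
 have "AE x in lborel. \<alpha> <= wd q x"
  by (rule AE_le_of_seg_int[OF loc_int_const primitive_loc[OF p(1)]])
   (use slopesD[OF q(1)] in \<open>simp add: seg_int_const primitiveD[OF p(1), symmetric]\<close>)
 then show "AE x in lborel. \<alpha> <= wd q x & wd q x <= \<beta>"
  using *(2) by eventually_elim auto
qed

lemma lborel_change_of_variables:
 assumes q: "slopes \<alpha> \<beta> q" "0 < \<alpha>"
 shows "lborel = distr (density lborel (%x. ennreal (wd q x))) borel q"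
proof (rule lborel_eqI)
 have [measurable]: "wd q \<in> Borel" "q \<in> Borel"
  using slopes_weak_deriv[OF q] by auto
 note p = slopes_weak_deriv(1)[OF q]
 fix l u :: real assume "!!b. b \<in> Basis ==> l \<bullet> b <= u \<bullet> b"
 then have lu: "l <= u" by simp
 let ?a = "inv q l" and ?b = "inv q u"
 have ab: "?a <= ?b" using slopes_le_iff[OF q, of ?a ?b] lu by (simp add: slopes_inv(1)[OF q])
 have v: "q -` box l u = {?a<..<?b}"
 proof -
  have "l < q x \<longleftrightarrow> ?a < x" "q x < u \<longleftrightarrow> x < ?b" for x
   using slopes_less_iff[OF q, of ?a x] slopes_less_iff[OF q, of x ?b] by (auto simp: slopes_inv(1)[OF q])
  then show ?thesis by (auto simp: box_real)
 qed
 have "emeasure (distr (density lborel (%x. ennreal (wd q x))) borel q) (box l u)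
   = emeasure (density lborel (%x. ennreal (wd q x))) {?a<..<?b}"
  by (subst emeasure_distr) (auto simp: v[simplified])
 also have "... = (\<integral>\<^sup>+x. ennreal (wd q x) * indicator {?a<..<?b} x \<partial>lborel)"
  by (simp add: emeasure_density)
 also have "... = (\<integral>\<^sup>+x. ennreal (indicator {?a..?b} x *\<^sub>R wd q x) \<partial>lborel)"
 proof (rule nn_integral_cong_AE)
  show "AE x in lborel. ennreal (wd q x) * indicator {?a<..<?b} x = ennreal (indicator {?a..?b} x *\<^sub>R wd q x)"
   using AE_lborel_singleton[of ?a] AE_lborel_singleton[of ?b] by eventually_elim (auto simp: indicator_def)
 qed
 also have "... = ennreal (seg_int (wd q) ?a ?b)"
  unfolding set_lebesgue_integral_def
 proof (rule nn_integral_eq_integral)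
  show "integrable lborel (%x. indicator {?a..?b} x *\<^sub>R wd q x)"
   using loc_int_seg[OF primitive_loc[OF p]] by (simp add: set_integrable_def)
  show "AE x in lborel. 0 <= indicator {?a..?b} x *\<^sub>R wd q x"
   using slopes_weak_deriv(2)[OF q] by eventually_elim (use q(2) in \<open>auto simp: indicator_def\<close>)
 qed
 also have "seg_int (wd q) ?a ?b = u - l"
  using primitiveD[OF p ab] by (simp add: slopes_inv(1)[OF q])
 finally show "emeasure (distr (density lborel (%x. ennreal (wd q x))) borel q) (box l u) = (\<Prod>b\<in>Basis. (u - l) \<bullet> b)"
  by simp
qed simp

lemma change_of_variables_nn:
 assumes q: "slopes \<alpha> \<beta> q" "0 < \<alpha>" and F[measurable]: "F \<in> Borel"
 shows "(\<integral>\<^sup>+x. F x \<partial>lborel) = (\<integral>\<^sup>+x. ennreal (wd q x) * F (q x) \<partial>lborel)"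
proof -
 have [measurable]: "wd q \<in> Borel" "q \<in> Borel"
  using slopes_weak_deriv[OF q] by auto
 have "(\<integral>\<^sup>+x. F x \<partial>lborel) = (\<integral>\<^sup>+x. F x \<partial>distr (density lborel (%x. ennreal (wd q x))) borel q)"
  using lborel_change_of_variables[OF q] by simp
 also have "... = (\<integral>\<^sup>+x. F (q x) \<partial>density lborel (%x. ennreal (wd q x)))"
  by (rule nn_integral_distr) auto
 also have "... = (\<integral>\<^sup>+x. ennreal (wd q x) * F (q x) \<partial>lborel)"
  by (rule nn_integral_density) auto
 finally show ?thesis .
qed

lemma change_of_variables_LINT:
 fixes F :: "real => real"
 assumes q: "slopes \<alpha> \<beta> q" "0 < \<alpha>" and F[measurable]: "F \<in> Borel"
 shows "(LINT x|lborel. F x) = (LINT x|lborel. wd q x * F (q x))"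
proof -
 have [measurable]: "wd q \<in> Borel" "q \<in> Borel"
  using slopes_weak_deriv[OF q] by auto
 have "(LINT x|lborel. F x) = (LINT x|distr (density lborel (%x. ennreal (wd q x))) borel q. F x)"
  using lborel_change_of_variables[OF q] by simp
 also have "... = (LINT x|density lborel (%x. ennreal (wd q x)). F (q x))"
  by (rule integral_distr) auto
 also have "... = (LINT x|lborel. wd q x *\<^sub>R F (q x))"
  by (rule integral_density) (use slopes_weak_deriv(2)[OF q] q(2) in \<open>auto elim!: eventually_mono\<close>)
 finally show ?thesis by simp
qed

lemma AE_compose_slopes:
 assumes q: "slopes \<alpha> \<beta> q" "0 < \<alpha>" and P: "AE x in lborel. P x"
 shows "AE x in lborel. P (q x)"
proof -
 have [measurable]: "wd q \<in> Borel" "q \<in> Borel"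
  using slopes_weak_deriv[OF q] by auto
 from P obtain N where N: "{x. \<not> P x} \<subseteq> N" "N \<in> sets lborel" "emeasure lborel N = 0"
  by (auto elim: AE_E)
 then have [measurable]: "N \<in> sets borel" by simp
 have "(\<integral>\<^sup>+x. ennreal (wd q x) * indicator N (q x) \<partial>lborel) = 0"
  using change_of_variables_nn[OF q, of "indicator N"] N(3) by simp
 then have "AE x in lborel. ennreal (wd q x) * indicator N (q x) = 0"
  by (subst (asm) nn_integral_0_iff_AE) auto
 then show ?thesis
  using slopes_weak_deriv(2)[OF q]
 proof eventually_elim
  case (elim x)
  then have "q x \<notin> N" using q(2) by (auto simp: indicator_def split: if_splits)
  then show ?case using N(1) by blast
 qed
qed

lemma seg_int_change_of_variables:
 assumes q: "slopes \<alpha> \<beta> q" "0 < \<alpha>" and F: "F \<in> Borel"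
 shows "seg_int F (q a) (q b) = seg_int (%x. F (q x) * wd q x) a b"
proof -
 have "seg_int F (q a) (q b) = (LINT x|lborel. wd q x * (indicator {q a..q b} (q x) *\<^sub>R F (q x)))"
  unfolding set_lebesgue_integral_def by (rule change_of_variables_LINT[OF q]) (use F in measurable)
 also have "... = seg_int (%x. F (q x) * wd q x) a b"
  unfolding set_lebesgue_integral_def
  by (intro Bochner_Integration.integral_cong refl) (auto simp: indicator_def slopes_le_iff[OF q])
 finally show ?thesis .
qed

text \<open>The chain rule: the derivative of a composition with a bi-Lipschitz map.\<close>

lemma Lipschitz_compose_weak_deriv:
 assumes q: "slopes \<alpha> \<beta> q" "0 < \<alpha>" and L: "!!a b. abs (u b - u a) <= L * abs (b - a)"
 shows "AE x in lborel. wd (%x. u (q x)) x = wd u (q x) * wd q x"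
proof -
 note u = Lipschitz_weak_deriv[OF L]
 note qd = slopes_weak_deriv[OF q]
 have [measurable]: "wd q \<in> Borel" "q \<in> Borel" "wd u \<in> Borel"
  using u qd by auto
 have L0: "0 <= L" using Lipschitz_nonneg[of u L] L by blast
 have "AE x in lborel. abs (wd u (q x)) <= L" by (rule AE_compose_slopes[OF q u(2)])
 with qd(2) have "AE x in lborel. abs (wd u (q x) * wd q x) <= L * \<beta>"
 proof eventually_elim
  case (elim x)
  have "abs (wd q x) <= \<beta>" using elim q(2) by auto
  then show ?case unfolding abs_mult using elim L0 by (intro mult_mono) auto
 qed
 then have loc: "loc_int (%x. wd u (q x) * wd q x)"
  by (intro loc_int_bounded[of _ "L * \<beta>"]) auto
 have "primitive (%x. u (q x)) (%x. wd u (q x) * wd q x)"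
  unfolding primitive_def
 proof (intro conjI loc allI impI)
  fix a b :: real assume "a <= b"
  then have "q a <= q b" using slopes_le_iff[OF q] by simp
  then show "u (q b) - u (q a) = seg_int (%x. wd u (q x) * wd q x) a b"
   using primitiveD[OF u(1)] seg_int_change_of_variables[OF q u(3), of a b] by simp
 qed
 from weak_deriv_primitive(4)[OF this this] show ?thesis .
qed

section \<open>Exponential kernels\<close>

lemma exp_kernel_bochner:
 fixes c x :: real
 assumes "c > 0"
 shows "has_bochner_integral lborel (%y. exp (- c * abs (x - y))) (2 / c)"
proof -
 have "(\<integral>\<^sup>+y. ennreal (exp (- c * y)) * indicator {0..} y \<partial>lborel) = ennreal (0 - (- exp (- c * 0) / c))"
 proof (rule nn_integral_FTC_atLeast)
  show "((%y. - exp (- c * y) / c) has_real_derivative exp (- c * y)) (at y)" for y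
   using assms by (auto intro!: derivative_eq_intros)
  have "filterlim (%y. c * y) at_top at_top"
   using assms by (intro filterlim_tendsto_pos_mult_at_top[OF tendsto_const _ filterlim_ident])
  then have "filterlim (%y. - (c * y)) at_bot at_top"
   by (simp add: filterlim_uminus_at_bot)
  from tendsto_divide[OF tendsto_minus[OF filterlim_compose[OF exp_at_bot this]] tendsto_const, of c]
  show "((%y. - exp (- c * y) / c) \<longlongrightarrow> 0) at_top" using assms by simp
 qed auto
 then have "(\<integral>\<^sup>+y. ennreal (exp (- c * y)) * indicator {0..} y \<partial>lborel) = ennreal (1 / c)"
  by simp
 then have "(\<integral>\<^sup>+y. ennreal (indicator {0..} y *\<^sub>R exp (- c * abs y)) \<partial>lborel) = ennreal (1 / c)"
  by (subst (asm) nn_integral_cong[where v="%y. ennreal (indicator {0..} y *\<^sub>R exp (- c * abs y))"])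
   (auto simp: indicator_def)
 then have "has_bochner_integral lborel (%y. indicator {0..} y *\<^sub>R exp (- c * abs y)) (1 / c)"
  using assms by (intro has_bochner_integral_nn_integral) auto
 from has_bochner_integral_even_function[OF this]
 have "has_bochner_integral lborel (%y. exp (- c * abs y)) (2 / c)" by simp
 then have "has_bochner_integral lborel (%y. exp (- c * abs (x + (-1) * y))) (2 / c /\<^sub>R (abs (-1)))"
  by (subst lborel_has_bochner_integral_real_affine_iff[symmetric]) auto
 then show ?thesis by simp
qed

lemma exp_kernel_integrable: "(c::real) > 0 ==> integrable lborel (%y. exp (- c * abs (x - y)))"
 and exp_kernel_LINT: "(c::real) > 0 ==> (LINT y|lborel. exp (- c * abs (x - y))) = 2 / c"
 using exp_kernel_bochner by (auto simp: has_bochner_integral_iff)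

lemma exp_kernel_mult_integrable:
 fixes c :: real and N :: "real => real"
 assumes "c > 0" and [measurable]: "N \<in> Borel" and N: "AE y in lborel. abs (N y) <= B"
 shows "integrable lborel (%y. exp (- c * abs (x - y)) * N y)"
proof (rule Bochner_Integration.integrable_bound)
 show "integrable lborel (%y. B * exp (- c * abs (x - y)))"
  using exp_kernel_integrable[OF assms(1)] by (rule integrable_mult_right)
 show "AE y in lborel. norm (exp (- c * abs (x - y)) * N y) <= norm (B * exp (- c * abs (x - y)))"
  using N
 proof eventually_elim
  case (elim y)
  then show ?case using mult_left_mono[of "abs (N y)" "abs B" "exp (- c * abs (x - y))"] by (simp add: abs_mult mult.commute)
 qed
qed simp

definition kconv :: "real => (real => real) => real => real" where
 "kconv c N x = (LINT y|lborel. exp (- c * abs (x - y)) * N y)"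

lemma kconv_borel [measurable (raw)]:
 assumes [measurable]: "N \<in> Borel"
 shows "kconv c N \<in> Borel"
 unfolding kconv_def[abs_def] by measurable

definition weight :: "real => (real => real) => bool" where
 "weight M D \<longleftrightarrow> D \<in> Borel & (\<forall>x. 0 <= D x & D x <= M)"

lemma weightD:
 assumes "weight M D"
 shows "D \<in> Borel" "0 <= D x" "D x <= M" "0 <= M" "abs (D x) <= M"
 using assms unfolding weight_def by (auto intro: order_trans)

lemma weight_loc: "weight M D ==> loc_int D"
 by (rule loc_int_bounded[of D M]) (auto simp: weightD)

lemma weight_kernel_integrable: "c > 0 ==> weight M N ==> integrable lborel (%y. exp (- c * abs (x - y)) * N y)"
 by (rule exp_kernel_mult_integrable[of _ _ M]) (auto simp: weightD)

lemma kconv_nonneg: "weight M N ==> 0 <= kconv c N x"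
 unfolding kconv_def by (rule Bochner_Integration.integral_nonneg) (auto simp: weightD)

lemma kconv_le:
 assumes "c > 0" "weight M N"
 shows "kconv c N x <= 2 / c * M"
proof -
 have "kconv c N x <= (LINT y|lborel. exp (- c * abs (x - y)) * M)"
  unfolding kconv_def
  by (rule integral_mono[OF weight_kernel_integrable[OF assms]])
   (use exp_kernel_integrable[OF assms(1)] weightD[OF assms(2)] in \<open>auto intro!: mult_left_mono\<close>)
 then show ?thesis using exp_kernel_LINT[OF assms(1)] by simp
qed

lemma kconv_antimono:
 assumes "0 < c" "c <= d" "weight M N"
 shows "kconv d N x <= kconv c N x"
 unfolding kconv_def
proof (rule integral_mono)
 show "integrable lborel (%y. exp (- d * abs (x - y)) * N y)" "integrable lborel (%y. exp (- c * abs (x - y)) * N y)"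
  using assms by (auto intro!: weight_kernel_integrable[simplified])
 fix y
 have "c * abs (x - y) <= d * abs (x - y)" using assms by (intro mult_right_mono) auto
 then show "exp (- d * abs (x - y)) * N y <= exp (- c * abs (x - y)) * N y"
  using weightD(2)[OF assms(3)] by (intro mult_right_mono) auto
qed

lemma kconv_add:
 assumes "c > 0" "weight M N" "weight M' N'"
 shows "kconv c (%y. N y + N' y) x = kconv c N x + kconv c N' x"
 unfolding kconv_def distrib_left
 by (rule Bochner_Integration.integral_add[OF weight_kernel_integrable[OF assms(1,2)] weight_kernel_integrable[OF assms(1,3)]])

lemma kconv_cmult: "kconv c (%y. k * N y) x = k * kconv c N x"
 unfolding kconv_def by (simp add: mult.left_commute)

lemma kconv_nn:
 assumes "c > 0" "weight M N"
 shows "ennreal (kconv c N x) = (\<integral>\<^sup>+y. ennreal (exp (- c * abs (x - y)) * N y) \<partial>lborel)"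
 unfolding kconv_def
 by (rule nn_integral_eq_integral[symmetric, OF weight_kernel_integrable[OF assms]]) (auto simp: weightD[OF assms(2)])

lemma weight_kconv:
 assumes "c > 0" "weight M N" shows "weight (2 / c * M) (kconv c N)"
 unfolding weight_def[of "2 / c * M"]
 using kconv_borel[OF weightD(1)[OF assms(2)]] kconv_nonneg[OF assms(2)] kconv_le[OF assms] by blast

lemma weight_add: "weight M D ==> weight M' D' ==> weight (M + M') (%x. D x + D' x)"
 unfolding weight_def by (auto intro: add_mono)

lemma weight_cmult: "weight M D ==> 0 <= k ==> weight (k * M) (%x. k * D x)"
 unfolding weight_def by (auto intro: mult_left_mono)

lemma weight_const: "0 <= c ==> weight c (%_. c)"
 by (simp add: weight_def)

text \<open>\<open>exp (- 2 \<mu> |x - y|) exp (- \<mu> |y - z|) \<le> exp (- \<mu> |x - y|) exp (- \<mu> |x - z|)\<close>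
  by the triangle inequality. A convolution of a weight is therefore stable under convolution with
  a kernel of twice the rate, which is how admissible weights arise.\<close>

lemma kconv_kconv_le:
 assumes "\<mu> > 0" and N: "weight M N"
 shows "kconv (2 * \<mu>) (kconv \<mu> N) x <= 2 / \<mu> * kconv \<mu> N x"
proof -
 note [measurable] = weightD(1)[OF N]
 have N0: "0 <= N y" for y using weightD[OF N] by auto
 have "ennreal (kconv (2 * \<mu>) (kconv \<mu> N) x) = (\<integral>\<^sup>+z. ennreal (exp (- (2 * \<mu>) * abs (x - z))) * ennreal (kconv \<mu> N z) \<partial>lborel)"
  using assms by (subst kconv_nn[OF _ weight_kconv[OF _ N]]) (auto simp: ennreal_mult kconv_nonneg[OF N])
 also have "... = (\<integral>\<^sup>+z. \<integral>\<^sup>+y. ennreal (exp (- (2 * \<mu>) * abs (x - z))) * ennreal (exp (- \<mu> * abs (z - y)) * N y) \<partial>lborel \<partial>lborel)"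
  unfolding kconv_nn[OF assms] by (intro nn_integral_cong nn_integral_cmult[symmetric]) measurable
 also have "... <= (\<integral>\<^sup>+z. \<integral>\<^sup>+y. ennreal (exp (- \<mu> * abs (x - z))) * ennreal (exp (- \<mu> * abs (x - y)) * N y) \<partial>lborel \<partial>lborel)"
 proof (intro nn_integral_mono)
  fix z y
  have "abs (x - y) <= abs (x - z) + abs (z - y)" by linarith
  then have "\<mu> * abs (x - y) <= \<mu> * abs (x - z) + \<mu> * abs (z - y)"
   using mult_left_mono[of "abs (x - y)" "abs (x - z) + abs (z - y)" \<mu>] assms(1) by (simp add: distrib_left)
  then have "exp (- (2 * \<mu>) * abs (x - z)) * exp (- \<mu> * abs (z - y)) <= exp (- \<mu> * abs (x - z)) * exp (- \<mu> * abs (x - y))"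
   by (simp add: exp_add[symmetric])
  from mult_right_mono[OF this N0[of y]]
  show "ennreal (exp (- (2 * \<mu>) * abs (x - z))) * ennreal (exp (- \<mu> * abs (z - y)) * N y) <= ennreal (exp (- \<mu> * abs (x - z))) * ennreal (exp (- \<mu> * abs (x - y)) * N y)"
   using N0 by (simp add: ennreal_mult[symmetric] mult.assoc)
 qed
 also have "... = (\<integral>\<^sup>+z. ennreal (exp (- \<mu> * abs (x - z))) \<partial>lborel) * ennreal (kconv \<mu> N x)"
  unfolding kconv_nn[OF assms] by (subst nn_integral_cmult) (auto simp: nn_integral_multc)
 also have "(\<integral>\<^sup>+z. ennreal (exp (- \<mu> * abs (x - z))) \<partial>lborel) = ennreal (2 / \<mu>)"
  using exp_kernel_LINT[OF assms(1), of x] nn_integral_eq_integral[OF exp_kernel_integrable[OF assms(1), of x]] by simp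
 finally show ?thesis
  using kconv_nonneg[OF N] assms(1) by (simp add: ennreal_mult[symmetric])
qed

text \<open>Young's inequality for the kernel, by Cauchy--Schwarz and Tonelli.\<close>

lemma kconv_L2_nn:
 assumes c: "c > 0" and [measurable]: "N \<in> Borel"
 shows "(\<integral>\<^sup>+x. (\<integral>\<^sup>+y. ennreal (exp (- c * abs (x - y))) * ennreal (abs (N y)) \<partial>lborel)^2 \<partial>lborel) <= ennreal ((2 / c)^2) * (\<integral>\<^sup>+x. ennreal ((N x)^2) \<partial>lborel)"
proof -
 let ?k = "%x y. exp (- c * abs (x - y))"
 have K: "(\<integral>\<^sup>+y. ennreal (?k x y) \<partial>lborel) = ennreal (2 / c)" for x
  using exp_kernel_LINT[OF c, of x] nn_integral_eq_integral[OF exp_kernel_integrable[OF c, of x]] by simp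
 have "(\<integral>\<^sup>+x. (\<integral>\<^sup>+y. ennreal (?k x y) * ennreal (abs (N y)) \<partial>lborel)^2 \<partial>lborel) <= (\<integral>\<^sup>+x. ennreal (2 / c) * (\<integral>\<^sup>+y. ennreal (?k x y) * ennreal ((N y)^2) \<partial>lborel) \<partial>lborel)"
 proof (rule nn_integral_mono)
  fix x
  have s: "ennreal (?k x y) * ennreal (abs (N y)) = ennreal (sqrt (?k x y)) * ennreal (sqrt (?k x y) * abs (N y))" for y
   by (simp add: ennreal_mult[symmetric] mult.assoc[symmetric])
  have "(\<integral>\<^sup>+y. ennreal (?k x y) * ennreal (abs (N y)) \<partial>lborel)^2 <= (\<integral>\<^sup>+y. (ennreal (sqrt (?k x y)))^2 \<partial>lborel) * (\<integral>\<^sup>+y. (ennreal (sqrt (?k x y) * abs (N y)))^2 \<partial>lborel)"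
   unfolding s by (rule Cauchy_Schwarz_nn_integral) measurable
  also have "(\<integral>\<^sup>+y. (ennreal (sqrt (?k x y)))^2 \<partial>lborel) = ennreal (2 / c)"
   by (simp add: ennreal_power K[simplified])
  also have "(\<integral>\<^sup>+y. (ennreal (sqrt (?k x y) * abs (N y)))^2 \<partial>lborel) = (\<integral>\<^sup>+y. ennreal (?k x y) * ennreal ((N y)^2) \<partial>lborel)"
   by (simp add: ennreal_power power_mult_distrib ennreal_mult[symmetric])
  finally show "(\<integral>\<^sup>+y. ennreal (?k x y) * ennreal (abs (N y)) \<partial>lborel)^2 <= ennreal (2 / c) * (\<integral>\<^sup>+y. ennreal (?k x y) * ennreal ((N y)^2) \<partial>lborel)" .
 qed
 also have "... = ennreal (2 / c) * (\<integral>\<^sup>+x. \<integral>\<^sup>+y. ennreal (?k x y) * ennreal ((N y)^2) \<partial>lborel \<partial>lborel)"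
  by (rule nn_integral_cmult) measurable
 also have "(\<integral>\<^sup>+x. \<integral>\<^sup>+y. ennreal (?k x y) * ennreal ((N y)^2) \<partial>lborel \<partial>lborel) = (\<integral>\<^sup>+y. \<integral>\<^sup>+x. ennreal (?k x y) * ennreal ((N y)^2) \<partial>lborel \<partial>lborel)"
  by (rule lborel_pair.Fubini'[symmetric]) measurable
 also have "... = (\<integral>\<^sup>+y. ennreal (2 / c) * ennreal ((N y)^2) \<partial>lborel)"
 proof (rule nn_integral_cong)
  fix y
  have "(\<integral>\<^sup>+x. ennreal (?k x y) * ennreal ((N y)^2) \<partial>lborel) = (\<integral>\<^sup>+x. ennreal (?k x y) \<partial>lborel) * ennreal ((N y)^2)"
   by (rule nn_integral_multc) measurable
  also have "(\<integral>\<^sup>+x. ennreal (?k x y) \<partial>lborel) = (\<integral>\<^sup>+x. ennreal (?k y x) \<partial>lborel)"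
   by (simp add: abs_minus_commute)
  finally show "(\<integral>\<^sup>+x. ennreal (?k x y) * ennreal ((N y)^2) \<partial>lborel) = ennreal (2 / c) * ennreal ((N y)^2)" by (simp only: K)
 qed
 also have "... = ennreal (2 / c) * (\<integral>\<^sup>+y. ennreal ((N y)^2) \<partial>lborel)"
  by (rule nn_integral_cmult) measurable
 also have "ennreal (2 / c) * (ennreal (2 / c) * (\<integral>\<^sup>+y. ennreal ((N y)^2) \<partial>lborel)) = ennreal ((2 / c)^2) * (\<integral>\<^sup>+x. ennreal ((N x)^2) \<partial>lborel)"
  using c by (simp add: ennreal_mult[symmetric] mult.assoc[symmetric] power2_eq_square)
 finally show ?thesis .
qed

section \<open>The Helmholtz operator\<close>

definition d_Helmholtz :: "(real => real) => real => real" where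
 "d_Helmholtz f x = (LINT y|lborel. - sgn (x - y) * exp (- abs (x - y)) / 2 * f y)"

lemma primitive_of_deriv:
 assumes "continuous_on UNIV f" "finite S" "loc_int g"
  and "!!x. x \<notin> S ==> (f has_real_derivative g x) (at x)"
 shows "primitive f g"
 unfolding primitive_def
proof (intro conjI allI impI assms(3))
 fix a b :: real assume "a <= b"
 then have "(g has_integral f b - f a) {a..b}"
  using assms by (intro fundamental_theorem_of_calculus_strong[of S])
   (auto intro: continuous_on_subset simp: has_real_derivative_iff_has_vector_derivative[symmetric]
    intro!: has_field_derivative_at_within)
 then show "f b - f a = seg_int g a b"
  unfolding loc_int_hk(2)[OF assms(3)] by (metis integral_unique)
qed

text \<open>Integrating the convolution over an interval moves the integral onto the kernel; this is how the
  Helmholtz inverse is seen to have a locally absolutely continuous derivative.\<close>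

lemma kernel_Fubini:
 fixes h f :: "real => real"
 assumes [measurable]: "h \<in> Borel" "f \<in> Borel"
  and h: "!!z. abs (h z) <= exp (- abs z)" and f: "AE y in lborel. abs (f y) <= B"
 shows "loc_int (%x. LINT y|lborel. h (x - y) * f y)"
  and "seg_int (%x. LINT y|lborel. h (x - y) * f y) a b = (LINT y|lborel. seg_int (%x. h (x - y)) a b * f y)"
  and "integrable lborel (%y. h (x - y) * f y)"
  and "abs (LINT y|lborel. h (x - y) * f y) <= 2 * B"
proof -
 have I: "integrable lborel (%y. exp (- abs (x - y)) * f y)" for x
  using exp_kernel_mult_integrable[of 1 f B x] f by simp
 show i: "integrable lborel (%y. h (x - y) * f y)" for x
  by (rule Bochner_Integration.integrable_bound[OF I[of x]]) (auto simp: abs_mult intro!: mult_right_mono h)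
 have bd: "(LINT y|lborel. abs (h (x - y) * f y)) <= 2 * B" for x
 proof -
  have "(LINT y|lborel. abs (h (x - y) * f y)) <= (LINT y|lborel. exp (- abs (x - y)) * B)"
  proof (rule integral_mono_AE)
   show "integrable lborel (%y. abs (h (x - y) * f y))" using i by simp
   show "integrable lborel (%y. exp (- abs (x - y)) * B)" using exp_kernel_integrable[of 1 x] by simp
   show "AE y in lborel. abs (h (x - y) * f y) <= exp (- abs (x - y)) * B"
    using f by eventually_elim (auto simp: abs_mult intro!: mult_mono h)
  qed
  then show ?thesis using exp_kernel_LINT[of 1 x] by simp
 qed
 show b: "abs (LINT y|lborel. h (x - y) * f y) <= 2 * B" for x
  using integral_abs_bound[of lborel "%y. h (x - y) * f y"] bd[of x] by linarith
 show "loc_int (%x. LINT y|lborel. h (x - y) * f y)"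
  by (rule loc_int_bounded[of _ "2 * B"]) (auto simp: b)
 have "integrable (lborel \<Otimes>\<^sub>M lborel) (%(x, y). indicator {a..b} x * (h (x - y) * f y))"
 proof (rule lborel_pair.Fubini_integrable)
  show "(%(x, y). indicator {a..b} x * (h (x - y) * f y)) \<in> borel_measurable (lborel \<Otimes>\<^sub>M lborel)" by measurable
  have "integrable lborel (%x. indicator {a..b} x * (2 * B))"
   by (intro integrable_mult_left integrable_real_indicator) (auto simp: emeasure_lborel_Icc_eq)
  then show "integrable lborel (%x. LINT y|lborel. norm (case (x, y) of (x, y) => indicator {a..b} x * (h (x - y) * f y)))"
  proof (rule Bochner_Integration.integrable_bound)
   show "AE x in lborel. norm (LINT y|lborel. norm (case (x, y) of (x, y) => indicator {a..b} x * (h (x - y) * f y)))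
     <= norm (indicator {a..b} x * (2 * B))"
   proof (rule AE_I2)
    fix x
    have "0 <= (LINT y|lborel. abs (h (x - y) * f y))" by (rule Bochner_Integration.integral_nonneg) simp
    then show "norm (LINT y|lborel. norm (case (x, y) of (x, y) => indicator {a..b} x * (h (x - y) * f y)))
     <= norm (indicator {a..b} x * (2 * B))"
     using bd[of x] by (auto simp: indicator_def)
   qed
  qed measurable
  show "AE x in lborel. integrable lborel (%y. case (x, y) of (x, y) => indicator {a..b} x * (h (x - y) * f y))"
   using i by simp
 qed
 from lborel_pair.Fubini_integral[OF this]
 have F: "(LINT y|lborel. LINT x|lborel. indicator {a..b} x * (h (x - y) * f y)) =
   (LINT x|lborel. LINT y|lborel. indicator {a..b} x * (h (x - y) * f y))" by simp
 have "seg_int (%x. LINT y|lborel. h (x - y) * f y) a b = (LINT x|lborel. LINT y|lborel. indicator {a..b} x * (h (x - y) * f y))"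
  by (simp add: set_lebesgue_integral_def)
 also have "... = (LINT y|lborel. LINT x|lborel. (indicator {a..b} x * h (x - y)) * f y)"
  unfolding F[symmetric] by (simp only: mult.assoc)
 also have "... = (LINT y|lborel. seg_int (%x. h (x - y)) a b * f y)"
  by (simp add: set_lebesgue_integral_def)
 finally show "seg_int (%x. LINT y|lborel. h (x - y) * f y) a b = (LINT y|lborel. seg_int (%x. h (x - y)) a b * f y)" .
qed

lemma exp_abs_deriv:
 assumes "z ~= 0"
 shows "((%z. exp (- abs z) / 2) has_real_derivative - sgn z * exp (- abs z) / 2) (at (z::real))"
proof (cases "z > 0")
 case True
 have "((%z. exp (- z) / 2) has_real_derivative - sgn z * exp (- abs z) / 2) (at z)"
  using True by (auto intro!: derivative_eq_intros)
 then show ?thesis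
  by (rule has_field_derivative_transform_within_open[of _ _ _ "{0<..}"]) (use True in auto)
next
 case False
 then have z: "z < 0" using assms by simp
 have "((%z. exp z / 2) has_real_derivative - sgn z * exp (- abs z) / 2) (at z)"
  using z by (auto intro!: derivative_eq_intros)
 then show ?thesis
  by (rule has_field_derivative_transform_within_open[of _ _ _ "{..<0}"]) (use z in auto)
qed

text \<open>
 \<open>smoothed_step\<close> is the primitive of the kernel; it differs from the derivative of the kernel by
 the Heaviside function, which accounts for the Dirac mass in $G'' = G - \delta$.
\<close>

definition smoothed_step :: "real => real" where
 "smoothed_step z = (if z <= 0 then exp z / 2 else 1 - exp (- z) / 2)"

lemma smoothed_step_continuous: "continuous_on UNIV smoothed_step"
proof -
 have "continuous_on ({..0} \<union> {0..}) (%z::real. if z <= 0 then exp z / 2 else 1 - exp (- z) / 2)"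
  by (rule continuous_on_If) (auto intro!: continuous_intros)
 moreover have "{..0} \<union> {0..} = (UNIV::real set)" by auto
 ultimately show ?thesis unfolding smoothed_step_def[abs_def] by simp
qed

lemma smoothed_step_deriv:
 assumes "z ~= 0"
 shows "(smoothed_step has_real_derivative exp (- abs z) / 2) (at z)"
proof (cases "z > 0")
 case True
 have "((%z. 1 - exp (- z) / 2) has_real_derivative exp (- abs z) / 2) (at z)"
  using True by (auto intro!: derivative_eq_intros)
 then show ?thesis
  by (rule has_field_derivative_transform_within_open[of _ _ _ "{0<..}"]) (use True in \<open>auto simp: smoothed_step_def\<close>)
next
 case False
 then have z: "z < 0" using assms by simp
 have "((%z. exp z / 2) has_real_derivative exp (- abs z) / 2) (at z)"
  using z by (auto intro!: derivative_eq_intros)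
 then show ?thesis
  by (rule has_field_derivative_transform_within_open[of _ _ _ "{..<0}"]) (use z in \<open>auto simp: smoothed_step_def\<close>)
qed

lemma smoothed_step_eq: "z ~= 0 ==> smoothed_step z = - sgn z * exp (- abs z) / 2 + indicator {0<..} z"
 by (auto simp: smoothed_step_def sgn_real_def)

lemma primitive_shift:
 assumes "continuous_on UNIV F" "!!z. z ~= 0 ==> (F has_real_derivative g z) (at z)"
  and "g \<in> Borel" "!!z. abs (g z) <= 1"
 shows "primitive (%x. F (x - y)) (%x. g (x - y))"
proof (rule primitive_of_deriv[of _ "{y}"])
 show "continuous_on UNIV (%x. F (x - y))"
  by (rule continuous_on_compose2[OF assms(1)]) (auto intro!: continuous_intros)
 show "loc_int (%x. g (x - y))"
  using assms(3,4) by (intro loc_int_bounded[of _ 1]) auto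
 fix x assume "x \<notin> {y}"
 then have "x - y ~= 0" by simp
 have d: "((%x. x - y) has_real_derivative 1) (at x)" by (auto intro!: derivative_eq_intros)
 from DERIV_chain2[OF assms(2)[OF \<open>x - y \<noteq> 0\<close>] d]
 show "((%x. F (x - y)) has_real_derivative g (x - y)) (at x)"
  by simp
qed simp

lemma half_exp_bounds: "abs (exp (- abs z) / 2) <= exp (- abs (z::real))" "abs (- sgn z * exp (- abs z) / 2) <= exp (- abs z)"
 by (auto simp: abs_mult sgn_real_def)

lemma Helmholtz_primitive:
 assumes [measurable]: "f \<in> Borel" and f: "AE y in lborel. abs (f y) <= B"
 shows "primitive (inv_Helmholtz f) (d_Helmholtz f)"
  and "primitive (d_Helmholtz f) (%x. inv_Helmholtz f x - f x)"
proof -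
 let ?g = "%z::real. exp (- abs z) / 2" and ?h = "%z::real. - sgn z * exp (- abs z) / 2"
 have [measurable]: "?g \<in> Borel" "?h \<in> Borel" by measurable
 note Fg = kernel_Fubini[of ?g f B, OF _ assms(1) half_exp_bounds(1) f]
 note Fh = kernel_Fubini[of ?h f B, OF _ assms(1) half_exp_bounds(2) f]
 have e1: "abs (?g z) <= 1" "abs (?h z) <= 1" for z
 proof -
  have "exp (- abs z) <= 1" by simp
  then show "abs (?g z) <= 1" "abs (?h z) <= 1"
   using half_exp_bounds[of z] by linarith+
 qed
 have gc: "continuous_on UNIV ?g" by (intro continuous_intros) auto
 have P1: "primitive (%x. ?g (x - y)) (%x. ?h (x - y))" for y
  by (rule primitive_shift[OF gc exp_abs_deriv _ e1(2)]) auto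
 have P2: "primitive (%x. smoothed_step (x - y)) (%x. ?g (x - y))" for y
  by (rule primitive_shift[OF smoothed_step_continuous smoothed_step_deriv _ e1(1)]) auto
 show "primitive (inv_Helmholtz f) (d_Helmholtz f)"
  unfolding primitive_def
 proof (intro conjI allI impI)
  show "loc_int (d_Helmholtz f)"
   unfolding d_Helmholtz_def[abs_def] by (rule Fh(1)) measurable
  fix a b :: real assume ab: "a <= b"
  have "inv_Helmholtz f b - inv_Helmholtz f a = (LINT y|lborel. (?g (b - y) - ?g (a - y)) * f y)"
   unfolding inv_Helmholtz_def using Fg(3) by (simp add: left_diff_distrib)
  also have "... = seg_int (d_Helmholtz f) a b"
   unfolding d_Helmholtz_def[abs_def] primitiveD[OF P1 ab] by (rule Fh(2)[symmetric]) measurable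
  finally show "inv_Helmholtz f b - inv_Helmholtz f a = seg_int (d_Helmholtz f) a b" .
 qed
 have gl: "loc_int (inv_Helmholtz f)"
  unfolding inv_Helmholtz_def[abs_def] by (rule Fg(1)) measurable
 have fl: "loc_int f" by (rule loc_int_bounded[OF assms(1) f])
 show "primitive (d_Helmholtz f) (%x. inv_Helmholtz f x - f x)"
  unfolding primitive_def
 proof (intro conjI allI impI)
  show "loc_int (%x. inv_Helmholtz f x - f x)"
   by (intro loc_int_diff gl fl)
  fix a b :: real assume ab: "a <= b"
  have [measurable]: "smoothed_step \<in> Borel"
   by (rule borel_measurable_continuous_onI[OF smoothed_step_continuous])
  have "seg_int (inv_Helmholtz f) a b = (LINT y|lborel. (smoothed_step (b - y) - smoothed_step (a - y)) * f y)"
   unfolding inv_Helmholtz_def[abs_def] primitiveD[OF P2 ab] by (rule Fg(2)) measurable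
  also have "... = (LINT y|lborel. (?h (b - y) * f y - ?h (a - y) * f y) + indicator {a..b} y *\<^sub>R f y)"
  proof (rule integral_cong_AE)
   show "AE y in lborel. (smoothed_step (b - y) - smoothed_step (a - y)) * f y = (?h (b - y) * f y - ?h (a - y) * f y) + indicator {a..b} y *\<^sub>R f y"
    using AE_lborel_singleton[of a] AE_lborel_singleton[of b]
   proof eventually_elim
    case (elim y)
    have "smoothed_step (b - y) = ?h (b - y) + indicator {0<..} (b - y)" "smoothed_step (a - y) = ?h (a - y) + indicator {0<..} (a - y)"
     using elim smoothed_step_eq[of "b - y"] smoothed_step_eq[of "a - y"] by simp_all
    moreover have "indicator {0<..} (b - y) - indicator {0<..} (a - y) = (indicator {a..b} y :: real)"
     using elim ab by (auto simp: indicator_def)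
    ultimately have "smoothed_step (b - y) - smoothed_step (a - y) = ?h (b - y) - ?h (a - y) + indicator {a..b} y" by linarith
    then show ?case by (simp only: left_diff_distrib distrib_right real_scaleR_def)
   qed
  qed measurable
  also have "... = (d_Helmholtz f b - d_Helmholtz f a) + seg_int f a b"
   unfolding d_Helmholtz_def set_lebesgue_integral_def
   using Fh(3) loc_int_seg[OF fl, of a b] unfolding set_integrable_def
   by (subst Bochner_Integration.integral_add) (auto intro!: Bochner_Integration.integrable_diff Bochner_Integration.integral_diff)
  finally show "d_Helmholtz f b - d_Helmholtz f a = seg_int (%x. inv_Helmholtz f x - f x) a b"
   by (simp add: seg_int_diff[OF gl fl])
 qed
qed

lemma LINT_abs_le_AE:
 fixes f g :: "real => real"
 assumes "f \<in> Borel" "integrable lborel g" "AE y in lborel. abs (f y) <= g y"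
 shows "abs (LINT y|lborel. f y) <= (LINT y|lborel. g y)" "integrable lborel f"
proof -
 show i: "integrable lborel f"
  by (rule Bochner_Integration.integrable_bound[OF assms(2)]) (use assms in \<open>auto elim!: eventually_mono\<close>)
 have "abs (LINT y|lborel. f y) <= (LINT y|lborel. abs (f y))" by (rule integral_abs_bound)
 also have "... <= (LINT y|lborel. g y)"
  by (rule integral_mono_AE) (use i assms in auto)
 finally show "abs (LINT y|lborel. f y) <= (LINT y|lborel. g y)" .
qed

lemma Helmholtz_kconv_le:
 assumes [measurable]: "f \<in> Borel" and f: "AE y in lborel. abs (f y) <= D y" and D: "weight M D"
 shows "abs (inv_Helmholtz f x) <= kconv 1 D x / 2" "abs (d_Helmholtz f x) <= kconv 1 D x / 2"
proof -
 have gen: "abs (LINT y|lborel. h (x - y) * f y) <= kconv 1 D x / 2"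
  if [measurable]: "h \<in> Borel" and h: "!!z. abs (h z) <= exp (- abs z) / 2" for h
 proof -
  have "abs (LINT y|lborel. h (x - y) * f y) <= (LINT y|lborel. exp (- 1 * abs (x - y)) * D y / 2)"
  proof (rule LINT_abs_le_AE)
   show "integrable lborel (%y. exp (- 1 * abs (x - y)) * D y / 2)"
    using weight_kernel_integrable[OF _ D, of 1 x] by (intro integrable_divide) auto
   show "AE y in lborel. abs (h (x - y) * f y) <= exp (- 1 * abs (x - y)) * D y / 2"
    using f
   proof eventually_elim
    case (elim y)
    have "abs (h (x - y)) * abs (f y) <= exp (- abs (x - y)) / 2 * D y"
     using elim by (intro mult_mono h) auto
    then show ?case by (simp add: abs_mult)
   qed
  qed measurable
  then show ?thesis by (simp add: kconv_def)
 qed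
 show "abs (inv_Helmholtz f x) <= kconv 1 D x / 2"
  unfolding inv_Helmholtz_def by (rule gen[of "%z. exp (- abs z) / 2"]) auto
 show "abs (d_Helmholtz f x) <= kconv 1 D x / 2"
  unfolding d_Helmholtz_def by (rule gen[of "%z. - sgn z * exp (- abs z) / 2"]) (auto simp: abs_mult sgn_real_def)
qed

section \<open>The nonlocal forces in Lagrangian variables\<close>

definition wbd :: "(real => real) => real => (real => real) => bool" where
 "wbd E k h \<longleftrightarrow> (\<forall>x. abs (h x) <= k * E x) & (\<forall>a b. a <= b --> abs (h b - h a) <= k * seg_int E a b)"

lemma seg_int_weight_nonneg: "weight M E ==> 0 <= seg_int E a b"
 unfolding set_lebesgue_integral_def
 by (rule Bochner_Integration.integral_nonneg) (auto simp: indicator_def weightD(2))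

lemma seg_int_weight_le: "weight M E ==> a <= b ==> seg_int E a b <= M * (b - a)"
 using seg_int_mono_AE[OF weight_loc loc_int_const[of M], of M E a b]
 by (simp add: seg_int_const weightD(3))

lemma wbd_Lipschitz:
 assumes E: "weight M E" and h: "wbd E k h" and k: "0 <= k"
 shows "abs (h b - h a) <= k * M * abs (b - a)"
proof -
 have *: "abs (h b - h a) <= k * M * abs (b - a)" if "a <= b" for a b
 proof -
  have "abs (h b - h a) <= k * seg_int E a b" using h that by (simp add: wbd_def)
  also have "... <= k * (M * (b - a))" by (intro mult_left_mono seg_int_weight_le[OF E that] k)
  finally show ?thesis using that by simp
 qed
 show ?thesis using *[of a b] *[of b a] by (cases "a <= b") (auto simp: abs_minus_commute)
qed

lemma wbd_abs_le:
 assumes "weight M E" "wbd E k h" "0 <= k"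
 shows "abs (h x) <= k * M"
proof -
 have "abs (h x) <= k * E x" using assms(2) by (simp add: wbd_def)
 also have "... <= k * M" by (intro mult_left_mono assms(3) weightD(3)[OF assms(1)])
 finally show ?thesis .
qed

lemma wbd_primitive_AE:
 assumes E: "weight M E" and h: "wbd E k h" and g: "primitive h g"
 shows "AE x in lborel. abs (g x) <= k * E x"
proof (rule AE_abs_le_of_seg_int[OF primitive_loc[OF g] loc_int_cmult[OF weight_loc[OF E]]])
 fix a b :: real assume "a <= b"
 then show "abs (seg_int g a b) <= seg_int (%x. k * E x) a b"
  using h[unfolded wbd_def, THEN conjunct2, rule_format, of a b] primitiveD[OF g, of a b] by simp
qed

lemma wbd_of_primitive:
 assumes E: "weight M E" and g: "primitive h g" and b: "AE x in lborel. abs (g x) <= k * E x"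
  and p: "!!x. abs (h x) <= k * E x"
 shows "wbd E k h"
 unfolding wbd_def
proof (intro conjI allI impI p)
 fix a b :: real assume "a <= b"
 then show "abs (h b - h a) <= k * seg_int E a b"
  using seg_int_abs_le[OF primitive_loc[OF g] loc_int_cmult[OF weight_loc[OF E]] b, of a b]
  by (simp add: primitiveD[OF g])
qed

lemma wbd_mono:
 assumes "weight M E" "wbd E k h" "k <= k'"
 shows "wbd E k' h"
 unfolding wbd_def
proof (intro conjI allI impI)
 show "abs (h x) <= k' * E x" for x
  using assms(2) mult_right_mono[OF assms(3) weightD(2)[OF assms(1), of x]] unfolding wbd_def
  by (meson order_trans)
 show "abs (h b - h a) <= k' * seg_int E a b" if "a <= b" for a b
  using assms(2) that mult_right_mono[OF assms(3) seg_int_weight_nonneg[OF assms(1), of a b]] unfolding wbd_def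
  by (meson order_trans)
qed

lemma wbd_primitive:
 assumes "weight M E" "wbd E k h" "0 <= k"
 shows "primitive h (wd h)" "wd h \<in> Borel" "h \<in> Borel"
  "AE x in lborel. abs (wd h x) <= k * E x"
proof -
 have L: "!!a b. abs (h b - h a) <= k * M * abs (b - a)" by (rule wbd_Lipschitz[OF assms])
 show 1: "primitive h (wd h)" "wd h \<in> Borel" "h \<in> Borel"
  using Lipschitz_weak_deriv[OF L] by auto
 show "AE x in lborel. abs (wd h x) <= k * E x" by (rule wbd_primitive_AE[OF assms(1,2) 1(1)])
qed

definition euler_src :: "real => (real => real) => real => real" where
 "euler_src kap u y = kap * u y + (u y)^2 + (wd u y)^2 / 2"

definition lag_src :: "real => (real => real) => (real => real) => real => real" where
 "lag_src kap q U \<eta> = kap * U \<eta> + (U \<eta>)^2 + (wd U \<eta> / wd q \<eta>)^2 / 2"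

definition lag_P :: "real => (real => real) => (real => real) => real => real" where
 "lag_P kap q U \<xi> = (LINT \<eta>|lborel. exp (- abs (q \<xi> - q \<eta>)) / 2 * lag_src kap q U \<eta> * wd q \<eta>)"

definition lag_Q :: "real => (real => real) => (real => real) => real => real" where
 "lag_Q kap q U \<xi> = (LINT \<eta>|lborel. - sgn (\<xi> - \<eta>) * exp (- abs (q \<xi> - q \<eta>)) / 2 * lag_src kap q U \<eta> * wd q \<eta>)"

lemma lag_src_AE_euler:
 assumes q: "slopes \<alpha> \<beta> q" "0 < \<alpha>" and L: "!!a b. abs (u b - u a) <= L * abs (b - a)"
  and U: "U = (%\<xi>. u (q \<xi>))"
 shows "AE \<eta> in lborel. lag_src kap q U \<eta> = euler_src kap u (q \<eta>)"
 using Lipschitz_compose_weak_deriv[OF q L] slopes_weak_deriv(2)[OF q]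
proof eventually_elim
 case (elim \<eta>)
 then have "wd U \<eta> / wd q \<eta> = wd u (q \<eta>)" using q(2) by (simp add: U)
 then show ?case by (simp add: lag_src_def euler_src_def U)
qed

lemma euler_src_borel:
 assumes L: "!!a b. abs (u b - u a) <= L * abs (b - a)"
 shows "euler_src kap u \<in> Borel"
proof -
 have [measurable]: "u \<in> Borel" "wd u \<in> Borel"
  using Lipschitz_weak_deriv[OF L] by auto
 show ?thesis unfolding euler_src_def[abs_def] by measurable
qed

lemma lag_src_borel:
 assumes "slopes \<alpha> \<beta> q" "0 < \<alpha>" "!!a b. abs (U b - U a) <= L * abs (b - a)"
 shows "lag_src kap q U \<in> Borel"
proof -
 have [measurable]: "U \<in> Borel" "wd U \<in> Borel" "wd q \<in> Borel"
  using Lipschitz_weak_deriv[OF assms(3)] slopes_weak_deriv[OF assms(1,2)] by auto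
 show ?thesis unfolding lag_src_def[abs_def] by measurable
qed

text \<open>The change of variables \<open>y = q \<eta>\<close>; it identifies the Lagrangian forces with the Eulerian ones.\<close>

lemma lag_PQ_euler:
 assumes q: "slopes \<alpha> \<beta> q" "0 < \<alpha>" and L: "!!a b. abs (u b - u a) <= L * abs (b - a)"
  and U: "U = (%\<xi>. u (q \<xi>))"
 shows "lag_P kap q U \<xi> = inv_Helmholtz (euler_src kap u) (q \<xi>)"
  and "lag_Q kap q U \<xi> = d_Helmholtz (euler_src kap u) (q \<xi>)"
proof -
 note s = lag_src_AE_euler[OF q L U, of kap]
 have [measurable]: "wd q \<in> Borel" "q \<in> Borel" "euler_src kap u \<in> Borel"
  using slopes_weak_deriv[OF q] euler_src_borel[OF L] by auto
 have UL: "abs (U b - U a) <= (L * \<beta>) * abs (b - a)" for a b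
 proof -
  have "abs (U b - U a) <= L * abs (q b - q a)" unfolding U by (rule L)
  also have "... <= L * (\<beta> * abs (b - a))"
   by (intro mult_left_mono slopes_abs(2)[OF q] Lipschitz_nonneg[of u L] L)
  finally show ?thesis by simp
 qed
 have [measurable]: "lag_src kap q U \<in> Borel" by (rule lag_src_borel[OF q UL])
 have sg: "sgn (q \<xi> - q \<eta>) = sgn (\<xi> - \<eta>)" for \<eta>
  using slopes_less_iff[OF q, of \<eta> \<xi>] slopes_less_iff[OF q, of \<xi> \<eta>] by (auto simp: sgn_real_def)
 have gen: "(LINT \<eta>|lborel. k (q \<xi> - q \<eta>) * lag_src kap q U \<eta> * wd q \<eta>) = (LINT y|lborel. k (q \<xi> - y) * euler_src kap u y)"
  if [measurable]: "k \<in> Borel" for k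
 proof -
  have "(LINT y|lborel. k (q \<xi> - y) * euler_src kap u y) = (LINT \<eta>|lborel. wd q \<eta> * (k (q \<xi> - q \<eta>) * euler_src kap u (q \<eta>)))"
   by (rule change_of_variables_LINT[OF q]) measurable
  also have "... = (LINT \<eta>|lborel. k (q \<xi> - q \<eta>) * lag_src kap q U \<eta> * wd q \<eta>)"
  proof (rule integral_cong_AE)
   show "AE \<eta> in lborel. wd q \<eta> * (k (q \<xi> - q \<eta>) * euler_src kap u (q \<eta>)) = k (q \<xi> - q \<eta>) * lag_src kap q U \<eta> * wd q \<eta>"
    using s by eventually_elim (simp add: mult_ac)
  qed measurable
  finally show ?thesis ..
 qed
 show "lag_P kap q U \<xi> = inv_Helmholtz (euler_src kap u) (q \<xi>)"
  unfolding lag_P_def inv_Helmholtz_def by (rule gen[of "%z. exp (- abs z) / 2"]) measurable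
 show "lag_Q kap q U \<xi> = d_Helmholtz (euler_src kap u) (q \<xi>)"
  unfolding lag_Q_def d_Helmholtz_def sg[symmetric] by (rule gen[of "%z. - sgn z * exp (- abs z) / 2"]) measurable
qed

definition src_const :: "real => real => real => real" where
 "src_const kap \<alpha> M = abs kap + M + M / (2 * \<alpha>^2)"

lemma src_const_nonneg: "0 <= M ==> 0 <= src_const kap \<alpha> M"
 by (simp add: src_const_def)

lemma lag_src_AE_le:
 assumes q: "slopes \<alpha> \<beta> q" "0 < \<alpha>" and D: "weight M D" and U: "wbd D 1 U"
 shows "AE \<eta> in lborel. abs (lag_src kap q U \<eta>) <= src_const kap \<alpha> M * D \<eta>"
 using wbd_primitive(4)[OF D U zero_le_one, unfolded mult_1_left] slopes_weak_deriv(2)[OF q]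
proof eventually_elim
 case (elim \<eta>)
 have D0: "0 <= D \<eta>" "D \<eta> <= M" using weightD[OF D] by auto
 have u: "abs (U \<eta>) <= D \<eta>" using U by (simp add: wbd_def)
 have w: "abs (wd U \<eta>) <= D \<eta>" and r: "\<alpha> <= wd q \<eta>" using elim by auto
 have v: "abs (wd U \<eta> / wd q \<eta>) <= D \<eta> / \<alpha>"
  unfolding abs_divide using w r q(2) D0 by (intro frac_le) auto
 have "(wd U \<eta> / wd q \<eta>)^2 <= (D \<eta> / \<alpha>)^2"
  using v D0 q(2) by (simp add: abs_le_square_iff[symmetric])
 also have "... <= M * D \<eta> / \<alpha>^2"
  using D0 by (simp add: power_divide power2_eq_square divide_right_mono mult_right_mono)
 finally have 1: "(wd U \<eta> / wd q \<eta>)^2 / 2 <= M / (2 * \<alpha>^2) * D \<eta>"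
  by simp
 have 2: "(U \<eta>)^2 <= M * D \<eta>"
 proof -
  have "(U \<eta>)^2 = abs (U \<eta>) * abs (U \<eta>)" by (simp add: power2_eq_square)
  also have "... <= M * D \<eta>" using u D0 by (intro mult_mono) auto
  finally show ?thesis .
 qed
 have 3: "abs (kap * U \<eta>) <= abs kap * D \<eta>" unfolding abs_mult by (intro mult_left_mono u) auto
 have "abs (lag_src kap q U \<eta>) <= abs (kap * U \<eta>) + (U \<eta>)^2 + (wd U \<eta> / wd q \<eta>)^2 / 2"
  unfolding lag_src_def by (rule order_trans[OF abs_triangle_ineq] add_mono order_refl)+ auto
 also have "... <= abs kap * D \<eta> + M * D \<eta> + M / (2 * \<alpha>^2) * D \<eta>" using 1 2 3 by (intro add_mono)
 finally show ?case by (simp add: src_const_def distrib_right)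
qed

lemma lag_kernel_le:
 assumes q: "slopes \<alpha> \<beta> q" "0 < \<alpha>" and D: "weight M D" and U: "wbd D 1 U"
  and k[measurable]: "k \<in> Borel" and kb: "!!\<eta>. abs (k \<eta>) <= exp (- abs (q \<xi> - q \<eta>)) / 2"
 shows "abs (LINT \<eta>|lborel. k \<eta> * lag_src kap q U \<eta> * wd q \<eta>) <= src_const kap \<alpha> M * \<beta> / 2 * kconv \<alpha> D \<xi>"
  and "integrable lborel (%\<eta>. k \<eta> * lag_src kap q U \<eta> * wd q \<eta>)"
proof -
 let ?S = "src_const kap \<alpha> M"
 have S: "0 <= ?S" using src_const_nonneg weightD(4)[OF D] by blast
 have UL: "!!a b. abs (U b - U a) <= 1 * M * abs (b - a)" by (rule wbd_Lipschitz[OF D U]) simp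
 have [measurable]: "wd q \<in> Borel" "lag_src kap q U \<in> Borel"
  using slopes_weak_deriv[OF q] lag_src_borel[OF q UL] by auto
 have i: "integrable lborel (%\<eta>. ?S * \<beta> / 2 * (exp (- \<alpha> * abs (\<xi> - \<eta>)) * D \<eta>))"
  by (rule integrable_mult_right) (rule weight_kernel_integrable[OF q(2) D])
 have ae: "AE \<eta> in lborel. abs (k \<eta> * lag_src kap q U \<eta> * wd q \<eta>) <= ?S * \<beta> / 2 * (exp (- \<alpha> * abs (\<xi> - \<eta>)) * D \<eta>)"
  using lag_src_AE_le[OF q D U, of kap] slopes_weak_deriv(2)[OF q]
 proof eventually_elim
  case (elim \<eta>)
  have "abs (k \<eta>) <= exp (- \<alpha> * abs (\<xi> - \<eta>)) / 2"
   using kb[of \<eta>] slopes_abs(1)[OF q, of \<xi> \<eta>] by (smt (verit) exp_le_cancel_iff divide_right_mono mult_minus_left)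
  moreover have "abs (wd q \<eta>) <= \<beta>" using elim q(2) by auto
  ultimately have "abs (k \<eta>) * abs (lag_src kap q U \<eta>) * abs (wd q \<eta>) <= (exp (- \<alpha> * abs (\<xi> - \<eta>)) / 2) * (?S * D \<eta>) * \<beta>"
   using elim S weightD(2)[OF D] by (intro mult_mono) auto
  then show ?case by (simp add: abs_mult mult_ac)
 qed
 have m: "(%\<eta>. k \<eta> * lag_src kap q U \<eta> * wd q \<eta>) \<in> Borel" by measurable
 show "abs (LINT \<eta>|lborel. k \<eta> * lag_src kap q U \<eta> * wd q \<eta>) <= ?S * \<beta> / 2 * kconv \<alpha> D \<xi>"
  using LINT_abs_le_AE(1)[OF m i ae] by (simp add: kconv_def)
 show "integrable lborel (%\<eta>. k \<eta> * lag_src kap q U \<eta> * wd q \<eta>)"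
  by (rule LINT_abs_le_AE(2)[OF m i ae])
qed

lemma lag_PQ_le:
 assumes q: "slopes \<alpha> \<beta> q" "0 < \<alpha>" and D: "weight M D" and U: "wbd D 1 U"
 shows "abs (lag_P kap q U \<xi>) <= src_const kap \<alpha> M * \<beta> / 2 * kconv \<alpha> D \<xi>"
  and "abs (lag_Q kap q U \<xi>) <= src_const kap \<alpha> M * \<beta> / 2 * kconv \<alpha> D \<xi>"
proof -
 have [measurable]: "q \<in> Borel" using slopes_weak_deriv[OF q] by auto
 show "abs (lag_P kap q U \<xi>) <= src_const kap \<alpha> M * \<beta> / 2 * kconv \<alpha> D \<xi>"
  unfolding lag_P_def by (rule lag_kernel_le(1)[OF q D U]) auto
 show "abs (lag_Q kap q U \<xi>) <= src_const kap \<alpha> M * \<beta> / 2 * kconv \<alpha> D \<xi>"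
  unfolding lag_Q_def by (rule lag_kernel_le(1)[OF q D U]) (auto simp: sgn_real_def abs_mult)
qed

text \<open>\<open>(1 - \<partial>\<^sub>x\<^sup>2) P = f\<close> gives \<open>\<partial>\<^sub>x Q = P - f\<close>, and the chain rule adds the factor \<open>q'\<close>.\<close>

lemma lag_Q_primitive:
 assumes q: "slopes \<alpha> \<beta> q" "0 < \<alpha>" and D: "weight M D" and U: "wbd D 1 U"
 shows "primitive (lag_Q kap q U) (%\<eta>. (lag_P kap q U \<eta> - lag_src kap q U \<eta>) * wd q \<eta>)"
proof -
 note qi = slopes_inv[OF q]
 define u where "u x = U (inv q x)" for x
 have Uu: "U = (%\<xi>. u (q \<xi>))" by (simp add: u_def qi(2))
 have M0: "0 <= M" using weightD(4)[OF D] .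
 have UL: "abs (U b - U a) <= M * abs (b - a)" for a b using wbd_Lipschitz[OF D U, of b a] by simp
 have L: "abs (u b - u a) <= (M * (1 / \<alpha>)) * abs (b - a)" for a b
 proof -
  have "abs (u b - u a) <= M * abs (inv q b - inv q a)" unfolding u_def by (rule UL)
  also have "... <= M * (1 / \<alpha> * abs (b - a))"
   by (intro mult_left_mono slopes_abs(2)[OF qi(3,4)] M0)
  finally show ?thesis by simp
 qed
 have [measurable]: "wd q \<in> Borel" "q \<in> Borel" "euler_src kap u \<in> Borel"
  "lag_src kap q U \<in> Borel"
  using slopes_weak_deriv[OF q] euler_src_borel[OF L] lag_src_borel[OF q UL] by auto
 have "AE \<eta> in lborel. abs (lag_src kap q U \<eta>) <= src_const kap \<alpha> M * M"
  using lag_src_AE_le[OF q D U, of kap]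
 proof eventually_elim
  case (elim \<eta>)
  then show ?case
   using mult_left_mono[OF weightD(3)[OF D, of \<eta>] src_const_nonneg[OF M0, of kap \<alpha>]] by linarith
 qed
 with lag_src_AE_euler[OF q L Uu, of kap]
 have "AE \<eta> in lborel. abs (euler_src kap u (q \<eta>)) <= src_const kap \<alpha> M * M" by eventually_elim simp
 from AE_compose_slopes[OF qi(3,4) this]
 have eb: "AE x in lborel. abs (euler_src kap u x) <= src_const kap \<alpha> M * M" by (simp add: qi(1))
 note H = Helmholtz_primitive[OF _ eb]
 have [measurable]: "inv_Helmholtz (euler_src kap u) \<in> Borel"
  by (rule primitive_borel[OF H(1)]) measurable
 note PQ = lag_PQ_euler[OF q L Uu, of kap]
 have [measurable]: "lag_P kap q U \<in> Borel" unfolding PQ(1)[abs_def] by measurable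
 have loc: "loc_int (%\<eta>. (lag_P kap q U \<eta> - lag_src kap q U \<eta>) * wd q \<eta>)"
 proof (rule loc_int_bounded)
  show "AE \<eta> in lborel. abs ((lag_P kap q U \<eta> - lag_src kap q U \<eta>) * wd q \<eta>)
    <= (src_const kap \<alpha> M * \<beta> / 2 * (2 / \<alpha> * M) + src_const kap \<alpha> M * M) * \<beta>"
   using \<open>AE \<eta> in lborel. abs (lag_src kap q U \<eta>) <= src_const kap \<alpha> M * M\<close> slopes_weak_deriv(2)[OF q]
  proof eventually_elim
   case (elim \<eta>)
   have b: "0 <= \<beta>" using slopes_le[OF q(1)] q(2) by linarith
   have "abs (lag_P kap q U \<eta>) <= src_const kap \<alpha> M * \<beta> / 2 * (2 / \<alpha> * M)"
    by (rule order_trans[OF lag_PQ_le(1)[OF q D U, of kap \<eta>] mult_left_mono[OF kconv_le[OF q(2) D]]])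
     (use src_const_nonneg[OF M0, of kap \<alpha>] b in simp)
   then have "abs (lag_P kap q U \<eta> - lag_src kap q U \<eta>) <= src_const kap \<alpha> M * \<beta> / 2 * (2 / \<alpha> * M) + src_const kap \<alpha> M * M"
    using elim by linarith
   moreover have "abs (wd q \<eta>) <= \<beta>" using elim q(2) by auto
   ultimately show ?case unfolding abs_mult by (intro mult_mono) auto
  qed
 qed measurable
 show ?thesis
  unfolding primitive_def
 proof (intro conjI loc allI impI)
  fix a b :: real assume ab: "a <= b"
  then have qab: "q a <= q b" using slopes_le_iff[OF q] by simp
  have "lag_Q kap q U b - lag_Q kap q U a = seg_int (%x. inv_Helmholtz (euler_src kap u) x - euler_src kap u x) (q a) (q b)"
   unfolding PQ(2) by (rule primitiveD[OF H(2) qab]) measurable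
  also have "... = seg_int (%\<eta>. (inv_Helmholtz (euler_src kap u) (q \<eta>) - euler_src kap u (q \<eta>)) * wd q \<eta>) a b"
   by (rule seg_int_change_of_variables[OF q]) measurable
  also have "... = seg_int (%\<eta>. (lag_P kap q U \<eta> - lag_src kap q U \<eta>) * wd q \<eta>) a b"
  proof (rule seg_int_cong_AE)
   show "AE \<eta> in lborel. (inv_Helmholtz (euler_src kap u) (q \<eta>) - euler_src kap u (q \<eta>)) * wd q \<eta> = (lag_P kap q U \<eta> - lag_src kap q U \<eta>) * wd q \<eta>"
    using lag_src_AE_euler[OF q L Uu, of kap] by eventually_elim (simp add: PQ(1))
  qed measurable
  finally show "lag_Q kap q U b - lag_Q kap q U a = seg_int (%\<eta>. (lag_P kap q U \<eta> - lag_src kap q U \<eta>) * wd q \<eta>) a b" .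
 qed
qed

text \<open>The weight leaves the convolution with a constant factor because it is admissible; this factor and the size
  of the source make up the constant.\<close>

lemma lag_Q_wbd:
 assumes q: "slopes \<alpha> \<beta> q" "0 < \<alpha>" and \<beta>: "1 <= \<beta>" and D: "weight M D" and U: "wbd D 1 U"
  and c: "!!x. kconv \<alpha> D x <= c * D x" "0 <= c"
 shows "wbd D ((\<beta> / 2 * c + 1) * \<beta> * src_const kap \<alpha> M) (lag_Q kap q U)"
proof (rule wbd_of_primitive[OF D lag_Q_primitive[OF q D U]])
 let ?S = "src_const kap \<alpha> M"
 have S: "0 <= ?S" using src_const_nonneg weightD(4)[OF D] by blast
 have kb: "?S * \<beta> / 2 * kconv \<alpha> D x <= ?S * (\<beta> / 2 * c) * D x" for x
  using mult_left_mono[OF c(1)[of x], of "?S * \<beta> / 2"] S \<beta> by (simp add: mult_ac)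
 show "AE \<eta> in lborel. abs ((lag_P kap q U \<eta> - lag_src kap q U \<eta>) * wd q \<eta>) <= (\<beta> / 2 * c + 1) * \<beta> * ?S * D \<eta>"
  using lag_src_AE_le[OF q D U, of kap] slopes_weak_deriv(2)[OF q]
 proof eventually_elim
  case (elim \<eta>)
  have "abs (lag_P kap q U \<eta> - lag_src kap q U \<eta>) <= ?S * (\<beta> / 2 * c) * D \<eta> + ?S * D \<eta>"
   using elim lag_PQ_le(1)[OF q D U, of kap \<eta>] kb[of \<eta>] by linarith
  moreover have "abs (wd q \<eta>) <= \<beta>" using elim q(2) by auto
  ultimately have "abs ((lag_P kap q U \<eta> - lag_src kap q U \<eta>) * wd q \<eta>) <= (?S * (\<beta> / 2 * c) * D \<eta> + ?S * D \<eta>) * \<beta>"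
   unfolding abs_mult by (intro mult_mono) auto
  then show ?case by (simp add: algebra_simps)
 qed
 fix \<xi>
 have "abs (lag_Q kap q U \<xi>) <= ?S * (\<beta> / 2 * c) * D \<xi>"
  using lag_PQ_le(2)[OF q D U, of kap \<xi>] kb[of \<xi>] by linarith
 also have "... <= (\<beta> / 2 * c + 1) * \<beta> * ?S * D \<xi>"
 proof (rule mult_right_mono)
  have e: "\<beta> / 2 * c <= (\<beta> / 2 * c + 1) * \<beta>"
   using mult_mono[of "\<beta> / 2 * c" "\<beta> / 2 * c + 1" 1 \<beta>] \<beta> c(2) by auto
  show "?S * (\<beta> / 2 * c) <= (\<beta> / 2 * c + 1) * \<beta> * ?S"
   using mult_left_mono[OF e S] by (simp only: mult.commute)
 qed (simp add: weightD[OF D])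
 finally show "abs (lag_Q kap q U \<xi>) <= (\<beta> / 2 * c + 1) * \<beta> * ?S * D \<xi>" .
qed

lemma exp_minus_Lipschitz:
 fixes A B m :: real
 assumes "m <= A" "m <= B"
 shows "abs (exp (- A) - exp (- B)) <= abs (A - B) * exp (- m)"
proof -
 have *: "abs (exp (- A) - exp (- B)) <= abs (A - B) * exp (- m)" if "A <= B" "m <= A" for A B
 proof -
  have "exp (- A) - exp (- B) = exp (- A) * (1 - exp (- (B - A)))"
   by (simp add: right_diff_distrib exp_add[symmetric])
  also have "... <= exp (- m) * (B - A)"
  proof (rule mult_mono)
   show "1 - exp (- (B - A)) <= B - A" using exp_ge_add_one_self[of "- (B - A)"] by linarith
  qed (use that in auto)
  finally have "exp (- A) - exp (- B) <= exp (- m) * (B - A)" .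
  moreover have "0 <= exp (- A) - exp (- B)" using that by simp
  ultimately show ?thesis using that by (simp add: mult.commute)
 qed
 show ?thesis using *[of A B] *[of B A] assms by (cases "A <= B") (auto simp: abs_minus_commute)
qed

lemma linear_times_exp_le:
 fixes \<alpha> z :: real
 assumes "0 < \<alpha>" "0 <= z"
 shows "z * exp (- (\<alpha> * z)) <= 2 / \<alpha> * exp (- (\<alpha> / 2 * z))"
proof -
 have "\<alpha> / 2 * z <= exp (\<alpha> / 2 * z)" using exp_ge_add_one_self[of "\<alpha> / 2 * z"] by linarith
 then have "\<alpha> / 2 * z * exp (- (\<alpha> * z)) <= exp (\<alpha> / 2 * z) * exp (- (\<alpha> * z))"
  by (rule mult_right_mono) simp
 also have "... = exp (- (\<alpha> / 2 * z))" by (simp add: exp_add[symmetric])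
 finally have "2 / \<alpha> * (\<alpha> / 2 * z * exp (- (\<alpha> * z))) <= 2 / \<alpha> * exp (- (\<alpha> / 2 * z))"
  using assms(1) by (intro mult_left_mono) auto
 then show ?thesis using assms(1) by simp
qed

lemma abs_mult_le:
 fixes a b :: real
 assumes "abs a <= A" "abs b <= B"
 shows "abs (a * b) <= A * B"
 unfolding abs_mult by (rule mult_mono[OF assms]) (use assms in auto)

lemma abs_mult3_le:
 fixes a b c :: real
 assumes "abs a <= A" "abs b <= B" "abs c <= C"
 shows "abs (a * b * c) <= A * B * C"
 by (rule abs_mult_le[OF abs_mult_le[OF assms(1,2)] assms(3)])

definition dsrc_const :: "real => real => real => real => real" where
 "dsrc_const kap \<alpha> M L = abs kap + 2 * M + M / \<alpha> * (1 / \<alpha> + L / \<alpha>^2)"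

definition dQ_const :: "real => real => real => real => real => real" where
 "dQ_const kap \<alpha> \<beta> M L = 2 / \<alpha> * src_const kap \<alpha> M * \<beta> * L + dsrc_const kap \<alpha> M L * \<beta> + src_const kap \<alpha> M * L"

definition dlag_const :: "real => real => real => real => real => real => real" where
 "dlag_const kap \<alpha> \<beta> M L c = (dQ_const kap \<alpha> \<beta> M L / 2 * c + dsrc_const kap \<alpha> M L) * \<beta>
  + (src_const kap \<alpha> M * \<beta> / 2 * c + src_const kap \<alpha> M) * L"

locale two_states =
 fixes kap \<alpha> \<beta> M M' L c eps :: real and D E q1 q2 U1 U2 :: "real => real"
 assumes q1: "slopes \<alpha> \<beta> q1" and q2: "slopes \<alpha> \<beta> q2" and \<alpha>: "0 < \<alpha>" and \<beta>: "1 <= \<beta>"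
  and D: "weight M D" and U1: "wbd D 1 U1" and U2: "wbd D 1 U2"
  and E: "weight M' E" and dU: "wbd E 1 (%x. U1 x - U2 x)"
  and dq: "!!a b. abs ((q1 b - q2 b) - (q1 a - q2 a)) <= eps * abs (b - a)"
  and epsD: "!!x. eps * D x <= L * E x" and L: "0 <= L"
  and c: "!!x. kconv (\<alpha> / 2) E x <= c * E x" "0 <= c"
begin

abbreviation "S \<equiv> src_const kap \<alpha> M"
abbreviation "S2 \<equiv> dsrc_const kap \<alpha> M L"

lemma eps_nonneg: "0 <= eps"
 using dq[of 1 0] by simp

lemma M_nonneg: "0 <= M" using weightD(4)[OF D] .

lemma S_nonneg: "0 <= S" by (rule src_const_nonneg[OF M_nonneg])

lemma S2_nonneg: "0 <= S2" unfolding dsrc_const_def using M_nonneg L \<alpha> by simp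

lemma dQ_nonneg: "0 <= dQ_const kap \<alpha> \<beta> M L"
 unfolding dQ_const_def using S_nonneg S2_nonneg L \<alpha> \<beta> by simp

lemma AE_dq: "AE x in lborel. abs (wd q1 x - wd q2 x) <= eps"
proof -
 have p: "primitive (%x. q1 x - q2 x) (%x. wd q1 x - wd q2 x)"
  by (intro primitive_diff slopes_weak_deriv(1)[OF q1 \<alpha>] slopes_weak_deriv(1)[OF q2 \<alpha>])
 show ?thesis
 proof (rule AE_abs_le_of_seg_int[OF primitive_loc[OF p] loc_int_const])
  fix a b :: real assume "a <= b"
  then show "abs (seg_int (%x. wd q1 x - wd q2 x) a b) <= seg_int (%_. eps) a b"
   using dq[where a=a and b=b] by (simp add: primitiveD[OF p, symmetric] seg_int_const)
 qed
qed

lemma AE_dU: "AE x in lborel. abs (wd U1 x - wd U2 x) <= E x"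
 using wbd_primitive_AE[OF E dU primitive_diff[OF wbd_primitive(1)[OF D U1] wbd_primitive(1)[OF D U2]]] by simp

lemma src_diff: "AE \<eta> in lborel. abs (lag_src kap q1 U1 \<eta> - lag_src kap q2 U2 \<eta>) <= S2 * E \<eta>"
 using wbd_primitive(4)[OF D U1 zero_le_one, unfolded mult_1_left] wbd_primitive(4)[OF D U2 zero_le_one, unfolded mult_1_left]
  slopes_weak_deriv(2)[OF q1 \<alpha>] slopes_weak_deriv(2)[OF q2 \<alpha>] AE_dq AE_dU
proof eventually_elim
 case (elim \<eta>)
 define W1 W2 r1 r2 where "W1 = wd U1 \<eta>" and "W2 = wd U2 \<eta>" and "r1 = wd q1 \<eta>" and "r2 = wd q2 \<eta>"
 have h: "abs W1 <= D \<eta>" "abs W2 <= D \<eta>" "\<alpha> <= r1" "\<alpha> <= r2" "abs (r1 - r2) <= eps" "abs (W1 - W2) <= E \<eta>"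
  using elim by (auto simp: W1_def W2_def r1_def r2_def)
 have pos: "0 < r1" "0 < r2" using h \<alpha> by auto
 have DE: "0 <= D \<eta>" "D \<eta> <= M" "0 <= E \<eta>" "eps * D \<eta> <= L * E \<eta>" using weightD[OF D] weightD[OF E] epsD by auto
 have V: "abs (W1 / r1) <= M / \<alpha>" "abs (W2 / r2) <= M / \<alpha>"
  unfolding abs_divide using h DE \<alpha> pos by (auto intro!: frac_le)
 have dV: "abs (W1 / r1 - W2 / r2) <= (1 / \<alpha> + L / \<alpha>^2) * E \<eta>"
 proof -
  have "W1 / r1 - W2 / r2 = (W1 - W2) / r1 + W2 * (r2 - r1) / (r1 * r2)"
   using pos by (simp add: field_simps)
  also have "\<bar>...\<bar> <= \<bar>(W1 - W2) / r1\<bar> + \<bar>W2 * (r2 - r1) / (r1 * r2)\<bar>" by (rule abs_triangle_ineq)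
  also have "abs ((W1 - W2) / r1) <= E \<eta> / \<alpha>"
   unfolding abs_divide using h DE \<alpha> pos by (intro frac_le) auto
  also have "abs (W2 * (r2 - r1) / (r1 * r2)) <= (L * E \<eta>) / (\<alpha> * \<alpha>)"
   unfolding abs_divide
  proof (rule frac_le)
   have "abs W2 * abs (r2 - r1) <= D \<eta> * eps" using h DE by (intro mult_mono) (auto simp: abs_minus_commute)
   then show "abs (W2 * (r2 - r1)) <= L * E \<eta>" using DE(4) by (simp add: abs_mult mult.commute)
   show "\<alpha> * \<alpha> <= abs (r1 * r2)" using h \<alpha> pos by (simp add: abs_mult mult_mono)
  qed (use L DE \<alpha> in auto)
  finally show ?thesis by (simp add: distrib_right power2_eq_square)
 qed
 have "abs ((W1 / r1)^2 / 2 - (W2 / r2)\<^sup>2 / 2) <= M / \<alpha> * ((1 / \<alpha> + L / \<alpha>^2) * E \<eta>)"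
 proof -
  have "(W1 / r1)^2 / 2 - (W2 / r2)\<^sup>2 / 2 = (W1 / r1 + W2 / r2) / 2 * (W1 / r1 - W2 / r2)"
   by (simp add: power2_eq_square algebra_simps)
  also have "\<bar>...\<bar> = \<bar>(W1 / r1 + W2 / r2) / 2\<bar> * \<bar>W1 / r1 - W2 / r2\<bar>" by (rule abs_mult)
  also have "... <= M / \<alpha> * ((1 / \<alpha> + L / \<alpha>^2) * E \<eta>)"
  proof (rule mult_mono[OF _ dV])
   have "abs (W1 / r1 + W2 / r2) <= M / \<alpha> + M / \<alpha>" using V by linarith
   then show "abs ((W1 / r1 + W2 / r2) / 2) <= M / \<alpha>" unfolding abs_divide by (simp add: mult.commute)
  qed (use M_nonneg \<alpha> in auto)
  finally show ?thesis .
 qed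
 moreover have "abs (kap * U1 \<eta> - kap * U2 \<eta>) <= abs kap * E \<eta>"
  using dU unfolding wbd_def by (simp add: right_diff_distrib[symmetric] abs_mult mult_left_mono)
 moreover have "abs ((U1 \<eta>)^2 - (U2 \<eta>)\<^sup>2) <= 2 * M * E \<eta>"
 proof -
  have "(U1 \<eta>)^2 - (U2 \<eta>)\<^sup>2 = (U1 \<eta> + U2 \<eta>) * (U1 \<eta> - U2 \<eta>)" by (simp add: power2_eq_square algebra_simps)
  also have "\<bar>...\<bar> = \<bar>U1 \<eta> + U2 \<eta>\<bar> * \<bar>U1 \<eta> - U2 \<eta>\<bar>" by (rule abs_mult)
  also have "... <= (2 * M) * E \<eta>"
  proof (rule mult_mono)
   show "abs (U1 \<eta> + U2 \<eta>) <= 2 * M" using wbd_abs_le[OF D U1, of \<eta>] wbd_abs_le[OF D U2, of \<eta>] by simp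
   show "abs (U1 \<eta> - U2 \<eta>) <= E \<eta>" using dU by (simp add: wbd_def)
  qed (use M_nonneg in auto)
  finally show ?thesis .
 qed
 moreover have "lag_src kap q1 U1 \<eta> - lag_src kap q2 U2 \<eta> = (kap * U1 \<eta> - kap * U2 \<eta>) + ((U1 \<eta>)^2 - (U2 \<eta>)\<^sup>2) + ((W1 / r1)^2 / 2 - (W2 / r2)\<^sup>2 / 2)"
  by (simp add: lag_src_def W1_def W2_def r1_def r2_def)
 ultimately have "abs (lag_src kap q1 U1 \<eta> - lag_src kap q2 U2 \<eta>) <= abs kap * E \<eta> + 2 * M * E \<eta> + M / \<alpha> * ((1 / \<alpha> + L / \<alpha>^2) * E \<eta>)"
  by linarith
 then show ?case unfolding dsrc_const_def by (simp only: distrib_right mult.assoc)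
qed

lemma kernel_diff:
 "abs (exp (- abs (q1 \<xi> - q1 \<eta>)) - exp (- abs (q2 \<xi> - q2 \<eta>))) <= eps * (2 / \<alpha> * exp (- (\<alpha> / 2 * abs (\<xi> - \<eta>))))"
proof -
 have "abs (exp (- abs (q1 \<xi> - q1 \<eta>)) - exp (- abs (q2 \<xi> - q2 \<eta>))) <= abs ((abs (q1 \<xi> - q1 \<eta>)) - abs (q2 \<xi> - q2 \<eta>)) * exp (- (\<alpha> * abs (\<xi> - \<eta>)))"
  by (rule exp_minus_Lipschitz) (use slopes_abs(1)[OF q1 \<alpha>] slopes_abs(1)[OF q2 \<alpha>] in auto)
 also have "... <= (eps * abs (\<xi> - \<eta>)) * exp (- (\<alpha> * abs (\<xi> - \<eta>)))"
 proof (rule mult_right_mono)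
  have "abs ((abs (q1 \<xi> - q1 \<eta>)) - abs (q2 \<xi> - q2 \<eta>)) <= abs ((q1 \<xi> - q1 \<eta>) - (q2 \<xi> - q2 \<eta>))" by (rule abs_triangle_ineq3)
  also have "... = abs ((q1 \<xi> - q2 \<xi>) - (q1 \<eta> - q2 \<eta>))" by (simp add: algebra_simps)
  also have "... <= eps * abs (\<xi> - \<eta>)" by (rule dq)
  finally show "abs ((abs (q1 \<xi> - q1 \<eta>)) - abs (q2 \<xi> - q2 \<eta>)) <= eps * abs (\<xi> - \<eta>)" .
 qed simp
 also have "... <= eps * (2 / \<alpha> * exp (- (\<alpha> / 2 * abs (\<xi> - \<eta>))))"
  unfolding mult.assoc by (intro mult_left_mono eps_nonneg linear_times_exp_le[OF \<alpha>, unfolded mult.assoc]) simp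
 finally show ?thesis .
qed

lemma kernel_decay: "exp (- abs (q2 \<xi> - q2 \<eta>)) <= exp (- (\<alpha> / 2 * abs (\<xi> - \<eta>)))"
proof -
 have "\<alpha> / 2 * abs (\<xi> - \<eta>) <= \<alpha> * abs (\<xi> - \<eta>)" using \<alpha> by (intro mult_right_mono) auto
 then show ?thesis using slopes_abs(1)[OF q2 \<alpha>, of \<xi> \<eta>] by simp
qed

text \<open>The integrand changes through the kernel, the source and the Jacobian. Each change is a multiple of
  \<open>E \<eta>\<close> times half of the exponential decay: the other half absorbs the linear growth of
  \<open>(q1 - q2) \<xi> - (q1 - q2) \<eta>\<close>.\<close>

lemma integral_diff:
 assumes [measurable]: "\<sigma> \<in> Borel" and \<sigma>: "!!\<eta>. abs (\<sigma> \<eta>) <= 1"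
 shows "abs ((LINT \<eta>|lborel. \<sigma> \<eta> * exp (- abs (q1 \<xi> - q1 \<eta>)) / 2 * lag_src kap q1 U1 \<eta> * wd q1 \<eta>)
  - (LINT \<eta>|lborel. \<sigma> \<eta> * exp (- abs (q2 \<xi> - q2 \<eta>)) / 2 * lag_src kap q2 U2 \<eta> * wd q2 \<eta>))
  <= dQ_const kap \<alpha> \<beta> M L / 2 * c * E \<xi>"
proof -
 let ?K = "dQ_const kap \<alpha> \<beta> M L"
 let ?g = "%q U \<eta>. \<sigma> \<eta> * exp (- abs (q \<xi> - q \<eta>)) / 2 * lag_src kap q U \<eta> * wd q \<eta>"
 let ?e = "%\<eta>. exp (- (\<alpha> / 2) * abs (\<xi> - \<eta>))"
 have [measurable]: "q1 \<in> Borel" "q2 \<in> Borel"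
  using slopes_weak_deriv[OF q1 \<alpha>] slopes_weak_deriv[OF q2 \<alpha>] by auto
 have \<sigma>e: "abs (\<sigma> \<eta> * exp z / 2) <= exp z / 2" for \<eta> z using \<sigma>[of \<eta>] by (simp add: abs_mult)
 have i1: "integrable lborel (?g q1 U1)" by (rule lag_kernel_le(2)[OF q1 \<alpha> D U1 _ \<sigma>e]) measurable
 have i2: "integrable lborel (?g q2 U2)" by (rule lag_kernel_le(2)[OF q2 \<alpha> D U2 _ \<sigma>e]) measurable
 have iE: "integrable lborel (%\<eta>. ?K / 2 * (?e \<eta> * E \<eta>))"
  by (rule integrable_mult_right) (rule weight_kernel_integrable[OF _ E], use \<alpha> in simp)
 have ae: "AE \<eta> in lborel. abs (?g q1 U1 \<eta> - ?g q2 U2 \<eta>) <= ?K / 2 * (?e \<eta> * E \<eta>)"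
  using lag_src_AE_le[OF q1 \<alpha> D U1, of kap] lag_src_AE_le[OF q2 \<alpha> D U2, of kap] src_diff AE_dq
   slopes_weak_deriv(2)[OF q1 \<alpha>]
 proof eventually_elim
  case (elim \<eta>)
  define K1 K2 s1 s2 r1 r2 e where d: "K1 = exp (- abs (q1 \<xi> - q1 \<eta>))" "K2 = exp (- abs (q2 \<xi> - q2 \<eta>))"
   "s1 = lag_src kap q1 U1 \<eta>" "s2 = lag_src kap q2 U2 \<eta>" "r1 = wd q1 \<eta>" "r2 = wd q2 \<eta>" "e = ?e \<eta>"
  have D0: "0 <= D \<eta>" and E0: "0 <= E \<eta>" using weightD(2)[OF D] weightD(2)[OF E] by auto
  have b: "abs s1 <= S * D \<eta>" "abs s2 <= S * D \<eta>" "abs (s1 - s2) <= S2 * E \<eta>" "abs (r1 - r2) <= eps" "abs r1 <= \<beta>"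
   using elim \<alpha> unfolding d by auto
  have k: "abs (K1 - K2) <= eps * (2 / \<alpha> * e)" "abs K2 <= e"
   using kernel_diff[of \<xi> \<eta>] kernel_decay[of \<xi> \<eta>] unfolding d by auto
  have e0: "0 <= e" by (simp add: d)
  have t1: "abs ((K1 - K2) * s1 * r1) <= e * (2 / \<alpha> * S * \<beta> * L) * E \<eta>"
  proof -
   have "abs ((K1 - K2) * s1 * r1) <= (eps * (2 / \<alpha> * e)) * (S * D \<eta>) * \<beta>"
    by (rule abs_mult3_le[OF k(1) b(1) b(5)])
   also have "... = (2 / \<alpha> * e * S * \<beta>) * (eps * D \<eta>)" by (simp add: mult_ac)
   also have "... <= (2 / \<alpha> * e * S * \<beta>) * (L * E \<eta>)"
    by (rule mult_left_mono[OF epsD]) (use \<alpha> e0 S_nonneg \<beta> in auto)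
   finally show ?thesis by (simp add: mult_ac)
  qed
  have t2: "abs (K2 * (s1 - s2) * r1) <= e * (S2 * \<beta>) * E \<eta>"
  proof -
   have "abs (K2 * (s1 - s2) * r1) <= e * (S2 * E \<eta>) * \<beta>"
    by (rule abs_mult3_le[OF k(2) b(3) b(5)])
   then show ?thesis by (simp add: mult_ac)
  qed
  have t3: "abs (K2 * s2 * (r1 - r2)) <= e * (S * L) * E \<eta>"
  proof -
   have "abs (K2 * s2 * (r1 - r2)) <= e * (S * D \<eta>) * eps"
    by (rule abs_mult3_le[OF k(2) b(2) b(4)])
   also have "... = (e * S) * (eps * D \<eta>)" by (simp add: mult_ac)
   also have "... <= (e * S) * (L * E \<eta>)"
    by (rule mult_left_mono[OF epsD]) (use e0 S_nonneg in auto)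
   finally show ?thesis by (simp add: mult_ac)
  qed
  have eq: "?g q1 U1 \<eta> - ?g q2 U2 \<eta> = \<sigma> \<eta> / 2 * ((K1 - K2) * s1 * r1 + K2 * (s1 - s2) * r1 + K2 * s2 * (r1 - r2))"
   unfolding d by (simp add: algebra_simps)
  have "abs ((K1 - K2) * s1 * r1 + K2 * (s1 - s2) * r1 + K2 * s2 * (r1 - r2)) <= e * (2 / \<alpha> * S * \<beta> * L) * E \<eta> + e * (S2 * \<beta>) * E \<eta> + e * (S * L) * E \<eta>"
   using t1 t2 t3 by linarith
  also have "... = ?K * (e * E \<eta>)" unfolding dQ_const_def by (simp only: distrib_left distrib_right mult_ac)
  finally have T: "abs ((K1 - K2) * s1 * r1 + K2 * (s1 - s2) * r1 + K2 * s2 * (r1 - r2)) <= ?K * (e * E \<eta>)" .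
  have "abs (?g q1 U1 \<eta> - ?g q2 U2 \<eta>) <= 1 / 2 * (?K * (e * E \<eta>))"
   unfolding eq by (rule abs_mult_le[OF _ T]) (use \<sigma>[of \<eta>] in simp)
  then show ?case unfolding d by (simp add: mult.assoc)
 qed
 have "abs ((LINT \<eta>|lborel. ?g q1 U1 \<eta>) - (LINT \<eta>|lborel. ?g q2 U2 \<eta>)) = abs (LINT \<eta>|lborel. ?g q1 U1 \<eta> - ?g q2 U2 \<eta>)"
  using Bochner_Integration.integral_diff[OF i1 i2] by simp
 also have "... <= (LINT \<eta>|lborel. ?K / 2 * (?e \<eta> * E \<eta>))"
  by (rule LINT_abs_le_AE(1)[OF borel_measurable_integrable[OF Bochner_Integration.integrable_diff[OF i1 i2], unfolded measurable_lborel2] iE ae])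
 also have "... = ?K / 2 * kconv (\<alpha> / 2) E \<xi>" by (simp add: kconv_def)
 also have "... <= ?K / 2 * (c * E \<xi>)" using c(1) dQ_nonneg by (intro mult_left_mono) auto
 finally show ?thesis by (simp add: mult.assoc)
qed

lemma P_diff: "abs (lag_P kap q1 U1 \<xi> - lag_P kap q2 U2 \<xi>) <= dQ_const kap \<alpha> \<beta> M L / 2 * c * E \<xi>"
 using integral_diff[of "%_. 1" \<xi>] by (simp add: lag_P_def)

lemma Q_diff: "abs (lag_Q kap q1 U1 \<xi> - lag_Q kap q2 U2 \<xi>) <= dQ_const kap \<alpha> \<beta> M L / 2 * c * E \<xi>"
 unfolding lag_Q_def by (rule integral_diff) (auto simp: sgn_real_def)

text \<open>The difference of the factors \<open>q'\<close> is bounded by \<open>eps\<close> and not by \<open>E\<close>; the product decays like \<open>E\<close>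
  because \<open>P\<close> carries the weight \<open>D\<close> and \<open>eps D \<le> L E\<close>.\<close>

lemma P_eps: "abs (lag_P kap q2 U2 \<xi>) * eps <= S * \<beta> / 2 * c * L * E \<xi>"
proof -
 have k: "eps * kconv \<alpha> D \<xi> <= L * (c * E \<xi>)"
 proof -
  have wD: "weight (eps * M) (%x. eps * D x)" by (rule weight_cmult[OF D eps_nonneg])
  have "eps * kconv \<alpha> D \<xi> = kconv \<alpha> (%y. eps * D y) \<xi>" by (simp add: kconv_cmult)
  also have "... <= kconv (\<alpha> / 2) (%y. eps * D y) \<xi>" by (rule kconv_antimono[OF _ _ wD]) (use \<alpha> in auto)
  also have "... <= kconv (\<alpha> / 2) (%y. L * E y) \<xi>"
   unfolding kconv_def
  proof (rule integral_mono)
   show "integrable lborel (%y. exp (- (\<alpha> / 2) * abs (\<xi> - y)) * (eps * D y))"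
    by (rule weight_kernel_integrable[OF _ wD]) (use \<alpha> in simp)
   show "integrable lborel (%y. exp (- (\<alpha> / 2) * abs (\<xi> - y)) * (L * E y))"
    by (rule weight_kernel_integrable[OF _ weight_cmult[OF E L]]) (use \<alpha> in simp)
  qed (intro mult_left_mono epsD, simp)
  also have "... = L * kconv (\<alpha> / 2) E \<xi>" by (simp add: kconv_cmult)
  also have "... <= L * (c * E \<xi>)" by (intro mult_left_mono c L)
  finally show ?thesis .
 qed
 have "abs (lag_P kap q2 U2 \<xi>) * eps <= (S * \<beta> / 2 * kconv \<alpha> D \<xi>) * eps"
  by (rule mult_right_mono[OF lag_PQ_le(1)[OF q2 \<alpha> D U2] eps_nonneg])
 also have "... = S * \<beta> / 2 * (eps * kconv \<alpha> D \<xi>)" by (simp add: mult_ac)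
 also have "... <= S * \<beta> / 2 * (L * (c * E \<xi>))" by (rule mult_left_mono[OF k]) (use S_nonneg \<beta> in auto)
 finally show ?thesis by (simp add: mult_ac)
qed

text \<open>Lipschitz dependence of the force on the state, in the weight \<open>E\<close> of the difference. It is the
  estimate on which contraction and stability rest.\<close>

lemma lag_Q_diff_wbd: "wbd E (dlag_const kap \<alpha> \<beta> M L c) (%\<xi>. lag_Q kap q1 U1 \<xi> - lag_Q kap q2 U2 \<xi>)"
proof (rule wbd_of_primitive[OF E primitive_diff[OF lag_Q_primitive[OF q1 \<alpha> D U1] lag_Q_primitive[OF q2 \<alpha> D U2]]])
 let ?K = "dQ_const kap \<alpha> \<beta> M L"
 show "AE \<eta> in lborel. abs ((lag_P kap q1 U1 \<eta> - lag_src kap q1 U1 \<eta>) * wd q1 \<eta> - (lag_P kap q2 U2 \<eta> - lag_src kap q2 U2 \<eta>) * wd q2 \<eta>)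
   <= dlag_const kap \<alpha> \<beta> M L c * E \<eta>"
  using lag_src_AE_le[OF q2 \<alpha> D U2, of kap] src_diff AE_dq slopes_weak_deriv(2)[OF q1 \<alpha>]
 proof eventually_elim
  case (elim \<eta>)
  define P1 P2 s1 s2 r1 r2 where d: "P1 = lag_P kap q1 U1 \<eta>" "P2 = lag_P kap q2 U2 \<eta>"
   "s1 = lag_src kap q1 U1 \<eta>" "s2 = lag_src kap q2 U2 \<eta>" "r1 = wd q1 \<eta>" "r2 = wd q2 \<eta>"
  have E0: "0 <= E \<eta>" using weightD(2)[OF E] .
  have b: "abs s2 <= S * D \<eta>" "abs (s1 - s2) <= S2 * E \<eta>" "abs (r1 - r2) <= eps" "abs r1 <= \<beta>"
   using elim \<alpha> unfolding d by auto
  have p: "abs (P1 - P2) <= ?K / 2 * c * E \<eta>" unfolding d by (rule P_diff)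
  have "abs (((P1 - P2) - (s1 - s2)) * r1) <= (?K / 2 * c * E \<eta> + S2 * E \<eta>) * \<beta>"
  proof -
   have "abs ((P1 - P2) - (s1 - s2)) <= ?K / 2 * c * E \<eta> + S2 * E \<eta>" using p b(2) by linarith
   then show ?thesis by (rule abs_mult_le[OF _ b(4)])
  qed
  moreover have "abs (P2 * (r1 - r2)) <= S * \<beta> / 2 * c * L * E \<eta>"
  proof -
   have "abs (P2 * (r1 - r2)) <= abs P2 * eps" unfolding abs_mult by (intro mult_left_mono b) simp
   also have "... <= S * \<beta> / 2 * c * L * E \<eta>" unfolding d by (rule P_eps)
   finally show ?thesis .
  qed
  moreover have "abs (s2 * (r1 - r2)) <= S * L * E \<eta>"
  proof -
   have "abs (s2 * (r1 - r2)) <= (S * D \<eta>) * eps"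
    by (rule abs_mult_le[OF b(1) b(3)])
   also have "... = S * (eps * D \<eta>)" by (simp add: mult_ac)
   also have "... <= S * (L * E \<eta>)" by (rule mult_left_mono[OF epsD S_nonneg])
   finally show ?thesis by (simp add: mult.assoc)
  qed
  moreover have "(P1 - s1) * r1 - (P2 - s2) * r2 = ((P1 - P2) - (s1 - s2)) * r1 + P2 * (r1 - r2) - s2 * (r1 - r2)"
   by (simp add: algebra_simps)
  ultimately have "abs ((P1 - s1) * r1 - (P2 - s2) * r2) <= (?K / 2 * c * E \<eta> + S2 * E \<eta>) * \<beta> + S * \<beta> / 2 * c * L * E \<eta> + S * L * E \<eta>"
   by linarith
  also have "... = dlag_const kap \<alpha> \<beta> M L c * E \<eta>" unfolding dlag_const_def by (simp add: algebra_simps)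
  finally show ?case unfolding d .
 qed
 fix \<xi>
 have "?K / 2 * c <= dlag_const kap \<alpha> \<beta> M L c"
 proof -
  have "?K / 2 * c <= (?K / 2 * c + S2) * \<beta>"
   using mult_mono[of "?K / 2 * c" "?K / 2 * c + S2" 1 \<beta>] \<beta> S2_nonneg dQ_nonneg c(2) by simp
  moreover have "0 <= (S * \<beta> / 2 * c + S) * L" using S_nonneg \<beta> c(2) L by simp
  ultimately show ?thesis unfolding dlag_const_def by linarith
 qed
 from mult_right_mono[OF this weightD(2)[OF E, of \<xi>]] Q_diff[of \<xi>]
 show "abs (lag_Q kap q1 U1 \<xi> - lag_Q kap q2 U2 \<xi>) <= dlag_const kap \<alpha> \<beta> M L c * E \<xi>" by linarith
qed

end

lemma dlag_const_nonneg:
 assumes "0 <= M" "0 < \<alpha>" "1 <= \<beta>" "0 <= L" "0 <= c"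
 shows "0 <= dlag_const kap \<alpha> \<beta> M L c"
 using assms unfolding dlag_const_def dQ_const_def dsrc_const_def src_const_def
 by (intro add_nonneg_nonneg mult_nonneg_nonneg divide_nonneg_nonneg) auto

section \<open>Oriented time integrals\<close>

definition tint :: "(real => real) => real => real" where
 "tint f t = (if 0 <= t then integral {0..t} f else - integral {t..0} f)"

lemma tint_0 [simp]: "tint f 0 = 0"
 by (simp add: tint_def)

lemma continuous_integrable_sub:
 fixes f :: "real => real"
 assumes "continuous_on {-T..T} f" "-T <= a" "b <= T"
 shows "f integrable_on {a..b}"
 by (rule integrable_continuous_real) (use assms in \<open>auto intro: continuous_on_subset\<close>)

lemma tint_eq:
 assumes "continuous_on {-T..T} f" "t \<in> {-T..T}"
 shows "tint f t = integral {-T..t} f - integral {-T..0} f"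
proof (cases "0 <= t")
 case True
 have "integral {-T..0} f + integral {0..t} f = integral {-T..t} f"
  by (rule Henstock_Kurzweil_Integration.integral_combine)
   (use True assms in \<open>auto intro!: continuous_integrable_sub[OF assms(1)]\<close>)
 then show ?thesis using True by (simp add: tint_def)
next
 case False
 have "integral {-T..t} f + integral {t..0} f = integral {-T..0} f"
  by (rule Henstock_Kurzweil_Integration.integral_combine)
   (use False assms in \<open>auto intro!: continuous_integrable_sub[OF assms(1)]\<close>)
 then show ?thesis using False by (simp add: tint_def)
qed

lemma tint_has_derivative:
 assumes "continuous_on {-T..T} f" "t \<in> {-T..T}"
 shows "(tint f has_vector_derivative f t) (at t within {-T..T})"
proof -
 have "((%t. integral {-T..t} f - integral {-T..0} f) has_vector_derivative f t - 0) (at t within {-T..T})"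
  by (intro has_vector_derivative_diff integral_has_vector_derivative assms has_vector_derivative_const)
 from has_vector_derivative_transform[OF assms(2) _ this, of "tint f"] show ?thesis
  by (simp add: tint_eq[OF assms(1)])
qed

lemma tint_minus_tint:
 assumes f: "continuous_on {-T..T} f" and "s \<in> {-T..T}" "t \<in> {-T..T}" "s <= t"
 shows "tint f t - tint f s = integral {s..t} f"
proof -
 have "integral {-T..s} f + integral {s..t} f = integral {-T..t} f"
  by (rule Henstock_Kurzweil_Integration.integral_combine)
   (use assms in \<open>auto intro!: continuous_integrable_sub[OF f]\<close>)
 then show ?thesis using assms by (simp add: tint_eq[OF f])
qed

lemma tint_Lipschitz:
 assumes f: "continuous_on {-T..T} f" and B: "!!s. s \<in> {-T..T} ==> abs (f s) <= B"
  and st: "s \<in> {-T..T}" "t \<in> {-T..T}"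
 shows "abs (tint f t - tint f s) <= B * abs (t - s)"
proof -
 have *: "abs (tint f t - tint f s) <= B * (t - s)" if "s <= t" "s \<in> {-T..T}" "t \<in> {-T..T}" for s t
  unfolding tint_minus_tint[OF f that(2,3,1)]
  using integral_bound[of s t f B] that continuous_on_subset[OF f, of "{s..t}"] B by auto
 show ?thesis using *[of s t] *[of t s] st by (cases "s <= t") (auto simp: abs_minus_commute)
qed

lemma tint_abs_le:
 assumes f: "continuous_on {-T..T} f" and k: "continuous_on {-T..T} k"
  and le: "!!s. s \<in> {-T..T} ==> abs (f s) <= k s" and t: "t \<in> {-T..T}"
 shows "abs (tint f t) <= abs (tint k t)"
proof -
 have *: "abs (integral {a..b} f) <= abs (integral {a..b} k)" if "-T <= a" "b <= T" for a b
 proof -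
  have "norm (integral {a..b} f) <= integral {a..b} k"
   by (rule integral_norm_bound_integral) (use that le in \<open>auto intro!: continuous_integrable_sub[OF f] continuous_integrable_sub[OF k]\<close>)
  then show ?thesis by simp
 qed
 show ?thesis using *[of 0 t] *[of t 0] t by (auto simp: tint_def)
qed

lemma tint_diff:
 assumes "continuous_on {-T..T} f" "continuous_on {-T..T} g" "t \<in> {-T..T}"
 shows "tint (%s. f s - g s) t = tint f t - tint g t"
proof -
 have "integral {a..b} (%s. f s - g s) = integral {a..b} f - integral {a..b} g" if "-T <= a" "b <= T" for a b
  by (intro Henstock_Kurzweil_Integration.integral_diff continuous_integrable_sub[OF assms(1)] continuous_integrable_sub[OF assms(2)] that)
 from this[of 0 t] this[of t 0] show ?thesis using assms(3) by (auto simp: tint_def)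
qed

lemma tint_cmult: "tint (%s. c * f s) t = c * tint f t"
 by (simp add: tint_def)

lemma tint_mult_right: "tint (%s. f s * c) t = tint f t * c"
 by (simp add: tint_def)

lemma abs_tint_exp_le:
 assumes "0 < l"
 shows "abs (tint (%s. exp (l * abs s)) t) <= exp (l * abs t) / l"
proof (cases "0 <= t")
 case True
 have "((%s. exp (l * s)) has_integral exp (l * t) / l - exp (l * 0) / l) {0..t}"
  by (rule fundamental_theorem_of_calculus[OF True])
   (use assms in \<open>auto intro!: derivative_eq_intros simp: has_real_derivative_iff_has_vector_derivative[symmetric]\<close>)
 then have "integral {0..t} (%s. exp (l * abs s)) = exp (l * t) / l - 1 / l"
  by (subst integral_cong[where g="%s. exp (l * s)"]) (auto dest: integral_unique)
 moreover have "1 / l <= exp (l * t) / l" using True assms by (intro divide_right_mono) auto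
 ultimately show ?thesis using True assms by (simp add: tint_def)
next
 case False
 then have t: "t <= 0" by simp
 have "((%s. exp (- (l * s))) has_integral (- exp (- (l * 0)) / l) - (- exp (- (l * t)) / l)) {t..0}"
  by (rule fundamental_theorem_of_calculus[OF t])
   (use assms in \<open>auto intro!: derivative_eq_intros simp: has_real_derivative_iff_has_vector_derivative[symmetric]\<close>)
 then have "integral {t..0} (%s. exp (l * abs s)) = exp (- (l * t)) / l - 1 / l"
  by (subst integral_cong[where g="%s. exp (- (l * s))"]) (auto dest: integral_unique)
 moreover have "1 / l <= exp (- (l * t)) / l" using t assms by (intro divide_right_mono) (auto simp: mult_nonneg_nonpos)
 ultimately show ?thesis using False assms by (simp add: tint_def)
qed

section \<open>Stability of the weighted bounds\<close>

lemma div_power2_tendsto_0: "(%n. (A::real) / 2 ^ n) \<longlonglongrightarrow> 0"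
proof -
 have "(%n. (1 / 2 :: real) ^ n) \<longlonglongrightarrow> 0" by (rule LIMSEQ_power_zero) simp
 from tendsto_mult_right_zero[OF this, of A] have "(%n. A * (1 / 2) ^ n) \<longlonglongrightarrow> 0" .
 moreover have "(%n. A * (1 / 2) ^ n) = (%n. A / 2 ^ n)" by (rule ext) (simp add: power_divide)
 ultimately show ?thesis by simp
qed

lemma wbd_add:
 assumes "wbd E k h" "wbd E k' h'"
 shows "wbd E (k + k') (%x. h x + h' x)"
 unfolding wbd_def
proof (intro conjI allI impI)
 show "abs (h x + h' x) <= (k + k') * E x" for x
  using assms abs_triangle_ineq[of "h x" "h' x"] unfolding wbd_def distrib_right by (smt (verit))
 fix a b :: real assume "a <= b"
 then have "abs (h b - h a) <= k * seg_int E a b" "abs (h' b - h' a) <= k' * seg_int E a b"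
  using assms by (simp_all add: wbd_def)
 then show "abs (h b + h' b - (h a + h' a)) <= (k + k') * seg_int E a b"
  unfolding distrib_right by linarith
qed

lemma wbd_minus: "wbd E k h ==> wbd E k (%x. - h x)"
 unfolding wbd_def by (auto simp: abs_minus_commute)

lemma wbd_diff: "wbd E k h ==> wbd E k' h' ==> wbd E (k + k') (%x. h x - h' x)"
 using wbd_add[of E k h k' "%x. - h' x"] wbd_minus[of E k' h'] by simp

lemma wbd_scale: "wbd (%x. c * E x) k h \<longleftrightarrow> wbd E (k * c) h"
 unfolding wbd_def by (simp add: mult.assoc)

lemma wbd_weight_mono:
 assumes E: "weight M E" and F: "weight M' F" and le: "!!x. E x <= l * F x" and h: "wbd E k h" and k: "0 <= k"
 shows "wbd F (k * l) h"
 unfolding wbd_def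
proof (intro conjI allI impI)
 fix x show "abs (h x) <= k * l * F x"
  using h mult_left_mono[OF le k, of x] unfolding wbd_def by (smt (verit) mult.assoc)
next
 fix a b :: real assume ab: "a <= b"
 have "seg_int E a b <= seg_int (%x. l * F x) a b"
  by (rule seg_int_mono_AE) (auto intro: weight_loc[OF E] loc_int_cmult weight_loc[OF F] le)
 then have "seg_int E a b <= l * seg_int F a b" by simp
 then show "abs (h b - h a) <= k * l * seg_int F a b"
  using h ab mult_left_mono[of "seg_int E a b" "l * seg_int F a b" k] k unfolding wbd_def
  by (smt (verit) mult.assoc)
qed

lemma wbd_limit:
 assumes h: "!!n. wbd E (k n) (h n)" and lim: "!!x. (%n. h n x) \<longlonglongrightarrow> g x" and k: "k \<longlonglongrightarrow> k'"
 shows "wbd E k' g"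
 unfolding wbd_def
proof (intro conjI allI impI)
 fix x
 show "abs (g x) <= k' * E x"
  by (rule tendsto_le[OF sequentially_bot tendsto_mult[OF k tendsto_const] tendsto_rabs[OF lim]])
   (use h in \<open>simp add: wbd_def\<close>)
next
 fix a b :: real assume "a <= b"
 then show "abs (g b - g a) <= k' * seg_int E a b"
  by (intro tendsto_le[OF sequentially_bot tendsto_mult[OF k tendsto_const] tendsto_rabs[OF tendsto_diff[OF lim lim]]])
   (use h in \<open>simp add: wbd_def\<close>)
qed

lemma wbd_tint:
 assumes E: "weight M E" and h: "!!s. s \<in> {-T..T} ==> wbd E (k s) (h s)"
  and hc: "!!x. continuous_on {-T..T} (%s. h s x)" and k: "continuous_on {-T..T} k" and t: "t \<in> {-T..T}"
 shows "wbd E (abs (tint k t)) (%x. tint (%s. h s x) t)"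
 unfolding wbd_def
proof (intro conjI allI impI)
 fix x
 have "abs (tint (%s. h s x) t) <= abs (tint (%s. k s * E x) t)"
  by (rule tint_abs_le[OF hc _ _ t]) (use h k in \<open>auto simp: wbd_def intro!: continuous_intros\<close>)
 then show "abs (tint (%s. h s x) t) <= abs (tint k t) * E x"
  using weightD(2)[OF E, of x] by (simp add: tint_mult_right abs_mult)
next
 fix a b :: real assume ab: "a <= b"
 have "tint (%s. h s b) t - tint (%s. h s a) t = tint (%s. h s b - h s a) t"
  by (rule tint_diff[OF hc hc t, symmetric])
 also have "\<bar>...\<bar> <= \<bar>tint (%s. k s * seg_int E a b) t\<bar>"
  by (rule tint_abs_le[OF _ _ _ t]) (use h k hc ab in \<open>auto simp: wbd_def intro!: continuous_intros\<close>)
 finally show "abs (tint (%s. h s b) t - tint (%s. h s a) t) <= abs (tint k t) * seg_int E a b"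
  using seg_int_weight_nonneg[OF E, of a b] by (simp add: tint_mult_right abs_mult)
qed

lemma Lipschitz_continuous_on:
 fixes f :: "real => real"
 assumes "!!s t. s \<in> S ==> t \<in> S ==> abs (f t - f s) <= L * abs (t - s)"
 shows "continuous_on S f"
 unfolding continuous_on
proof
 fix s assume s: "s \<in> S"
 show "(f \<longlongrightarrow> f s) (at s within S)"
 proof (rule LIM_zero_cancel, rule Lim_null_comparison)
  show "\<forall>\<^sub>F t in at s within S. norm (f t - f s) <= L * abs (t - s)"
   unfolding eventually_at_filter using assms s by (auto intro!: always_eventually)
  show "((%t. L * abs (t - s)) \<longlongrightarrow> 0) (at s within S)"
   by (auto intro!: tendsto_eq_intros)
 qed
qed

section \<open>Lagrangian trajectories\<close>

definition qf :: "(real => real => real) => real => real => real" where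
 "qf U t \<xi> = \<xi> + tint (%s. U s \<xi>) t"

definition Qt :: "real => (real => real => real) => real => real => real" where
 "Qt kap U s \<xi> = lag_Q kap (qf U s) (U s) \<xi>"

definition Phi :: "real => (real => real) => (real => real => real) => real => real => real" where
 "Phi kap u0 U t \<xi> = u0 \<xi> - tint (%s. Qt kap U s \<xi>) t"

locale lag_params =
 fixes kap T \<alpha> \<beta> M c \<Lambda> :: real and D :: "real => real"
 assumes T: "0 <= T" and \<alpha>: "0 < \<alpha>" and \<beta>: "1 <= \<beta>" and D: "weight M D"
  and \<Lambda>: "1 <= \<Lambda>" and c: "!!x. kconv (\<alpha> / 2) D x <= c * D x" "0 <= c"
begin

definition traj :: "(real => real => real) => bool" where
 "traj U \<longleftrightarrow> (\<forall>t\<in>{-T..T}. wbd D 1 (U t) & slopes \<alpha> \<beta> (qf U t)) &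
  (\<forall>s\<in>{-T..T}. \<forall>t\<in>{-T..T}. wbd D (\<Lambda> * abs (t - s)) (%x. U t x - U s x))"

lemma M_nonneg: "0 <= M" using weightD(4)[OF D] .

lemma trajD:
 assumes "traj U" "t \<in> {-T..T}"
 shows "wbd D 1 (U t)" "slopes \<alpha> \<beta> (qf U t)" "s \<in> {-T..T} ==> wbd D (\<Lambda> * abs (t - s)) (%x. U t x - U s x)"
 using assms by (auto simp: traj_def)

lemma traj_continuous:
 assumes "traj U" shows "continuous_on {-T..T} (%t. U t x)"
proof (rule Lipschitz_continuous_on[of _ _ "\<Lambda> * D x"])
 fix s t assume "s \<in> {-T..T}" "t \<in> {-T..T}"
 then show "abs (U t x - U s x) <= \<Lambda> * D x * abs (t - s)"
  using trajD(3)[OF assms, of t s] by (simp add: wbd_def mult_ac)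
qed

lemma traj_Lipschitz:
 assumes "traj U" "t \<in> {-T..T}"
 shows "abs (U t b - U t a) <= M * abs (b - a)" "abs (U t a) <= M"
 using wbd_Lipschitz[OF D trajD(1)[OF assms]] wbd_abs_le[OF D trajD(1)[OF assms]] by auto

lemma qf_time:
 assumes U: "traj U" and st: "s \<in> {-T..T}" "t \<in> {-T..T}"
 shows "abs (qf U t x - qf U s x) <= M * abs (t - s)"
  and "abs ((qf U t b - qf U s b) - (qf U t a - qf U s a)) <= M * abs (t - s) * abs (b - a)"
proof -
 show "abs (qf U t x - qf U s x) <= M * abs (t - s)"
  using tint_Lipschitz[OF traj_continuous[OF U] traj_Lipschitz(2)[OF U] st] by (simp add: qf_def)
 have "(qf U t b - qf U s b) - (qf U t a - qf U s a) = tint (%s. U s b - U s a) t - tint (%s. U s b - U s a) s"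
  using st by (simp add: qf_def tint_diff[OF traj_continuous[OF U] traj_continuous[OF U]])
 also have "\<bar>...\<bar> <= (M * \<bar>b - a\<bar>) * \<bar>t - s\<bar>"
  by (rule tint_Lipschitz[OF continuous_on_diff[OF traj_continuous[OF U] traj_continuous[OF U]] traj_Lipschitz(1)[OF U] st])
 finally show "abs ((qf U t b - qf U s b) - (qf U t a - qf U s a)) <= M * abs (t - s) * abs (b - a)"
  by (simp add: mult_ac)
qed

lemma kconv_alpha: "kconv \<alpha> D x <= c * D x"
 using kconv_antimono[OF _ _ D, of "\<alpha> / 2" \<alpha> x] \<alpha> c(1)[of x] by simp

definition Kq :: real where "Kq = (\<beta> / 2 * c + 1) * \<beta> * src_const kap \<alpha> M"

lemma Kq_nonneg: "0 <= Kq"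
 unfolding Kq_def using \<beta> c(2) src_const_nonneg[OF M_nonneg] by simp

lemma Qt_wbd:
 assumes "traj U" "t \<in> {-T..T}"
 shows "wbd D Kq (Qt kap U t)"
 unfolding Qt_def[abs_def] Kq_def
 by (rule lag_Q_wbd[OF trajD(2)[OF assms] \<alpha> \<beta> D trajD(1)[OF assms] kconv_alpha c(2)])

lemma Qt_time:
 assumes U: "traj U" and st: "s \<in> {-T..T}" "t \<in> {-T..T}"
 shows "wbd D (dlag_const kap \<alpha> \<beta> M M c * \<Lambda> * abs (t - s)) (%x. Qt kap U t x - Qt kap U s x)"
proof -
 let ?k = "\<Lambda> * abs (t - s)"
 have k: "0 <= ?k" using \<Lambda> by simp
 interpret two_states kap \<alpha> \<beta> M "?k * M" M c "M * abs (t - s)" D "%x. ?k * D x" "qf U t" "qf U s" "U t" "U s"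
 proof
  show "wbd (%x. ?k * D x) 1 (%x. U t x - U s x)"
   using trajD(3)[OF U st(2) st(1)] by (simp add: wbd_scale)
  show "M * abs (t - s) * D x <= M * (?k * D x)" for x
  proof -
   have "abs (t - s) * D x <= \<Lambda> * (abs (t - s) * D x)"
    using mult_right_mono[OF \<Lambda>, of "abs (t - s) * D x"] weightD(2)[OF D, of x] by simp
   from mult_left_mono[OF this M_nonneg] show ?thesis by (simp add: mult.assoc)
  qed
  show "kconv (\<alpha> / 2) (%x. ?k * D x) x <= c * (?k * D x)" for x
   unfolding kconv_cmult mult.left_commute[of c] by (rule mult_left_mono[OF c(1) k])
  show "slopes \<alpha> \<beta> (qf U t)" "slopes \<alpha> \<beta> (qf U s)" by (rule trajD(2)[OF U st(2)], rule trajD(2)[OF U st(1)])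
  show "wbd D 1 (U t)" "wbd D 1 (U s)" by (rule trajD(1)[OF U st(2)], rule trajD(1)[OF U st(1)])
  show "weight (?k * M) (%x. ?k * D x)" by (rule weight_cmult[OF D k])
 qed (rule \<alpha> \<beta> D qf_time(2)[OF U st] M_nonneg c(2))+
 show ?thesis
  using lag_Q_diff_wbd unfolding wbd_scale Qt_def mult.assoc .
qed

lemma Qt_continuous:
 assumes U: "traj U" shows "continuous_on {-T..T} (%s. Qt kap U s x)"
proof (rule Lipschitz_continuous_on[of _ _ "dlag_const kap \<alpha> \<beta> M M c * \<Lambda> * D x"])
 fix s t assume "s \<in> {-T..T}" "t \<in> {-T..T}"
 then show "abs (Qt kap U t x - Qt kap U s x) <= dlag_const kap \<alpha> \<beta> M M c * \<Lambda> * D x * abs (t - s)"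
  using Qt_time[OF U, of s t] by (simp add: wbd_def mult_ac)
qed

definition lam :: "real => real => real" where
 "lam L c' = max 1 (max L (2 * dlag_const kap \<alpha> \<beta> M L c'))"

lemma lam: "0 < lam L c'" "1 <= lam L c'" "L <= lam L c'" "2 * dlag_const kap \<alpha> \<beta> M L c' <= lam L c'"
 by (auto simp: lam_def)

text \<open>
 The Picard operator halves differences that are measured with the exponential weight
 \<open>exp (lam * abs t)\<close> in time and with an admissible weight \<open>E\<close> in space. The three uses are
 existence and uniqueness (\<open>E\<close> constant) and continuous dependence (\<open>E\<close> square integrable).
\<close>

lemma contraction:
 assumes U1: "traj U1" and U2: "traj U2" and E: "weight M' E" and L: "0 <= L"
  and eps: "0 <= eps" "M' <= L * eps" "!!x. eps * D x <= L * E x"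
  and c': "!!x. kconv (\<alpha> / 2) E x <= c' * E x" "0 <= c'"
  and \<delta>: "0 <= \<delta>" and d: "!!s. s \<in> {-T..T} ==> wbd E (\<delta> * exp (lam L c' * abs s)) (%x. U1 s x - U2 s x)"
  and t: "t \<in> {-T..T}"
 shows "wbd E (\<delta> / 2 * exp (lam L c' * abs t)) (%x. tint (%s. Qt kap U1 s x) t - tint (%s. Qt kap U2 s x) t)"
proof -
 let ?l = "lam L c'" and ?C = "dlag_const kap \<alpha> \<beta> M L c'"
 have C0: "0 <= ?C" by (rule dlag_const_nonneg[OF M_nonneg \<alpha> \<beta> L c'(2)])
 have Qd: "wbd E (?C * (\<delta> * exp (?l * abs s))) (%x. Qt kap U1 s x - Qt kap U2 s x)" if s: "s \<in> {-T..T}" for s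
 proof -
  let ?k = "\<delta> * exp (?l * abs s)"
  have k: "0 <= ?k" using \<delta> by simp
  interpret two_states kap \<alpha> \<beta> M "?k * M'" L c' "?k * eps" D "%x. ?k * E x" "qf U1 s" "qf U2 s" "U1 s" "U2 s"
  proof
   show "wbd (%x. ?k * E x) 1 (%x. U1 s x - U2 s x)"
    using d[OF s] by (simp add: wbd_scale)
   show "?k * eps * D x <= L * (?k * E x)" for x
    using mult_left_mono[OF eps(3)[of x] k] by (simp add: mult_ac)
   show "kconv (\<alpha> / 2) (%x. ?k * E x) x <= c' * (?k * E x)" for x
    unfolding kconv_cmult mult.left_commute[of c'] by (rule mult_left_mono[OF c'(1) k])
   fix a b :: real
   have cU: "continuous_on {-T..T} (%s. (U1 s b - U2 s b) - (U1 s a - U2 s a))"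
    by (intro continuous_intros traj_continuous U1 U2)
   have eq: "(qf U1 s b - qf U2 s b) - (qf U1 s a - qf U2 s a) = tint (%s. (U1 s b - U2 s b) - (U1 s a - U2 s a)) s"
    using s by (simp add: qf_def tint_diff[of T] traj_continuous[OF U1] traj_continuous[OF U2] continuous_on_diff)
   define m where "m = \<delta> * (M' * abs (b - a))"
   have m0: "0 <= m" unfolding m_def using \<delta> weightD(4)[OF E] by simp
   have "abs (tint (%s. (U1 s b - U2 s b) - (U1 s a - U2 s a)) s) <= abs (tint (%r. m * exp (?l * abs r)) s)"
   proof (rule tint_abs_le[OF cU _ _ s])
    fix r assume r: "r \<in> {-T..T}"
    show "abs ((U1 r b - U2 r b) - (U1 r a - U2 r a)) <= m * exp (?l * abs r)"
     using wbd_Lipschitz[OF E d[OF r], of b a] \<delta> by (simp add: m_def mult_ac)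
   qed (intro continuous_intros)
   also have "abs (tint (%r. m * exp (?l * abs r)) s) = m * abs (tint (%r. exp (?l * abs r)) s)"
    unfolding tint_cmult abs_mult using m0 by simp
   also have "m * abs (tint (%r. exp (?l * abs r)) s) <= m * (exp (?l * abs s) / ?l)"
    by (rule mult_left_mono[OF abs_tint_exp_le[OF lam(1)] m0])
   also have "m * (exp (?l * abs s) / ?l) = (?k * abs (b - a)) * (M' / ?l)" by (simp add: m_def mult_ac)
   also have "(?k * abs (b - a)) * (M' / ?l) <= (?k * abs (b - a)) * eps"
   proof (rule mult_left_mono)
    have "M' <= ?l * eps" by (rule order_trans[OF eps(2) mult_right_mono[OF lam(3) eps(1)]])
    then show "M' / ?l <= eps" using lam(1)[of L c'] by (simp add: divide_le_eq mult.commute)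
   qed (use k in simp)
   finally show "abs ((qf U1 s b - qf U2 s b) - (qf U1 s a - qf U2 s a)) <= ?k * eps * abs (b - a)"
    unfolding eq by (simp only: mult_ac)
   show "slopes \<alpha> \<beta> (qf U1 s)" "slopes \<alpha> \<beta> (qf U2 s)" by (rule trajD(2)[OF U1 s], rule trajD(2)[OF U2 s])
   show "wbd D 1 (U1 s)" "wbd D 1 (U2 s)" by (rule trajD(1)[OF U1 s], rule trajD(1)[OF U2 s])
   show "weight (?k * M') (%x. ?k * E x)" by (rule weight_cmult[OF E k])
  qed (rule \<alpha> \<beta> D L c'(2))+
  show ?thesis
   using lag_Q_diff_wbd unfolding wbd_scale Qt_def .
 qed
 have "wbd E (abs (tint (%s. ?C * (\<delta> * exp (?l * abs s))) t)) (%x. tint (%s. Qt kap U1 s x - Qt kap U2 s x) t)"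
  by (rule wbd_tint[OF E Qd _ _ t]) (auto intro!: continuous_intros Qt_continuous U1 U2)
 moreover have "(%x. tint (%s. Qt kap U1 s x - Qt kap U2 s x) t) = (%x. tint (%s. Qt kap U1 s x) t - tint (%s. Qt kap U2 s x) t)"
  by (rule ext) (rule tint_diff[OF Qt_continuous[OF U1] Qt_continuous[OF U2] t])
 moreover have "abs (tint (%s. ?C * (\<delta> * exp (?l * abs s))) t) <= \<delta> / 2 * exp (?l * abs t)"
 proof -
  have m0: "0 <= ?C * \<delta>" using C0 \<delta> by simp
  have "abs (tint (%s. ?C * (\<delta> * exp (?l * abs s))) t) = ?C * \<delta> * abs (tint (%s. exp (?l * abs s)) t)"
   unfolding mult.assoc[symmetric] tint_cmult abs_mult[of "?C * \<delta>"] using m0 by simp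
  also have "?C * \<delta> * abs (tint (%s. exp (?l * abs s)) t) <= ?C * \<delta> * (exp (?l * abs t) / ?l)"
   by (rule mult_left_mono[OF abs_tint_exp_le[OF lam(1)] m0])
  also have "?C * \<delta> * (exp (?l * abs t) / ?l) = (\<delta> * exp (?l * abs t)) * (?C / ?l)" by (simp add: mult_ac)
  also have "(\<delta> * exp (?l * abs t)) * (?C / ?l) <= (\<delta> * exp (?l * abs t)) * (1 / 2)"
  proof (rule mult_left_mono)
   have "?C * 2 <= ?l" using lam(4)[of L c'] by (simp only: mult.commute)
   then show "?C / ?l <= 1 / 2" using lam(1)[of L c'] by (simp add: divide_le_eq)
  qed (use \<delta> in simp)
  finally show ?thesis by simp
 qed
 ultimately show ?thesis using wbd_mono[OF E] by auto
qed

text \<open>The two solutions differ by the difference of the data plus a term which the Picard operator halves.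
  From any finite a priori bound \<open>A\<close>, iterating this leaves twice the contribution of the data; the
  value of \<open>A\<close> disappears in the limit.\<close>

lemma stability:
 assumes U1: "traj U1" and U2: "traj U2" and E: "weight M' E" and L: "0 <= L"
  and eps: "0 <= eps" "M' <= L * eps" "!!x. eps * D x <= L * E x"
  and c': "!!x. kconv (\<alpha> / 2) E x <= c' * E x" "0 <= c'"
  and fix1: "!!t x. t \<in> {-T..T} ==> U1 t x = Phi kap u1 U1 t x"
  and fix2: "!!t x. t \<in> {-T..T} ==> U2 t x = Phi kap u2 U2 t x"
  and init: "wbd E i (%x. u1 x - u2 x)" "0 <= i"
  and apriori: "!!s. s \<in> {-T..T} ==> wbd E A (%x. U1 s x - U2 s x)" "0 <= A"
  and t: "t \<in> {-T..T}"
 shows "wbd E (2 * i * exp (lam L c' * abs t)) (%x. U1 t x - U2 t x)"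
proof -
 let ?l = "lam L c'"
 have *: "\<forall>t\<in>{-T..T}. wbd E ((2 * i + A / 2 ^ n) * exp (?l * abs t)) (%x. U1 t x - U2 t x)" for n
 proof (induction n)
  case 0
  show ?case
  proof
   fix t assume "t \<in> {-T..T}"
   have "A * 1 <= (2 * i + A) * exp (?l * abs t)"
    by (rule mult_mono) (use init(2) apriori(2) lam(1)[of L c'] in auto)
   then show "wbd E ((2 * i + A / 2 ^ 0) * exp (?l * abs t)) (%x. U1 t x - U2 t x)"
    using wbd_mono[OF E apriori(1)[OF \<open>t \<in> {-T..T}\<close>]] by simp
  qed
 next
  case (Suc n)
  show ?case
  proof
   fix t assume t: "t \<in> {-T..T}"
   have "wbd E ((2 * i + A / 2 ^ n) / 2 * exp (?l * abs t)) (%x. tint (%s. Qt kap U1 s x) t - tint (%s. Qt kap U2 s x) t)"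
    by (rule contraction[OF U1 U2 E L eps c' _ _ t]) (use Suc.IH init(2) apriori(2) in auto)
   from wbd_diff[OF init(1) this]
   have "wbd E (i + (2 * i + A / 2 ^ n) / 2 * exp (?l * abs t)) (%x. U1 t x - U2 t x)"
    by (simp add: fix1[OF t] fix2[OF t] Phi_def algebra_simps)
   moreover have "i * 1 <= i * exp (?l * abs t)" using init(2) lam(1)[of L c'] by (intro mult_left_mono) auto
   then have "i + (2 * i + A / 2 ^ n) / 2 * exp (?l * abs t) <= (2 * i + A / 2 ^ Suc n) * exp (?l * abs t)"
   proof -
    define e where "e = exp (?l * abs t)"
    assume "i * 1 <= i * exp (?l * abs t)"
    then have "i <= i * e" by (simp add: e_def)
    moreover have "(2 * i + A / 2 ^ n) / 2 * e = i * e + A / 2 ^ Suc n * e" by (simp add: field_simps)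
    moreover have "(2 * i + A / 2 ^ Suc n) * e = i * e + i * e + A / 2 ^ Suc n * e" by (simp only: distrib_right mult_2)
    ultimately have "i + (2 * i + A / 2 ^ n) / 2 * e <= (2 * i + A / 2 ^ Suc n) * e" by linarith
    then show ?thesis by (simp only: e_def)
   qed
   ultimately show "wbd E ((2 * i + A / 2 ^ Suc n) * exp (?l * abs t)) (%x. U1 t x - U2 t x)"
    by (rule wbd_mono[OF E])
  qed
 qed
 have z: "(%n. A / 2 ^ n) \<longlonglongrightarrow> 0" by (rule div_power2_tendsto_0)
 have "(%n. (2 * i + A / 2 ^ n) * exp (?l * abs t)) \<longlonglongrightarrow> (2 * i + 0) * exp (?l * abs t)"
  by (intro tendsto_mult tendsto_add tendsto_const z)
 then have l: "(%n. (2 * i + A / 2 ^ n) * exp (?l * abs t)) \<longlonglongrightarrow> 2 * i * exp (?l * abs t)" by simp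
 show ?thesis
 proof (rule wbd_limit[OF _ _ l])
  show "wbd E ((2 * i + A / 2 ^ n) * exp (?l * abs t)) (%x. U1 t x - U2 t x)" for n
   using *[of n] t by blast
 qed (rule tendsto_const)
qed

end

section \<open>Existence and uniqueness of Lagrangian solutions\<close>

lemma geometric_telescope:
 fixes x :: "nat => real"
 assumes d: "!!n. abs (x (Suc n) - x n) <= B / 2 ^ n" and nm: "n <= m"
 shows "abs (x m - x n) <= 2 * B / 2 ^ n - 2 * B / 2 ^ m"
 using nm
proof (induction m rule: dec_induct)
 case base
 then show ?case by simp
next
 case (step m)
 have "abs (x (Suc m) - x n) <= abs (x (Suc m) - x m) + abs (x m - x n)" by linarith
 also have "... <= B / 2 ^ m + (2 * B / 2 ^ n - 2 * B / 2 ^ m)" by (intro add_mono d step.IH)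
 also have "... = 2 * B / 2 ^ n - 2 * B / 2 ^ Suc m" by simp
 finally show ?case .
qed

lemma geometric_limit:
 fixes x :: "nat => real"
 assumes d: "!!n. abs (x (Suc n) - x n) <= B / 2 ^ n"
 shows "x \<longlonglongrightarrow> lim x" "x \<longlonglongrightarrow> l ==> abs (x n - l) <= 2 * B / 2 ^ n"
proof -
 have B: "0 <= B" using d[of 0] by simp
 have "Cauchy x"
 proof (rule metric_CauchyI)
  fix e :: real assume e: "0 < e"
  from div_power2_tendsto_0[of "2 * B", THEN order_tendstoD(2), OF e]
  obtain N where N: "!!n. n \<ge> N ==> 2 * B / 2 ^ n < e" by (auto simp: eventually_sequentially)
  have *: "dist (x m) (x n) < e" if "N <= n" "n <= m" for m n
  proof -
   have "0 <= 2 * B / 2 ^ m" using B by simp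
   then show ?thesis using geometric_telescope[OF d that(2)] N[OF that(1)] by (simp add: dist_real_def)
  qed
  show "\<exists>M. \<forall>m\<ge>M. \<forall>n\<ge>M. dist (x m) (x n) < e"
  proof (intro exI[of _ N] allI impI)
   fix m n assume "N <= m" "N <= n"
   then show "dist (x m) (x n) < e" using *[of n m] *[of m n] by (cases "n <= m") (auto simp: dist_commute)
  qed
 qed
 then show "x \<longlonglongrightarrow> lim x" by (simp add: Cauchy_convergent_iff convergent_LIMSEQ_iff)
 assume l: "x \<longlonglongrightarrow> l"
 have "abs (l - x n) <= 2 * B / 2 ^ n"
 proof (rule tendsto_le[OF sequentially_bot tendsto_const tendsto_rabs[OF tendsto_diff[OF l tendsto_const]]])
  show "\<forall>\<^sub>F m in sequentially. abs (x m - x n) <= 2 * B / 2 ^ n"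
   unfolding eventually_sequentially
  proof (intro exI[of _ n] allI impI)
   fix m assume "n <= m"
   from geometric_telescope[OF d this] have "abs (x m - x n) <= 2 * B / 2 ^ n - 2 * B / 2 ^ m" .
   moreover have "0 <= 2 * B / 2 ^ m" using B by simp
   ultimately show "abs (x m - x n) <= 2 * B / 2 ^ n" by linarith
  qed
 qed
 then show "abs (x n - l) <= 2 * B / 2 ^ n" by (simp add: abs_minus_commute)
qed

lemma kconv_one: "0 < \<gamma> ==> kconv \<gamma> (%_. 1) x = 2 / \<gamma>"
 using exp_kernel_LINT[of \<gamma> x] by (simp add: kconv_def)

lemma wbd_uminus_tint_const: "wbd E k h ==> weight M E ==> 0 <= k ==> wbd (%_. 1) (k * M) h"
 by (rule wbd_weight_mono[where F="%_. 1" and M'=1]) (auto simp: weightD weight_const)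

context lag_params
begin

lemma Phi_time:
 assumes U: "traj U" and st: "s \<in> {-T..T}" "t \<in> {-T..T}"
 shows "wbd D (Kq * abs (t - s)) (%x. Phi kap u0 U t x - Phi kap u0 U s x)"
proof -
 note Qw = Qt_wbd[OF U]
 have "abs (Phi kap u0 U t x - Phi kap u0 U s x) <= Kq * abs (t - s) * D x" for x
 proof -
  have "abs (tint (%s. Qt kap U s x) t - tint (%s. Qt kap U s x) s) <= (Kq * D x) * abs (t - s)"
   by (rule tint_Lipschitz[OF Qt_continuous[OF U] _ st]) (use Qw in \<open>simp add: wbd_def\<close>)
  then show ?thesis by (simp add: Phi_def abs_minus_commute mult_ac)
 qed
 moreover have "abs ((Phi kap u0 U t b - Phi kap u0 U s b) - (Phi kap u0 U t a - Phi kap u0 U s a)) <= Kq * abs (t - s) * seg_int D a b"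
  if ab: "a <= b" for a b
 proof -
  have c: "continuous_on {-T..T} (%s. Qt kap U s b - Qt kap U s a)"
   by (intro continuous_on_diff Qt_continuous U)
  have "abs (tint (%s. Qt kap U s b - Qt kap U s a) t - tint (%s. Qt kap U s b - Qt kap U s a) s) <= (Kq * seg_int D a b) * abs (t - s)"
   by (rule tint_Lipschitz[OF c _ st]) (use Qw ab in \<open>simp add: wbd_def\<close>)
  moreover have "tint (%s. Qt kap U s b - Qt kap U s a) r = tint (%s. Qt kap U s b) r - tint (%s. Qt kap U s a) r" if "r \<in> {-T..T}" for r
   by (rule tint_diff[OF Qt_continuous[OF U] Qt_continuous[OF U] that])
  ultimately have "abs ((tint (%s. Qt kap U s b) t - tint (%s. Qt kap U s a) t) - (tint (%s. Qt kap U s b) s - tint (%s. Qt kap U s a) s)) <= (Kq * seg_int D a b) * abs (t - s)"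
   using st by simp
  then show ?thesis unfolding Phi_def by (simp add: mult_ac)
 qed
 ultimately show ?thesis by (simp add: wbd_def)
qed

text \<open>The slopes of \<open>q\<close> need no separate argument: they differ from \<open>1\<close> by at most \<open>T M\<close>. Hence the set in which the
  iteration runs is described by bounds on \<open>U\<close> only.\<close>

lemma traj_intro:
 assumes b: "!!t. t \<in> {-T..T} ==> wbd D 1 (U t)"
  and l: "!!s t. s \<in> {-T..T} ==> t \<in> {-T..T} ==> wbd D (\<Lambda> * abs (t - s)) (%x. U t x - U s x)"
  and TM: "T * M <= 1 / 2" "\<alpha> <= 1 / 2" "3 / 2 <= \<beta>"
 shows "traj U"
proof -
 have c: "continuous_on {-T..T} (%t. U t x)" for x
 proof (rule Lipschitz_continuous_on[of _ _ "\<Lambda> * D x"])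
  fix s t assume "s \<in> {-T..T}" "t \<in> {-T..T}"
  then show "abs (U t x - U s x) <= \<Lambda> * D x * abs (t - s)"
   using l[of s t] by (simp add: wbd_def mult_ac)
 qed
 have "slopes \<alpha> \<beta> (qf U t)" if t: "t \<in> {-T..T}" for t
  unfolding slopes_def
 proof (intro allI impI)
  fix a b' :: real assume ab: "a <= b'"
  have e: "qf U t b' - qf U t a = (b' - a) + (tint (%s. U s b' - U s a) t)"
   by (simp add: qf_def tint_diff[OF c c t])
  have "abs (tint (%s. U s b' - U s a) t - tint (%s. U s b' - U s a) 0) <= (M * abs (b' - a)) * abs (t - 0)"
  proof (rule tint_Lipschitz[of T])
   show "abs (U s b' - U s a) <= M * abs (b' - a)" if "s \<in> {-T..T}" for s
    using wbd_Lipschitz[OF D b[OF that], of b' a] by simp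
  qed (use c t T in \<open>auto intro: continuous_on_diff\<close>)
  also have "(M * abs (b' - a)) * abs (t - 0) <= (M * abs (b' - a)) * T"
   by (rule mult_left_mono) (use t M_nonneg in auto)
  also have "(M * abs (b' - a)) * T = (T * M) * (b' - a)" using ab by simp
  also have "(T * M) * (b' - a) <= 1 / 2 * (b' - a)" by (rule mult_right_mono[OF TM(1)]) (use ab in simp)
  finally have "abs (tint (%s. U s b' - U s a) t) <= 1 / 2 * (b' - a)" by simp
  moreover have "\<alpha> * (b' - a) <= 1 / 2 * (b' - a)" by (rule mult_right_mono[OF TM(2)]) (use ab in simp)
  moreover have "3 / 2 * (b' - a) <= \<beta> * (b' - a)" by (rule mult_right_mono[OF TM(3)]) (use ab in simp)
  ultimately show "\<alpha> * (b' - a) <= qf U t b' - qf U t a & qf U t b' - qf U t a <= \<beta> * (b' - a)"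
  proof -
   define d x where "d = b' - a" and "x = tint (%s. U s b' - U s a) t"
   assume "abs (tint (%s. U s b' - U s a) t) <= 1 / 2 * (b' - a)" "\<alpha> * (b' - a) <= 1 / 2 * (b' - a)" "3 / 2 * (b' - a) <= \<beta> * (b' - a)"
   then have h: "abs x <= 1 / 2 * d" "\<alpha> * d <= 1 / 2 * d" "3 / 2 * d <= \<beta> * d" by (simp_all only: d_def x_def)
   have "\<alpha> * d <= d + x" "d + x <= \<beta> * d" using h by linarith+
   then show ?thesis unfolding e d_def x_def by blast
  qed
 qed
 then show ?thesis using b l by (simp add: traj_def)
qed

lemma wbd_one_seg: "wbd (%_. 1) k h \<longleftrightarrow> (\<forall>x. abs (h x) <= k) & (\<forall>a b. a <= b --> abs (h b - h a) <= k * (b - a))"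
 by (auto simp: wbd_def seg_int_const)

definition L1 :: real where "L1 = max 1 M"

lemma contraction_const:
 assumes U1: "traj U1" and U2: "traj U2" and \<delta>: "0 <= \<delta>"
  and d: "!!s. s \<in> {-T..T} ==> wbd (%_. 1) (\<delta> * exp (lam L1 (4 / \<alpha>) * abs s)) (%x. U1 s x - U2 s x)"
  and t: "t \<in> {-T..T}"
 shows "wbd (%_. 1) (\<delta> / 2 * exp (lam L1 (4 / \<alpha>) * abs t)) (%x. Phi kap u0 U2 t x - Phi kap u0 U1 t x)"
proof -
 have "wbd (%_. 1) (\<delta> / 2 * exp (lam L1 (4 / \<alpha>) * abs t)) (%x. tint (%s. Qt kap U1 s x) t - tint (%s. Qt kap U2 s x) t)"
  by (rule contraction[OF U1 U2 weight_const[of 1] _ _ _ _ _ _ \<delta> d t, where eps=1])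
   (use weightD[OF D] \<alpha> in \<open>auto simp: L1_def kconv_one le_max_iff_disj\<close>)
 then show ?thesis by (simp add: Phi_def)
qed

text \<open>Stability with equal data. A constant weight dominates every difference of trajectories and is admissible.\<close>

lemma lag_unique:
 assumes U1: "traj U1" and U2: "traj U2"
  and fix1: "!!t x. t \<in> {-T..T} ==> U1 t x = Phi kap u0 U1 t x"
  and fix2: "!!t x. t \<in> {-T..T} ==> U2 t x = Phi kap u0 U2 t x"
  and t: "t \<in> {-T..T}"
 shows "U1 t x = U2 t x"
proof -
 have "wbd (%_. 1) (2 * 0 * exp (lam L1 (4 / \<alpha>) * abs t)) (%x. U1 t x - U2 t x)"
 proof (rule stability[OF U1 U2 weight_const[of 1] _ _ _ _ _ _ fix1 fix2 _ _ _ _ t, where eps=1 and A="(1 + 1) * M"])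
  show "wbd (%_. 1) ((1 + 1) * M) (%x. U1 s x - U2 s x)" if s: "s \<in> {-T..T}" for s
   by (rule wbd_uminus_tint_const[OF wbd_diff[OF trajD(1)[OF U1 s] trajD(1)[OF U2 s]] D]) simp
  show "wbd (%_. 1) 0 (%x. u0 x - u0 x)" by (simp add: wbd_def)
 qed (use weightD[OF D] \<alpha> in \<open>auto simp: L1_def kconv_one le_max_iff_disj\<close>)
 then show ?thesis by (simp add: wbd_def)
qed

text \<open>Picard iteration, starting from the constant trajectory \<open>u0\<close>. It converges geometrically for the constant
  weight, and the limit keeps the bounds with weight \<open>D\<close>, which are closed under pointwise limits.\<close>

lemma lag_exists:
 assumes u0: "wbd D (1 / 2) u0" and TK: "T * Kq <= 1 / 2" and Kl: "Kq <= \<Lambda>"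
  and TM: "T * M <= 1 / 2" "\<alpha> <= 1 / 2" "3 / 2 <= \<beta>"
 shows "\<exists>U. traj U & (\<forall>t\<in>{-T..T}. \<forall>x. U t x = Phi kap u0 U t x)"
proof -
 define X where "X n = ((Phi kap u0) ^^ n) (%_. u0)" for n
 have X0: "X 0 = (%_. u0)" and XS: "X (Suc n) = Phi kap u0 (X n)" for n
  by (simp_all add: X_def)
 have u0': "wbd D 1 u0" by (rule wbd_mono[OF D u0]) simp
 have Xt: "traj (X n)" for n
 proof (induction n)
  case 0
  show ?case unfolding X0
  proof (rule traj_intro[OF _ _ TM])
   show "wbd D (\<Lambda> * abs (t - s)) (%x. u0 x - u0 x)" for s t
    using \<Lambda> weightD(2)[OF D] seg_int_weight_nonneg[OF D] by (simp add: wbd_def)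
  qed (rule u0')
 next
  case (Suc n)
  show ?case unfolding XS
  proof (rule traj_intro[OF _ _ TM])
   fix s t assume st: "s \<in> {-T..T}" "t \<in> {-T..T}"
   show "wbd D (\<Lambda> * abs (t - s)) (%x. Phi kap u0 (X n) t x - Phi kap u0 (X n) s x)"
    by (rule wbd_mono[OF D Phi_time[OF Suc.IH st]]) (rule mult_right_mono[OF Kl], simp)
  next
   fix t assume t: "t \<in> {-T..T}"
   have 0: "0 \<in> {-T..T}" using T by simp
   have "wbd D (Kq * abs (t - 0) + 1 / 2) (%x. (Phi kap u0 (X n) t x - Phi kap u0 (X n) 0 x) + u0 x)"
    by (rule wbd_add[OF Phi_time[OF Suc.IH 0 t] u0])
   then have w: "wbd D (Kq * abs (t - 0) + 1 / 2) (Phi kap u0 (X n) t)" by (simp add: Phi_def[abs_def])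
   have "Kq * abs (t - 0) <= Kq * T" by (rule mult_left_mono[OF _ Kq_nonneg]) (use t in auto)
   also have "Kq * T = T * Kq" by (rule mult.commute)
   finally have "Kq * abs (t - 0) + 1 / 2 <= 1" using TK by linarith
   then show "wbd D 1 (Phi kap u0 (X n) t)" by (rule wbd_mono[OF D w])
  qed
 qed
 let ?l = "lam L1 (4 / \<alpha>)"
 define A where "A = (1 + 1) * M"
 have A: "0 <= A" using M_nonneg by (simp add: A_def)
 have l1: "1 <= exp (?l * abs t)" for t using lam(1)[of L1 "4 / \<alpha>"] by simp
 have diff: "\<forall>t\<in>{-T..T}. wbd (%_. 1) (A / 2 ^ n * exp (?l * abs t)) (%x. X (Suc n) t x - X n t x)" for n
 proof (induction n)
  case 0
  show ?case
  proof
   fix t assume t: "t \<in> {-T..T}"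
   have w: "wbd (%_. 1) A (%x. X (Suc 0) t x - X 0 t x)" unfolding A_def
    by (rule wbd_uminus_tint_const[OF wbd_diff[OF trajD(1)[OF Xt t] trajD(1)[OF Xt t]] D]) simp
   have "A <= A / 2 ^ 0 * exp (?l * abs t)" using mult_left_mono[OF l1[of t] A] by simp
   then show "wbd (%_. 1) (A / 2 ^ 0 * exp (?l * abs t)) (%x. X (Suc 0) t x - X 0 t x)"
    by (rule wbd_mono[OF weight_const[of 1] w, rotated]) simp
  qed
 next
  case (Suc n)
  show ?case
  proof
   fix t assume t: "t \<in> {-T..T}"
   have d: "wbd (%_. 1) (A / 2 ^ n * exp (?l * abs s)) (%x. X n s x - X (Suc n) s x)" if "s \<in> {-T..T}" for s
    using wbd_minus[OF bspec[OF Suc.IH that]] by simp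
   have "wbd (%_. 1) (A / 2 ^ n / 2 * exp (?l * abs t)) (%x. Phi kap u0 (X (Suc n)) t x - Phi kap u0 (X n) t x)"
    by (rule contraction_const[OF Xt Xt _ d t]) (use A in simp)
   note w = this
   have eq: "A / 2 ^ n / 2 = A / 2 ^ Suc n" by simp
   from w[unfolded eq] show "wbd (%_. 1) (A / 2 ^ Suc n * exp (?l * abs t)) (%x. X (Suc (Suc n)) t x - X (Suc n) t x)"
    unfolding XS[symmetric] .
  qed
 qed
 define e where "e t = exp (?l * abs t)" for t
 have e0: "0 < e t" for t by (simp add: e_def)
 have dp: "abs (X (Suc n) t x - X n t x) <= (A * e t) / 2 ^ n" if "t \<in> {-T..T}" for n t x
  using bspec[OF diff that] by (simp add: wbd_one_seg e_def)
 have dl: "abs ((X (Suc n) t b - X (Suc n) t a) - (X n t b - X n t a)) <= (A * e t * (b - a)) / 2 ^ n" if "t \<in> {-T..T}" "a <= b" for n t a b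
 proof -
  have "abs ((X (Suc n) t b - X n t b) - (X (Suc n) t a - X n t a)) <= A / 2 ^ n * e t * (b - a)"
   using bspec[OF diff that(1)] that(2) unfolding wbd_one_seg e_def by blast
  moreover have "(X (Suc n) t b - X n t b) - (X (Suc n) t a - X n t a) = (X (Suc n) t b - X (Suc n) t a) - (X n t b - X n t a)" by simp
  ultimately show ?thesis by simp
 qed
 define U where "U t x = lim (%n. X n t x)" for t x
 have lim: "(%n. X n t x) \<longlonglongrightarrow> U t x" if "t \<in> {-T..T}" for t x
  unfolding U_def by (rule geometric_limit(1)[OF dp[OF that]])
 have Ut: "traj U"
 proof (rule traj_intro[OF _ _ TM])
  fix t assume t: "t \<in> {-T..T}"
  show "wbd D 1 (U t)"
   by (rule wbd_limit[OF trajD(1)[OF Xt t] lim[OF t] tendsto_const])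
  fix s assume s: "s \<in> {-T..T}"
  show "wbd D (\<Lambda> * abs (s - t)) (%x. U s x - U t x)"
   by (rule wbd_limit[OF trajD(3)[OF Xt s t] tendsto_diff[OF lim[OF s] lim[OF t]] tendsto_const])
 qed
 have near: "wbd (%_. 1) (2 * A / 2 ^ n * exp (?l * abs t)) (%x. X n t x - U t x)" if t: "t \<in> {-T..T}" for n t
  unfolding wbd_one_seg
 proof (intro conjI allI impI)
  show "abs (X n t x - U t x) <= 2 * A / 2 ^ n * exp (?l * abs t)" for x
   using geometric_limit(2)[OF dp[OF t] lim[OF t], of n x] by (simp add: e_def)
  fix a b :: real assume ab: "a <= b"
  have "abs ((X n t b - X n t a) - (U t b - U t a)) <= 2 * (A * e t * (b - a)) / 2 ^ n"
   by (rule geometric_limit(2)[OF dl[OF t ab] tendsto_diff[OF lim[OF t] lim[OF t]]])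
  moreover have "(X n t b - U t b) - (X n t a - U t a) = (X n t b - X n t a) - (U t b - U t a)" by simp
  ultimately have "abs ((X n t b - U t b) - (X n t a - U t a)) <= 2 * (A * e t * (b - a)) / 2 ^ n" by (simp only:)
  then show "abs ((X n t b - U t b) - (X n t a - U t a)) <= 2 * A / 2 ^ n * exp (?l * abs t) * (b - a)"
   by (simp add: e_def mult_ac)
 qed
 have "U t x = Phi kap u0 U t x" if t: "t \<in> {-T..T}" for t x
 proof -
  have "abs (Phi kap u0 U t x - X (Suc n) t x) <= (A * e t) / 2 ^ n" for n
  proof -
   have "wbd (%_. 1) (2 * A / 2 ^ n / 2 * exp (?l * abs t)) (%x. Phi kap u0 U t x - Phi kap u0 (X n) t x)"
    by (rule contraction_const[OF Xt Ut _ near t]) (use A in simp)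
   then show ?thesis unfolding XS by (simp add: wbd_one_seg e_def)
  qed
  then have "(%n. Phi kap u0 U t x - X (Suc n) t x) \<longlonglongrightarrow> 0"
   by (intro Lim_null_comparison[OF always_eventually div_power2_tendsto_0]) auto
  moreover have "(%n. Phi kap u0 U t x - X (Suc n) t x) \<longlonglongrightarrow> Phi kap u0 U t x - U t x"
   by (intro tendsto_diff tendsto_const LIMSEQ_Suc lim t)
  ultimately have "Phi kap u0 U t x - U t x = 0" using LIMSEQ_unique by blast
  then show ?thesis by simp
 qed
 then show ?thesis using Ut by blast
qed

end

section \<open>Square integrals\<close>

definition N2 :: "(real => real) => ennreal" where
 "N2 f = (\<integral>\<^sup>+x. ennreal ((f x)^2) \<partial>lborel)"

lemma pos_mult_divide_cancel: "0 < (g::real) ==> g * (x / g) = x" by simp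

lemma N2_mono_AE: "AE x in lborel. abs (f x) <= abs (g x) ==> N2 f <= N2 g"
 unfolding N2_def by (rule nn_integral_mono_AE) (auto elim!: eventually_mono simp: abs_le_square_iff intro!: ennreal_leI)

lemma N2_mono: "(!!x. abs (f x) <= abs (g x)) ==> N2 f <= N2 g"
 by (rule N2_mono_AE) auto

lemma N2_cong_AE: "AE x in lborel. f x = g x ==> N2 f = N2 g"
 unfolding N2_def by (rule nn_integral_cong_AE) (auto elim!: eventually_mono)

lemma N2_cmult:
 assumes [measurable]: "f \<in> Borel"
 shows "N2 (%x. c * f x) = ennreal (c^2) * N2 f"
 unfolding N2_def by (subst nn_integral_cmult[symmetric]) (auto simp: ennreal_mult power_mult_distrib)

lemma N2_uminus: "N2 (%x. - f x) = N2 f"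
 by (simp add: N2_def)

lemma N2_commute: "N2 (%x. f x - g x) = N2 (%x. g x - f x)"
 by (simp add: N2_def power2_commute)

lemma N2_add:
 assumes [measurable]: "f \<in> Borel" "g \<in> Borel"
 shows "N2 (%x. f x + g x) <= 2 * N2 f + 2 * N2 g"
proof -
 have "N2 (%x. f x + g x) <= (\<integral>\<^sup>+x. 2 * ennreal ((f x)^2) + 2 * ennreal ((g x)^2) \<partial>lborel)"
  unfolding N2_def
 proof (rule nn_integral_mono)
  fix x
  have "(f x + g x)^2 <= 2 * (f x)^2 + 2 * (g x)^2"
   using zero_le_power2[of "f x - g x"] by (simp add: power2_eq_square algebra_simps)
  then have "ennreal ((f x + g x)^2) <= ennreal (2 * (f x)^2 + 2 * (g x)^2)" by (rule ennreal_leI)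
  also have "... = 2 * ennreal ((f x)^2) + 2 * ennreal ((g x)^2)"
   by (simp add: ennreal_plus ennreal_mult)
  finally show "ennreal ((f x + g x)^2) <= 2 * ennreal ((f x)^2) + 2 * ennreal ((g x)^2)" .
 qed
 also have "... = 2 * N2 f + 2 * N2 g"
  unfolding N2_def by (subst nn_integral_add) (auto simp: nn_integral_cmult)
 finally show ?thesis .
qed

lemma N2_diff:
 assumes "f \<in> Borel" "g \<in> Borel"
 shows "N2 (%x. f x - g x) <= 2 * N2 f + 2 * N2 g"
 using N2_add[of f "%x. - g x"] assms by (simp add: N2_uminus)

lemma N2_add_finite:
 "f \<in> Borel ==> g \<in> Borel ==> N2 f < \<infinity> ==> N2 g < \<infinity> ==> N2 (%x. f x + g x) < \<infinity>"
 by (rule le_less_trans[OF N2_add]) (auto simp: ennreal_mult_less_top)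

lemma N2_diff_finite:
 "f \<in> Borel ==> g \<in> Borel ==> N2 f < \<infinity> ==> N2 g < \<infinity> ==> N2 (%x. f x - g x) < \<infinity>"
 by (rule le_less_trans[OF N2_diff]) (auto simp: ennreal_mult_less_top)

text \<open>Comparison up to a factor, in the form in which it is used for limits.\<close>

lemma N2_add_le:
 assumes "f \<in> Borel" "g \<in> Borel" "N2 f <= ennreal a" "N2 g <= ennreal b" "0 <= a" "0 <= b"
 shows "N2 (%x. f x + g x) <= ennreal (2 * a + 2 * b)"
proof -
 have "N2 (%x. f x + g x) <= 2 * N2 f + 2 * N2 g" by (rule N2_add[OF assms(1,2)])
 also have "... <= 2 * ennreal a + 2 * ennreal b" by (intro add_mono mult_left_mono assms) auto
 also have "... = ennreal (2 * a + 2 * b)" using assms(5,6) by (simp add: ennreal_plus ennreal_mult)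
 finally show ?thesis .
qed

lemma N2_diff_le:
 assumes "f \<in> Borel" "g \<in> Borel" "N2 f <= ennreal a" "N2 g <= ennreal b" "0 <= a" "0 <= b"
 shows "N2 (%x. f x - g x) <= ennreal (2 * a + 2 * b)"
 using N2_add_le[of f "%x. - g x" a b] assms by (simp add: N2_uminus)

lemma N2_bounded_mult:
 assumes [measurable]: "g \<in> Borel" and "AE x in lborel. abs (f x) <= C * abs (g x)"
 shows "N2 f <= ennreal (C^2) * N2 g"
proof -
 have "N2 f <= N2 (%x. C * g x)"
 proof (rule N2_mono_AE)
  show "AE x in lborel. abs (f x) <= abs (C * g x)" using assms(2)
  proof eventually_elim
   case (elim x)
   have "C * abs (g x) <= abs C * abs (g x)" by (rule mult_right_mono) auto
   then show ?case using elim by (simp add: abs_mult)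
  qed
 qed
 then show ?thesis by (simp add: N2_cmult)
qed

lemma L2_space_iff: "f \<in> L2_space \<longleftrightarrow> f \<in> Borel & N2 f < \<infinity>"
proof -
 have "integrable lborel (%x. (f x)^2) \<longleftrightarrow> N2 f < \<infinity>" if [measurable]: "f \<in> Borel"
  unfolding N2_def by (subst integrable_iff_bounded) simp
 then show ?thesis by (auto simp: L2_space_def)
qed

lemma L2_space_diff: "f \<in> L2_space ==> g \<in> L2_space ==> (%x. f x - g x) \<in> L2_space"
 unfolding L2_space_iff using N2_diff_finite[of f g] by (simp add: borel_measurable_diff)

lemma L2_norm_sq:
 assumes [measurable]: "f \<in> Borel"
 shows "(L2_norm f)^2 = enn2real (N2 f)" "0 <= L2_norm f"
proof -
 have "(LINT x|lborel. (f x)^2) = enn2real (N2 f)"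
  unfolding N2_def by (rule integral_eq_nn_integral) auto
 then show "(L2_norm f)^2 = enn2real (N2 f)" by (simp add: L2_norm_def)
 show "0 <= L2_norm f" unfolding L2_norm_def by (intro real_sqrt_ge_zero Bochner_Integration.integral_nonneg) simp
qed

lemma N2_eq_L2_norm: "f \<in> L2_space ==> N2 f = ennreal ((L2_norm f)^2)"
 by (simp add: L2_space_iff L2_norm_sq)

lemma L2_norm_le:
 assumes "f \<in> Borel" "N2 f <= ennreal (e^2)" "0 <= e"
 shows "L2_norm f <= e"
proof -
 have "enn2real (N2 f) <= e^2" using assms(2) by (metis enn2real_ennreal enn2real_mono ennreal_less_top zero_le_power2)
 then have "(L2_norm f)^2 <= e^2" by (simp add: L2_norm_sq(1)[OF assms(1)])
 then show ?thesis using assms(3) by (rule power2_le_imp_le)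
qed

lemma N2_zero_iff:
 assumes [measurable]: "f \<in> Borel"
 shows "N2 f = 0 \<longleftrightarrow> (AE x in lborel. f x = 0)"
 unfolding N2_def by (subst nn_integral_0_iff_AE) auto

lemma N2_kconv:
 assumes "0 < c" "weight M N"
 shows "N2 (kconv c N) <= ennreal ((2 / c)^2) * N2 N"
proof -
 have [measurable]: "N \<in> Borel" by (rule weightD(1)[OF assms(2)])
 have "N2 (kconv c N) = (\<integral>\<^sup>+x. (\<integral>\<^sup>+y. ennreal (exp (- c * abs (x - y))) * ennreal (abs (N y)) \<partial>lborel)^2 \<partial>lborel)"
  unfolding N2_def
 proof (rule nn_integral_cong)
  fix x
  have "ennreal ((kconv c N x)^2) = (ennreal (kconv c N x))^2"
   using kconv_nonneg[OF assms(2)] by (simp add: ennreal_power)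
  also have "ennreal (kconv c N x) = (\<integral>\<^sup>+y. ennreal (exp (- c * abs (x - y))) * ennreal (abs (N y)) \<partial>lborel)"
   unfolding kconv_nn[OF assms] using weightD(2)[OF assms(2)] by (intro nn_integral_cong) (simp add: ennreal_mult)
  finally show "ennreal ((kconv c N x)^2) = (\<integral>\<^sup>+y. ennreal (exp (- c * abs (x - y))) * ennreal (abs (N y)) \<partial>lborel)^2" .
 qed
 also have "... <= ennreal ((2 / c)^2) * N2 N"
  unfolding N2_def by (rule kconv_L2_nn[OF assms(1)]) measurable
 finally show ?thesis .
qed

lemma N2_compose:
 assumes p: "slopes \<alpha> \<beta> p" "0 < \<alpha>" and [measurable]: "f \<in> Borel"
 shows "N2 (%x. f (p x)) <= ennreal (1 / \<alpha>) * N2 f"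
proof -
 note pi = slopes_inv[OF p]
 have [measurable]: "p \<in> Borel" "inv p \<in> Borel" "wd (inv p) \<in> Borel"
  using slopes_weak_deriv[OF p] slopes_weak_deriv[OF pi(3,4)] by auto
 have "N2 (%x. f (p x)) = (\<integral>\<^sup>+x. ennreal (wd (inv p) x) * ennreal ((f (p (inv p x)))^2) \<partial>lborel)"
  unfolding N2_def by (rule change_of_variables_nn[OF pi(3,4)]) measurable
 also have "... <= (\<integral>\<^sup>+x. ennreal (1 / \<alpha>) * ennreal ((f x)^2) \<partial>lborel)"
 proof (rule nn_integral_mono_AE)
  show "AE x in lborel. ennreal (wd (inv p) x) * ennreal ((f (p (inv p x)))^2) <= ennreal (1 / \<alpha>) * ennreal ((f x)^2)"
   using slopes_weak_deriv(2)[OF pi(3,4)] by eventually_elim (auto simp: pi(1) intro!: mult_right_mono ennreal_leI)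
 qed
 also have "... = ennreal (1 / \<alpha>) * N2 f"
  unfolding N2_def by (rule nn_integral_cmult) measurable
 finally show ?thesis .
qed

lemma AE_lborel_lebesgue_notin:
 assumes "negligible N" shows "AE x in lborel. x \<notin> N"
proof -
 have "AE x in lebesgue. x \<notin> N"
  using assms by (simp add: negligible_iff_null_sets AE_not_in)
 then show ?thesis by (simp add: AE_completion_iff)
qed

definition cutoff :: "real => real => real" where
 "cutoff R x = max 0 (min 1 (R + 1 - abs x))"

lemma cutoff: "continuous_on UNIV (cutoff R)" "0 <= cutoff R x" "cutoff R x <= 1" "R + 1 <= abs x ==> cutoff R x = 0" "abs x <= R ==> cutoff R x = 1"
 unfolding cutoff_def by (auto intro!: continuous_intros)

definition clamp_to :: "real => real => real" where
 "clamp_to R y = max (- R) (min R y)"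

lemma clamp_to: "0 <= R ==> abs (clamp_to R y) <= R" "abs y <= R ==> clamp_to R y = y" "0 <= R ==> abs (y - clamp_to R y) <= abs y" "continuous_on UNIV (clamp_to R)"
 unfolding clamp_to_def by (auto intro!: continuous_intros)

lemma nn_integral_tendsto_0:
 fixes f :: "nat => real => real"
 assumes [measurable]: "!!n. f n \<in> Borel" "w \<in> Borel"
  and dom: "!!n. AE x in lborel. abs (f n x) <= abs (w x)" and w: "N2 w < \<infinity>"
  and lim: "AE x in lborel. (%n. f n x) \<longlonglongrightarrow> 0"
 shows "(%n. N2 (f n)) \<longlonglongrightarrow> 0"
proof -
 have "(%n. \<integral>\<^sup>+x. norm (0 - (f n x)\<^sup>2) \<partial>lborel) \<longlonglongrightarrow> 0"
 proof (rule nn_integral_dominated_convergence_norm[where w="%x. (w x)^2"])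
  show "AE x in lborel. norm ((f n x)^2) <= (w x)^2" for n
   using dom[of n] by eventually_elim (auto simp: abs_le_square_iff)
  show "(\<integral>\<^sup>+x. ennreal ((w x)^2) \<partial>lborel) < \<infinity>" using w by (simp add: N2_def)
  show "AE x in lborel. (%n. (f n x)^2) \<longlonglongrightarrow> 0"
   using lim
  proof eventually_elim
   case (elim x)
   from tendsto_power[OF elim, of 2] show ?case by simp
  qed
 qed auto
 then show ?thesis by (simp add: N2_def)
qed

lemma tendsto_0_ennreal_ex:
 fixes a :: "nat => ennreal"
 assumes "a \<longlonglongrightarrow> 0" "0 < e"
 shows "\<exists>n. a n <= ennreal e"
proof -
 have "\<forall>\<^sub>F n in sequentially. a n < ennreal e"
  by (rule order_tendstoD(2)[OF assms(1)]) (use assms(2) in simp)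
 then show ?thesis by (auto simp: eventually_sequentially intro: less_imp_le)
qed

text \<open>Continuous functions of compact support are dense in \<open>L2\<close>.\<close>

lemma N2_approx_continuous:
 assumes V[measurable]: "V \<in> Borel" and fin: "N2 V < \<infinity>" and e: "0 < e"
 shows "\<exists>g R. continuous_on UNIV g & 0 <= R & (\<forall>x. abs x > R --> g x = 0) & N2 (%x. V x - g x) <= ennreal e"
proof -
 have [measurable]: "cutoff R \<in> Borel" "clamp_to R \<in> Borel" for R
  by (intro borel_measurable_continuous_onI cutoff clamp_to)+
 define W where "W n x = clamp_to (real n) (V x) * cutoff (real n) x" for n :: nat and x
 have [measurable]: "W n \<in> Borel" for n unfolding W_def[abs_def] by measurable
 have "(%n. N2 (%x. V x - W n x)) \<longlonglongrightarrow> 0"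
 proof (rule nn_integral_tendsto_0[OF _ V _ fin])
  show "AE x in lborel. abs (V x - W n x) <= abs (V x)" for n
  proof (rule AE_I2)
   fix x
   have c: "0 <= cutoff (real n) x" "cutoff (real n) x <= 1" by (rule cutoff)+
   have "V x - W n x = cutoff (real n) x * (V x - clamp_to (real n) (V x)) + (1 - cutoff (real n) x) * V x"
    by (simp add: W_def algebra_simps)
   also have "\<bar>...\<bar> <= \<bar>cutoff (real n) x * (V x - clamp_to (real n) (V x))\<bar> + \<bar>(1 - cutoff (real n) x) * V x\<bar>" by (rule abs_triangle_ineq)
   also have "... <= cutoff (real n) x * abs (V x) + (1 - cutoff (real n) x) * abs (V x)"
    using c clamp_to(3)[of "real n" "V x"] by (intro add_mono) (auto simp: abs_mult intro!: mult_left_mono)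
   also have "... = abs (V x)" by (simp add: algebra_simps)
   finally show "abs (V x - W n x) <= abs (V x)" .
  qed
  show "AE x in lborel. (%n. V x - W n x) \<longlonglongrightarrow> 0"
  proof (rule AE_I2, rule tendsto_eventually)
   fix x
   obtain N :: nat where N: "abs (V x) + abs x <= real N" using real_arch_simple by blast
   show "\<forall>\<^sub>F n in sequentially. V x - W n x = 0"
    unfolding eventually_sequentially
   proof (intro exI[of _ N] allI impI)
    fix n assume "N <= n"
    then have "abs (V x) <= real n" "abs x <= real n" using N by linarith+
    then show "V x - W n x = 0" by (simp add: W_def clamp_to cutoff)
   qed
  qed
 qed measurable
 from tendsto_0_ennreal_ex[OF this, of "e / 4"] obtain n where n: "N2 (%x. V x - W n x) <= ennreal (e / 4)" using e by auto
 have "V \<in> borel_measurable lebesgue" using V by (simp add: borel_measurable_if_I measurable_completion)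
 then have "V measurable_on UNIV" by (intro lebesgue_measurable_imp_measurable_on_real) auto
 then obtain N g where N: "negligible N" and gc: "!!k. continuous_on UNIV (g k)" and gl: "!!x. x \<notin> N ==> (%k. g k x) \<longlonglongrightarrow> (if x \<in> UNIV then V x else 0)"
  unfolding measurable_on_def by blast
 define G where "G k x = clamp_to (real n) (g k x) * cutoff (real n) x" for k :: nat and x
 have Gc: "continuous_on UNIV (G k)" for k
  unfolding G_def[abs_def]
  by (intro continuous_on_mult cutoff(1) continuous_on_compose2[OF clamp_to(4) gc]) auto
 have [measurable]: "G k \<in> Borel" for k by (rule borel_measurable_continuous_onI[OF Gc])
 have "(%k. N2 (%x. W n x - G k x)) \<longlonglongrightarrow> 0"
 proof (rule nn_integral_tendsto_0[where w="%x. 2 * real n * indicator {-(real n + 1)..real n + 1} x"])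
  show "AE x in lborel. abs (W n x - G k x) <= abs (2 * real n * indicator {-(real n + 1)..real n + 1} x)" for k
  proof (rule AE_I2)
   fix x
   have "W n x - G k x = (clamp_to (real n) (V x) - clamp_to (real n) (g k x)) * cutoff (real n) x"
    by (simp add: W_def G_def algebra_simps)
   also have "\<bar>...\<bar> <= (2 * real n) * indicator {-(real n + 1)..real n + 1} x"
   proof (rule abs_mult_le)
    show "abs (clamp_to (real n) (V x) - clamp_to (real n) (g k x)) <= 2 * real n"
     using clamp_to(1)[of "real n" "V x"] clamp_to(1)[of "real n" "g k x"] by linarith
    show "abs (cutoff (real n) x) <= indicator {-(real n + 1)..real n + 1} x"
     using cutoff(2,3,4)[of "real n" x] by (cases "real n + 1 <= abs x") (auto simp: indicator_def)
   qed
   finally show "abs (W n x - G k x) <= abs (2 * real n * indicator {-(real n + 1)..real n + 1} x)" by simp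
  qed
  have "N2 (%x. 2 * real n * indicator {-(real n + 1)..real n + 1} x) = ennreal ((2 * real n)^2) * N2 (indicator {-(real n + 1)..real n + 1})"
   by (rule N2_cmult) measurable
  also have "N2 (indicator {-(real n + 1)..real n + 1}) = (\<integral>\<^sup>+x. indicator {-(real n + 1)..real n + 1} x \<partial>lborel)"
   unfolding N2_def by (intro nn_integral_cong) (auto simp: indicator_def)
  also have "... = ennreal (2 * (real n + 1))" by simp
  finally show "N2 (%x. 2 * real n * indicator {-(real n + 1)..real n + 1} x) < \<infinity>"
   by (simp add: ennreal_mult_less_top)
  show "AE x in lborel. (%k. W n x - G k x) \<longlonglongrightarrow> 0"
   using AE_lborel_lebesgue_notin[OF N]
  proof eventually_elim
   case (elim x)
   have gx: "(%k. g k x) \<longlonglongrightarrow> V x" using gl[OF elim] by simp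
   have "(%k. clamp_to (real n) (g k x)) \<longlonglongrightarrow> clamp_to (real n) (V x)"
    by (rule continuous_on_tendsto_compose[OF clamp_to(4) gx]) auto
   then have "(%k. W n x - G k x) \<longlonglongrightarrow> W n x - clamp_to (real n) (V x) * cutoff (real n) x"
    unfolding G_def by (intro tendsto_intros)
   then show ?case by (simp add: W_def)
  qed
 qed measurable
 from tendsto_0_ennreal_ex[OF this, of "e / 4"] obtain k where k: "N2 (%x. W n x - G k x) <= ennreal (e / 4)" using e by auto
 have "N2 (%x. (V x - W n x) + (W n x - G k x)) <= ennreal (2 * (e / 4) + 2 * (e / 4))"
  by (rule N2_add_le[OF _ _ n k]) (use e in auto)
 then have "N2 (%x. V x - G k x) <= ennreal e" by simp
 moreover have "G k x = 0" if "abs x > real n + 1" for x using that by (simp add: G_def cutoff(4))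
 ultimately show ?thesis using Gc by (intro exI[of _ "G k"] exI[of _ "real n + 1"]) auto
qed

lemma slopes_indicator_nn:
 assumes p: "slopes \<alpha> \<beta> p" "0 < \<alpha>" and R: "0 <= R"
 shows "(\<integral>\<^sup>+x. indicator {-R..R} (p x) \<partial>lborel) <= ennreal (2 * R / \<alpha>)"
proof -
 have "(\<integral>\<^sup>+x. indicator {-R..R} (p x) \<partial>lborel) = N2 (%x. indicator {-R..R} (p x))"
  unfolding N2_def by (intro nn_integral_cong) (auto simp: indicator_def)
 also have "... <= ennreal (1 / \<alpha>) * N2 (indicator {-R..R})" by (rule N2_compose[OF p]) measurable
 also have "N2 (indicator {-R..R}) = (\<integral>\<^sup>+x. indicator {-R..R} x \<partial>lborel)"
  unfolding N2_def by (intro nn_integral_cong) (auto simp: indicator_def)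
 also have "... = ennreal (2 * R)" using R by simp
 also have "ennreal (1 / \<alpha>) * ennreal (2 * R) = ennreal (2 * R / \<alpha>)"
  using R p(2) by (simp add: ennreal_mult[symmetric])
 finally show ?thesis .
qed

text \<open>
 Composition with uniformly bi-Lipschitz maps is continuous in \<open>L2\<close>, uniformly in the maps: this
 is uniform continuity for continuous functions of compact support, and density in general.
\<close>

lemma N2_compose_continuous:
 assumes V[measurable]: "V \<in> Borel" and fin: "N2 V < \<infinity>" and e: "0 < e" and \<alpha>: "0 < \<alpha>"
 shows "\<exists>\<delta>>0. \<forall>p1 p2 \<beta>. slopes \<alpha> \<beta> p1 --> slopes \<alpha> \<beta> p2 --> (\<forall>x. abs (p1 x - p2 x) <= \<delta>) -->
  N2 (%x. V (p1 x) - V (p2 x)) <= ennreal e"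
proof -
 define e1 where "e1 = e * \<alpha> / 16"
 have e1: "0 < e1" using e \<alpha> by (simp add: e1_def)
 obtain g R where gc: "continuous_on UNIV g" and R: "0 <= R" and g0: "!!x. abs x > R ==> g x = 0"
  and gV: "N2 (%x. V x - g x) <= ennreal e1"
  using N2_approx_continuous[OF V fin e1] by auto
 have [measurable]: "g \<in> Borel" by (rule borel_measurable_continuous_onI[OF gc])
 define w where "w = sqrt (e * \<alpha> / (16 * (2 * R + 1)))"
 have w: "0 < w" "w^2 = e * \<alpha> / (16 * (2 * R + 1))" using e \<alpha> R by (auto simp: w_def)
 have "uniformly_continuous_on {-(R+2)..R+2} g"
  by (rule compact_uniformly_continuous) (auto intro: continuous_on_subset[OF gc])
 then obtain d where d: "0 < d" "!!x y. x \<in> {-(R+2)..R+2} ==> y \<in> {-(R+2)..R+2} ==> dist y x < d ==> dist (g y) (g x) < w"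
  unfolding uniformly_continuous_on_def using w(1) by meson
 define \<delta> where "\<delta> = min 1 (d / 2)"
 have \<delta>: "0 < \<delta>" "\<delta> <= 1" "\<delta> < d" using d(1) by (auto simp: \<delta>_def)
 have gw: "abs (g y - g x) <= w * (indicator {-R..R} x + indicator {-R..R} y)" if xy: "abs (y - x) <= \<delta>" for x y
 proof (cases "x \<in> {-R..R} \<or> y \<in> {-R..R}")
  case True
  then have "x \<in> {-(R+2)..R+2}" "y \<in> {-(R+2)..R+2}" using xy \<delta>(2) by auto
  then have "abs (g y - g x) <= w" using d(2)[of x y] xy \<delta>(3) by (simp add: dist_real_def)
  also have "w <= w * (indicator {-R..R} x + indicator {-R..R} y)"
   using True w(1) by (auto simp: indicator_def)
  finally show ?thesis .
 next
  case False
  then have "g x = 0" "g y = 0" using g0[of x] g0[of y] by (auto simp: not_le abs_less_iff)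
  then show ?thesis using w(1) by simp
 qed
 show ?thesis
 proof (intro exI[of _ \<delta>] conjI \<delta>(1) allI impI)
  fix p1 p2 \<beta> assume p1: "slopes \<alpha> \<beta> p1" and p2: "slopes \<alpha> \<beta> p2" and cl: "\<forall>x. abs (p1 x - p2 x) <= \<delta>"
  have [measurable]: "p1 \<in> Borel" "p2 \<in> Borel"
   using slopes_borel[OF p1 \<alpha>] slopes_borel[OF p2 \<alpha>] by auto
  have c: "N2 (%x. V (p x) - g (p x)) <= ennreal (e / 16)" if p: "slopes \<alpha> \<beta> p" for p
  proof -
   have "N2 (%x. V (p x) - g (p x)) <= ennreal (1 / \<alpha>) * N2 (%x. V x - g x)"
    by (rule N2_compose[OF p \<alpha>, of "%x. V x - g x"]) measurable
   also have "... <= ennreal (1 / \<alpha>) * ennreal e1" by (rule mult_left_mono[OF gV]) simp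
   also have "... = ennreal (e / 16)" using e1 \<alpha> by (simp add: ennreal_mult[symmetric] e1_def)
   finally show ?thesis .
  qed
  have m: "N2 (%x. g (p1 x) - g (p2 x)) <= ennreal (e / 4)"
  proof -
   have sq: "(indicator {-R..R} (p2 x) + indicator {-R..R} (p1 x))^2 <= (2 * indicator {-R..R} (p2 x) + 2 * indicator {-R..R} (p1 x) :: real)" for x
    by (auto simp: indicator_def)
   have "N2 (%x. g (p1 x) - g (p2 x)) <= (\<integral>\<^sup>+x. ennreal (w^2 * 2) * indicator {-R..R} (p2 x) + ennreal (w^2 * 2) * indicator {-R..R} (p1 x) \<partial>lborel)"
    unfolding N2_def
   proof (rule nn_integral_mono)
    fix x
    have "abs (g (p1 x) - g (p2 x)) <= w * (indicator {-R..R} (p2 x) + indicator {-R..R} (p1 x))"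
     using gw[of "p1 x" "p2 x"] cl by auto
    then have "(g (p1 x) - g (p2 x))^2 <= (w * (indicator {-R..R} (p2 x) + indicator {-R..R} (p1 x)))^2"
     using w(1) by (simp add: abs_le_square_iff[symmetric])
    also have "... <= w^2 * (2 * indicator {-R..R} (p2 x) + 2 * indicator {-R..R} (p1 x))"
     unfolding power_mult_distrib by (rule mult_left_mono[OF sq]) simp
    finally have "ennreal ((g (p1 x) - g (p2 x))^2) <= ennreal (w^2 * (2 * indicator {-R..R} (p2 x) + 2 * indicator {-R..R} (p1 x)))"
     by (rule ennreal_leI)
    also have "... = ennreal (w^2 * 2) * indicator {-R..R} (p2 x) + ennreal (w^2 * 2) * indicator {-R..R} (p1 x)"
     by (auto simp: indicator_def ennreal_plus[symmetric] simp del: ennreal_plus)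
    finally show "ennreal ((g (p1 x) - g (p2 x))^2) <= ennreal (w^2 * 2) * indicator {-R..R} (p2 x) + ennreal (w^2 * 2) * indicator {-R..R} (p1 x)" .
   qed
   also have "... = ennreal (w^2 * 2) * (\<integral>\<^sup>+x. indicator {-R..R} (p2 x) \<partial>lborel) + ennreal (w^2 * 2) * (\<integral>\<^sup>+x. indicator {-R..R} (p1 x) \<partial>lborel)"
    by (subst nn_integral_add) (auto simp: nn_integral_cmult)
   also have "... <= ennreal (w^2 * 2) * ennreal (2 * R / \<alpha>) + ennreal (w^2 * 2) * ennreal (2 * R / \<alpha>)"
    by (intro add_mono mult_left_mono slopes_indicator_nn[OF p1 \<alpha> R] slopes_indicator_nn[OF p2 \<alpha> R]) auto
   also have "... = ennreal (w^2 * 4 * (2 * R / \<alpha>))"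
    using R \<alpha> by (simp add: ennreal_mult[symmetric] ennreal_plus[symmetric] del: ennreal_plus)
   also have "w^2 * 4 * (2 * R / \<alpha>) = e / 4 * ((2 * R) / (2 * R + 1))"
    using \<alpha> R unfolding w(2) by (simp add: field_simps)
   also have "ennreal ... <= ennreal (e / 4)"
    using e R by (intro ennreal_leI) (simp add: divide_le_eq mult_left_le)
   finally show ?thesis .
  qed
  have "N2 (%x. (V (p1 x) - g (p1 x)) - (V (p2 x) - g (p2 x))) <= ennreal (2 * (e / 16) + 2 * (e / 16))"
   by (rule N2_diff_le[OF _ _ c[OF p1] c[OF p2]]) (use e in auto)
  then have "N2 (%x. ((V (p1 x) - g (p1 x)) - (V (p2 x) - g (p2 x))) + (g (p1 x) - g (p2 x))) <= ennreal (2 * (2 * (e / 16) + 2 * (e / 16)) + 2 * (e / 4))"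
   by (intro N2_add_le m) (use e in auto)
  then show "N2 (%x. V (p1 x) - V (p2 x)) <= ennreal e" using e by simp
 qed
qed

lemma slopes_ident: "slopes 1 1 (%x. x + c)" by (simp add: slopes_def)

text \<open>Averages of translation differences.\<close>

lemma N2_translation_average:
 assumes V[measurable]: "V \<in> Borel" and fin: "N2 V < \<infinity>" and e: "0 < e"
 shows "\<exists>\<delta>>0. \<forall>h. 0 < h --> h <= \<delta> -->
  (\<integral>\<^sup>+x. (\<integral>\<^sup>+s. indicator {-h..h} s * ennreal (abs (V (x + s) - V x)) \<partial>lborel)^2 \<partial>lborel) <= ennreal (h^2 * e)"
proof -
 obtain \<delta> where \<delta>: "0 < \<delta>" and cl: "!!p1 p2 \<beta>. slopes 1 \<beta> p1 ==> slopes 1 \<beta> p2 ==> (!!x. abs (p1 x - p2 x) <= \<delta>) ==>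
  N2 (%x. V (p1 x) - V (p2 x)) <= ennreal (e / 4)"
  using N2_compose_continuous[OF V fin, of "e / 4" 1] e by auto
 show ?thesis
 proof (intro exI[of _ \<delta>] conjI \<delta> allI impI)
  fix h :: real assume h: "0 < h" "h <= \<delta>"
  have i2: "(\<integral>\<^sup>+s. (indicator {-h..h} s)^2 \<partial>lborel) = ennreal (2 * h)"
  proof -
   have "(\<integral>\<^sup>+s. (indicator {-h..h} s)^2 \<partial>lborel) = (\<integral>\<^sup>+s. indicator {-h..h} s \<partial>(lborel :: real measure))"
    by (intro nn_integral_cong) (auto simp: indicator_def)
   then show ?thesis using h by simp
  qed
  have "(\<integral>\<^sup>+x. \<integral>\<^sup>+s. indicator {-h..h} s * ennreal ((V (x + s) - V x)^2) \<partial>lborel \<partial>lborel) = (\<integral>\<^sup>+s. \<integral>\<^sup>+x. indicator {-h..h} s * ennreal ((V (x + s) - V x)^2) \<partial>lborel \<partial>lborel)"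
   by (rule lborel_pair.Fubini'[symmetric]) measurable
  also have "... <= (\<integral>\<^sup>+s. ennreal (e / 4) * indicator {-h..h} s \<partial>lborel)"
  proof (rule nn_integral_mono)
   fix s :: real
   have "(\<integral>\<^sup>+x. indicator {-h..h} s * ennreal ((V (x + s) - V x)^2) \<partial>lborel) = indicator {-h..h} s * N2 (%x. V (x + s) - V (x + 0))"
    unfolding N2_def by (subst nn_integral_cmult) auto
   also have "... <= ennreal (e / 4) * indicator {-h..h} s"
   proof (cases "s \<in> {-h..h}")
    case True
    have "N2 (%x. V (x + s) - V (x + 0)) <= ennreal (e / 4)"
     by (rule cl[OF slopes_ident slopes_ident]) (use True h in auto)
    then show ?thesis using True by simp
   qed simp
   finally show "(\<integral>\<^sup>+x. indicator {-h..h} s * ennreal ((V (x + s) - V x)^2) \<partial>lborel) <= ennreal (e / 4) * indicator {-h..h} s" .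
  qed
  also have "(\<integral>\<^sup>+s. ennreal (e / 4) * indicator {-h..h} s \<partial>lborel) = ennreal (e / 4) * ennreal (2 * h)"
   using h by (subst nn_integral_cmult) auto
  finally have I: "(\<integral>\<^sup>+x. \<integral>\<^sup>+s. indicator {-h..h} s * ennreal ((V (x + s) - V x)^2) \<partial>lborel \<partial>lborel) <= ennreal (e / 4) * ennreal (2 * h)" .
  have "(\<integral>\<^sup>+x. (\<integral>\<^sup>+s. indicator {-h..h} s * ennreal (abs (V (x + s) - V x)) \<partial>lborel)^2 \<partial>lborel)
   <= (\<integral>\<^sup>+x. ennreal (2 * h) * (\<integral>\<^sup>+s. indicator {-h..h} s * ennreal ((V (x + s) - V x)^2) \<partial>lborel) \<partial>lborel)"
  proof (rule nn_integral_mono)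
   fix x
   have eq: "(\<integral>\<^sup>+s. indicator {-h..h} s * ennreal (abs (V (x + s) - V x)) \<partial>lborel)
    = (\<integral>\<^sup>+s. indicator {-h..h} s * (indicator {-h..h} s * ennreal (abs (V (x + s) - V x))) \<partial>lborel)"
    by (intro nn_integral_cong) (auto simp: indicator_def)
   have "(\<integral>\<^sup>+s. indicator {-h..h} s * ennreal (abs (V (x + s) - V x)) \<partial>lborel)^2 <= (\<integral>\<^sup>+s. (indicator {-h..h} s)^2 \<partial>lborel) * (\<integral>\<^sup>+s. (indicator {-h..h} s * ennreal (abs (V (x + s) - V x)))^2 \<partial>lborel)"
    unfolding eq by (rule Cauchy_Schwarz_nn_integral) measurable
   also have "(\<integral>\<^sup>+s. (indicator {-h..h} s * ennreal (abs (V (x + s) - V x)))^2 \<partial>lborel) = (\<integral>\<^sup>+s. indicator {-h..h} s * ennreal ((V (x + s) - V x)^2) \<partial>lborel)"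
    by (intro nn_integral_cong) (auto simp: indicator_def ennreal_power)
   finally show "(\<integral>\<^sup>+s. indicator {-h..h} s * ennreal (abs (V (x + s) - V x)) \<partial>lborel)^2 <= ennreal (2 * h) * (\<integral>\<^sup>+s. indicator {-h..h} s * ennreal ((V (x + s) - V x)^2) \<partial>lborel)"
    by (simp only: i2)
  qed
  also have "... = ennreal (2 * h) * (\<integral>\<^sup>+x. \<integral>\<^sup>+s. indicator {-h..h} s * ennreal ((V (x + s) - V x)^2) \<partial>lborel \<partial>lborel)"
   by (rule nn_integral_cmult) measurable
  also have "ennreal (2 * h) * (\<integral>\<^sup>+x. \<integral>\<^sup>+s. indicator {-h..h} s * ennreal ((V (x + s) - V x)^2) \<partial>lborel \<partial>lborel) <= ennreal (2 * h) * (ennreal (e / 4) * ennreal (2 * h))"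
   by (rule mult_left_mono[OF I]) simp
  also have "ennreal (2 * h) * (ennreal (e / 4) * ennreal (2 * h)) = ennreal (h^2 * e)"
   using h e by (simp add: ennreal_mult[symmetric] power2_eq_square mult_ac)
  finally show "(\<integral>\<^sup>+x. (\<integral>\<^sup>+s. indicator {-h..h} s * ennreal (abs (V (x + s) - V x)) \<partial>lborel)^2 \<partial>lborel) <= ennreal (h^2 * e)"
   .
 qed
qed

section \<open>Families converging to zero in the mean\<close>

definition null :: "'i filter => ('i => real => real) => bool" where
 "null F f \<longleftrightarrow> ((%i. N2 (f i)) \<longlongrightarrow> 0) F"

lemma null_I:
 assumes "!!e. 0 < e ==> \<forall>\<^sub>F i in F. N2 (f i) <= ennreal e"
 shows "null F f"
 unfolding null_def
proof (rule order_tendstoI)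
 fix a :: ennreal assume "0 < a"
 then obtain b where b: "0 < b" "b < a" using dense by blast
 then have bt: "b < top" using less_le_trans top_greatest by blast
 then have "0 < enn2real b" using b(1) by (simp add: enn2real_positive_iff)
 from assms[OF this] show "\<forall>\<^sub>F i in F. N2 (f i) < a"
  by eventually_elim (use b(2) bt in \<open>auto intro: le_less_trans\<close>)
qed simp

lemma null_D: "null F f ==> 0 < e ==> \<forall>\<^sub>F i in F. N2 (f i) <= ennreal e"
 unfolding null_def using order_tendstoD(2)[of "%i. N2 (f i)" 0 F "ennreal e"] by (auto elim!: eventually_mono)

lemma null_le:
 assumes "\<forall>\<^sub>F i in F. N2 (f i) <= b i" "(b \<longlongrightarrow> 0) F"
 shows "null F f"
 unfolding null_def by (rule tendsto_sandwich[OF always_eventually assms(1) tendsto_const assms(2)]) simp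

lemma null_mono: "null F g ==> \<forall>\<^sub>F i in F. AE x in lborel. abs (f i x) <= abs (g i x) ==> null F f"
 by (rule null_le[where b = "%i. N2 (g i)"]) (auto simp: null_def elim!: eventually_mono intro: N2_mono_AE)

lemma null_sum:
 assumes f: "null F f" and g: "null F g"
  and le: "\<forall>\<^sub>F i in F. f i \<in> Borel & g i \<in> Borel & (AE x in lborel. abs (h i x) <= abs (f i x) + abs (g i x))"
 shows "null F h"
proof (rule null_le)
 show "((%i. 2 * N2 (f i) + 2 * N2 (g i)) \<longlongrightarrow> 0) F"
  using tendsto_add[OF ennreal_tendsto_cmult[of 2, OF _ f[unfolded null_def]] ennreal_tendsto_cmult[of 2, OF _ g[unfolded null_def]]] by simp
 show "\<forall>\<^sub>F i in F. N2 (h i) <= 2 * N2 (f i) + 2 * N2 (g i)"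
  using le
 proof eventually_elim
  case (elim i)
  then have [measurable]: "f i \<in> Borel" "g i \<in> Borel" by auto
  have "N2 (h i) <= N2 (%x. abs (f i x) + abs (g i x))" by (rule N2_mono_AE) (use elim in auto)
  also have "... <= 2 * N2 (%x. abs (f i x)) + 2 * N2 (%x. abs (g i x))" by (rule N2_add) measurable
  finally show ?case by (simp add: N2_def)
 qed
qed

lemma null_scale:
 assumes "(r \<longlongrightarrow> 0) F" "g \<in> Borel" "N2 g < \<infinity>"
 shows "null F (%i x. r i * g x)"
proof (rule null_le[OF always_eventually])
 have "((%i. ennreal ((r i)^2 * enn2real (N2 g))) \<longlongrightarrow> ennreal (0^2 * enn2real (N2 g))) F"
  by (intro tendsto_intros assms(1))
 then show "((%i. ennreal ((r i)^2 * enn2real (N2 g))) \<longlongrightarrow> 0) F" by simp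
 show "\<forall>i. N2 (%x. r i * g x) <= ennreal ((r i)^2 * enn2real (N2 g))"
  using assms(3) by (simp add: N2_cmult[OF assms(2)] ennreal_mult)
qed

lemma null_cmult:
 assumes "null F f" "\<forall>\<^sub>F i in F. f i \<in> Borel"
 shows "null F (%i x. c * f i x)"
proof (rule null_le)
 show "\<forall>\<^sub>F i in F. N2 (%x. c * f i x) <= ennreal (c^2) * N2 (f i)"
  using assms(2) by eventually_elim (simp add: N2_cmult)
 show "((%i. ennreal (c^2) * N2 (f i)) \<longlongrightarrow> 0) F"
  using ennreal_tendsto_cmult[OF _ assms(1)[unfolded null_def], of "ennreal (c^2)"] by simp
qed

lemma null_compose:
 assumes "null F f" "0 < \<alpha>" "\<forall>\<^sub>F i in F. slopes \<alpha> (b i) (p i) & f i \<in> Borel"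
 shows "null F (%i x. f i (p i x))"
proof (rule null_le)
 show "\<forall>\<^sub>F i in F. N2 (%x. f i (p i x)) <= ennreal (1 / \<alpha>) * N2 (f i)"
  using assms(3) by eventually_elim (auto intro: N2_compose assms(2))
 show "((%i. ennreal (1 / \<alpha>) * N2 (f i)) \<longlongrightarrow> 0) F"
  using ennreal_tendsto_cmult[OF _ assms(1)[unfolded null_def], of "ennreal (1 / \<alpha>)"] by simp
qed

lemma null_compose_continuous:
 assumes V: "V \<in> Borel" "N2 V < \<infinity>" and \<alpha>: "0 < \<alpha>" and r: "(r \<longlongrightarrow> 0) F"
  and p: "\<forall>\<^sub>F i in F. slopes \<alpha> (b i) (p1 i) & slopes \<alpha> (b i) (p2 i) & (\<forall>x. abs (p1 i x - p2 i x) <= r i)"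
 shows "null F (%i x. V (p1 i x) - V (p2 i x))"
proof (rule null_I)
 fix e :: real assume "0 < e"
 then obtain \<delta> where \<delta>: "0 < \<delta>" "!!p1 p2 \<beta>. slopes \<alpha> \<beta> p1 ==> slopes \<alpha> \<beta> p2 ==> (!!x. abs (p1 x - p2 x) <= \<delta>) ==> N2 (%x. V (p1 x) - V (p2 x)) <= ennreal e"
  using N2_compose_continuous[OF V _ \<alpha>] by blast
 show "\<forall>\<^sub>F i in F. N2 (%x. V (p1 i x) - V (p2 i x)) <= ennreal e"
  using p order_tendstoD(2)[OF r \<delta>(1)]
 proof eventually_elim
  case (elim i)
  show ?case by (rule \<delta>(2)[of "b i"]) (use elim in \<open>auto intro: order_trans less_imp_le\<close>)
 qed
qed

lemma null_const: "null F (%_. f) ==> F ~= bot ==> N2 f = 0"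
 unfolding null_def using tendsto_unique[OF _ tendsto_const] by metis

lemma L2_norm_tendsto_0_iff:
 assumes f: "\<forall>\<^sub>F i in F. f i \<in> L2_space"
 shows "((%i. L2_norm (f i)) \<longlongrightarrow> 0) F \<longleftrightarrow> null F f"
proof
 have eq: "\<forall>\<^sub>F i in F. ennreal ((L2_norm (f i))^2) = N2 (f i)" using f by eventually_elim (simp add: N2_eq_L2_norm)
 assume "((%i. L2_norm (f i)) \<longlongrightarrow> 0) F"
 from tendsto_ennrealI[OF tendsto_power[OF this, of 2]] show "null F f"
  unfolding null_def by (intro Lim_transform_eventually[OF _ eq]) simp
next
 assume "null F f"
 then have "((%i. enn2real (N2 (f i))) \<longlongrightarrow> 0) F" unfolding null_def by (intro tendsto_enn2real) auto
 moreover have "\<forall>\<^sub>F i in F. sqrt (enn2real (N2 (f i))) = L2_norm (f i)"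
  using f by eventually_elim (simp add: N2_eq_L2_norm L2_norm_def)
 ultimately show "((%i. L2_norm (f i)) \<longlongrightarrow> 0) F"
  using Lim_transform_eventually[OF tendsto_real_sqrt] by fastforce
qed

section \<open>From Lagrangian to Eulerian variables\<close>

locale lag_state =
 fixes \<alpha> \<beta> M :: real and D q U :: "real => real"
 assumes q: "slopes \<alpha> \<beta> q" and \<alpha>: "0 < \<alpha>" and D: "weight M D" and U: "wbd D 1 U"
begin

definition u :: "real => real" where "u x = U (inv q x)"

lemmas qi = slopes_inv[OF q \<alpha>]

lemma M_nonneg: "0 <= M" using weightD(4)[OF D] .

lemma beta_pos: "0 < \<beta>" using slopes_le[OF q] \<alpha> by linarith

lemma U_eq: "U = (%\<xi>. u (q \<xi>))"
 by (simp add: u_def qi(2))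

lemma U_Lipschitz: "abs (U b - U a) <= M * abs (b - a)"
 using wbd_Lipschitz[OF D U, of b a] by simp

lemma u_Lipschitz: "abs (u b - u a) <= M / \<alpha> * abs (b - a)"
proof -
 have "abs (u b - u a) <= M * abs (inv q b - inv q a)" unfolding u_def by (rule U_Lipschitz)
 also have "... <= M * (1 / \<alpha> * abs (b - a))"
  by (intro mult_left_mono slopes_abs(2)[OF qi(3,4)] M_nonneg)
 finally show ?thesis by simp
qed

lemma u_bound: "abs (u x) <= D (inv q x)" "abs (u x) <= M"
proof -
 show "abs (u x) <= D (inv q x)" using U by (simp add: u_def wbd_def)
 then show "abs (u x) <= M" using weightD(3)[OF D, of "inv q x"] by linarith
qed

lemmas u_deriv = Lipschitz_weak_deriv[OF u_Lipschitz]

lemma u_weak_deriv: "AE x in lborel. wd u x = wd U (inv q x) / wd q (inv q x)"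
proof -
 have "AE \<eta> in lborel. wd U \<eta> = wd u (q \<eta>) * wd q \<eta>"
  using Lipschitz_compose_weak_deriv[OF q \<alpha> u_Lipschitz] by (simp add: U_eq[symmetric])
 with slopes_weak_deriv(2)[OF q \<alpha>]
 have "AE \<eta> in lborel. wd u (q \<eta>) = wd U \<eta> / wd q \<eta>"
  by eventually_elim (use \<alpha> in auto)
 from AE_compose_slopes[OF qi(3,4) this] show ?thesis by (simp add: qi(1))
qed

lemma measurable_u [measurable]: "u \<in> Borel" "wd u \<in> Borel"
 "D \<in> Borel" "q \<in> Borel" "inv q \<in> Borel" "wd q \<in> Borel"
 "U \<in> Borel" "wd U \<in> Borel"
 using u_deriv weightD(1)[OF D] slopes_weak_deriv[OF q \<alpha>] slopes_borel[OF qi(3,4)] wbd_primitive[OF D U] by auto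

lemma u_weak_deriv_bound: "AE x in lborel. abs (wd u x) <= D (inv q x) / \<alpha>"
proof -
 have "AE \<eta> in lborel. abs (wd U \<eta> / wd q \<eta>) <= D \<eta> / \<alpha>"
  using wbd_primitive(4)[OF D U zero_le_one, unfolded mult_1_left] slopes_weak_deriv(2)[OF q \<alpha>]
 proof eventually_elim
  case (elim \<eta>)
  then show ?case unfolding abs_divide using \<alpha> weightD(2)[OF D] by (intro frac_le) auto
 qed
 from AE_compose_slopes[OF qi(3,4) this] u_weak_deriv show ?thesis
  by eventually_elim simp
qed

lemma N2_u: "N2 u <= ennreal \<beta> * N2 D" "N2 (wd u) <= ennreal (\<beta> / \<alpha>^2) * N2 D"
proof -
 have c: "N2 (%x. D (inv q x)) <= ennreal \<beta> * N2 D"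
  using N2_compose[OF qi(3,4), of D] by simp
 have "N2 u <= N2 (%x. D (inv q x))"
  by (rule N2_mono) (use u_bound(1) weightD(2)[OF D] in auto)
 then show "N2 u <= ennreal \<beta> * N2 D" using c by (rule order_trans)
 have "N2 (wd u) <= ennreal ((1 / \<alpha>)^2) * N2 (%x. D (inv q x))"
  by (rule N2_bounded_mult) (measurable, use u_weak_deriv_bound weightD(2)[OF D] in \<open>auto elim!: eventually_mono\<close>)
 also have "... <= ennreal ((1 / \<alpha>)^2) * (ennreal \<beta> * N2 D)" by (rule mult_left_mono[OF c]) simp
 also have "ennreal ((1 / \<alpha>)^2) * (ennreal \<beta> * N2 D) = ennreal (\<beta> / \<alpha>^2) * N2 D"
 proof -
  have c1: "ennreal ((1 / \<alpha>)^2) * ennreal \<beta> = ennreal (\<beta> / \<alpha>^2)"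
   by (subst ennreal_mult[symmetric]) (use beta_pos in \<open>auto simp: power_divide\<close>)
  show ?thesis unfolding mult.assoc[symmetric] c1 ..
 qed
 finally show "N2 (wd u) <= ennreal (\<beta> / \<alpha>^2) * N2 D" .
qed

end

lemma null_add:
 assumes "null F f" "null F g" "\<forall>\<^sub>F i in F. f i \<in> Borel & g i \<in> Borel"
 shows "null F (%i x. f i x + g i x)"
 by (rule null_sum[OF assms(1,2)]) (use assms(3) in \<open>eventually_elim, intro conjI AE_I2 abs_triangle_ineq; blast\<close>)

text \<open>By the chain rule the derivative in question is \<open>(U2' / q2') \<circ> q2\<^sup>-\<^sup>1\<close>, up to a null set. The quotient differs from
  \<open>U' / q'\<close> by small terms; what is left is to compare two compositions with one fixed function.\<close>

lemma (in lag_state) slope_difference: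
 assumes q2: "slopes \<alpha> \<beta> q2" and E: "weight M' E" and dU: "wbd E 1 (%x. U2 x - U x)"
  and dq: "!!a b. abs ((q2 b - q b) - (q2 a - q a)) <= \<delta> * abs (b - a)"
 shows "(%x. U2 (inv q2 x)) \<in> Borel" "wd (%x. U2 (inv q2 x)) \<in> Borel"
  "AE x in lborel. abs (wd (%x. U2 (inv q2 x)) x - wd U (inv q2 x) / wd q (inv q2 x))
   <= 1 / \<alpha> * E (inv q2 x) + \<delta> / \<alpha>^2 * D (inv q2 x)"
proof -
 have \<delta>: "0 <= \<delta>" using dq[of 1 0] by (simp add: order_trans[OF abs_ge_zero])
 note q2i = slopes_inv[OF q2 \<alpha>]
 have "wbd (%x. D x + E x) (1 * 1) U" "wbd (%x. D x + E x) (1 * 1) (%x. U2 x - U x)"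
  by (rule wbd_weight_mono[OF D weight_add[OF D E] _ U], use weightD(2)[OF E] in simp, simp)
   (rule wbd_weight_mono[OF E weight_add[OF D E] _ dU], use weightD(2)[OF D] in simp, simp)
 from wbd_add[OF this] have U2w: "wbd (%x. 2 * (D x + E x)) 1 U2"
  unfolding wbd_scale by (simp only: mult_1_left one_add_one add_diff_cancel_left' diff_add_cancel add_diff_eq)
 interpret s2: lag_state \<alpha> \<beta> "2 * (M + M')" "%x. 2 * (D x + E x)" q2 U2
  by unfold_locales (rule q2 \<alpha> U2w weight_cmult[OF weight_add[OF D E], of 2, simplified] | simp)+
 have u2: "s2.u = (%x. U2 (inv q2 x))" by (rule ext) (rule s2.u_def)
 show "(%x. U2 (inv q2 x)) \<in> Borel" "wd (%x. U2 (inv q2 x)) \<in> Borel"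
  using s2.measurable_u(1,2) unfolding u2 .
 define V where "V \<eta> = wd U \<eta> / wd q \<eta>" for \<eta>
 define V2 where "V2 \<eta> = wd U2 \<eta> / wd q2 \<eta>" for \<eta>
 have Wb: "AE \<eta> in lborel. abs (wd U \<eta>) <= D \<eta>"
  using wbd_primitive(4)[OF D U zero_le_one, unfolded mult_1_left] .
 have p: "primitive (%x. q2 x - q x) (%x. wd q2 x - wd q x)"
  by (intro primitive_diff slopes_weak_deriv(1)[OF q2 \<alpha>] slopes_weak_deriv(1)[OF q \<alpha>])
 have "AE x in lborel. abs (wd q2 x - wd q x) <= \<delta>"
 proof (rule AE_abs_le_of_seg_int[OF primitive_loc[OF p] loc_int_const])
  fix a b :: real assume "a <= b"
  then show "abs (seg_int (%x. wd q2 x - wd q x) a b) <= seg_int (%_. \<delta>) a b"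
   using dq[of b a] by (simp add: primitiveD[OF p, symmetric] seg_int_const)
 qed
 moreover have "AE x in lborel. abs (wd U2 x - wd U x) <= E x"
  using wbd_primitive_AE[OF E dU primitive_diff[OF wbd_primitive(1)[OF s2.D U2w] wbd_primitive(1)[OF D U]]] by simp
 ultimately have "AE \<eta> in lborel. abs (V2 \<eta> - V \<eta>) <= 1 / \<alpha> * E \<eta> + \<delta> / \<alpha>^2 * D \<eta>"
  using Wb slopes_weak_deriv(2)[OF q \<alpha>] slopes_weak_deriv(2)[OF q2 \<alpha>]
 proof eventually_elim
  case (elim \<eta>)
  define W W2 r r2 where d: "W = wd U \<eta>" "W2 = wd U2 \<eta>" "r = wd q \<eta>" "r2 = wd q2 \<eta>"
  have h: "abs (r2 - r) <= \<delta>" "abs (W2 - W) <= E \<eta>" "abs W <= D \<eta>" "\<alpha> <= r" "\<alpha> <= r2" using elim by (auto simp: d)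
  have pos: "0 < r" "0 < r2" using h \<alpha> by auto
  have 1: "abs ((W2 - W) / r2) <= E \<eta> / \<alpha>" unfolding abs_divide using h \<alpha> pos by (intro frac_le) auto
  have 2: "abs (W * (r - r2) / (r * r2)) <= D \<eta> * \<delta> / (\<alpha> * \<alpha>)"
   unfolding abs_divide
  proof (rule frac_le)
   show "abs (W * (r - r2)) <= D \<eta> * \<delta>" by (rule abs_mult_le) (use h in \<open>auto simp: abs_minus_commute\<close>)
   show "\<alpha> * \<alpha> <= abs (r * r2)" using mult_mono[OF h(4,5)] \<alpha> pos by (simp add: abs_mult)
   show "0 <= D \<eta> * \<delta>" using weightD(2)[OF D, of \<eta>] \<delta>(1) by simp
  qed (use \<alpha> in simp)
  have eq: "V2 \<eta> - V \<eta> = (W2 - W) / r2 + W * (r - r2) / (r * r2)"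
   using pos by (simp add: V_def V2_def d[symmetric] field_simps)
  have "abs (V2 \<eta> - V \<eta>) <= abs ((W2 - W) / r2) + abs (W * (r - r2) / (r * r2))"
   unfolding eq by (rule abs_triangle_ineq)
  also have "abs ((W2 - W) / r2) + abs (W * (r - r2) / (r * r2)) <= E \<eta> / \<alpha> + D \<eta> * \<delta> / (\<alpha> * \<alpha>)"
   using 1 2 by (rule add_mono)
  also have "... = 1 / \<alpha> * E \<eta> + \<delta> / \<alpha>^2 * D \<eta>" by (simp add: power2_eq_square)
  finally show ?case by linarith
 qed
 from AE_compose_slopes[OF q2i(3,4) this] s2.u_weak_deriv
 show "AE x in lborel. abs (wd (%x. U2 (inv q2 x)) x - wd U (inv q2 x) / wd q (inv q2 x))
   <= 1 / \<alpha> * E (inv q2 x) + \<delta> / \<alpha>^2 * D (inv q2 x)"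
  unfolding u2 by eventually_elim (simp add: V_def V2_def)
qed

text \<open>Small pointwise differences of the states are only moved by the change of variables, and the fixed profiles
  \<open>U\<close> and \<open>U' / q'\<close> composed with \<open>q2\<^sup>-\<^sup>1\<close> and with \<open>q\<^sup>-\<^sup>1\<close> are close by continuity of compositions.\<close>

lemma (in lag_state) close_states:
 assumes fin: "N2 D < \<infinity>" and r: "(r \<longlongrightarrow> 0) F"
  and ev: "\<forall>\<^sub>F i in F. slopes \<alpha> \<beta> (q2 i) & (\<forall>x. abs (q2 i x - q x) <= r i) & (\<forall>a b. abs ((q2 i b - q b) - (q2 i a - q a)) <= r i * abs (b - a)) &
   (\<exists>E M'. weight M' E & wbd E 1 (%x. U2 i x - U x) & N2 E <= ennreal (r i))"
 shows "null F (%i x. U2 i (inv (q2 i) x) - u x)" "null F (%i x. wd (%x. U2 i (inv (q2 i) x)) x - wd u x)"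
proof -
 define E where "E i = (SOME E. \<exists>M'. weight M' E & wbd E 1 (%x. U2 i x - U x) & N2 E <= ennreal (r i))" for i
 define p where "p i = inv (q2 i)" for i
 have ev: "\<forall>\<^sub>F i in F. slopes \<alpha> \<beta> (q2 i) & (\<forall>x. abs (q2 i x - q x) <= r i) & (\<forall>a b. abs ((q2 i b - q b) - (q2 i a - q a)) <= r i * abs (b - a)) &
   (\<exists>M'. weight M' (E i) & wbd (E i) 1 (%x. U2 i x - U x) & N2 (E i) <= ennreal (r i))"
  using ev
 proof eventually_elim
  case (elim i)
  then have "\<exists>E M'. weight M' E & wbd E 1 (%x. U2 i x - U x) & N2 E <= ennreal (r i)" by blast
  from someI_ex[OF this] show ?case using elim unfolding E_def by blast
 qed
 define V where "V \<eta> = wd U \<eta> / wd q \<eta>" for \<eta>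
 have [measurable]: "V \<in> Borel" unfolding V_def[abs_def] by measurable
 have finU: "N2 U < \<infinity>" by (rule le_less_trans[OF N2_mono fin]) (use U weightD(2)[OF D] in \<open>auto simp: wbd_def\<close>)
 have "N2 V <= ennreal ((1 / \<alpha>)^2) * N2 D"
 proof (rule N2_bounded_mult)
  show "AE x in lborel. abs (V x) <= 1 / \<alpha> * abs (D x)"
   using wbd_primitive(4)[OF D U zero_le_one, unfolded mult_1_left] slopes_weak_deriv(2)[OF q \<alpha>]
  proof eventually_elim
   case (elim \<eta>)
   then have "abs (V \<eta>) <= D \<eta> / \<alpha>" unfolding V_def abs_divide using \<alpha> weightD(2)[OF D] by (intro frac_le) auto
   then show ?case using weightD(2)[OF D, of \<eta>] by simp
  qed
 qed measurable
 then have finV: "N2 V < \<infinity>" by (rule le_less_trans) (use fin in \<open>simp add: ennreal_mult_less_top\<close>)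
 have ib: "0 < 1 / \<beta>" by (rule qi(4))
 have ra: "((%i. r i / \<alpha>) \<longlongrightarrow> 0) F" "((%i. r i / \<alpha>^2) \<longlongrightarrow> 0) F"
  using tendsto_divide[OF r tendsto_const[of \<alpha>]] tendsto_divide[OF r tendsto_const[of "\<alpha>^2"]] \<alpha> by auto
 have pev: "\<forall>\<^sub>F i in F. slopes (1 / \<beta>) (1 / \<alpha>) (p i) & slopes (1 / \<beta>) (1 / \<alpha>) (inv q) & (\<forall>x. abs (p i x - inv q x) <= r i / \<alpha>)"
  using ev
 proof eventually_elim
  case (elim i)
  then have q2: "slopes \<alpha> \<beta> (q2 i)" and cl: "!!x. abs (q2 i x - q x) <= r i" by auto
  have "abs (p i x - inv q x) <= r i / \<alpha>" for x
  proof -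
   have "\<alpha> * abs (p i x - inv q x) <= abs (q (p i x) - q (inv q x))" by (rule slopes_abs(1)[OF q \<alpha>])
   also have "... = abs (q2 i (p i x) - q (p i x))" by (simp add: p_def qi(1) slopes_inv(1)[OF q2 \<alpha>] abs_minus_commute)
   also have "... <= r i" by (rule cl)
   finally show ?thesis using \<alpha> by (simp add: le_divide_eq mult.commute)
  qed
  then show ?case using slopes_inv(3)[OF q2 \<alpha>] qi(3) by (simp add: p_def)
 qed
 have m: "\<forall>\<^sub>F i in F. slopes (1 / \<beta>) (1 / \<alpha>) (p i) & p i \<in> Borel & E i \<in> Borel"
  using ev pev by eventually_elim (auto intro: slopes_borel[OF _ ib] weightD(1))
 have E0: "null F E"
  by (rule null_le[where b = "%i. ennreal (r i)"]) (use ev tendsto_ennrealI[OF r] in \<open>auto elim!: eventually_mono\<close>)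
 have EP: "null F (%i x. E i (p i x))"
  by (rule null_compose[OF E0 ib]) (use m in \<open>eventually_elim, blast\<close>)
 have EP': "null F (%i x. 1 / \<alpha> * E i (p i x))"
  by (rule null_cmult[OF EP]) (use m in \<open>eventually_elim, auto intro: measurable_compose\<close>)
 have DP: "null F (%i x. r i / \<alpha>^2 * D (p i x))"
  by (rule null_compose[OF null_scale[OF ra(2) _ fin] ib, where b = "%_. 1 / \<alpha>"]) (use m in \<open>measurable, eventually_elim, auto\<close>)
 have cU: "null F (%i x. U (p i x) - U (inv q x))" and cV: "null F (%i x. V (p i x) - V (inv q x))"
  by (rule null_compose_continuous[OF _ _ ib ra(1) pev]; use finU finV in simp)+
 show "null F (%i x. U2 i (inv (q2 i) x) - u x)"
 proof (rule null_sum[OF EP cU])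
  show "\<forall>\<^sub>F i in F. (%x. E i (p i x)) \<in> Borel & (%x. U (p i x) - U (inv q x)) \<in> Borel &
   (AE x in lborel. abs (U2 i (inv (q2 i) x) - u x) <= abs (E i (p i x)) + abs (U (p i x) - U (inv q x)))"
   using ev m
  proof eventually_elim
   case (elim i)
   then have [measurable]: "p i \<in> Borel" "E i \<in> Borel" by auto
   have "abs (U2 i z - U z) <= E i z" for z using elim by (auto simp: wbd_def)
   then have "abs (U2 i (inv (q2 i) x) - u x) <= abs (E i (p i x)) + abs (U (p i x) - U (inv q x))" for x
    using abs_ge_self[of "E i (p i x)"] unfolding u_def p_def by (smt (verit))
   then have ae: "AE x in lborel. abs (U2 i (inv (q2 i) x) - u x) <= abs (E i (p i x)) + abs (U (p i x) - U (inv q x))" by (rule AE_I2)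
   show ?case by (intro conjI ae; measurable)
  qed
 qed
 have S: "null F (%i x. 1 / \<alpha> * E i (p i x) + r i / \<alpha>^2 * D (p i x))"
  by (rule null_add[OF EP' DP]) (use m in \<open>eventually_elim, auto intro!: borel_measurable_times intro: measurable_compose\<close>)
 show "null F (%i x. wd (%x. U2 i (inv (q2 i) x)) x - wd u x)"
 proof (rule null_sum[OF S cV])
  show "\<forall>\<^sub>F i in F. (%x. 1 / \<alpha> * E i (p i x) + r i / \<alpha>^2 * D (p i x)) \<in> Borel & (%x. V (p i x) - V (inv q x)) \<in> Borel &
   (AE x in lborel. abs (wd (%x. U2 i (inv (q2 i) x)) x - wd u x) <= abs (1 / \<alpha> * E i (p i x) + r i / \<alpha>^2 * D (p i x)) + abs (V (p i x) - V (inv q x)))"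
   using ev m
  proof eventually_elim
   case (elim i)
   then obtain M' where q2: "slopes \<alpha> \<beta> (q2 i)" and E: "weight M' (E i)" and dU: "wbd (E i) 1 (%x. U2 i x - U x)"
    and dq: "!!a b. abs ((q2 i b - q b) - (q2 i a - q a)) <= r i * abs (b - a)" by blast
   have [measurable]: "p i \<in> Borel" "E i \<in> Borel" using elim by auto
   have ae: "AE x in lborel. abs (wd (%x. U2 i (inv (q2 i) x)) x - wd u x) <= abs (1 / \<alpha> * E i (p i x) + r i / \<alpha>^2 * D (p i x)) + abs (V (p i x) - V (inv q x))"
    using slope_difference(3)[OF q2 E dU dq] u_weak_deriv unfolding p_def by eventually_elim (simp add: V_def)
   show ?case by (intro conjI ae; measurable)
  qed
 qed
qed

section \<open>The velocity field of the evolution\<close>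

definition vel :: "real => (real => real) => real => real" where
 "vel kap u x = - (u x * wd u x + d_Helmholtz (euler_src kap u) x)"

definition bLip :: "real => (real => real) => bool" where
 "bLip K u \<longleftrightarrow> (\<forall>x. abs (u x) <= K) & (\<forall>a b. abs (u b - u a) <= K * abs (b - a))"

lemma bLip_deriv:
 assumes "bLip K u"
 shows "primitive u (wd u)" "AE x in lborel. abs (wd u x) <= K"
  "wd u \<in> Borel" "u \<in> Borel" "0 <= K" "euler_src kap u \<in> Borel"
proof -
 have L: "!!a b. abs (u b - u a) <= K * abs (b - a)" using assms by (simp add: bLip_def)
 show "primitive u (wd u)" "AE x in lborel. abs (wd u x) <= K"
  "wd u \<in> Borel" "u \<in> Borel"
  using Lipschitz_weak_deriv[OF L] by auto
 show "0 <= K" using Lipschitz_nonneg[of u K] L by blast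
 show "euler_src kap u \<in> Borel" by (rule euler_src_borel[OF L])
qed

lemma d_Helmholtz_N2:
 assumes [measurable]: "f \<in> Borel" and b: "AE x in lborel. abs (f x) <= B"
 shows "N2 (d_Helmholtz f) <= N2 f" "N2 (inv_Helmholtz f) <= N2 f"
  "abs (d_Helmholtz f x) <= B" "abs (inv_Helmholtz f x) <= B"
proof -
 define N where "N x = (if (abs (f x)) <= B then (abs (f x)) else 0)" for x
 have B: "0 <= B"
 proof (rule ccontr)
  assume n: "\<not> 0 <= B"
  have "AE x in (lborel :: real measure). False" using b by eventually_elim (use n in auto)
  then show False by (simp add: eventually_False ae_filter_eq_bot_iff)
 qed
 have [measurable]: "N \<in> Borel" unfolding N_def[abs_def] by measurable
 have w: "weight B N" using B by (auto simp: weight_def N_def)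
 have fN: "AE y in lborel. abs (f y) <= N y" using b by eventually_elim (simp add: N_def)
 note le = Helmholtz_kconv_le[OF assms(1) fN w]
 have "N2 (%x. kconv 1 N x / 2) <= N2 f"
 proof -
  have "N2 (%x. 1 / 2 * kconv 1 N x) = ennreal ((1 / 2)^2) * N2 (kconv 1 N)" by (rule N2_cmult) measurable
  also have "... <= ennreal ((1 / 2)^2) * (ennreal ((2 / 1)^2) * N2 N)"
   by (rule mult_left_mono[OF N2_kconv[OF _ w]]) auto
  also have "ennreal ((1 / 2)^2) * (ennreal ((2 / 1)^2) * N2 N) = N2 N"
  proof -
   have c1: "ennreal ((1 / 2)^2) * ennreal ((2 / 1)^2) = 1"
    by (subst ennreal_mult[symmetric]) (auto simp: power2_eq_square)
   show ?thesis unfolding mult.assoc[symmetric] c1 by simp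
  qed
  also have "N2 N <= N2 f" by (rule N2_mono) (simp add: N_def)
  finally show ?thesis by simp
 qed
 note half = this
 have "abs (kconv 1 N x / 2) = kconv 1 N x / 2" for x using kconv_nonneg[OF w, of 1 x] by simp
 then have le': "abs (inv_Helmholtz f x) <= abs (kconv 1 N x / 2)" "abs (d_Helmholtz f x) <= abs (kconv 1 N x / 2)" for x using le by simp_all
 show "N2 (d_Helmholtz f) <= N2 f" by (rule order_trans[OF N2_mono[OF le'(2)] half])
 show "N2 (inv_Helmholtz f) <= N2 f" by (rule order_trans[OF N2_mono[OF le'(1)] half])
 have "kconv 1 N x / 2 <= B" using kconv_le[OF _ w, of 1 x] by simp
 then show "abs (d_Helmholtz f x) <= B" "abs (inv_Helmholtz f x) <= B" using le[of x] by linarith+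
qed

lemma Helmholtz_diff:
 assumes [measurable]: "f \<in> Borel" "g \<in> Borel" and b: "AE x in lborel. abs (f x) <= B" "AE x in lborel. abs (g x) <= B'"
 shows "d_Helmholtz (%x. f x - g x) x = d_Helmholtz f x - d_Helmholtz g x"
  "inv_Helmholtz (%x. f x - g x) x = inv_Helmholtz f x - inv_Helmholtz g x"
proof -
 have 1: "(%z::real. - sgn z * exp (- abs z) / 2) \<in> Borel" "(%z::real. exp (- abs z) / 2) \<in> Borel" by measurable
 note K = kernel_Fubini(3)[OF 1(1) _ half_exp_bounds(2), where x=x] kernel_Fubini(3)[OF 1(2) _ half_exp_bounds(1), where x=x]
 show "d_Helmholtz (%x. f x - g x) x = d_Helmholtz f x - d_Helmholtz g x"
  unfolding d_Helmholtz_def right_diff_distrib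
  by (rule Bochner_Integration.integral_diff) (rule K(1)[OF assms(1) b(1)] K(1)[OF assms(2) b(2)])+
 show "inv_Helmholtz (%x. f x - g x) x = inv_Helmholtz f x - inv_Helmholtz g x"
  unfolding inv_Helmholtz_def right_diff_distrib
  by (rule Bochner_Integration.integral_diff) (rule K(2)[OF assms(1) b(1)] K(2)[OF assms(2) b(2)])+
qed

lemma euler_src_bound:
 assumes u: "bLip K u"
 shows "AE x in lborel. abs (euler_src kap u x) <= (abs kap + 2 * K) * K"
  "AE x in lborel. abs (euler_src kap u x) <= (abs kap + 2 * K) * abs ((abs (u x)) + abs (wd u x))"
proof -
 have K: "0 <= K" using bLip_deriv(5)[OF u] .
 have *: "AE x in lborel. abs (euler_src kap u x) <= (abs kap + 2 * K) * K & abs (euler_src kap u x) <= (abs kap + 2 * K) * (abs (u x) + abs (wd u x))"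
  using bLip_deriv(2)[OF u]
 proof eventually_elim
  case (elim x)
  have ub: "abs (u x) <= K" using u by (simp add: bLip_def)
  have 1: "abs (kap * u x) = abs kap * abs (u x)" by (rule abs_mult)
  have 2: "(u x)^2 <= K * abs (u x)" using mult_right_mono[OF ub, of "abs (u x)"] by (simp add: power2_eq_square)
  have 3: "(wd u x)^2 / 2 <= K * abs (wd u x)"
  proof -
   have "(wd u x)^2 <= K * abs (wd u x)"
    using mult_right_mono[OF elim, of "abs (wd u x)"] by (simp add: power2_eq_square)
   moreover have "(wd u x)^2 / 2 <= (wd u x)^2" by simp
   ultimately show ?thesis by linarith
  qed
  have 4: "(wd u x)^2 / 2 <= K * K"
   using 3 mult_left_mono[OF elim K] by linarith
  have s: "abs (euler_src kap u x) <= abs kap * abs (u x) + (u x)^2 + (wd u x)^2 / 2"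
   unfolding euler_src_def 1[symmetric] by (smt (verit) zero_le_power2 divide_nonneg_pos)
  have "abs kap * abs (u x) <= abs kap * K" "K * abs (u x) <= K * K" by (intro mult_left_mono ub K abs_ge_zero)+
  then have a: "abs (euler_src kap u x) <= (abs kap + 2 * K) * K" using s 2 4 by (simp add: distrib_right)
  have "0 <= K * abs (u x)" "0 <= abs kap * abs (wd u x)" "0 <= K * abs (wd u x)" using K by auto
  moreover have "(abs kap + 2 * K) * (abs (u x) + abs (wd u x)) = abs kap * abs (u x) + 2 * (K * abs (u x)) + (abs kap * abs (wd u x) + 2 * (K * abs (wd u x)))"
   by (simp add: algebra_simps)
  ultimately have "abs (euler_src kap u x) <= (abs kap + 2 * K) * (abs (u x) + abs (wd u x))"
   using s 2 3 by linarith
  with a show ?case by simp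
 qed
 then show "AE x in lborel. abs (euler_src kap u x) <= (abs kap + 2 * K) * K" by eventually_elim simp
 from * show "AE x in lborel. abs (euler_src kap u x) <= (abs kap + 2 * K) * abs ((abs (u x)) + abs (wd u x))" by eventually_elim simp
qed

lemma euler_src_diff:
 assumes u: "bLip K u" and v: "bLip K v"
 shows "AE x in lborel. abs (euler_src kap u x - euler_src kap v x) <= (abs kap + 2 * K) * abs ((abs (u x - v x)) + abs (wd u x - wd v x))"
 using bLip_deriv(2)[OF u] bLip_deriv(2)[OF v]
proof eventually_elim
 case (elim x)
 have K: "0 <= K" using bLip_deriv(5)[OF u] .
 define a b where ab: "a = u x - v x" "b = wd u x - wd v x"
 have s: "abs (u x + v x) <= 2 * K"
 proof -
  have "abs (u x) <= K" "abs (v x) <= K" using u v unfolding bLip_def by blast+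
  then show ?thesis by linarith
 qed
 have t: "abs ((wd u x + wd v x) / 2) <= K"
 proof -
  have "abs (wd u x + wd v x) <= K + K" using elim by linarith
  then show ?thesis unfolding abs_divide by simp
 qed
 have "euler_src kap u x - euler_src kap v x = kap * a + (u x + v x) * a + (wd u x + wd v x) / 2 * b"
  by (simp add: euler_src_def ab power2_eq_square field_simps)
 moreover have "abs (kap * a) <= abs kap * abs a" by (simp add: abs_mult)
 moreover have "abs ((u x + v x) * a) <= 2 * K * abs a" by (rule abs_mult_le[OF s order_refl])
 moreover have "abs ((wd u x + wd v x) / 2 * b) <= K * abs b" by (rule abs_mult_le[OF t order_refl])
 moreover have "0 <= abs kap * abs b" "0 <= K * abs b" using K by auto
 ultimately have "abs (euler_src kap u x - euler_src kap v x) <= abs kap * abs a + 2 * K * abs a + (abs kap * abs b + 2 * (K * abs b))" by linarith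
 also have "... = (abs kap + 2 * K) * abs ((abs a) + abs b)" by (simp add: algebra_simps)
 finally show ?case unfolding ab .
qed

lemma N2_abs_sum_le:
 assumes [measurable]: "f \<in> Borel" "g \<in> Borel" and "N2 f <= ennreal e" "N2 g <= ennreal e" "0 <= e"
 shows "N2 (%x. abs (f x) + abs (g x)) <= ennreal (4 * e)"
proof -
 have "N2 (%x. abs (f x) + abs (g x)) <= ennreal (2 * e + 2 * e)"
  by (rule N2_add_le) (use assms in \<open>auto simp: N2_def\<close>)
 then show ?thesis by simp
qed

definition vel_const :: "real => real => real" where
 "vel_const kap K = 8 * K^2 + 8 * (abs kap + 2 * K)^2"

text \<open>The transport term and the source are quadratic, hence Lipschitz on bounded sets of Lipschitz functions;
  the kernel preserves square integrals by Young's inequality.\<close>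

lemma vel_diff:
 assumes u: "bLip K u" and v: "bLip K v" and e: "0 <= e"
  and d: "N2 (%x. u x - v x) <= ennreal e" "N2 (%x. wd u x - wd v x) <= ennreal e"
 shows "N2 (%x. vel kap u x - vel kap v x) <= ennreal (vel_const kap K * e)"
  "N2 (%x. euler_src kap u x - euler_src kap v x) <= ennreal ((abs kap + 2 * K)^2 * (4 * e))"
proof -
 note [measurable] = bLip_deriv(3,4)[OF u] bLip_deriv(3,4)[OF v] bLip_deriv(6)[OF u, of kap] bLip_deriv(6)[OF v, of kap]
 have K: "0 <= K" using bLip_deriv(5)[OF u] .
 have sum: "N2 (%x. abs (u x - v x) + abs (wd u x - wd v x)) <= ennreal (4 * e)"
  by (rule N2_abs_sum_le[OF _ _ d e]) measurable
 have A: "N2 (%x. u x * wd u x - v x * wd v x) <= ennreal (K^2 * (4 * e))"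
 proof -
  have "N2 (%x. u x * wd u x - v x * wd v x) <= ennreal (K^2) * N2 (%x. abs (u x - v x) + abs (wd u x - wd v x))"
  proof (rule N2_bounded_mult)
   show "AE x in lborel. abs (u x * wd u x - v x * wd v x) <= K * abs ((abs (u x - v x)) + abs (wd u x - wd v x))"
    using bLip_deriv(2)[OF v]
   proof eventually_elim
    case (elim x)
    have "u x * wd u x - v x * wd v x = u x * (wd u x - wd v x) + wd v x * (u x - v x)" by (simp add: algebra_simps)
    moreover have "abs (u x * (wd u x - wd v x)) <= K * abs (wd u x - wd v x)"
     by (rule abs_mult_le) (use u in \<open>auto simp: bLip_def\<close>)
    moreover have "abs (wd v x * (u x - v x)) <= K * abs (u x - v x)" by (rule abs_mult_le[OF elim order_refl])
    ultimately show ?case by (simp add: distrib_left)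
   qed
  qed measurable
  also have "... <= ennreal (K^2) * ennreal (4 * e)" by (rule mult_left_mono[OF sum]) simp
  finally show ?thesis using e by (simp add: ennreal_mult)
 qed
 show B: "N2 (%x. euler_src kap u x - euler_src kap v x) <= ennreal ((abs kap + 2 * K)^2 * (4 * e))"
 proof -
  have "N2 (%x. euler_src kap u x - euler_src kap v x) <= ennreal ((abs kap + 2 * K)^2) * N2 (%x. abs (u x - v x) + abs (wd u x - wd v x))"
   by (rule N2_bounded_mult[OF _ euler_src_diff[OF u v]]) measurable
  also have "... <= ennreal ((abs kap + 2 * K)^2) * ennreal (4 * e)" by (rule mult_left_mono[OF sum]) simp
  finally show ?thesis using e by (simp add: ennreal_mult)
 qed
 have bd: "AE x in lborel. abs (euler_src kap u x - euler_src kap v x) <= 2 * ((abs kap + 2 * K) * K)"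
  using euler_src_bound(1)[OF u, of kap] euler_src_bound(1)[OF v, of kap] by eventually_elim linarith
 have pd: "primitive (inv_Helmholtz (euler_src kap w)) (d_Helmholtz (euler_src kap w))" if "bLip K w" for w
  by (rule Helmholtz_primitive(1)[OF bLip_deriv(6)[OF that] euler_src_bound(1)[OF that]])
 note [measurable] = loc_int_borel[OF primitive_loc[OF pd[OF u]]] loc_int_borel[OF primitive_loc[OF pd[OF v]]]
 have "N2 (%x. d_Helmholtz (euler_src kap u) x - d_Helmholtz (euler_src kap v) x) = N2 (d_Helmholtz (%x. euler_src kap u x - euler_src kap v x))"
  unfolding N2_def by (simp add: Helmholtz_diff(1)[OF _ _ euler_src_bound(1)[OF u] euler_src_bound(1)[OF v]])
 also have "... <= N2 (%x. euler_src kap u x - euler_src kap v x)" by (rule d_Helmholtz_N2(1)[OF _ bd]) measurable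
 finally have C: "N2 (%x. d_Helmholtz (euler_src kap u) x - d_Helmholtz (euler_src kap v) x) <= ennreal ((abs kap + 2 * K)^2 * (4 * e))"
  using B by (rule order_trans)
 have "N2 (%x. (u x * wd u x - v x * wd v x) + (d_Helmholtz (euler_src kap u) x - d_Helmholtz (euler_src kap v) x))
  <= ennreal (2 * (K^2 * (4 * e)) + 2 * ((abs kap + 2 * K)^2 * (4 * e)))"
  by (rule N2_add_le[OF _ _ A C]) (use e in auto)
 also have "2 * (K^2 * (4 * e)) + 2 * ((abs kap + 2 * K)^2 * (4 * e)) = vel_const kap K * e" by (simp add: vel_const_def algebra_simps)
 also have "N2 (%x. (u x * wd u x - v x * wd v x) + (d_Helmholtz (euler_src kap u) x - d_Helmholtz (euler_src kap v) x))
  = N2 (%x. vel kap u x - vel kap v x)"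
  unfolding vel_def by (subst N2_commute) (simp add: N2_def algebra_simps)
 finally show "N2 (%x. vel kap u x - vel kap v x) <= ennreal (vel_const kap K * e)" .
qed

lemma null_vel:
 assumes u: "\<forall>\<^sub>F i in F. bLip K (u i)" and v: "bLip K v"
  and n: "null F (%i x. u i x - v x)" "null F (%i x. wd (u i) x - wd v x)"
 shows "null F (%i x. vel kap (u i) x - vel kap v x)"
proof (rule null_I)
 fix e :: real assume e: "0 < e"
 have c: "0 < vel_const kap K + 1" by (simp add: vel_const_def add_nonneg_pos)
 define e' where "e' = e / (vel_const kap K + 1)"
 have e': "0 < e'" "(vel_const kap K + 1) * e' = e" using e c by (auto simp: e'_def)
 then have le: "vel_const kap K * e' <= e" by (simp add: distrib_right)
 show "\<forall>\<^sub>F i in F. N2 (%x. vel kap (u i) x - vel kap v x) <= ennreal e"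
  using u null_D[OF n(1) e'(1)] null_D[OF n(2) e'(1)]
 proof eventually_elim
  case (elim i)
  show ?case by (rule order_trans[OF vel_diff(1)[OF elim(1) v less_imp_le[OF e'(1)] elim(2,3)] ennreal_leI[OF le]])
 qed
qed

lemma vel_measurable:
 assumes u: "bLip K u"
 shows "vel kap u \<in> Borel" "d_Helmholtz (euler_src kap u) \<in> Borel"
  "inv_Helmholtz (euler_src kap u) \<in> Borel"
proof -
 note [measurable] = bLip_deriv(3,4)[OF u] bLip_deriv(6)[OF u, of kap]
 note p = Helmholtz_primitive(1)[OF bLip_deriv(6)[OF u] euler_src_bound(1)[OF u], of kap]
 show 1[measurable]: "d_Helmholtz (euler_src kap u) \<in> Borel"
  by (rule loc_int_borel[OF primitive_loc[OF p]])
 show "inv_Helmholtz (euler_src kap u) \<in> Borel" by (rule primitive_borel[OF p])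
 show "vel kap u \<in> Borel" unfolding vel_def[abs_def] by measurable
qed

lemma vel_finite:
 assumes u: "bLip K u" and fin: "N2 u < \<infinity>" "N2 (wd u) < \<infinity>"
 shows "N2 (euler_src kap u) < \<infinity>" "N2 (d_Helmholtz (euler_src kap u)) < \<infinity>" "N2 (vel kap u) < \<infinity>"
proof -
 note [measurable] = bLip_deriv(3,4)[OF u] bLip_deriv(6)[OF u, of kap] vel_measurable[OF u, of kap]
 have "N2 (euler_src kap u) <= ennreal ((abs kap + 2 * K)^2) * N2 (%x. abs (u x) + abs (wd u x))"
  by (rule N2_bounded_mult[OF _ euler_src_bound(2)[OF u]]) measurable
 also have "... < \<infinity>"
  using N2_add_finite[of "%x. abs (u x)" "%x. abs (wd u x)"] fin by (simp add: N2_def ennreal_mult_less_top)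
 finally show 1: "N2 (euler_src kap u) < \<infinity>" .
 show 2: "N2 (d_Helmholtz (euler_src kap u)) < \<infinity>"
  by (rule le_less_trans[OF d_Helmholtz_N2(1)[OF _ euler_src_bound(1)[OF u]] 1]) measurable
 have "N2 (%x. u x * wd u x) <= ennreal (K^2) * N2 (wd u)"
  by (rule N2_bounded_mult) (measurable, use u in \<open>auto simp: bLip_def abs_mult intro!: mult_right_mono\<close>)
 also have "... < \<infinity>" using fin by (simp add: ennreal_mult_less_top)
 finally have 3: "N2 (%x. u x * wd u x) < \<infinity>" .
 have "N2 (%x. u x * wd u x + d_Helmholtz (euler_src kap u) x) < \<infinity>"
  by (rule N2_add_finite[OF _ _ 3 2]) measurable
 then show "N2 (vel kap u) < \<infinity>" unfolding vel_def[abs_def] by (simp only: N2_uminus)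
qed

section \<open>Norms of the function spaces\<close>

lemma AE_lborel_False: "AE x in (lborel :: real measure). False ==> False"
 by (simp add: eventually_False ae_filter_eq_bot_iff)

lemma Linf_norm_le:
 assumes "f \<in> Borel" "AE x in lborel. abs (f x) <= C" "0 <= C"
 shows "Linf_norm f <= C"
proof -
 have "esssup lborel (%x. ereal (abs (f x))) <= ereal C"
  by (rule esssup_I) (use assms in auto)
 then show ?thesis unfolding Linf_norm_def using assms(3)
  by (cases "esssup lborel (%x. ereal (abs (f x)))") auto
qed

lemma Linf_norm_AE:
 assumes "f \<in> Linf_space"
 shows "AE x in lborel. abs (f x) <= Linf_norm f" "0 <= Linf_norm f"
proof -
 obtain C where C: "AE x in lborel. abs (f x) <= C" using assms by (auto simp: Linf_space_def)
 let ?s = "esssup lborel (%x. ereal (abs (f x)))"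
 have m: "(%x. ereal (abs (f x))) \<in> borel_measurable lborel" using assms by (auto simp: Linf_space_def)
 have le: "?s <= ereal C" by (rule esssup_I[OF m]) (use C in auto)
 have ae: "AE x in lborel. ereal (abs (f x)) <= ?s" by (rule esssup_AE)
 have ge: "0 <= ?s"
 proof (rule ccontr)
  assume n: "\<not> 0 <= ?s"
  have "AE x in (lborel :: real measure). False" using ae
  proof eventually_elim
   case (elim x)
   have "0 <= ereal (abs (f x))" by simp
   with elim n show False using order_trans by blast
  qed
  then show False by (rule AE_lborel_False)
 qed
 have eq: "ereal (Linf_norm f) = ?s" unfolding Linf_norm_def using le ge by (cases ?s) auto
 show "AE x in lborel. abs (f x) <= Linf_norm f" using ae unfolding eq[symmetric] by simp
 show "0 <= Linf_norm f" using ge unfolding eq[symmetric] by simp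
qed

lemma H1_norm_sq:
 assumes F: "primitive F g" and f: "f \<in> Borel" "AE x in lborel. f x = F x"
 shows "(H1_norm f)^2 = enn2real (N2 F) + enn2real (N2 g)" "0 <= H1_norm f"
proof -
 note w = weak_deriv_AE_primitive[OF F f]
 have [measurable]: "wd f \<in> Borel"
  by (rule loc_int_borel[OF primitive_loc[OF w(3)]])
 have "(H1_norm f)^2 = (L2_norm f)^2 + (L2_norm (wd f))^2" by (simp add: H1_norm_def)
 also have "... = enn2real (N2 f) + enn2real (N2 (wd f))" using f by (simp add: L2_norm_sq)
 also have "N2 f = N2 F" by (rule N2_cong_AE[OF f(2)])
 also have "N2 (wd f) = N2 g" by (rule N2_cong_AE[OF w(4)])
 finally show "(H1_norm f)^2 = enn2real (N2 F) + enn2real (N2 g)" .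
 show "0 <= H1_norm f" by (simp add: H1_norm_def)
qed

lemma H1_norm_le:
 assumes "primitive F g" "f \<in> Borel" "AE x in lborel. f x = F x"
  and N: "N2 F <= ennreal a" "N2 g <= ennreal b" "0 <= a" "0 <= b"
 shows "H1_norm f <= sqrt (a + b)"
proof -
 have "enn2real (N2 F) <= a" "enn2real (N2 g) <= b" using N by (simp_all add: enn2real_leI)
 then have "(H1_norm f)^2 <= a + b" using H1_norm_sq(1)[OF assms(1-3)] by simp
 then show ?thesis by (rule real_le_rsqrt)
qed

lemma H1_space_primitive:
 assumes "f \<in> H1_space"
 shows "\<exists>F. primitive F (wd f) & (AE x in lborel. f x = F x)" "f \<in> Borel"
  "N2 f < \<infinity>" "N2 (wd f) < \<infinity>" "wd f \<in> Borel"
proof -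
 from assms obtain g where f: "f \<in> L2_space" and g: "g \<in> L2_space" "has_weak_deriv f g" by (auto simp: H1_space_def)
 show b: "f \<in> Borel" "N2 f < \<infinity>" using f by (auto simp: L2_space_iff)
 obtain F where F: "primitive F g" "AE x in lborel. f x = F x" using has_weak_deriv_imp_primitive[OF g(2)] by auto
 note w = weak_deriv_AE_primitive[OF F(1) b(1) F(2)]
 show "\<exists>F. primitive F (wd f) & (AE x in lborel. f x = F x)" using w(3) F(2) by blast
 show "wd f \<in> Borel" by (rule loc_int_borel[OF primitive_loc[OF w(3)]])
 show "N2 (wd f) < \<infinity>" using g(1) N2_cong_AE[OF w(4)] by (simp add: L2_space_iff)
qed

lemma H1_space_I:
 assumes F: "primitive F g" "f \<in> Borel" "AE x in lborel. f x = F x" and fin: "N2 F < \<infinity>" "N2 g < \<infinity>"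
 shows "f \<in> H1_space"
 unfolding H1_space_def
 using weak_deriv_AE_primitive(1)[OF F] fin F(2) N2_cong_AE[OF F(3)] loc_int_borel[OF primitive_loc[OF F(1)]]
 by (auto simp: L2_space_iff intro!: bexI[of _ g])

lemma W1inf_space_I:
 assumes F: "primitive F g" "f \<in> Borel" "AE x in lborel. f x = F x"
  and b: "AE x in lborel. abs (F x) <= a" "AE x in lborel. abs (g x) <= a'" "0 <= a" "0 <= a'"
 shows "f \<in> W1inf_space" "W1inf_norm f <= a + a'"
proof -
 note w = weak_deriv_AE_primitive[OF F]
 have gb: "g \<in> Borel" by (rule loc_int_borel[OF primitive_loc[OF F(1)]])
 have wb: "wd f \<in> Borel" by (rule loc_int_borel[OF primitive_loc[OF w(3)]])
 have fa: "AE x in lborel. abs (f x) <= a" using F(3) b(1) by eventually_elim simp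
 have wa: "AE x in lborel. abs (wd f x) <= a'" using w(4) b(2) by eventually_elim simp
 have "f \<in> Linf_space" "g \<in> Linf_space" using F(2) gb fa b(2) by (auto simp: Linf_space_def)
 then show "f \<in> W1inf_space" using w(1) by (auto simp: W1inf_space_def)
 show "W1inf_norm f <= a + a'" unfolding W1inf_norm_def
  by (intro add_mono Linf_norm_le F(2) wb fa wa b)
qed

lemma W1inf_space_primitive:
 assumes "f \<in> W1inf_space"
 shows "\<exists>F. primitive F (wd f) & (AE x in lborel. f x = F x)" "f \<in> Borel"
  "AE x in lborel. abs (f x) <= Linf_norm f" "AE x in lborel. abs (wd f x) <= Linf_norm (wd f)"
  "0 <= Linf_norm f" "0 <= Linf_norm (wd f)"
proof -
 from assms obtain g where f: "f \<in> Linf_space" and g: "g \<in> Linf_space" "has_weak_deriv f g" by (auto simp: W1inf_space_def)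
 show b: "f \<in> Borel" using f by (auto simp: Linf_space_def)
 obtain F where F: "primitive F g" "AE x in lborel. f x = F x" using has_weak_deriv_imp_primitive[OF g(2)] by auto
 note w = weak_deriv_AE_primitive[OF F(1) b F(2)]
 show "\<exists>F. primitive F (wd f) & (AE x in lborel. f x = F x)" using w(3) F(2) by blast
 have wb: "wd f \<in> Borel" by (rule loc_int_borel[OF primitive_loc[OF w(3)]])
 have "AE x in lborel. abs (wd f x) <= Linf_norm g" using w(4) Linf_norm_AE(1)[OF g(1)] by eventually_elim simp
 then have wl: "wd f \<in> Linf_space" using wb by (auto simp: Linf_space_def)
 show "AE x in lborel. abs (f x) <= Linf_norm f" "0 <= Linf_norm f" using Linf_norm_AE[OF f] by auto
 show "AE x in lborel. abs (wd f x) <= Linf_norm (wd f)" "0 <= Linf_norm (wd f)" using Linf_norm_AE[OF wl] by auto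
qed

section \<open>Derivatives of curves in \<open>L2\<close>\<close>

lemma L2_space_diff_quotient:
 assumes "f \<in> L2_space" "g \<in> L2_space" "v \<in> L2_space"
 shows "(%x. (f x - g x) / h - v x) \<in> L2_space"
proof -
 have [measurable]: "f \<in> Borel" "g \<in> Borel" "v \<in> Borel"
  using assms by (auto simp: L2_space_iff)
 have "N2 (%x. 1 / h * (f x - g x)) = ennreal ((1 / h)^2) * N2 (%x. f x - g x)" by (rule N2_cmult) measurable
 also have "... < \<infinity>" using assms N2_diff_finite[of f g] by (simp add: L2_space_iff ennreal_mult_less_top)
 finally have "N2 (%x. 1 / h * (f x - g x) - v x) < \<infinity>" using assms by (intro N2_diff_finite) (auto simp: L2_space_iff)
 then show ?thesis by (simp add: L2_space_iff)
qed

lemma has_L2_time_deriv_iff: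
 assumes u: "!!s. abs (s - t) < r ==> u s \<in> L2_space" "0 < r"
 shows "has_L2_time_deriv u v t \<longleftrightarrow> v \<in> L2_space & null (at 0) (%h x. (u (t + h) x - u t x) / h - v x)"
proof (cases "v \<in> L2_space")
 case True
 have "\<forall>\<^sub>F h in at 0. (%x. (u (t + h) x - u t x) / h - v x) \<in> L2_space"
  unfolding eventually_at by (rule exI[of _ r]) (use u in \<open>auto intro!: L2_space_diff_quotient True\<close>)
 from L2_norm_tendsto_0_iff[OF this] True show ?thesis by (simp add: has_L2_time_deriv_def)
qed (simp add: has_L2_time_deriv_def)

text \<open>A function that is null along \<open>h \<rightarrow> 0\<close> and does not depend on \<open>h\<close> vanishes almost everywhere.\<close>

lemma has_L2_time_deriv_unique:
 assumes d1: "has_L2_time_deriv u v t" and d2: "has_L2_time_deriv u' v' t"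
  and u: "!!s. abs (s - t) < r ==> u s \<in> L2_space" "!!s. abs (s - t) < r ==> u' s \<in> L2_space" "0 < r"
  and eq: "!!s. abs (s - t) < r ==> AE x in lborel. u s x = u' s x"
 shows "AE x in lborel. v x = v' x"
proof -
 have n1: "v \<in> L2_space & null (at 0) (%h x. (u (t + h) x - u t x) / h - v x)"
  using has_L2_time_deriv_iff[of t r u v] u(1,3) d1 by blast
 have n2: "v' \<in> L2_space & null (at 0) (%h x. (u' (t + h) x - u' t x) / h - v' x)"
  using has_L2_time_deriv_iff[of t r u' v'] u(2,3) d2 by blast
 have [measurable]: "v \<in> Borel" "v' \<in> Borel" using n1 n2 by (auto simp: L2_space_iff)
 have "null (at (0::real)) (%h x. v' x - v x)"
 proof (rule null_sum[OF n1[THEN conjunct2] n2[THEN conjunct2]])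
  show "\<forall>\<^sub>F h in at 0. (%x. (u (t + h) x - u t x) / h - v x) \<in> Borel & (%x. (u' (t + h) x - u' t x) / h - v' x) \<in> Borel &
   (AE x in lborel. abs (v' x - v x) <= abs ((u (t + h) x - u t x) / h - v x) + abs ((u' (t + h) x - u' t x) / h - v' x))"
   unfolding eventually_at
  proof (intro exI[of _ r] conjI[OF u(3)] ballI impI)
   fix h :: real assume "h ~= 0 & dist h 0 < r"
   then have s: "abs ((t + h) - t) < r" "abs (t - t) < r" using u(3) by auto
   have [measurable]: "u (t + h) \<in> Borel" "u t \<in> Borel" "u' (t + h) \<in> Borel" "u' t \<in> Borel"
    using u(1,2)[OF s(1)] u(1,2)[OF s(2)] by (auto simp: L2_space_iff)
   have ae: "AE x in lborel. abs (v' x - v x) <= abs ((u (t + h) x - u t x) / h - v x) + abs ((u' (t + h) x - u' t x) / h - v' x)"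
    using eq[OF s(1)] eq[OF s(2)] by eventually_elim simp
   show "(%x. (u (t + h) x - u t x) / h - v x) \<in> Borel & (%x. (u' (t + h) x - u' t x) / h - v' x) \<in> Borel &
    (AE x in lborel. abs (v' x - v x) <= abs ((u (t + h) x - u t x) / h - v x) + abs ((u' (t + h) x - u' t x) / h - v' x))" by (intro conjI ae; measurable)
  qed
 qed
 from null_const[OF this] have "AE x in lborel. v' x - v x = 0" by (subst N2_zero_iff[symmetric]) auto
 then show ?thesis by eventually_elim simp
qed

lemma time_deriv_has_deriv: "has_L2_time_deriv u v t ==> has_L2_time_deriv u (time_deriv u t) t"
 unfolding time_deriv_def by (rule someI[of "%v. has_L2_time_deriv u v t"])

section \<open>The Eulerian solution\<close>

definition eul :: "(real => real => real) => real => real => real" where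
 "eul U t x = U t (inv (qf U t) x)"

lemma tint_remainder:
 assumes f: "continuous_on {-T..T} f" and t: "t \<in> {-T..T}" "t + h \<in> {-T..T}"
  and L: "!!s. s \<in> {-T..T} ==> abs (f s - f t) <= L * abs (s - t)" "0 <= L"
 shows "abs (tint f (t + h) - tint f t - h * f t) <= L * h^2"
proof -
 have c: "continuous_on {a..b} (%s. f s - f t)" if "-T <= a" "b <= T" for a b
  by (intro continuous_intros continuous_on_subset[OF f]) (use that in auto)
 have i: "integral {a..b} (%s. f s - f t) = integral {a..b} f - (b - a) * f t" if "-T <= a" "a <= b" "b <= T" for a b
  using that by (subst Henstock_Kurzweil_Integration.integral_diff) (auto intro!: continuous_integrable_sub[OF f])
 show ?thesis
 proof (cases "0 <= h")
  case True
  have "norm (integral {t..t + h} (%s. f s - f t)) <= (L * h) * (t + h - t)"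
  proof (rule integral_bound)
   fix s assume s: "s \<in> {t..t + h}"
   have "abs (f s - f t) <= L * abs (s - t)" by (rule L(1)) (use s t in auto)
   also have "... <= L * h" by (rule mult_left_mono[OF _ L(2)]) (use s in auto)
   finally show "norm (f s - f t) <= L * h" by simp
  qed (use True t c in auto)
  then show ?thesis using tint_minus_tint[OF f t] i[of t "t + h"] t True by (simp add: power2_eq_square mult.assoc)
 next
  case False
  have "norm (integral {t + h..t} (%s. f s - f t)) <= (L * (- h)) * (t - (t + h))"
  proof (rule integral_bound)
   fix s assume s: "s \<in> {t + h..t}"
   have "abs (f s - f t) <= L * abs (s - t)" by (rule L(1)) (use s t in auto)
   also have "... <= L * (- h)" by (rule mult_left_mono[OF _ L(2)]) (use s in auto)
   finally show "norm (f s - f t) <= L * (- h)" by simp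
  qed (use False t c in auto)
  moreover have "tint f t - tint f (t + h) = integral {t + h..t} f"
   by (rule tint_minus_tint[OF f t(2,1)]) (use False in simp)
  ultimately show ?thesis using i[of "t + h" t] t False by (simp add: power2_eq_square mult.assoc abs_minus_commute)
 qed
qed

lemma slopes_compose:
 assumes "slopes \<alpha> \<beta> p" "slopes \<alpha>' \<beta>' q" "0 < \<alpha>" "0 < \<alpha>'"
 shows "slopes (\<alpha> * \<alpha>') (\<beta> * \<beta>') (%x. p (q x))"
 unfolding slopes_def
proof (intro allI impI conjI)
 fix a b :: real assume ab: "a <= b"
 have q: "\<alpha>' * (b - a) <= q b - q a" "q b - q a <= \<beta>' * (b - a)" by (rule slopesD[OF assms(2) ab])+
 have "q a <= q b" using slopes_le_iff[OF assms(2,4)] ab by simp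
 note p = slopesD[OF assms(1) this]
 have "\<alpha> * (\<alpha>' * (b - a)) <= \<alpha> * (q b - q a)" by (rule mult_left_mono[OF q(1)]) (use assms in simp)
 then show "\<alpha> * \<alpha>' * (b - a) <= p (q b) - p (q a)" using p(1) by (simp add: mult.assoc)
 have "\<beta> * (q b - q a) <= \<beta> * (\<beta>' * (b - a))" by (rule mult_left_mono[OF q(2)]) (use assms slopes_le[OF assms(1)] in simp)
 then show "p (q b) - p (q a) <= \<beta> * \<beta>' * (b - a)" using p(2) by (simp add: mult.assoc)
qed

lemma weight_mono: "weight M D ==> M <= M' ==> weight M' D"
 unfolding weight_def by (meson order_trans)

lemma wbd_sum_weights:
 assumes E: "weight M E" and F: "weight M' F" and h: "wbd E k h" and g: "wbd F l g"
 shows "wbd (%x. k * E x + l * F x) 1 (%x. h x + g x)"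
 unfolding wbd_def
proof (intro conjI allI impI)
 fix x
 have "abs (h x) <= k * E x" "abs (g x) <= l * F x" using h g by (auto simp: wbd_def)
 then show "abs (h x + g x) <= 1 * (k * E x + l * F x)" unfolding mult_1 by linarith
next
 fix a b :: real assume "a <= b"
 then have "abs (h b - h a) <= k * seg_int E a b" "abs (g b - g a) <= l * seg_int F a b" using h g by (auto simp: wbd_def)
 moreover have "seg_int (%x. k * E x + l * F x) a b = k * seg_int E a b + l * seg_int F a b"
  by (simp only: seg_int_add[OF loc_int_cmult[OF weight_loc[OF E]] loc_int_cmult[OF weight_loc[OF F]]] seg_int_cmult)
 ultimately show "abs ((h b + g b) - (h a + g a)) <= 1 * seg_int (%x. k * E x + l * F x) a b" by linarith
qed

lemma (in lag_params) traj_weight_mono: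
 assumes U: "traj U" and P: "lag_params T \<alpha> \<beta> M' c' \<Lambda> D'" and le: "!!x. D x <= D' x"
 shows "lag_params.traj T \<alpha> \<beta> \<Lambda> D' U"
proof -
 have D': "weight M' D'" using P by (simp add: lag_params_def)
 have le': "D x <= 1 * D' x" for x using le by simp
 show ?thesis
  unfolding lag_params.traj_def[OF P]
 proof (intro conjI ballI)
  fix t assume t: "t \<in> {-T..T}"
  show "wbd D' 1 (U t)" using wbd_weight_mono[OF D D' le' trajD(1)[OF U t]] by simp
  show "slopes \<alpha> \<beta> (qf U t)" by (rule trajD(2)[OF U t])
 next
  fix s t assume st: "s \<in> {-T..T}" "t \<in> {-T..T}"
  show "wbd D' (\<Lambda> * abs (t - s)) (%x. U t x - U s x)"
   using wbd_weight_mono[OF D D' le' trajD(3)[OF U st(2,1)]] \<Lambda> by simp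
 qed
qed

locale lag_sol = lag_params +
 fixes U :: "real => real => real" and u0 :: "real => real"
 assumes U: "traj U" and sol: "!!t x. t \<in> {-T..T} ==> U t x = Phi kap u0 U t x" and finD: "N2 D < \<infinity>"
begin

lemma state: "t \<in> {-T..T} ==> lag_state \<alpha> \<beta> M D (qf U t) (U t)"
 by unfold_locales (auto intro: trajD[OF U] \<alpha> D)

lemma eul_eq: "t \<in> {-T..T} ==> lag_state.u (qf U t) (U t) = eul U t"
 by (rule ext) (simp add: lag_state.u_def[OF state] eul_def)

definition Kb :: real where "Kb = M + M / \<alpha>"

lemma Kb_nonneg: "0 <= Kb" unfolding Kb_def using M_nonneg \<alpha> by simp

lemma eul_bLip: assumes t: "t \<in> {-T..T}" shows "bLip Kb (eul U t)"
 unfolding bLip_def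
proof (intro conjI allI)
 interpret s: lag_state \<alpha> \<beta> M D "qf U t" "U t" by (rule state[OF t])
 have m: "0 <= M / \<alpha>" using M_nonneg \<alpha> by simp
 show "abs (eul U t x) <= Kb" for x using s.u_bound(2)[of x] m unfolding eul_eq[OF t] Kb_def by linarith
 fix a b
 have "M / \<alpha> * abs (b - a) <= Kb * abs (b - a)" by (rule mult_right_mono) (use M_nonneg in \<open>auto simp: Kb_def\<close>)
 then show "abs (eul U t b - eul U t a) <= Kb * abs (b - a)" using s.u_Lipschitz[of b a] unfolding eul_eq[OF t] by linarith
qed

lemma eul_N2:
 assumes t: "t \<in> {-T..T}"
 shows "N2 (eul U t) <= ennreal \<beta> * N2 D" "N2 (wd (eul U t)) <= ennreal (\<beta> / \<alpha>^2) * N2 D"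
  "N2 (eul U t) < \<infinity>" "N2 (wd (eul U t)) < \<infinity>"
proof -
 interpret s: lag_state \<alpha> \<beta> M D "qf U t" "U t" by (rule state[OF t])
 show 1: "N2 (eul U t) <= ennreal \<beta> * N2 D" "N2 (wd (eul U t)) <= ennreal (\<beta> / \<alpha>^2) * N2 D"
  using s.N2_u unfolding eul_eq[OF t] by auto
 show "N2 (eul U t) < \<infinity>" "N2 (wd (eul U t)) < \<infinity>"
  using finD by (auto intro!: le_less_trans[OF 1(1)] le_less_trans[OF 1(2)] simp: ennreal_mult_less_top)
qed

lemma Qt_eul:
 assumes t: "t \<in> {-T..T}"
 shows "Qt kap U t \<xi> = d_Helmholtz (euler_src kap (eul U t)) (qf U t \<xi>)"
proof -
 interpret s: lag_state \<alpha> \<beta> M D "qf U t" "U t" by (rule state[OF t])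
 show ?thesis unfolding Qt_def
  using lag_PQ_euler(2)[OF s.q \<alpha> s.u_Lipschitz s.U_eq] unfolding eul_eq[OF t] by simp
qed

definition stab_L :: real where "stab_L = 1 + (M + M)"
definition stab_const :: real where "stab_const = 2 * exp (lag_params.lam kap \<alpha> \<beta> (M + M) stab_L c * T)"

lemma stab_L: "1 <= stab_L" using M_nonneg by (simp add: stab_L_def)
lemma stab_const: "0 <= stab_const" by (simp add: stab_const_def)

text \<open>The summand \<open>d (D + D')\<close> has two purposes: it makes the weight of the difference dominate \<open>d D\<close>, as the
  difference of the Jacobians requires, and it provides the a priori bound that stability asks for.\<close>

lemma difference_weight:
 assumes V: "lag_sol kap T \<alpha> \<beta> M c \<Lambda> D' V v0" and d: "0 < d" and E0: "weight d E0" "!!x. kconv (\<alpha> / 2) E0 x <= c * E0 x"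
  and init: "wbd E0 1 (%x. u0 x - v0 x)"
 shows "weight (stab_L * d) (%x. E0 x + d * (D x + D' x))"
  and "t \<in> {-T..T} ==> wbd (%x. E0 x + d * (D x + D' x)) stab_const (%x. U t x - V t x)"
proof -
 let ?E = "%x. E0 x + d * (D x + D' x)"
 have VP: "lag_params T \<alpha> \<beta> M c \<Lambda> D'" using V by (simp add: lag_sol_def)
 have D': "weight M D'" and c': "!!x. kconv (\<alpha> / 2) D' x <= c * D' x" using VP by (auto simp: lag_params_def)
 have trV: "lag_params.traj T \<alpha> \<beta> \<Lambda> D' V" and solV: "!!t x. t \<in> {-T..T} ==> V t x = Phi kap v0 V t x"
  using V by (auto simp: lag_sol_def lag_sol_axioms_def)
 note DD = weight_add[OF D D']
 have a2: "0 < \<alpha> / 2" using \<alpha> by simp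
 have k: "kconv (\<alpha> / 2) (%x. D x + D' x) x <= c * (D x + D' x)" for x
  unfolding kconv_add[OF a2 D D'] using c(1)[of x] c'[of x] by (simp add: distrib_left)
 have P: "lag_params T \<alpha> \<beta> (M + M) c \<Lambda> (%x. D x + D' x)"
  by unfold_locales (use T \<alpha> \<beta> DD \<Lambda> k c in auto)
 have nn: "0 <= D x" "0 <= D' x" "0 <= E0 x" for x using weightD(2)[OF D] weightD(2)[OF D'] weightD(2)[OF E0(1)] by auto
 note trU = traj_weight_mono[OF U P] and trV' = lag_params.traj_weight_mono[OF VP trV P]
 have E: "weight (d + d * (M + M)) ?E" by (intro weight_add E0 weight_cmult DD) (use d in simp)
 have Ld: "stab_L * d = d + d * (M + M)" by (simp add: stab_L_def algebra_simps)
 show E': "weight (stab_L * d) ?E" unfolding Ld by (rule E)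
 have kE: "kconv (\<alpha> / 2) ?E x <= c * ?E x" for x
 proof -
  have "kconv (\<alpha> / 2) ?E x = kconv (\<alpha> / 2) E0 x + d * kconv (\<alpha> / 2) (%x. D x + D' x) x"
   unfolding kconv_add[OF a2 E0(1) weight_cmult[OF DD order_less_imp_le[OF d]]] kconv_cmult ..
  also have "... <= c * E0 x + d * (c * (D x + D' x))" by (intro add_mono E0 mult_left_mono k) (use d in simp)
  finally show ?thesis by (simp add: algebra_simps)
 qed
 assume t: "t \<in> {-T..T}"
 have E0E: "E0 x <= 1 * ?E x" for x using nn[of x] d by simp
 have i: "wbd ?E 1 (%x. u0 x - v0 x)" using wbd_weight_mono[OF E0(1) E E0E init] by simp
 have ap: "wbd ?E (2 * (1 / d)) (%x. U s x - V s x)" if s: "s \<in> {-T..T}" for s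
 proof (rule wbd_weight_mono[OF DD E])
  show "D x + D' x <= 1 / d * ?E x" for x using nn[of x] d by (simp add: field_simps)
  have "wbd (%x. D x + D' x) (1 + 1) (%x. U s x - V s x)"
   by (rule wbd_diff[OF lag_params.trajD(1)[OF P trU s] lag_params.trajD(1)[OF P trV' s]]) (use nn in auto)
  then show "wbd (%x. D x + D' x) 2 (%x. U s x - V s x)" by simp
 qed simp
 have L1: "d * (D x + D' x) <= stab_L * ?E x" for x
 proof -
  have "?E x <= stab_L * ?E x" using mult_right_mono[OF stab_L, of "?E x"] nn[of x] d by simp
  then show ?thesis by (rule order_trans[rotated]) (use nn(3)[of x] in simp)
 qed
 have "wbd ?E (2 * 1 * exp (lag_params.lam kap \<alpha> \<beta> (M + M) stab_L c * abs t)) (%x. U t x - V t x)"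
  by (rule lag_params.stability[OF P _ _ E' _ _ _ L1 kE _ sol solV i _ ap _ t])
   (use trU trV' nn stab_L d c t in auto)
 then show "wbd ?E stab_const (%x. U t x - V t x)"
 proof (rule wbd_mono[OF E])
  have "lag_params.lam kap \<alpha> \<beta> (M + M) stab_L c * abs t <= lag_params.lam kap \<alpha> \<beta> (M + M) stab_L c * T"
   by (rule mult_left_mono) (use t lag_params.lam(1)[OF P, of kap stab_L c] in auto)
  then show "2 * 1 * exp (lag_params.lam kap \<alpha> \<beta> (M + M) stab_L c * abs t) <= stab_const" by (simp add: stab_const_def)
 qed
qed

lemma tint_sup_le:
 assumes "continuous_on {-T..T} f" "!!s. s \<in> {-T..T} ==> abs (f s) <= b" "t \<in> {-T..T}"
 shows "abs (tint f t) <= b * T"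
proof -
 have "abs (tint f t - tint f 0) <= b * abs (t - 0)" by (rule tint_Lipschitz[OF assms(1,2)]) (use assms(3) T in auto)
 moreover have "0 <= b" using assms(2)[of 0] T by (simp add: order_trans[OF abs_ge_zero])
 then have "b * abs (t - 0) <= b * T" by (intro mult_left_mono) (use assms(3) in auto)
 ultimately show ?thesis by simp
qed

definition close_data :: "real => real => (real => real => real) => bool" where
 "close_data S d V \<longleftrightarrow> 0 < d & (\<exists>D' v0 E0. lag_sol kap T \<alpha> \<beta> M c \<Lambda> D' V v0 & N2 D' <= ennreal S &
  weight d E0 & N2 E0 <= ennreal (S * d^2) & (\<forall>x. kconv (\<alpha> / 2) E0 x <= c * E0 x) & wbd E0 1 (%x. u0 x - v0 x))"

lemma close_data_self:
 assumes "0 < d" "enn2real (N2 D) <= S"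
 shows "close_data S d U"
proof -
 have "N2 D <= ennreal S" using finD assms(2) by (metis ennreal_enn2real ennreal_leI infinity_ennreal_def)
 then show ?thesis unfolding close_data_def
  using assms(1) lag_sol_axioms
  by (intro conjI exI[of _ D] exI[of _ u0] exI[of _ "%_. 0"]) (auto simp: weight_def N2_def kconv_def wbd_def set_lebesgue_integral_def)
qed

definition dist_bound :: "real => real => real => real" where
 "dist_bound S d \<tau> = 2 * (stab_const^2 * (2 * S + 2 * (2 * enn2real (N2 D) + 2 * S))) * d^2
  + 2 * (\<Lambda>^2 * enn2real (N2 D)) * \<tau>^2 + (stab_const * stab_L * T * d + M * \<tau>)"

text \<open>The difference in time and the difference of the solutions add up; both are measured by weights whose
  \<open>L2\<close> norms are controlled.\<close>

lemma state_distance: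
 assumes s: "s \<in> {-T..T}" and t: "t \<in> {-T..T}" and cd: "close_data S d V" and S: "0 <= S"
 shows "slopes \<alpha> \<beta> (qf V t) & (\<forall>x. abs (qf V t x - qf U s x) <= dist_bound S d (abs (t - s))) &
  (\<forall>a b. abs ((qf V t b - qf U s b) - (qf V t a - qf U s a)) <= dist_bound S d (abs (t - s)) * abs (b - a)) &
  (\<exists>E M'. weight M' E & wbd E 1 (%x. V t x - U s x) & N2 E <= ennreal (dist_bound S d (abs (t - s))))"
proof -
 define ND where "ND = enn2real (N2 D)"
 have ND: "N2 D = ennreal ND" "0 <= ND" using finD by (auto simp: ND_def)
 define k where "k = stab_const"
 have k: "0 <= k" by (simp add: k_def stab_const)
 define \<tau> where "\<tau> = abs (t - s)"
 define r where "r = dist_bound S d \<tau>"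
 from cd obtain D' v0 E0 where d: "0 < d" and V: "lag_sol kap T \<alpha> \<beta> M c \<Lambda> D' V v0" and D'N: "N2 D' <= ennreal S"
  and E0: "weight d E0" "N2 E0 <= ennreal (S * d^2)" "!!x. kconv (\<alpha> / 2) E0 x <= c * E0 x" "wbd E0 1 (%x. u0 x - v0 x)"
  unfolding close_data_def by blast
 have nn: "0 <= k * stab_L * T * d + M * \<tau>" "0 <= 2 * (k^2 * (2 * S + 2 * (2 * ND + 2 * S))) * d^2 + 2 * (\<Lambda>^2 * ND) * \<tau>^2"
  using k stab_L T d M_nonneg S ND by (auto simp: \<tau>_def)
 have r: "k * stab_L * T * d + M * \<tau> <= r" "2 * (k^2 * (2 * S + 2 * (2 * ND + 2 * S))) * d^2 + 2 * (\<Lambda>^2 * ND) * \<tau>^2 <= r"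
  using nn unfolding r_def dist_bound_def ND_def k_def by linarith+
 have VP: "lag_params T \<alpha> \<beta> M c \<Lambda> D'" using V by (simp add: lag_sol_def)
 have D': "weight M D'" using VP by (auto simp: lag_params_def)
 have trV: "lag_params.traj T \<alpha> \<beta> \<Lambda> D' V" using V by (auto simp: lag_sol_def lag_sol_axioms_def)
 let ?E = "%x. E0 x + d * (D x + D' x)"
 note dw = difference_weight[OF V d E0(1,3,4), folded k_def]
 note E = dw(1)
 have UV: "wbd ?E k (%x. - (U r x - V r x))" if "r \<in> {-T..T}" for r by (rule wbd_minus[OF dw(2)[OF that]])
 let ?F = "%x. k * ?E x + \<Lambda> * \<tau> * D x"
 have F: "weight (k * (stab_L * d) + \<Lambda> * \<tau> * M) ?F"
  by (intro weight_add weight_cmult E D) (use k \<Lambda> in \<open>auto simp: \<tau>_def\<close>)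
 have wF: "wbd ?F 1 (%x. V t x - U s x)"
  using wbd_sum_weights[OF E D UV[OF t] trajD(3)[OF U t s, folded \<tau>_def]] by simp
 have Db[measurable]: "D \<in> Borel" "D' \<in> Borel" "E0 \<in> Borel"
  using weightD(1)[OF D] weightD(1)[OF D'] weightD(1)[OF E0(1)] .
 have NE: "N2 ?E <= ennreal (2 * (S * d^2) + 2 * (d^2 * (2 * ND + 2 * S)))"
 proof (rule N2_add_le[OF _ _ E0(2)])
  have "N2 (%x. D x + D' x) <= ennreal (2 * ND + 2 * S)"
   by (rule N2_add_le[OF Db(1,2) _ D'N]) (use ND S in auto)
  from mult_left_mono[OF this, of "ennreal (d^2)"]
  show "N2 (%x. d * (D x + D' x)) <= ennreal (d^2 * (2 * ND + 2 * S))"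
   using ND(2) S by (subst N2_cmult) (auto simp: ennreal_mult)
 qed (use S ND in auto)
 have "N2 ?F <= ennreal (2 * (k^2 * (2 * (S * d^2) + 2 * (d^2 * (2 * ND + 2 * S)))) + 2 * ((\<Lambda> * \<tau>)^2 * ND))"
 proof (rule N2_add_le)
  show "N2 (%x. k * ?E x) <= ennreal (k^2 * (2 * (S * d^2) + 2 * (d^2 * (2 * ND + 2 * S))))"
   using mult_left_mono[OF NE, of "ennreal (k^2)"] ND(2) S by (subst N2_cmult) (auto simp: ennreal_mult)
  show "N2 (%x. \<Lambda> * \<tau> * D x) <= ennreal ((\<Lambda> * \<tau>)^2 * ND)"
   using ND by (subst N2_cmult) (auto simp: ennreal_mult)
 qed (use S ND in auto)
 also have "2 * (k^2 * (2 * (S * d^2) + 2 * (d^2 * (2 * ND + 2 * S)))) + 2 * ((\<Lambda> * \<tau>)^2 * ND)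
  = 2 * (k^2 * (2 * S + 2 * (2 * ND + 2 * S))) * d^2 + 2 * (\<Lambda>^2 * ND) * \<tau>^2"
  by (simp add: power_mult_distrib algebra_simps)
 also have "ennreal ... <= ennreal r" by (rule ennreal_leI[OF r(2)])
 finally have NF: "N2 ?F <= ennreal r" .
 have cU: "continuous_on {-T..T} (%r. U r x)" "continuous_on {-T..T} (%r. V r x)" for x
  using traj_continuous[OF U] lag_params.traj_continuous[OF VP trV] by auto
 have qVU: "qf V t x - qf U t x = tint (%r. V r x - U r x) t" for x
  unfolding qf_def tint_diff[OF cU(2) cU(1) t] by simp
 have L: "abs (V r x - U r x) <= k * (stab_L * d)" "abs ((V r b - U r b) - (V r a - U r a)) <= k * (stab_L * d) * abs (b - a)"
  if r: "r \<in> {-T..T}" for r x a b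
  using wbd_abs_le[OF E UV[OF r] k, of x] wbd_Lipschitz[OF E UV[OF r] k, of b a] by simp_all
 have q1: "abs (qf V t x - qf U s x) <= r" for x
 proof -
  have "abs (qf V t x - qf U t x) <= k * (stab_L * d) * T" unfolding qVU
   by (rule tint_sup_le[OF continuous_on_diff[OF cU(2) cU(1)] L(1) t])
  moreover have "k * (stab_L * d) * T = k * stab_L * T * d" by simp
  ultimately show ?thesis using qf_time(1)[OF U s t, of x, folded \<tau>_def] r(1) by linarith
 qed
 have q2: "abs ((qf V t b - qf U s b) - (qf V t a - qf U s a)) <= r * abs (b - a)" for a b
 proof -
  have "(qf V t b - qf U t b) - (qf V t a - qf U t a) = tint (%r. (V r b - U r b) - (V r a - U r a)) t"
   unfolding qVU by (rule tint_diff[symmetric, OF continuous_on_diff[OF cU(2) cU(1)] continuous_on_diff[OF cU(2) cU(1)] t])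
  moreover have "abs (tint (%r. (V r b - U r b) - (V r a - U r a)) t) <= k * (stab_L * d) * abs (b - a) * T"
   by (rule tint_sup_le[OF _ L(2) t]) (intro continuous_on_diff cU)
  moreover have "k * (stab_L * d) * abs (b - a) * T = k * stab_L * T * d * abs (b - a)" by simp
  moreover note qf_time(2)[OF U s t, of b a, folded \<tau>_def]
  moreover have "k * stab_L * T * d * abs (b - a) + M * \<tau> * abs (b - a) <= r * abs (b - a)"
   using mult_right_mono[OF r(1), of "abs (b - a)"] by (simp add: distrib_right)
  ultimately show ?thesis by linarith
 qed
 show ?thesis
  unfolding \<tau>_def[symmetric] r_def[symmetric]
  using lag_params.trajD(2)[OF VP trV t] q1 q2 F wF NF by blast
qed

lemma eul_tendsto:
 assumes s: "s \<in> {-T..T}" and S: "0 <= S" and t: "(t \<longlongrightarrow> s) F" and d: "(d \<longlongrightarrow> 0) F"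
  and ev: "\<forall>\<^sub>F i in F. t i \<in> {-T..T} & close_data S (d i) (V i)"
 shows "null F (%i x. eul (V i) (t i) x - eul U s x)" "null F (%i x. wd (eul (V i) (t i)) x - wd (eul U s) x)"
proof -
 have "((%i. dist_bound S (d i) (abs (t i - s))) \<longlongrightarrow> dist_bound S 0 (abs (s - s))) F"
  unfolding dist_bound_def by (intro tendsto_intros t d)
 then have "((%i. dist_bound S (d i) (abs (t i - s))) \<longlongrightarrow> 0) F" by (simp add: dist_bound_def)
 note C = lag_state.close_states[OF state[OF s] finD this, where ?q2.0 = "%i. qf (V i) (t i)" and ?U2.0 = "%i. V i (t i)"]
 have ev': "\<forall>\<^sub>F i in F. slopes \<alpha> \<beta> (qf (V i) (t i)) & (\<forall>x. abs (qf (V i) (t i) x - qf U s x) <= dist_bound S (d i) (abs (t i - s))) &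
  (\<forall>a b. abs ((qf (V i) (t i) b - qf U s b) - (qf (V i) (t i) a - qf U s a)) <= dist_bound S (d i) (abs (t i - s)) * abs (b - a)) &
  (\<exists>E M'. weight M' E & wbd E 1 (%x. V i (t i) x - U s x) & N2 E <= ennreal (dist_bound S (d i) (abs (t i - s))))"
  using ev by eventually_elim (intro state_distance s S; blast)
 show "null F (%i x. eul (V i) (t i) x - eul U s x)" "null F (%i x. wd (eul (V i) (t i)) x - wd (eul U s) x)"
  using C[OF ev', unfolded lag_state.u_def[OF state[OF s], abs_def]] unfolding eul_def[abs_def] .
qed

lemma eul_time_continuous:
 assumes s: "s \<in> {-T..T}"
 shows "null (at s within {-T..T}) (%t x. eul U t x - eul U s x)" "null (at s within {-T..T}) (%t x. wd (eul U t) x - wd (eul U s) x)"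
proof -
 have "((%t. abs (t - s)) \<longlongrightarrow> (abs (s - s))) (at s within {-T..T})" by (intro tendsto_intros)
 then have d: "((%t. abs (t - s)) \<longlongrightarrow> 0) (at s within {-T..T})" by simp
 have ev: "\<forall>\<^sub>F t in at s within {-T..T}. t \<in> {-T..T} & close_data (enn2real (N2 D)) (abs (t - s)) U"
  unfolding eventually_at_filter by (intro always_eventually) (auto intro: close_data_self)
 show "null (at s within {-T..T}) (%t x. eul U t x - eul U s x)" "null (at s within {-T..T}) (%t x. wd (eul U t) x - wd (eul U s) x)"
  by (rule eul_tendsto[OF s _ tendsto_ident_at d ev]; simp)+
qed

end

text \<open>A difference quotient deviates from the derivative by at most an average of translation differences. In
  contrast to a maximal function, this average is elementary to estimate in \<open>L2\<close>.\<close>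

lemma primitive_average_bound:
 assumes u: "primitive u w" and b: "AE x in lborel. abs (w x) <= K" and r: "abs (x - y) <= r"
 shows "abs (u x - u y - (x - y) * w x) <= seg_int (%s. abs (w (x + s) - w x)) (- r) r"
  and "loc_int (%s. abs (w (x + s) - w x))"
proof -
 have wl: "loc_int w" by (rule primitive_loc[OF u])
 have [measurable]: "w \<in> Borel" by (rule loc_int_borel[OF wl])
 have "AE s in lborel. abs (w (s + x)) <= K" by (rule AE_compose_slopes[OF slopes_ident _ b]) simp
 then have "AE s in lborel. abs (w (x + s) - w x) <= K + abs (w x)"
  by eventually_elim (simp add: add.commute)
 then have "loc_int (%s. w (x + s) - w x)" by (intro loc_int_bounded) auto
 then show loc: "loc_int (%s. abs (w (x + s) - w x))" by (rule loc_int_abs)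
 have gen: "seg_int (%z. abs (w z - w x)) a b <= seg_int (%s. abs (w (x + s) - w x)) (- r) r" if "x - r <= a" "b <= x + r" for a b
 proof -
  have "seg_int (%z. abs (w z - w x)) a b = (LINT s|lborel. indicator {a..b} (x + s) *\<^sub>R (abs (w (x + s) - w x)))"
   unfolding set_lebesgue_integral_def
   using lborel_integral_real_affine[of 1 "%z. indicator {a..b} z *\<^sub>R (abs (w z - w x))" x] by simp
  also have "... <= (LINT s|lborel. indicator {- r..r} s *\<^sub>R (abs (w (x + s) - w x)))"
  proof (rule integral_mono')
   show "integrable lborel (%s. indicator {- r..r} s *\<^sub>R (abs (w (x + s) - w x)))"
    using loc_int_seg[OF loc] by (simp add: set_integrable_def)
   show "indicator {a..b} (x + s) *\<^sub>R (abs (w (x + s) - w x)) <= indicator {- r..r} s *\<^sub>R (abs (w (x + s) - w x))" for s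
    using that by (auto simp: indicator_def)
  qed (auto simp: indicator_def)
  finally show ?thesis unfolding set_lebesgue_integral_def .
 qed
 have l2: "loc_int (%z. w z - w x)" by (intro loc_int_diff wl loc_int_const)
 have *: "abs (seg_int w a b - (b - a) * w x) <= seg_int (%z. abs (w z - w x)) a b" if "a <= b" for a b
 proof -
  have "seg_int w a b - (b - a) * w x = seg_int (%z. w z - w x) a b"
   by (simp add: seg_int_diff[OF wl loc_int_const] seg_int_const[OF that] mult.commute)
  then show ?thesis using seg_int_abs_le[OF l2 loc_int_abs[OF l2], of a b] by simp
 qed
 show "abs (u x - u y - (x - y) * w x) <= seg_int (%s. abs (w (x + s) - w x)) (- r) r"
 proof (cases "y <= x")
  case True
  have "abs (u x - u y - (x - y) * w x) <= seg_int (%z. abs (w z - w x)) y x"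
   using *[OF True] by (simp add: primitiveD[OF u True])
  also have "... <= seg_int (%s. abs (w (x + s) - w x)) (- r) r" by (rule gen) (use r True in auto)
  finally show ?thesis .
 next
  case False
  then have xy: "x <= y" by simp
  have e: "u x - u y - (x - y) * w x = - (seg_int w x y - (y - x) * w x)"
   using primitiveD[OF u xy] by (simp add: algebra_simps)
  have "abs (u x - u y - (x - y) * w x) <= seg_int (%z. abs (w z - w x)) x y"
   unfolding e abs_minus_cancel by (rule *[OF xy])
  also have "... <= seg_int (%s. abs (w (x + s) - w x)) (- r) r" by (rule gen) (use r xy in auto)
  finally show ?thesis .
 qed
qed

lemma N2_average:
 assumes w[measurable]: "w \<in> Borel" and loc: "!!x. loc_int (%s. abs (w (x + s) - w x))"
 shows "N2 (%x. seg_int (%s. abs (w (x + s) - w x)) (- r) r) = (\<integral>\<^sup>+x. (\<integral>\<^sup>+s. indicator {-r..r} s * ennreal (abs (w (x + s) - w x)) \<partial>lborel)^2 \<partial>lborel)"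
 unfolding N2_def
proof (rule nn_integral_cong)
 fix x
 have nn: "0 <= seg_int (%s. abs (w (x + s) - w x)) (- r) r"
  unfolding set_lebesgue_integral_def by (rule Bochner_Integration.integral_nonneg) simp
 have "ennreal (seg_int (%s. abs (w (x + s) - w x)) (- r) r) = (\<integral>\<^sup>+s. ennreal (indicator {-r..r} s *\<^sub>R (abs (w (x + s) - w x))) \<partial>lborel)"
  unfolding set_lebesgue_integral_def
  by (rule nn_integral_eq_integral[symmetric])
   (use loc_int_seg[OF loc] in \<open>auto simp: set_integrable_def\<close>)
 also have "... = (\<integral>\<^sup>+s. indicator {-r..r} s * ennreal (abs (w (x + s) - w x)) \<partial>lborel)"
  by (intro nn_integral_cong) (auto simp: indicator_def)
 finally show "ennreal ((seg_int (%s. abs (w (x + s) - w x)) (- r) r)^2) = (\<integral>\<^sup>+s. indicator {-r..r} s * ennreal (abs (w (x + s) - w x)) \<partial>lborel)^2"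
  using nn by (simp add: ennreal_power[symmetric])
qed

context lag_sol
begin

definition C1q :: real where "C1q = dlag_const kap \<alpha> \<beta> M M c * \<Lambda>"

lemma C1q_nonneg: "0 <= C1q"
 unfolding C1q_def using dlag_const_nonneg[OF M_nonneg \<alpha> \<beta> M_nonneg c(2)] \<Lambda> by simp

text \<open>Let \<open>\<xi> = inv (qf U (t + h)) x\<close> and \<open>y = qf U t \<xi>\<close>. Then \<open>u(t + h, x) - u(t, x)\<close> is
  \<open>U (t + h) \<xi> - U t \<xi>\<close>, which the equation determines, plus \<open>u(t, y) - u(t, x)\<close> with \<open>y - x \<approx> - h u\<close>. The error
  terms are the four summands on the right.\<close>

lemma eul_increment:
 assumes t: "t \<in> {-T..T}" "t + h \<in> {-T..T}" and h: "h ~= 0"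
 shows "abs ((eul U (t + h) x - eul U t x) / h - vel kap (eul U t) x)
  <= (abs (d_Helmholtz (euler_src kap (eul U t)) (x + 0) - d_Helmholtz (euler_src kap (eul U t)) (qf U t (inv (qf U (t + h)) x)))
   + C1q * abs h * D (inv (qf U (t + h)) x))
  + ((M / \<alpha> * M + \<Lambda> * M) * abs h * abs (wd (eul U t) x)
   + seg_int (%s. abs (wd (eul U t) (x + s) - wd (eul U t) x)) (- ((M + 1) * abs h)) ((M + 1) * abs h) / abs h)"
proof -
 interpret s: lag_state \<alpha> \<beta> M D "qf U t" "U t" by (rule state[OF t(1)])
 define u where "u = eul U t"
 have su: "s.u = u" by (simp add: eul_eq[OF t(1)] u_def)
 define \<xi> where "\<xi> = inv (qf U (t + h)) x"
 define y where "y = qf U t \<xi>"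
 define Q where "Q = d_Helmholtz (euler_src kap u)"
 define w where "w = wd u"
 have x: "x = qf U (t + h) \<xi>" unfolding \<xi>_def by (rule slopes_inv(1)[symmetric, OF trajD(2)[OF U t(2)] \<alpha>])
 have uy: "u y = U t \<xi>" unfolding su[symmetric] y_def s.u_def by (simp add: s.qi(2))
 have ux: "eul U (t + h) x = U (t + h) \<xi>" by (simp add: eul_def \<xi>_def)
 have Qy: "Q y = Qt kap U t \<xi>" unfolding Q_def u_def y_def by (rule Qt_eul[OF t(1), symmetric])
 have D0: "0 <= D \<xi>" "D \<xi> <= M" using weightD[OF D] by auto
 have xy: "abs (x - y) <= M * abs h" unfolding x y_def using qf_time(1)[OF U t, of \<xi>] by simp
 have B: "abs ((U (t + h) \<xi> - U t \<xi> + h * Q y) / h) <= C1q * abs h * D \<xi>"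
 proof -
  have "abs (tint (%s. Qt kap U s \<xi>) (t + h) - tint (%s. Qt kap U s \<xi>) t - h * Qt kap U t \<xi>) <= (C1q * D \<xi>) * h^2"
  proof (rule tint_remainder[OF Qt_continuous[OF U] t])
   fix r assume r: "r \<in> {-T..T}"
   show "abs (Qt kap U r \<xi> - Qt kap U t \<xi>) <= C1q * D \<xi> * abs (r - t)"
    using Qt_time[OF U t(1) r] by (simp add: wbd_def C1q_def mult_ac)
  qed (use C1q_nonneg D0 in simp)
  moreover have "U (t + h) \<xi> - U t \<xi> + h * Q y = - (tint (%s. Qt kap U s \<xi>) (t + h) - tint (%s. Qt kap U s \<xi>) t - h * Qt kap U t \<xi>)"
   unfolding sol[OF t(1)] sol[OF t(2)] Qy by (simp add: Phi_def)
  ultimately have "abs (U (t + h) \<xi> - U t \<xi> + h * Q y) <= (C1q * D \<xi>) * h^2" by (simp only: abs_minus_cancel)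
  then have "abs (U (t + h) \<xi> - U t \<xi> + h * Q y) / abs h <= ((C1q * D \<xi>) * h^2) / abs h" by (rule divide_right_mono) simp
  also have "... = C1q * abs h * D \<xi>" using h by (simp add: power2_eq_square abs_mult_self_eq[symmetric, of h] del: abs_mult_self_eq)
  finally show ?thesis by (simp add: abs_divide)
 qed
 have C: "abs (w x * (u x - (x - y) / h)) <= (M / \<alpha> * M + \<Lambda> * M) * abs h * abs (w x)"
 proof -
  have "abs (tint (%s. U s \<xi>) (t + h) - tint (%s. U s \<xi>) t - h * U t \<xi>) <= (\<Lambda> * M) * h^2"
  proof (rule tint_remainder[OF traj_continuous[OF U] t])
   fix r assume r: "r \<in> {-T..T}"
   have "abs (U r \<xi> - U t \<xi>) <= (\<Lambda> * abs (r - t)) * D \<xi>" using trajD(3)[OF U r t(1)] by (simp add: wbd_def)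
   also have "... <= (\<Lambda> * abs (r - t)) * M" by (rule mult_left_mono[OF D0(2)]) (use \<Lambda> in simp)
   finally show "abs (U r \<xi> - U t \<xi>) <= \<Lambda> * M * abs (r - t)" by (simp add: mult_ac)
  qed (use \<Lambda> M_nonneg in simp)
  moreover have "x - y = tint (%s. U s \<xi>) (t + h) - tint (%s. U s \<xi>) t" by (simp add: x y_def qf_def)
  ultimately have "abs ((x - y) - h * u y) <= (\<Lambda> * M) * h^2" by (simp add: uy)
  then have "abs ((x - y) - h * u y) / abs h <= ((\<Lambda> * M) * h^2) / abs h" by (rule divide_right_mono) simp
  also have "... = \<Lambda> * M * abs h" using h by (simp add: power2_eq_square abs_mult_self_eq[symmetric, of h] del: abs_mult_self_eq)
  also have "abs ((x - y) - h * u y) / abs h = abs (u y - (x - y) / h)"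
   using h by (simp add: abs_divide[symmetric] diff_divide_distrib abs_minus_commute)
  finally have 1: "abs (u y - (x - y) / h) <= \<Lambda> * M * abs h" .
  have "abs (u x - u y) <= M / \<alpha> * abs (x - y)" unfolding su[symmetric] by (rule s.u_Lipschitz)
  also have "... <= M / \<alpha> * (M * abs h)" by (rule mult_left_mono[OF xy]) (use M_nonneg \<alpha> in simp)
  finally have "abs (u x - (x - y) / h) <= (M / \<alpha> * M + \<Lambda> * M) * abs h" using 1 by (simp add: distrib_right)
  from abs_mult_le[OF order_refl this, of "w x"] show ?thesis by (simp only: mult.commute)
 qed
 have Dd: "abs ((u x - u y - (x - y) * w x) / h) <= seg_int (%s. abs (w (x + s) - w x)) (- ((M + 1) * abs h)) ((M + 1) * abs h) / abs h"
  unfolding abs_divide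
 proof (rule divide_right_mono[OF primitive_average_bound(1)])
  show "primitive u w" "AE x in lborel. abs (w x) <= M / \<alpha>" unfolding w_def su[symmetric] by (rule s.u_deriv)+
  have "M * abs h <= (M + 1) * abs h" by (rule mult_right_mono) auto
  then show "abs (x - y) <= (M + 1) * abs h" using xy by linarith
 qed simp
 have "(eul U (t + h) x - u x) / h - vel kap u x
   = (Q x - Q y) + (U (t + h) \<xi> - U t \<xi> + h * Q y) / h + w x * (u x - (x - y) / h) - (u x - u y - (x - y) * w x) / h"
  using h unfolding vel_def Q_def[symmetric] w_def[symmetric] ux uy by (simp add: field_simps)
 note eq = this
 have tri: "abs (a + b + c' - d) <= (abs a + abs b) + (abs c' + abs d)" for a b c' d :: real by linarith
 have "abs ((eul U (t + h) x - u x) / h - vel kap u x) <= (abs (Q x - Q y) + abs ((U (t + h) \<xi> - U t \<xi> + h * Q y) / h))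
  + (abs (w x * (u x - (x - y) / h)) + abs ((u x - u y - (x - y) * w x) / h))"
  unfolding eq by (rule tri)
 also have "... <= (abs (Q x - Q y) + C1q * abs h * D \<xi>) + ((M / \<alpha> * M + \<Lambda> * M) * abs h * abs (w x) + seg_int (%s. abs (w (x + s) - w x)) (- ((M + 1) * abs h)) ((M + 1) * abs h) / abs h)"
  by (intro add_mono order_refl B C Dd)
 finally have "abs ((eul U (t + h) x - u x) / h - vel kap u x) <= (abs (Q x - Q y) + C1q * abs h * D \<xi>) + ((M / \<alpha> * M + \<Lambda> * M) * abs h * abs (w x) + seg_int (%s. abs (w (x + s) - w x)) (- ((M + 1) * abs h)) ((M + 1) * abs h) / abs h)" .
 then show ?thesis unfolding Q_def w_def u_def y_def \<xi>_def by simp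
qed

text \<open>Each error term tends to zero in \<open>L2\<close>: the first by continuity of compositions, the last by averages of
  translation differences, and the other two carry a factor \<open>h\<close>.\<close>

lemma eul_time_deriv_null:
 assumes t: "t \<in> {-T<..<T}"
 shows "null (at 0) (%h x. (eul U (t + h) x - eul U t x) / h - vel kap (eul U t) x)"
proof -
 have t': "t \<in> {-T..T}" using t by simp
 define u where "u = eul U t"
 define w where "w = wd u"
 define Q where "Q = d_Helmholtz (euler_src kap u)"
 have bL: "bLip Kb u" unfolding u_def by (rule eul_bLip[OF t'])
 note fin = eul_N2(3,4)[OF t', folded u_def, folded w_def]
 have Qfin: "N2 Q < \<infinity>" unfolding Q_def by (rule vel_finite(2)[OF bL]) (use fin in \<open>auto simp: w_def\<close>)
 have Qm[measurable]: "Q \<in> Borel" unfolding Q_def by (rule vel_measurable(2)[OF bL])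
 have wm[measurable]: "w \<in> Borel" "u \<in> Borel" unfolding w_def using bLip_deriv[OF bL] by auto
 have Dm[measurable]: "D \<in> Borel" by (rule weightD(1)[OF D])
 have b0: "0 < \<beta>" using \<beta> by simp
 have ab: "0 < \<alpha> / \<beta>" using \<alpha> b0 by simp
 note q = trajD(2)[OF U t']
 define M1 where "M1 = M + 1"
 have M1: "0 < M1" using M_nonneg by (simp add: M1_def)
 define C2 where "C2 = M / \<alpha> * M + \<Lambda> * M"
 have C2: "0 <= C2" unfolding C2_def using M_nonneg \<alpha> \<Lambda> by simp
 have lin: "((%h::real. a * abs h) \<longlongrightarrow> 0) (at 0)" for a :: real
  by (rule tendsto_eq_rhs[OF tendsto_mult[OF tendsto_const tendsto_rabs[OF tendsto_ident_at]]]) simp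
 define p where "p h = inv (qf U (t + h))" for h
 have near: "\<forall>\<^sub>F h in at 0. h ~= 0 & t + h \<in> {-T..T}"
  unfolding eventually_at by (rule exI[of _ "T - abs t"]) (use t in \<open>auto simp: dist_real_def\<close>)
 have ps: "slopes (1 / \<beta>) (1 / \<alpha>) (p h)" "0 < 1 / \<beta>" if "t + h \<in> {-T..T}" for h
  unfolding p_def by (rule slopes_inv(3,4)[OF trajD(2)[OF U that] \<alpha>])+
 have pm: "p h \<in> Borel" if "t + h \<in> {-T..T}" for h by (rule slopes_borel[OF ps[OF that]])
 have qm[measurable]: "qf U t \<in> Borel" by (rule slopes_borel[OF q \<alpha>])
 have idc: "slopes (\<alpha> / \<beta>) (\<beta> / \<alpha>) (%x. x + 0)"
  unfolding slopes_def
 proof (intro allI impI conjI)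
  fix a b :: real assume "a <= b"
  have r: "\<alpha> / \<beta> <= 1" "1 <= \<beta> / \<alpha>" using slopes_le[OF q] \<alpha> b0 by simp_all
  have "\<alpha> / \<beta> * (b - a) <= 1 * (b - a)" "1 * (b - a) <= \<beta> / \<alpha> * (b - a)"
   by (rule mult_right_mono[OF r(1)], use \<open>a <= b\<close> in simp) (rule mult_right_mono[OF r(2)], use \<open>a <= b\<close> in simp)
  then show "\<alpha> / \<beta> * (b - a) <= b + 0 - (a + 0)" "b + 0 - (a + 0) <= \<beta> / \<alpha> * (b - a)" by simp_all
 qed
 define S where "S h x = seg_int (%s. abs (w (x + s) - w x)) (- (M1 * abs h)) (M1 * abs h)" for h x
 have Sm[measurable]: "S h \<in> Borel" for h unfolding S_def[abs_def] set_lebesgue_integral_def by measurable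
 have ABm: "(%x. Q (x + 0) - Q (qf U t (p h x))) \<in> Borel" "(%x. C1q * abs h * D (p h x)) \<in> Borel" if "t + h \<in> {-T..T}" for h
  by (intro borel_measurable_diff measurable_compose[OF _ Qm] borel_measurable_add measurable_compose[OF pm[OF that] qm]; simp)
   (intro borel_measurable_times borel_measurable_const measurable_compose[OF pm[OF that] Dm])
 have CSm: "(%x. C2 * abs h * w x) \<in> Borel" "(%x. 1 / abs h * S h x) \<in> Borel" for h
  by (intro borel_measurable_times borel_measurable_const wm Sm)+
 have A: "null (at 0) (%h x. Q (x + 0) - Q (qf U t (p h x)))"
 proof (rule null_compose_continuous[OF Qm Qfin ab lin[of M]])
  show "\<forall>\<^sub>F h in at 0. slopes (\<alpha> / \<beta>) (\<beta> / \<alpha>) (%x. x + 0) & slopes (\<alpha> / \<beta>) (\<beta> / \<alpha>) (%x. qf U t (p h x)) & (\<forall>x. abs (x + 0 - qf U t (p h x)) <= M * abs h)"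
   using near
  proof eventually_elim
   case (elim h)
   then have th: "t + h \<in> {-T..T}" by simp
   have "abs (x + 0 - qf U t (p h x)) <= M * abs h" for x
    using qf_time(1)[OF U t' th, of "p h x"] slopes_inv(1)[OF trajD(2)[OF U th] \<alpha>, of x] by (simp add: p_def)
   then show ?case using idc slopes_compose[OF q ps(1)[OF th] \<alpha> ps(2)[OF th]] by simp
  qed
 qed
 have B: "null (at 0) (%h x. C1q * abs h * D (p h x))"
  by (rule null_compose[OF null_scale[OF lin Dm finD], where \<alpha> = "1 / \<beta>" and b = "%_. 1 / \<alpha>"])
   (use b0 in simp, use near in \<open>eventually_elim, intro conjI borel_measurable_times borel_measurable_const Dm ps; blast\<close>)
 have C: "null (at 0) (%h x. C2 * abs h * w x)" by (rule null_scale[OF lin wm(1) fin(2)])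
 have loc: "loc_int (%s. abs (w (x + s) - w x))" for x
  unfolding w_def by (rule primitive_average_bound(2)[OF bLip_deriv(1,2)[OF bL], of x x 0]) simp
 have S: "null (at 0) (%h x. 1 / abs h * S h x)"
 proof (rule null_I)
  fix e :: real assume e: "0 < e"
  then have "0 < e / M1^2" using M1 by simp
  from N2_translation_average[OF wm(1) fin(2) this] obtain \<delta> where \<delta>: "0 < \<delta>" and cS: "!!h. 0 < h ==> h <= \<delta> ==>
   (\<integral>\<^sup>+x. (\<integral>\<^sup>+s. indicator {-h..h} s * ennreal (abs (w (x + s) - w x)) \<partial>lborel)^2 \<partial>lborel) <= ennreal (h^2 * (e / M1^2))"
   by auto
  show "\<forall>\<^sub>F h in at 0. N2 (%x. 1 / abs h * S h x) <= ennreal e"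
   using near order_tendstoD(2)[OF lin[of M1] \<delta>]
  proof eventually_elim
   case (elim h)
   have "N2 (%x. 1 / abs h * S h x) = ennreal ((1 / abs h)^2) * N2 (S h)" by (rule N2_cmult) measurable
   also have "... <= ennreal ((1 / abs h)^2) * ennreal ((M1 * abs h)^2 * (e / M1^2))"
    unfolding S_def N2_average[OF wm(1) loc] by (intro mult_left_mono cS) (use M1 elim in auto)
   also have "... = ennreal ((1 / abs h)^2 * ((M1 * abs h)^2 * (e / M1^2)))" by (rule ennreal_mult[symmetric]) (use e in auto)
   also have "(1 / abs h)^2 * ((M1 * abs h)^2 * (e / M1^2)) = e" using elim M1 by (simp add: power_divide power_mult_distrib)
   finally show ?case .
  qed
 qed
 have AB: "null (at 0) (%h x. abs (Q (x + 0) - Q (qf U t (p h x))) + abs (C1q * abs h * D (p h x)))"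
 proof (rule null_sum[OF A B])
  show "\<forall>\<^sub>F h in at 0. (%x. Q (x + 0) - Q (qf U t (p h x))) \<in> Borel & (%x. C1q * abs h * D (p h x)) \<in> Borel &
   (AE x in lborel. abs ((abs (Q (x + 0) - Q (qf U t (p h x)))) + abs (C1q * abs h * D (p h x))) <= abs (Q (x + 0) - Q (qf U t (p h x))) + abs (C1q * abs h * D (p h x)))"
   using near
  proof eventually_elim
   case (elim h)
   then show ?case by (intro conjI ABm AE_I2 abs_of_nonneg[THEN eq_refl]) auto
  qed
 qed
 have CS: "null (at 0) (%h x. abs (C2 * abs h * w x) + abs (1 / abs h * S h x))"
  by (rule null_sum[OF C S], intro always_eventually allI conjI AE_I2 abs_of_nonneg[THEN eq_refl] CSm) simp
 have bound: "abs ((eul U (t + h) x - eul U t x) / h - vel kap (eul U t) x)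
    <= abs ((abs (Q (x + 0) - Q (qf U t (p h x)))) + abs (C1q * abs h * D (p h x))) + abs ((abs (C2 * abs h * w x)) + abs (1 / abs h * S h x))"
  if h: "h ~= 0" and th: "t + h \<in> {-T..T}" for h x
 proof -
  have "0 <= S h x" unfolding S_def set_lebesgue_integral_def by (rule Bochner_Integration.integral_nonneg) simp
  then have 1: "abs (1 / abs h * S h x) = S h x / abs h" by simp
  have "0 <= C1q * abs h * D (p h x)" "0 <= C2 * abs h" using C1q_nonneg weightD(2)[OF D] C2 by simp_all
  then have 2: "abs (C1q * abs h * D (p h x)) = C1q * abs h * D (p h x)" "abs (C2 * abs h * w x) = C2 * abs h * abs (w x)"
   unfolding abs_mult[of _ "w x"] by (simp_all only: abs_of_nonneg)
  have tri: "z <= abs (a + b) + abs (c + e)" if "z <= (a + b) + (c + e)" for a b c e z :: real using that by linarith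
  show ?thesis unfolding 1 2
   by (rule tri) (rule eul_increment[OF t' th h, of x, folded p_def C2_def M1_def, folded u_def, folded w_def Q_def, folded S_def, unfolded u_def])
 qed
 show ?thesis
 proof (rule null_sum[OF AB CS])
  show "\<forall>\<^sub>F h in at 0. (%x. abs (Q (x + 0) - Q (qf U t (p h x))) + abs (C1q * abs h * D (p h x))) \<in> Borel &
   (%x. abs (C2 * abs h * w x) + abs (1 / abs h * S h x)) \<in> Borel &
   (AE x in lborel. abs ((eul U (t + h) x - eul U t x) / h - vel kap (eul U t) x)
    <= abs ((abs (Q (x + 0) - Q (qf U t (p h x)))) + abs (C1q * abs h * D (p h x))) + abs ((abs (C2 * abs h * w x)) + abs (1 / abs h * S h x)))"
   using near
  proof eventually_elim
   case (elim h)
   then have h: "h ~= 0" and th: "t + h \<in> {-T..T}" by auto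
   note [measurable] = pm[OF th]
   from bound[OF h th] have ae: "AE x in lborel. abs ((eul U (t + h) x - eul U t x) / h - vel kap (eul U t) x)
    <= abs ((abs (Q (x + 0) - Q (qf U t (p h x)))) + abs (C1q * abs h * D (p h x))) + abs ((abs (C2 * abs h * w x)) + abs (1 / abs h * S h x))" by (rule AE_I2)
   show ?case by (intro conjI ae borel_measurable_add borel_measurable_abs ABm[OF th] CSm)
  qed
 qed
qed

lemma eul_L2: "t \<in> {-T..T} ==> eul U t \<in> L2_space"
 using eul_N2(3) bLip_deriv(4)[OF eul_bLip] by (simp add: L2_space_iff)

lemma vel_L2: "t \<in> {-T..T} ==> vel kap (eul U t) \<in> L2_space"
 using vel_finite(3)[OF eul_bLip eul_N2(3,4)] vel_measurable(1)[OF eul_bLip] by (simp add: L2_space_iff)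

lemma eul_has_time_deriv:
 assumes t: "t \<in> {-T<..<T}"
 shows "has_L2_time_deriv (eul U) (vel kap (eul U t)) t"
proof -
 have s: "s \<in> {-T..T}" if "abs (s - t) < T - abs t" for s using that by auto
 have "0 < T - abs t" using t by auto
 then show ?thesis using has_L2_time_deriv_iff[of t "T - abs t" "eul U" "vel kap (eul U t)"] eul_L2[OF s] vel_L2 eul_time_deriv_null[OF t] t by simp
qed

lemma time_deriv_eul:
 assumes t: "t \<in> {-T<..<T}"
 shows "AE x in lborel. time_deriv (eul U) t x = vel kap (eul U t) x" "time_deriv (eul U) t \<in> L2_space"
proof -
 note d = eul_has_time_deriv[OF t]
 note d' = time_deriv_has_deriv[OF d]
 have s: "s \<in> {-T..T}" if "abs (s - t) < T - abs t" for s using that by auto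
 show "AE x in lborel. time_deriv (eul U) t x = vel kap (eul U t) x"
  by (rule has_L2_time_deriv_unique[OF d' d eul_L2[OF s] eul_L2[OF s]]) (use t in auto)
 show "time_deriv (eul U) t \<in> L2_space" using d' by (simp add: has_L2_time_deriv_def)
qed

end

lemma Lipschitz_diff_primitive:
 assumes "bLip K u" "bLip K' v"
 shows "primitive (%x. u x - v x) (%x. wd u x - wd v x)"
 by (intro primitive_diff bLip_deriv(1)[OF assms(1)] bLip_deriv(1)[OF assms(2)])

lemma H1_norm_tendsto_0:
 assumes u: "\<forall>\<^sub>F i in F. bLip K (u i)" and v: "bLip K' v"
  and n: "null F (%i x. u i x - v x)" "null F (%i x. wd (u i) x - wd v x)"
 shows "((%i. H1_norm (%x. u i x - v x)) \<longlongrightarrow> 0) F"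
proof -
 have z: "((%i. enn2real (N2 (f i))) \<longlongrightarrow> 0) F" if "null F f" for f
  using that unfolding null_def by (intro tendsto_enn2real) auto
 have "((%i. sqrt (enn2real (N2 (%x. u i x - v x)) + enn2real (N2 (%x. wd (u i) x - wd v x)))) \<longlongrightarrow> sqrt (0 + 0)) F"
  by (intro tendsto_real_sqrt tendsto_add z n)
 moreover have "\<forall>\<^sub>F i in F. sqrt (enn2real (N2 (%x. u i x - v x)) + enn2real (N2 (%x. wd (u i) x - wd v x))) = H1_norm (%x. u i x - v x)"
  using u
 proof eventually_elim
  case (elim i)
  note p = Lipschitz_diff_primitive[OF elim v]
  show ?case using H1_norm_sq[OF p primitive_borel[OF p] AE_I2[OF refl]] by (metis real_sqrt_unique)
 qed
 ultimately show ?thesis using Lim_transform_eventually by fastforce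
qed

lemma inv_Helmholtz_cong_AE:
 assumes "f \<in> Borel" "g \<in> Borel" "AE x in lborel. f x = g x"
 shows "inv_Helmholtz f = inv_Helmholtz g"
proof
 fix x
 note [measurable] = assms(1,2)
 show "inv_Helmholtz f x = inv_Helmholtz g x"
  unfolding inv_Helmholtz_def
 proof (rule integral_cong_AE)
  show "AE y in lborel. exp (- abs (x - y)) / 2 * f y = exp (- abs (x - y)) / 2 * g y"
   using assms(3) by eventually_elim simp
 qed measurable
qed

lemma weak_deriv_inv_Helmholtz:
 assumes "bLip K u"
 shows "AE x in lborel. wd (inv_Helmholtz (euler_src kap u)) x = d_Helmholtz (euler_src kap u) x"
proof -
 note p = Helmholtz_primitive(1)[OF bLip_deriv(6)[OF assms] euler_src_bound(1)[OF assms]]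
 show ?thesis by (rule weak_deriv_primitive(4)[OF p p])
qed

lemma euler_src_eq: "euler_src kap u = (%y. kap * u y + (u y)^2 + (wd u y)^2 / 2)"
 by (rule ext) (simp add: euler_src_def)

context lag_sol
begin

lemma eul_H1: assumes "t \<in> {-T..T}" shows "eul U t \<in> H1_space"
 by (rule H1_space_I[OF bLip_deriv(1,4)[OF eul_bLip[OF assms]] _ eul_N2(3,4)[OF assms]]) simp

lemma eul_W1inf: assumes "t \<in> {-T..T}" shows "eul U t \<in> W1inf_space" "W1inf_norm (eul U t) <= Kb + Kb"
proof -
 have b: "AE x in lborel. abs (eul U t x) <= Kb" using eul_bLip[OF assms] by (simp add: bLip_def)
 note * = W1inf_space_I[OF bLip_deriv(1,4)[OF eul_bLip[OF assms]] _ b bLip_deriv(2)[OF eul_bLip[OF assms]] Kb_nonneg Kb_nonneg]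
 show "eul U t \<in> W1inf_space" "W1inf_norm (eul U t) <= Kb + Kb" by (rule *; simp)+
qed

lemma eul_C_H1: "eul U \<in> C_H1 T"
 unfolding C_H1_def
proof (intro CollectI conjI ballI eul_H1)
 fix s assume s: "s \<in> {-T..T}"
 have "\<forall>\<^sub>F t in at s within {-T..T}. bLip Kb (eul U t)"
  unfolding eventually_at_filter by (intro always_eventually) (auto intro: eul_bLip)
 then show "((%t. H1_norm (%x. eul U t x - eul U s x)) \<longlongrightarrow> 0) (at s within {-T..T})"
  by (rule H1_norm_tendsto_0[OF _ eul_bLip[OF s] eul_time_continuous[OF s]])
qed

lemma eul_Linf: "eul U \<in> Linf_W1inf T"
 unfolding Linf_W1inf_def using eul_W1inf by auto

lemma eul_C1: "eul U \<in> C1_L2 T"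
 unfolding C1_L2_def
proof (intro CollectI conjI ballI)
 show "eul U t \<in> L2_space" if "t \<in> {-T<..<T}" for t using eul_L2 that by auto
 show "\<exists>v. has_L2_time_deriv (eul U) v t" if "t \<in> {-T<..<T}" for t using eul_has_time_deriv[OF that] by blast
 fix s assume s: "s \<in> {-T<..<T}"
 have s': "s \<in> {-T..T}" using s by simp
 show "((%t. L2_norm (%x. time_deriv (eul U) t x - time_deriv (eul U) s x)) \<longlongrightarrow> 0) (at s)"
 proof -
  have at: "at s within {-T..T} = at s" using s by (intro at_within_interior) simp
  have I: "\<forall>\<^sub>F t in at s. t \<in> {-T<..<T}" using s by (intro eventually_at_topological[THEN iffD2] exI[of _ "{-T<..<T}"]) auto
  have "\<forall>\<^sub>F t in at s. bLip Kb (eul U t)" using I by eventually_elim (auto intro: eul_bLip)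
  from null_vel[OF this eul_bLip[OF s'] eul_time_continuous[OF s', unfolded at], of kap]
  have n: "null (at s) (%t x. time_deriv (eul U) t x - time_deriv (eul U) s x)"
  proof (rule null_mono)
   show "\<forall>\<^sub>F t in at s. AE x in lborel. abs (time_deriv (eul U) t x - time_deriv (eul U) s x) <= abs (vel kap (eul U t) x - vel kap (eul U s) x)"
    using I
   proof eventually_elim
    case (elim t)
    show ?case using time_deriv_eul(1)[OF elim] time_deriv_eul(1)[OF s] by eventually_elim simp
   qed
  qed
  have m: "\<forall>\<^sub>F t in at s. (%x. time_deriv (eul U) t x - time_deriv (eul U) s x) \<in> L2_space"
   using I by eventually_elim (intro L2_space_diff time_deriv_eul(2) s)
  show ?thesis using n L2_norm_tendsto_0_iff[OF m] by simp
 qed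
qed

lemma eul_0: "eul U 0 = u0"
proof -
 have "qf U 0 = (%x. x)" by (rule ext) (simp add: qf_def)
 then have "inv (qf U 0) x = x" for x using inv_f_f[of "%x. x" x] by simp
 moreover have "U 0 x = u0 x" for x using sol[of 0 x] T by (simp add: Phi_def)
 ultimately show ?thesis by (intro ext) (simp add: eul_def)
qed

lemma eul_CH_solution:
 assumes "AE x in lborel. u0' x = u0 x"
 shows "CH_solution kap T u0' (eul U)"
 unfolding CH_solution_def
proof (intro conjI ballI)
 show "eul U \<in> Z_space T" using eul_C_H1 eul_Linf eul_C1 by (simp add: Z_space_def)
 show "AE x in lborel. eul U 0 x = u0' x" unfolding eul_0 using assms by eventually_elim simp
 fix t assume t: "t \<in> {-T<..<T}"
 then have t': "t \<in> {-T..T}" by simp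
 show "AE x in lborel. time_deriv (eul U) t x + eul U t x * wd (eul U t) x = - wd (inv_Helmholtz
      (%y. kap * eul U t y + (eul U t y)^2 + (wd (eul U t) y)^2 / 2)) x"
  using time_deriv_eul(1)[OF t] weak_deriv_inv_Helmholtz[OF eul_bLip[OF t'], of kap]
  unfolding euler_src_eq[symmetric]
  by eventually_elim (simp add: vel_def)
qed

end

section \<open>Sobolev embedding\<close>

lemma seg_int_abs_le_N2:
 assumes f: "loc_int f" and N: "N2 f <= ennreal a" "0 <= a" and xy: "x <= y"
 shows "seg_int (%z. abs (f z)) x y <= sqrt ((y - x) * a)"
proof -
 have [measurable]: "f \<in> Borel" by (rule loc_int_borel[OF f])
 have nn: "0 <= seg_int (%z. abs (f z)) x y" unfolding set_lebesgue_integral_def by (rule Bochner_Integration.integral_nonneg) simp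
 have "ennreal (seg_int (%z. abs (f z)) x y) = (\<integral>\<^sup>+z. ennreal (indicator {x..y} z *\<^sub>R (abs (f z))) \<partial>lborel)"
  unfolding set_lebesgue_integral_def
  by (rule nn_integral_eq_integral[symmetric])
   (use loc_int_seg[OF loc_int_abs[OF f]] in \<open>auto simp: set_integrable_def\<close>)
 also have "... = (\<integral>\<^sup>+z. indicator {x..y} z * ennreal (abs (f z)) \<partial>lborel)"
  by (intro nn_integral_cong) (auto simp: indicator_def)
 finally have eq: "ennreal (seg_int (%z. abs (f z)) x y) = (\<integral>\<^sup>+z. indicator {x..y} z * ennreal (abs (f z)) \<partial>lborel)" .
 have "ennreal ((seg_int (%z. abs (f z)) x y)^2) = (\<integral>\<^sup>+z. indicator {x..y} z * ennreal (abs (f z)) \<partial>lborel)^2"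
  using nn by (simp add: ennreal_power[symmetric] eq)
 also have "... <= (\<integral>\<^sup>+z. (indicator {x..y} z)^2 \<partial>lborel) * (\<integral>\<^sup>+z. (ennreal (abs (f z)))^2 \<partial>lborel)"
  by (rule Cauchy_Schwarz_nn_integral) measurable
 also have "(\<integral>\<^sup>+z. (indicator {x..y} z)^2 \<partial>lborel) = (\<integral>\<^sup>+z. indicator {x..y} z \<partial>(lborel :: real measure))"
  by (intro nn_integral_cong) (auto simp: indicator_def)
 also have "... = ennreal (y - x)" using xy by simp
 also have "(\<integral>\<^sup>+z. (ennreal (abs (f z)))^2 \<partial>lborel) = N2 f" unfolding N2_def by (intro nn_integral_cong) (simp add: ennreal_power)
 also have "ennreal (y - x) * N2 f <= ennreal (y - x) * ennreal a" by (rule mult_left_mono[OF N(1)]) simp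
 also have "... = ennreal ((y - x) * a)" using xy N(2) by (simp add: ennreal_mult)
 finally have "(seg_int (%z. abs (f z)) x y)^2 <= (y - x) * a" using xy N(2) by (simp add: ennreal_le_iff)
 then show ?thesis by (rule real_le_rsqrt)
qed

lemma Sobolev:
 assumes p: "primitive f g" and N: "N2 f <= ennreal a" "N2 g <= ennreal a" "0 <= a"
 shows "abs (f x) <= 2 * sqrt a"
proof -
 have gl: "loc_int g" by (rule primitive_loc[OF p])
 have fl: "loc_int f" by (rule continuous_loc_int[OF primitive_continuous[OF p]])
 have 1: "abs (f x) <= abs (f y) + seg_int (%z. abs (g z)) x (x + 1)" if "x <= y" "y <= x + 1" for y
 proof -
  have "abs (f y - f x) <= seg_int (%z. abs (g z)) x y"
   using seg_int_abs_le[OF gl loc_int_abs[OF gl], of x y] by (simp add: primitiveD[OF p that(1)])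
  moreover have "seg_int (%z. abs (g z)) x (x + 1) = seg_int (%z. abs (g z)) x y + seg_int (%z. abs (g z)) y (x + 1)"
   by (rule seg_int_combine[OF loc_int_abs[OF gl] that])
  moreover have "0 <= seg_int (%z. abs (g z)) y (x + 1)" unfolding set_lebesgue_integral_def by (rule Bochner_Integration.integral_nonneg) simp
  ultimately show ?thesis by linarith
 qed
 have l2: "loc_int (%y. abs (f y) + seg_int (%z. abs (g z)) x (x + 1))"
  by (intro loc_int_add loc_int_abs fl loc_int_const)
 have "seg_int (%_. abs (f x)) x (x + 1) <= seg_int (%y. abs (f y) + seg_int (%z. abs (g z)) x (x + 1)) x (x + 1)"
  by (rule set_integral_mono[OF loc_int_seg[OF loc_int_const] loc_int_seg[OF l2]]) (use 1 in auto)
 also have "... = seg_int (%y. abs (f y)) x (x + 1) + seg_int (%z. abs (g z)) x (x + 1)"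
  by (simp add: seg_int_add[OF loc_int_abs[OF fl] loc_int_const] seg_int_const)
 also have "... <= sqrt ((x + 1 - x) * a) + sqrt ((x + 1 - x) * a)"
  by (intro add_mono seg_int_abs_le_N2 fl gl N) auto
 finally show ?thesis by (simp add: seg_int_const)
qed

lemma Helmholtz_sup:
 assumes f[measurable]: "f \<in> Borel" and b: "AE x in lborel. abs (f x) <= B" and N: "N2 f <= ennreal a" "0 <= a"
 shows "abs (inv_Helmholtz f x) <= 2 * sqrt a" "abs (d_Helmholtz f x) <= 2 * sqrt (4 * a)"
proof -
 note H = Helmholtz_primitive[OF f b]
 note n = order_trans[OF d_Helmholtz_N2(1)[OF f b] N(1)] order_trans[OF d_Helmholtz_N2(2)[OF f b] N(1)]
 show "abs (inv_Helmholtz f x) <= 2 * sqrt a" by (rule Sobolev[OF H(1) n(2,1) N(2)])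
 have [measurable]: "inv_Helmholtz f \<in> Borel" by (rule primitive_borel[OF H(1)])
 show "abs (d_Helmholtz f x) <= 2 * sqrt (4 * a)"
 proof (rule Sobolev[OF H(2)])
  show "N2 (d_Helmholtz f) <= ennreal (4 * a)" by (rule order_trans[OF n(1)]) (rule ennreal_leI, use N(2) in simp)
  have "N2 (%x. inv_Helmholtz f x - f x) <= ennreal (2 * a + 2 * a)"
   by (rule N2_diff_le[OF _ _ n(2) N(1) N(2) N(2)]) measurable
  then show "N2 (%x. inv_Helmholtz f x - f x) <= ennreal (4 * a)" by simp
 qed (use N(2) in simp)
qed

lemma continuous_AE_abs_le:
 assumes c: "continuous_on UNIV (f :: real => real)" and b: "AE x in lborel. abs (f x) <= C"
 shows "abs (f x) <= C"
proof -
 have "(%x. max (abs (f x)) C) = (%x. C)"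
  by (rule continuous_AE_eq_imp_eq) (use b in \<open>auto intro!: continuous_intros c elim!: eventually_mono\<close>)
 from fun_cong[OF this, of x] show ?thesis by simp
qed

section \<open>Characteristics\<close>

lemma continuous_on_compose_Lipschitz:
 fixes F :: "real => real => real"
 assumes L: "!!t a b. t \<in> S ==> abs (F t a - F t b) <= M * abs (a - b)"
  and c: "!!x. continuous_on S (%t. F t x)" and y: "continuous_on S y"
 shows "continuous_on S (%t. F t (y t))"
 unfolding continuous_on
proof
 fix t assume t: "t \<in> S"
 have "((%s. (F s (y s) - F s (y t)) + F s (y t)) \<longlongrightarrow> 0 + F t (y t)) (at t within S)"
 proof (rule tendsto_add)
  show "((%s. F s (y t)) \<longlongrightarrow> F t (y t)) (at t within S)" using c[of "y t"] t by (auto simp: continuous_on)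
  show "((%s. F s (y s) - F s (y t)) \<longlongrightarrow> 0) (at t within S)"
  proof (rule Lim_null_comparison)
   show "\<forall>\<^sub>F s in at t within S. norm (F s (y s) - F s (y t)) <= M * abs (y s - y t)"
    unfolding eventually_at_filter using L by (intro always_eventually) auto
   have "(y \<longlongrightarrow> y t) (at t within S)" using y t by (auto simp: continuous_on)
   then show "((%s. M * abs (y s - y t)) \<longlongrightarrow> 0) (at t within S)" by (auto intro!: tendsto_eq_intros)
  qed
 qed
 then show "((%s. F s (y s)) \<longlongrightarrow> F t (y t)) (at t within S)" by simp
qed

text \<open>Picard iteration for a scalar equation with a uniformly Lipschitz right-hand side.\<close>

lemma scalar_ode_exists:
 fixes F :: "real => real => real"
 assumes M: "0 < M" and T: "0 <= T" and L: "!!t a b. t \<in> {-T..T} ==> abs (F t a - F t b) <= M * abs (a - b)"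
  and c: "!!x. continuous_on {-T..T} (%t. F t x)" and B: "!!t x. t \<in> {-T..T} ==> abs (F t x) <= M"
 shows "\<exists>y. continuous_on {-T..T} (%t. F t (y t)) & continuous_on {-T..T} y & (\<forall>t\<in>{-T..T}. y t = \<xi> + tint (%s. F s (y s)) t)"
proof -
 have comp: "continuous_on {-T..T} (%t. F t (y t))" if "continuous_on {-T..T} y" for y
  by (rule continuous_on_compose_Lipschitz[OF L c that])
 have tc: "continuous_on {-T..T} (%t. \<xi> + tint f t)" if f: "continuous_on {-T..T} f" "!!t. t \<in> {-T..T} ==> abs (f t) <= M" for f
 proof (rule Lipschitz_continuous_on[of _ _ M])
  fix s t assume "s \<in> {-T..T}" "t \<in> {-T..T}"
  then show "abs ((\<xi> + tint f t) - (\<xi> + tint f s)) <= M * abs (t - s)"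
   using tint_Lipschitz[OF f, of s t] by simp
 qed
 define X where "X n = ((%y t. \<xi> + tint (%s. F s (y s)) t) ^^ n) (%_. \<xi>)" for n
 have X0: "X 0 = (%_. \<xi>)" and XS: "X (Suc n) = (%t. \<xi> + tint (%s. F s (X n s)) t)" for n by (simp_all add: X_def)
 have Xc: "continuous_on {-T..T} (X n)" for n
 proof (induction n)
  case (Suc n) show ?case unfolding XS by (rule tc[OF comp[OF Suc] B])
 qed (simp add: X0)
 define l where "l = 2 * M"
 have l: "0 < l" using M by (simp add: l_def)
 have step: "abs (tint (%s. F s (y s)) t - tint (%s. F s (z s)) t) <= \<delta> / 2 * exp (l * abs t)"
  if y: "continuous_on {-T..T} y" and z: "continuous_on {-T..T} z" and d: "!!s. s \<in> {-T..T} ==> abs (y s - z s) <= \<delta> * exp (l * abs s)"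
   and t: "t \<in> {-T..T}" and \<delta>: "0 <= \<delta>" for y z \<delta> t
 proof -
  have "abs (tint (%s. F s (y s) - F s (z s)) t) <= abs (tint (%s. (M * \<delta>) * exp (l * abs s)) t)"
  proof (rule tint_abs_le[OF _ _ _ t])
   fix s assume s: "s \<in> {-T..T}"
   have "abs (F s (y s) - F s (z s)) <= M * abs (y s - z s)" by (rule L[OF s])
   also have "... <= M * (\<delta> * exp (l * abs s))" by (rule mult_left_mono[OF d[OF s]]) (use M in simp)
   finally show "abs (F s (y s) - F s (z s)) <= (M * \<delta>) * exp (l * abs s)" by (simp add: mult.assoc)
  qed (intro continuous_on_diff comp y z continuous_intros)+
  also have "abs (tint (%s. (M * \<delta>) * exp (l * abs s)) t) = (M * \<delta>) * abs (tint (%s. exp (l * abs s)) t)"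
   unfolding tint_cmult abs_mult using M \<delta> by simp
  also have "(M * \<delta>) * abs (tint (%s. exp (l * abs s)) t) <= (M * \<delta>) * (exp (l * abs t) / l)"
   by (rule mult_left_mono[OF abs_tint_exp_le[OF l]]) (use M \<delta> in simp)
  also have "(M * \<delta>) * (exp (l * abs t) / l) = \<delta> / 2 * exp (l * abs t)" using M by (simp add: l_def)
  finally show ?thesis using tint_diff[OF comp[OF y] comp[OF z] t] by simp
 qed
 define A where "A = M * T"
 have A: "0 <= A" using M T by (simp add: A_def)
 have l1: "1 <= exp (l * abs t)" for t using l by simp
 have diff: "\<forall>t\<in>{-T..T}. abs (X (Suc n) t - X n t) <= A / 2 ^ n * exp (l * abs t)" for n
 proof (induction n)
  case 0
  show ?case
  proof
   fix t assume t: "t \<in> {-T..T}"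
   have "abs (tint (%s. F s \<xi>) t - tint (%s. F s \<xi>) 0) <= M * abs (t - 0)" by (rule tint_Lipschitz[OF c B]) (use t T in auto)
   also have "... <= A" unfolding A_def by (rule mult_left_mono) (use t M in auto)
   also have "A <= A * exp (l * abs t)" using mult_left_mono[OF l1[of t] A] by simp
   finally show "abs (X (Suc 0) t - X 0 t) <= A / 2 ^ 0 * exp (l * abs t)" by (simp add: XS X0)
  qed
 next
  case (Suc n)
  show ?case
  proof
   fix t assume t: "t \<in> {-T..T}"
   have "abs (tint (%s. F s (X (Suc n) s)) t - tint (%s. F s (X n s)) t) <= A / 2 ^ n / 2 * exp (l * abs t)"
    by (rule step[OF Xc Xc _ t]) (use Suc.IH A in auto)
   then show "abs (X (Suc (Suc n)) t - X (Suc n) t) <= A / 2 ^ Suc n * exp (l * abs t)"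
    unfolding XS[of "Suc n"] XS[of n, symmetric] by (simp add: XS[of n, symmetric]) (simp add: XS)
  qed
 qed
 have dp: "abs (X (Suc n) t - X n t) <= (A * exp (l * abs t)) / 2 ^ n" if "t \<in> {-T..T}" for n t
  using bspec[OF diff that] by simp
 define y where "y t = lim (%n. X n t)" for t
 have lim: "(%n. X n t) \<longlonglongrightarrow> y t" if "t \<in> {-T..T}" for t
  unfolding y_def by (rule geometric_limit(1)[OF dp[OF that]])
 have near: "abs (X n t - y t) <= 2 * A / 2 ^ n * exp (l * abs t)" if t: "t \<in> {-T..T}" for n t
  using geometric_limit(2)[OF dp[OF t] lim[OF t], of n] by simp
 have yL: "abs (y t - y s) <= M * abs (t - s)" if "s \<in> {-T..T}" "t \<in> {-T..T}" for s t
 proof (rule tendsto_le[OF sequentially_bot tendsto_const tendsto_rabs[OF tendsto_diff[OF lim[OF that(2), THEN LIMSEQ_Suc] lim[OF that(1), THEN LIMSEQ_Suc]]]])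
  show "\<forall>\<^sub>F n in sequentially. abs (X (Suc n) t - X (Suc n) s) <= M * abs (t - s)"
   unfolding XS using tint_Lipschitz[OF comp[OF Xc] B that] by (intro always_eventually) simp
 qed
 have yc: "continuous_on {-T..T} y"
  by (rule Lipschitz_continuous_on[of _ _ M]) (rule yL)
 have "y t = \<xi> + tint (%s. F s (y s)) t" if t: "t \<in> {-T..T}" for t
 proof -
  have "abs (X (Suc n) t - (\<xi> + tint (%s. F s (y s)) t)) <= (A * exp (l * abs t)) / 2 ^ n" for n
   unfolding XS using step[OF Xc yc near t, of n] A by simp
  then have "(%n. X (Suc n) t - (\<xi> + tint (%s. F s (y s)) t)) \<longlonglongrightarrow> 0"
   by (intro Lim_null_comparison[OF always_eventually div_power2_tendsto_0]) auto
  moreover have "(%n. X (Suc n) t - (\<xi> + tint (%s. F s (y s)) t)) \<longlonglongrightarrow> y t - (\<xi> + tint (%s. F s (y s)) t)"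
   by (intro tendsto_diff tendsto_const LIMSEQ_Suc lim t)
  ultimately have "y t - (\<xi> + tint (%s. F s (y s)) t) = 0" using LIMSEQ_unique by blast
  then show ?thesis by simp
 qed
 then show ?thesis using comp[OF yc] yc by blast
qed

section \<open>Uniqueness\<close>

lemma Gronwall_two_sided:
 fixes d d' :: "real => real"
 assumes c: "continuous_on {-T..T} d" and D: "!!t. t \<in> {-T<..<T} ==> (d has_real_derivative d' t) (at t)"
  and b: "!!t. t \<in> {-T<..<T} ==> abs (d' t) <= K * abs (d t)" and K: "0 <= K" and t: "t \<in> {-T..T}"
 shows "abs (d 0) <= exp (K * T) * abs (d t)" "abs (d t) <= exp (K * T) * abs (d 0)"
proof -
 have dd: "abs (d t * d' t) <= K * (d t)^2" if "t \<in> {-T<..<T}" for t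
  using mult_left_mono[OF b[OF that], of "abs (d t)"] by (simp add: abs_mult power2_eq_square mult.left_commute)
 have up: "abs (d x) * exp (K * x) <= abs (d y) * exp (K * y)" if xy: "-T <= x" "x <= y" "y <= T" for x y
 proof -
  have "(d x)^2 * exp (2 * K * x) <= (d y)^2 * exp (2 * K * y)"
  proof (rule DERIV_nonneg_imp_increasing_open[OF xy(2)])
   fix z assume z: "x < z" "z < y"
   then have zi: "z \<in> {-T<..<T}" using xy by auto
   have "((%z. (d z)^2 * exp (2 * K * z)) has_real_derivative 2 * exp (2 * K * z) * (d z * d' z + K * (d z)^2)) (at z)"
    by (auto intro!: derivative_eq_intros D[OF zi] simp: algebra_simps power2_eq_square)
   moreover have "0 <= 2 * exp (2 * K * z) * (d z * d' z + K * (d z)^2)" using dd[OF zi] by (intro mult_nonneg_nonneg) auto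
   ultimately show "\<exists>w. ((%z. (d z)^2 * exp (2 * K * z)) has_real_derivative w) (at z) & 0 <= w" by blast
  next
   show "continuous_on {x..y} (%z. (d z)^2 * exp (2 * K * z))"
    using xy by (intro continuous_intros continuous_on_subset[OF c]) auto
  qed
  then have "(abs (d x) * exp (K * x))^2 <= (abs (d y) * exp (K * y))^2"
   by (simp add: power_mult_distrib exp_double[symmetric] mult.assoc)
  then show ?thesis by (rule power2_le_imp_le) simp
 qed
 have down: "abs (d y) * exp (- (K * y)) <= abs (d x) * exp (- (K * x))" if xy: "-T <= x" "x <= y" "y <= T" for x y
 proof -
  have "- ((d x)^2 * exp (2 * (- (K * x)))) <= - ((d y)^2 * exp (2 * (- (K * y))))"
  proof (rule DERIV_nonneg_imp_increasing_open[OF xy(2)])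
   fix z assume z: "x < z" "z < y"
   then have zi: "z \<in> {-T<..<T}" using xy by auto
   have "((%z. - ((d z)^2 * exp (2 * (- (K * z))))) has_real_derivative 2 * exp (2 * (- (K * z))) * (K * (d z)^2 - d z * d' z)) (at z)"
    by (auto intro!: derivative_eq_intros D[OF zi] simp: algebra_simps power2_eq_square)
   moreover have "0 <= 2 * exp (2 * (- (K * z))) * (K * (d z)^2 - d z * d' z)" using dd[OF zi] by (intro mult_nonneg_nonneg) auto
   ultimately show "\<exists>w. ((%z. - ((d z)^2 * exp (2 * (- (K * z))))) has_real_derivative w) (at z) & 0 <= w" by blast
  next
   show "continuous_on {x..y} (%z. - ((d z)^2 * exp (2 * (- (K * z)))))"
    using xy by (intro continuous_intros continuous_on_subset[OF c]) auto
  qed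
  then have "(abs (d y) * exp (- (K * y)))^2 <= (abs (d x) * exp (- (K * x)))^2"
   unfolding power_mult_distrib exp_double[symmetric] by simp
  then show ?thesis by (rule power2_le_imp_le) simp
 qed
 have T: "0 <= T" using t by simp
 have e: "exp (K * abs t) <= exp (K * T)" using mult_left_mono[OF _ K, of "abs t" T] t by (simp add: abs_le_iff)
 have mv: "a <= b * exp s" if "a * exp (- s) <= b" for a b s :: real
  using mult_right_mono[OF that, of "exp s"] by (simp add: mult.assoc exp_minus_inverse flip: exp_add)
 have "abs (d 0) <= exp (K * abs t) * abs (d t) & abs (d t) <= exp (K * abs t) * abs (d 0)"
 proof (cases "0 <= t")
  case True
  then show ?thesis using up[of 0 t] mv[of "abs (d t)" "K * t" "abs (d 0)"] down[of 0 t] t T by (simp add: mult.commute)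
 next
  case False
  then show ?thesis using down[of t 0] mv[of "abs (d t)" "- (K * t)" "abs (d 0)"] up[of t 0] t T by (simp add: mult.commute)
 qed
 then show "abs (d 0) <= exp (K * T) * abs (d t)" "abs (d t) <= exp (K * T) * abs (d 0)"
  using mult_right_mono[OF e, of "abs (d t)"] mult_right_mono[OF e, of "abs (d 0)"] by auto
qed

lemma tint_has_real_derivative:
 assumes "continuous_on {-T..T} f" "t \<in> {-T<..<T}"
 shows "(tint f has_real_derivative f t) (at t)"
 using tint_has_derivative[OF assms(1), of t] assms(2)
 by (simp add: at_within_Icc_at has_real_derivative_iff_has_vector_derivative)

locale eulerian_sol =
 fixes kap T K :: real and V :: "real => real => real"
 assumes T: "0 < T" and K: "1 <= K" and lip: "!!t. t \<in> {-T..T} ==> bLip K (V t)"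
  and close: "!!s e. s \<in> {-T..T} ==> 0 < e ==> \<exists>\<delta>>0. \<forall>t\<in>{-T..T}. abs (t - s) < \<delta> -->
   N2 (%x. V t x - V s x) <= ennreal e & N2 (%x. wd (V t) x - wd (V s) x) <= ennreal e"
  and deriv: "!!t e. t \<in> {-T<..<T} ==> 0 < e ==> \<exists>\<delta>>0. \<forall>h. h ~= 0 --> abs h < \<delta> -->
   N2 (%x. (V (t + h) x - V t x) / h - vel kap (V t) x) <= ennreal e"
begin

definition P :: "real => real => real" where "P t = inv_Helmholtz (euler_src kap (V t))"
definition Q :: "real => real => real" where "Q t = d_Helmholtz (euler_src kap (V t))"
definition B :: real where "B = (abs kap + 2 * K) * K"

lemma B: "0 <= B" using K by (simp add: B_def)

lemma V_bound: assumes "t \<in> {-T..T}" shows "abs (V t x) <= K" "abs (V t b - V t a) <= K * abs (b - a)"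
 using lip[OF assms] by (auto simp: bLip_def)

lemma V_continuous: "t \<in> {-T..T} ==> continuous_on UNIV (V t)"
 by (rule Lipschitz_continuous[of _ K]) (rule V_bound)

lemma PQ:
 assumes t: "t \<in> {-T..T}"
 shows "abs (Q t x) <= B" "primitive (P t) (Q t)" "abs (Q t y - Q t x) <= 2 * B * abs (y - x)"
proof -
 note m = bLip_deriv(6)[OF lip[OF t], of kap] and b = euler_src_bound(1)[OF lip[OF t], of kap, folded B_def]
 show "abs (Q t x) <= B" unfolding Q_def by (rule d_Helmholtz_N2(3)[OF m b])
 show "primitive (P t) (Q t)" unfolding P_def Q_def by (rule Helmholtz_primitive(1)[OF m b])
 have "AE x in lborel. abs (inv_Helmholtz (euler_src kap (V t)) x - euler_src kap (V t) x) <= 2 * B"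
  using b
 proof eventually_elim
  case (elim x)
  then show ?case using d_Helmholtz_N2(4)[OF m b, of x] by linarith
 qed
 then show "abs (Q t y - Q t x) <= 2 * B * abs (y - x)" unfolding Q_def
  by (rule primitive_abs_le[OF Helmholtz_primitive(2)[OF m b]])
qed

text \<open>The Sobolev embedding turns convergence in \<open>H1\<close> into uniform convergence.\<close>

lemma sup_close:
 assumes s: "s \<in> {-T..T}" and e: "0 < e"
 shows "\<exists>\<delta>>0. \<forall>t\<in>{-T..T}. abs (t - s) < \<delta> --> (\<forall>x. abs (V t x - V s x) <= e & abs (Q t x - Q s x) <= e)"
proof -
 define a where "a = abs kap + 2 * K"
 have a: "0 <= a" using K by (simp add: a_def)
 define r where "r = e / (2 * (1 + 4 * a))"
 have r: "0 < r" using e a by (simp add: r_def)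
 have "2 * (1 + 4 * a) * r = e" unfolding r_def by (rule pos_mult_divide_cancel) (use a in simp)
 then have re: "2 * r + 8 * (a * r) = e" by (simp add: algebra_simps)
 have ar: "0 <= a * r" using a r by simp
 obtain \<delta> where \<delta>: "0 < \<delta>" "!!t. t \<in> {-T..T} ==> abs (t - s) < \<delta> ==> N2 (%x. V t x - V s x) <= ennreal (r^2) & N2 (%x. wd (V t) x - wd (V s) x) <= ennreal (r^2)"
  using close[OF s, of "r^2"] r by auto
 show ?thesis
 proof (intro exI[of _ \<delta>] conjI \<delta>(1) ballI impI allI)
  fix t x assume t: "t \<in> {-T..T}" "abs (t - s) < \<delta>"
  note n = \<delta>(2)[OF t, THEN conjunct1] \<delta>(2)[OF t, THEN conjunct2]
  have "abs (V t x - V s x) <= 2 * sqrt (r^2)"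
   by (rule Sobolev[OF Lipschitz_diff_primitive[OF lip[OF t(1)] lip[OF s]] n]) simp
  also have "... = 2 * r" using r by simp
  finally show "abs (V t x - V s x) <= e" using re ar by linarith
  note mt = bLip_deriv(6)[OF lip[OF t(1)], of kap] and ms = bLip_deriv(6)[OF lip[OF s], of kap]
   and bt = euler_src_bound(1)[OF lip[OF t(1)], of kap, folded B_def] and bs = euler_src_bound(1)[OF lip[OF s], of kap, folded B_def]
  have b: "AE x in lborel. abs (euler_src kap (V t) x - euler_src kap (V s) x) <= B + B"
   using bt bs by eventually_elim linarith
  have "abs (d_Helmholtz (%x. euler_src kap (V t) x - euler_src kap (V s) x) x) <= 2 * sqrt (4 * (a^2 * (4 * r^2)))"
   unfolding a_def
   by (rule Helmholtz_sup(2)[OF borel_measurable_diff[OF mt ms] b vel_diff(2)[OF lip[OF t(1)] lip[OF s] _ n]]) auto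
  also have "4 * (a^2 * (4 * r^2)) = (4 * (a * r))^2" by (simp add: power_mult_distrib)
  also have "2 * sqrt ((4 * (a * r))^2) = 8 * (a * r)" using ar by (simp only: real_sqrt_abs)
  finally show "abs (Q t x - Q s x) <= e" unfolding Q_def Helmholtz_diff(1)[OF mt ms bt bs] using re r by linarith
 qed
qed

lemma VQ_time_continuous:
 "continuous_on {-T..T} (%t. V t x)" "continuous_on {-T..T} (%t. Q t x)"
proof -
 have "\<exists>\<delta>>0. \<forall>t\<in>{-T..T}. dist t s < \<delta> --> dist (V t x) (V s x) < e & dist (Q t x) (Q s x) < e"
  if s: "s \<in> {-T..T}" and e: "0 < e" for s e
 proof -
  obtain \<delta> where \<delta>: "0 < \<delta>" "!!t x. t \<in> {-T..T} ==> abs (t - s) < \<delta> ==> abs (V t x - V s x) <= e / 2 & abs (Q t x - Q s x) <= e / 2"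
   using sup_close[OF s, of "e / 2"] e by auto
  have "dist (V t x) (V s x) < e & dist (Q t x) (Q s x) < e" if "t \<in> {-T..T}" "dist t s < \<delta>" for t
   using \<delta>(2)[of t x] that e by (simp add: dist_real_def)
  then show ?thesis using \<delta>(1) by blast
 qed
 then show "continuous_on {-T..T} (%t. V t x)" "continuous_on {-T..T} (%t. Q t x)"
  unfolding continuous_on_iff by blast+
qed

text \<open>The nonlocal equation is a conservation law for \<open>u\<close> with flux \<open>u\<^sup>2 / 2 + P\<close>.\<close>

lemma momentum_balance:
 assumes t: "t \<in> {-T<..<T}" and ab: "a <= b"
 shows "((%h. (seg_int (V (t + h)) a b - seg_int (V t) a b) / h) \<longlongrightarrow> - (1 / 2 * (V t b * V t b - V t a * V t a) + (P t b - P t a))) (at 0)"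
proof -
 have t': "t \<in> {-T..T}" using t by simp
 note p = bLip_deriv(1)[OF lip[OF t']]
 have "primitive (%x. (- 1 / 2) * (V t x * V t x) + (- 1) * P t x)
   (%x. (- 1 / 2) * (V t x * wd (V t) x + wd (V t) x * V t x) + (- 1) * Q t x)"
  by (intro primitive_add primitive_cmult primitive_mult[OF p p] PQ(2)[OF t'])
 moreover have "(%x. (- 1 / 2) * (V t x * wd (V t) x + wd (V t) x * V t x) + (- 1) * Q t x) = vel kap (V t)"
  by (rule ext) (simp add: vel_def Q_def)
 ultimately have p: "primitive (%x. (- 1 / 2) * (V t x * V t x) + (- 1) * P t x) (vel kap (V t))" by simp
 have sv: "seg_int (vel kap (V t)) a b = - (1 / 2 * (V t b * V t b - V t a * V t a) + (P t b - P t a))"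
  unfolding primitiveD[OF p ab, symmetric] by (simp add: field_simps)
 note vl = primitive_loc[OF p]
 have Vl: "loc_int (V s)" if "s \<in> {-T..T}" for s by (rule continuous_loc_int[OF V_continuous[OF that]])
 show ?thesis
 proof (rule tendstoI)
  fix e :: real assume e: "0 < e"
  define e' where "e' = (e / 2)^2 / (b - a + 1)"
  have e': "0 < e'" using e ab by (simp add: e'_def)
  have be: "(b - a) * e' <= (e / 2)^2"
  proof -
   have "(b - a) * e' <= (b - a + 1) * e'" using e' by (intro mult_right_mono) auto
   also have "... = (e / 2)^2" unfolding e'_def by (rule pos_mult_divide_cancel) (use ab in simp)
   finally show ?thesis .
  qed
  obtain \<delta> where \<delta>: "0 < \<delta>" "!!h. h ~= 0 ==> abs h < \<delta> ==> N2 (%x. (V (t + h) x - V t x) / h - vel kap (V t) x) <= ennreal e'"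
   using deriv[OF t e'] by blast
  show "\<forall>\<^sub>F h in at 0. dist ((seg_int (V (t + h)) a b - seg_int (V t) a b) / h) (- (1 / 2 * (V t b * V t b - V t a * V t a) + (P t b - P t a))) < e"
   unfolding eventually_at
  proof (intro exI[of _ "min \<delta> (T - abs t)"] conjI ballI impI)
   show "0 < min \<delta> (T - abs t)" using \<delta>(1) t by auto
   fix h :: real assume "h ~= 0 & dist h 0 < min \<delta> (T - abs t)"
   then have h: "h ~= 0" "abs h < \<delta>" "t + h \<in> {-T..T}" by (auto simp: dist_real_def)
   define f where "f x = (1 / h) * (V (t + h) x - V t x) - vel kap (V t) x" for x
   have fl: "loc_int f" unfolding f_def
    by (intro loc_int_diff loc_int_cmult Vl h t' vl)
   have "f = (%x. (V (t + h) x - V t x) / h - vel kap (V t) x)" by (rule ext) (simp add: f_def)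
   then have fN: "N2 f <= ennreal e'" using \<delta>(2)[OF h(1,2)] by simp
   have "seg_int f a b = (1 / h) * (seg_int (V (t + h)) a b - seg_int (V t) a b) - seg_int (vel kap (V t)) a b"
    unfolding f_def
    by (simp only: seg_int_diff[OF loc_int_cmult[OF loc_int_diff[OF Vl[OF h(3)] Vl[OF t']]] vl]
      seg_int_cmult seg_int_diff[OF Vl[OF h(3)] Vl[OF t']])
   moreover have "abs (seg_int f a b) <= seg_int (%x. abs (f x)) a b" by (rule seg_int_abs_le[OF fl loc_int_abs[OF fl]]) simp
   moreover have "seg_int (%x. abs (f x)) a b <= sqrt ((b - a) * e')" by (rule seg_int_abs_le_N2[OF fl fN _ ab]) (use e' in simp)
   moreover have "sqrt ((b - a) * e') <= e / 2" by (rule real_le_lsqrt) (use be e in auto)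
   ultimately show "dist ((seg_int (V (t + h)) a b - seg_int (V t) a b) / h) (- (1 / 2 * (V t b * V t b - V t a * V t a) + (P t b - P t a))) < e"
    unfolding sv[symmetric] dist_real_def using e by simp
  qed
 qed
qed

text \<open>An antiderivative in space: integrals of \<open>V t\<close> over moving intervals become differences of its values.\<close>

definition W :: "real => real => real" where "W t = tint (V t)"

lemma W_deriv: assumes "t \<in> {-T..T}" shows "(W t has_real_derivative V t y) (at y)"
 unfolding W_def by (rule tint_has_real_derivative[of "abs y + 1", OF continuous_on_subset[OF V_continuous[OF assms]]]) auto

lemma W_seg: "t \<in> {-T..T} ==> a <= b ==> W t b - W t a = seg_int (V t) a b"
 by (rule primitiveD[OF continuous_primitive[OF W_deriv V_continuous]])

lemma W_increment:
 assumes s: "s \<in> {-T..T}" and t: "t \<in> {-T..T}" and \<eta>: "!!x. abs (V s x - V t x) <= \<eta>"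
 shows "abs (W s y' - W s y - (y' - y) * V t y) <= (K * abs (y' - y) + \<eta>) * abs (y' - y)"
proof -
 have "norm ((W s y' - y' * V t y) - (W s y - y * V t y)) <= (K * abs (y' - y) + \<eta>) * norm (y' - y)"
 proof (rule field_differentiable_bound[of "cball y (abs (y' - y))" "%z. W s z - z * V t y" "%z. V s z - V t y"])
  fix z assume z: "z \<in> cball y (abs (y' - y))"
  show "((%z. W s z - z * V t y) has_field_derivative V s z - V t y) (at z within cball y (abs (y' - y)))"
   by (rule has_field_derivative_at_within) (auto intro!: derivative_eq_intros W_deriv[OF s])
  have "abs (V t z - V t y) <= K * abs (y' - y)"
   by (rule order_trans[OF V_bound(2)[OF t] mult_left_mono]) (use z K in \<open>auto simp: dist_real_def\<close>)
  then show "norm (V s z - V t y) <= K * abs (y' - y) + \<eta>" using \<eta>[of z] by simp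
 qed (auto simp: dist_real_def)
 then show ?thesis by (simp add: algebra_simps)
qed

definition q :: "real => real => real" where
 "q t \<xi> = (SOME y. continuous_on {-T..T} (%t. V t (y t)) & continuous_on {-T..T} y &
  (\<forall>t\<in>{-T..T}. y t = \<xi> + tint (%s. V s (y s)) t)) t"

definition U :: "real => real => real" where "U t \<xi> = V t (q t \<xi>)"

lemma q:
 shows "continuous_on {-T..T} (%t. U t \<xi>)" "continuous_on {-T..T} (%t. q t \<xi>)"
  "t \<in> {-T..T} ==> qf U t \<xi> = q t \<xi>"
proof -
 have "\<exists>y. continuous_on {-T..T} (%t. V t (y t)) & continuous_on {-T..T} y & (\<forall>t\<in>{-T..T}. y t = \<xi> + tint (%s. V s (y s)) t)"
  by (rule scalar_ode_exists[of K]) (use T K V_bound VQ_time_continuous in auto)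
 from someI_ex[OF this]
 have *: "continuous_on {-T..T} (%t. V t (q t \<xi>))" "continuous_on {-T..T} (%t. q t \<xi>)"
  "!!t. t \<in> {-T..T} ==> q t \<xi> = \<xi> + tint (%s. V s (q s \<xi>)) t"
  unfolding q_def[symmetric] by blast+
 show "continuous_on {-T..T} (%t. U t \<xi>)" "continuous_on {-T..T} (%t. q t \<xi>)" using * by (simp_all add: U_def)
 show "t \<in> {-T..T} ==> qf U t \<xi> = q t \<xi>" unfolding qf_def U_def using *(3) by simp
qed

lemma q_0: "q 0 \<xi> = \<xi>" using q(3)[of 0 \<xi>] T by (simp add: qf_def)

lemma q_time: "s \<in> {-T..T} ==> t \<in> {-T..T} ==> abs (q t \<xi> - q s \<xi>) <= K * abs (t - s)"
 unfolding q(3)[symmetric] qf_def using tint_Lipschitz[OF q(1), of \<xi> K s t] V_bound(1) by (simp add: U_def)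

lemma q_deriv:
 assumes t: "t \<in> {-T<..<T}" shows "((%t. q t \<xi>) has_real_derivative U t \<xi>) (at t)"
proof (rule has_field_derivative_transform_within_open[where S = "{-T<..<T}" and f = "%t. qf U t \<xi>"])
 show "((%t. qf U t \<xi>) has_real_derivative U t \<xi>) (at t)"
  unfolding qf_def by (auto intro!: derivative_eq_intros tint_has_real_derivative[OF q(1) t])
qed (use t q(3) in auto)

lemma q_slopes:
 assumes t: "t \<in> {-T..T}"
 shows "slopes (1 / exp (K * T)) (exp (K * T)) (q t)"
proof -
 have "1 / exp (K * T) * (b - a) <= q t b - q t a & q t b - q t a <= exp (K * T) * (b - a)" if "a < b" for a b
 proof -
  define d where "d t = q t b - q t a" for t
  have dc: "continuous_on {-T..T} d" unfolding d_def by (intro continuous_intros q)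
  have G: "abs (d 0) <= exp (K * T) * abs (d t)" "abs (d t) <= exp (K * T) * abs (d 0)" if t: "t \<in> {-T..T}" for t
  proof -
   have D: "(d has_real_derivative U t b - U t a) (at t)" if "t \<in> {-T<..<T}" for t
    unfolding d_def by (intro derivative_intros q_deriv that)
   have b: "abs (U t b - U t a) <= K * abs (d t)" if "t \<in> {-T<..<T}" for t
    unfolding d_def U_def by (rule V_bound(2)) (use that in auto)
   show "abs (d 0) <= exp (K * T) * abs (d t)" "abs (d t) <= exp (K * T) * abs (d 0)"
    by (rule Gronwall_two_sided[OF dc D b _ t]; use K in simp)+
  qed
  have d0: "d 0 = b - a" by (simp add: d_def q_0)
  have nz: "d s ~= 0" if "s \<in> {-T..T}" for s using G(1)[OF that] d0 \<open>a < b\<close> by auto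
  have "0 < d t"
  proof (rule ccontr)
   assume "\<not> 0 < d t"
   then have neg: "d t <= 0" by simp
   have "\<exists>s\<in>{-T..T}. d s = 0"
   proof (cases "0 <= t")
    case True
    show ?thesis using IVT2'[of d t 0 0, OF neg _ True continuous_on_subset[OF dc]] d0 \<open>a < b\<close> t T by force
   next
    case False
    show ?thesis using IVT'[of d t 0 0, OF neg _ _ continuous_on_subset[OF dc]] d0 \<open>a < b\<close> t T False by force
   qed
   then show False using nz by blast
  qed
  then show ?thesis using G[OF t] \<open>a < b\<close> unfolding d0 by (simp add: d_def field_simps)
 qed
 then show ?thesis unfolding slopes_def by (metis diff_self mult_zero_right order_le_less order_refl)
qed

lemma Q_time_continuous: "continuous_on {-T..T} (%s. Q s (q s \<xi>))"
 by (rule continuous_on_compose_Lipschitz[OF PQ(3) VQ_time_continuous(2) q(2)])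

text \<open>Only the end points of the interval move here: \<open>W (t + h)\<close> has slope \<open>V (t + h)\<close>, and \<open>V\<close> is uniformly continuous.\<close>

lemma W_transported:
 assumes t: "t \<in> {-T<..<T}"
 shows "((%h. (W (t + h) (q (t + h) \<xi> + c) - W (t + h) (q t \<xi> + c)) / h) \<longlongrightarrow> U t \<xi> * V t (q t \<xi> + c)) (at 0)"
proof -
 have t': "t \<in> {-T..T}" using t by simp
 define k where "k h = q (t + h) \<xi> - q t \<xi>" for h
 define R where "R h = W (t + h) (q (t + h) \<xi> + c) - W (t + h) (q t \<xi> + c) - k h * V t (q t \<xi> + c)" for h
 have A: "((%h. k h / h * V t (q t \<xi> + c)) \<longlongrightarrow> U t \<xi> * V t (q t \<xi> + c)) (at 0)"
  using q_deriv[OF t, of \<xi>] unfolding DERIV_def k_def by (intro tendsto_mult tendsto_const)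
 have "((%h. R h / h) \<longlongrightarrow> 0) (at 0)"
 proof (rule tendstoI)
  fix e :: real assume e: "0 < e"
  define \<eta> where "\<eta> = e / (4 * K)"
  have \<eta>: "0 < \<eta>" using e K by (simp add: \<eta>_def)
  have K\<eta>: "K * \<eta> = e / 4" using K by (simp add: \<eta>_def)
  obtain \<delta> where \<delta>: "0 < \<delta>" "!!s x. s \<in> {-T..T} ==> abs (s - t) < \<delta> ==> abs (V s x - V t x) <= \<eta>"
   using sup_close[OF t' \<eta>] by blast
  define r where "r = min \<delta> (min (T - abs t) (\<eta> / K^2))"
  have r: "0 < r" using \<delta>(1) t \<eta> K by (auto simp: r_def)
  show "\<forall>\<^sub>F h in at 0. dist (R h / h) 0 < e"
   unfolding eventually_at
  proof (intro exI[of _ r] conjI ballI impI r)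
   fix h :: real assume "h ~= 0 & dist h 0 < r"
   then have h: "h ~= 0" "abs h < \<delta>" "abs h < T - abs t" "abs h < \<eta> / K^2" by (auto simp: r_def dist_real_def)
   then have th: "t + h \<in> {-T..T}" by auto
   have kh: "abs (k h) <= K * abs h" using q_time[OF t' th, of \<xi>] by (simp add: k_def)
   have kh2: "K * abs (k h) <= \<eta>"
   proof -
    have "K * abs (k h) <= K * (K * abs h)" by (rule mult_left_mono[OF kh]) (use K in simp)
    also have "... = K^2 * abs h" by (simp add: power2_eq_square)
    also have "... <= K^2 * (\<eta> / K^2)" by (rule mult_left_mono) (use h(4) in auto)
    also have "... = \<eta>" by (rule pos_mult_divide_cancel) (use K in simp)
    finally show ?thesis .
   qed
   have "abs (R h) <= (K * abs (k h) + \<eta>) * abs (k h)"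
    using W_increment[OF th t' \<delta>(2)[OF th], of "q (t + h) \<xi> + c" "q t \<xi> + c"] h(2) by (simp add: R_def k_def)
   also have "(K * abs (k h) + \<eta>) * abs (k h) <= (\<eta> + \<eta>) * (K * abs h)" by (rule mult_mono) (use kh2 kh \<eta> in auto)
   also have "(\<eta> + \<eta>) * (K * abs h) = 2 * (K * \<eta>) * abs h" by (simp add: algebra_simps)
   also have "2 * (K * \<eta>) * abs h = e / 2 * abs h" unfolding K\<eta> by simp
   finally have "abs (R h) / abs h <= e / 2" using h(1) by (simp add: pos_divide_le_eq)
   then show "dist (R h / h) 0 < e" unfolding dist_real_def diff_0_right abs_divide using e by linarith
  qed
 qed
 from tendsto_add[OF this A] show ?thesis by (simp add: R_def diff_divide_distrib)
qed

text \<open>The flux through the moving end points leaves \<open>- \<integral> u u\<^sub>x + \<integral> u\<^sub>x (u \<circ> q)\<close> and the increment of \<open>P\<close> over an interval of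
  length \<open>eps\<close>. The first is of order \<open>eps\<^sup>2\<close> since \<open>u\<close> is Lipschitz, and the increment of \<open>P\<close> is \<open>eps Q\<close> up to order
  \<open>eps\<^sup>2\<close> since \<open>Q\<close> is Lipschitz.\<close>

lemma transported_average_deriv:
 assumes t: "t \<in> {-T<..<T}" and eps: "0 < eps"
 shows "\<exists>D. ((%t. (W t (q t \<xi> + eps) - W t (q t \<xi>)) + eps * tint (%s. Q s (q s \<xi>)) t) has_real_derivative D) (at t) & abs D <= (K^2 + 2 * B) * eps^2"
proof -
 have t': "t \<in> {-T..T}" using t by simp
 define y where "y = q t \<xi>"
 define D where "D = U t \<xi> * V t (y + eps) - U t \<xi> * V t (y + 0) + - (1 / 2 * (V t (y + eps) * V t (y + eps) - V t y * V t y) + (P t (y + eps) - P t y)) + eps * Q t y"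
 let ?f = "%t. (W t (q t \<xi> + eps) - W t (q t \<xi>)) + eps * tint (%s. Q s (q s \<xi>)) t"
 have 1: "((%h. (tint (%s. Q s (q s \<xi>)) (t + h) - tint (%s. Q s (q s \<xi>)) t) / h) \<longlongrightarrow> Q t y) (at 0)"
  using tint_has_real_derivative[OF Q_time_continuous t, of \<xi>] by (simp add: DERIV_def y_def)
 have "((%h. (W (t + h) (q (t + h) \<xi> + eps) - W (t + h) (y + eps)) / h - (W (t + h) (q (t + h) \<xi> + 0) - W (t + h) (y + 0)) / h
  + (seg_int (V (t + h)) y (y + eps) - seg_int (V t) y (y + eps)) / h + eps * ((tint (%s. Q s (q s \<xi>)) (t + h) - tint (%s. Q s (q s \<xi>)) t) / h)) \<longlongrightarrow> D) (at 0)"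
  unfolding D_def
  by (intro tendsto_add tendsto_diff tendsto_mult tendsto_const 1 W_transported[OF t, of \<xi>, folded y_def] momentum_balance[OF t]) (use eps in simp)
 moreover have "\<forall>\<^sub>F h in at 0. (W (t + h) (q (t + h) \<xi> + eps) - W (t + h) (y + eps)) / h - (W (t + h) (q (t + h) \<xi> + 0) - W (t + h) (y + 0)) / h
  + (seg_int (V (t + h)) y (y + eps) - seg_int (V t) y (y + eps)) / h + eps * ((tint (%s. Q s (q s \<xi>)) (t + h) - tint (%s. Q s (q s \<xi>)) t) / h)
  = (?f (t + h) - ?f t) / h"
  unfolding eventually_at
 proof (intro exI[of _ "T - abs t"] conjI ballI impI)
  show "0 < T - abs t" using t by auto
  fix h :: real assume "h ~= 0 & dist h 0 < T - abs t"
  then have th: "t + h \<in> {-T..T}" by (auto simp: dist_real_def)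
  have "y <= y + eps" using eps by simp
  show "(W (t + h) (q (t + h) \<xi> + eps) - W (t + h) (y + eps)) / h - (W (t + h) (q (t + h) \<xi> + 0) - W (t + h) (y + 0)) / h
  + (seg_int (V (t + h)) y (y + eps) - seg_int (V t) y (y + eps)) / h + eps * ((tint (%s. Q s (q s \<xi>)) (t + h) - tint (%s. Q s (q s \<xi>)) t) / h)
  = (?f (t + h) - ?f t) / h"
   unfolding W_seg[OF th \<open>y <= y + eps\<close>, symmetric] W_seg[OF t' \<open>y <= y + eps\<close>, symmetric] y_def[symmetric]
   by (simp add: diff_divide_distrib add_divide_distrib right_diff_distrib)
 qed
 ultimately have "((%h. (?f (t + h) - ?f t) / h) \<longlongrightarrow> D) (at 0)" by (rule Lim_transform_eventually)
 then have der: "(?f has_real_derivative D) (at t)" by (simp add: DERIV_def)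
 have Ql: "loc_int (Q t)" by (rule primitive_loc[OF PQ(2)[OF t']])
 have Pe: "P t (y + eps) - P t y = seg_int (Q t) y (y + eps)" by (rule primitiveD[OF PQ(2)[OF t']]) (use eps in simp)
 have Qn: "abs (Q t z - Q t y) <= 2 * B * eps" if "z \<in> {y..y + eps}" for z
  by (rule order_trans[OF PQ(3)[OF t'] mult_left_mono]) (use that B in auto)
 have "seg_int (Q t) y (y + eps) <= seg_int (%_. Q t y + 2 * B * eps) y (y + eps)"
  by (rule set_integral_mono[OF loc_int_seg[OF Ql] loc_int_seg[OF loc_int_const]]) (use Qn in \<open>force simp: abs_le_iff\<close>)
 also have "... = (Q t y + 2 * B * eps) * eps" using seg_int_const[of y "y + eps"] eps by simp
 finally have P1: "P t (y + eps) - P t y - eps * Q t y <= 2 * B * eps^2" unfolding Pe by (simp add: algebra_simps power2_eq_square)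
 have "seg_int (%_. Q t y - 2 * B * eps) y (y + eps) <= seg_int (Q t) y (y + eps)"
  by (rule set_integral_mono[OF loc_int_seg[OF loc_int_const] loc_int_seg[OF Ql]]) (use Qn in \<open>force simp: abs_le_iff\<close>)
 moreover have "seg_int (%_. Q t y - 2 * B * eps) y (y + eps) = (Q t y - 2 * B * eps) * eps" using seg_int_const[of y "y + eps"] eps by simp
 ultimately have P2: "- (2 * B * eps^2) <= P t (y + eps) - P t y - eps * Q t y" unfolding Pe by (simp add: algebra_simps power2_eq_square)
 have "abs (V t (y + eps) - V t y) <= K * eps" using V_bound(2)[OF t', of "y + eps" y] eps by simp
 then have "(V t (y + eps) - V t y)^2 <= (K * eps)^2" using eps K by (simp add: abs_le_square_iff[symmetric])
 then have V2: "(V t (y + eps) - V t y)^2 <= K^2 * eps^2" by (simp add: power_mult_distrib)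
 have Deq: "D = - (1 / 2) * (V t (y + eps) - V t y)^2 - (P t (y + eps) - P t y - eps * Q t y)"
  by (simp add: D_def U_def y_def power2_eq_square algebra_simps)
 have tri: "abs (- (1 / 2) * v - p) <= v' + p'" if "0 <= v" "v <= v'" "p <= p'" "- p' <= p" for v v' p p' :: real using that by (simp add: abs_le_iff)
 have "abs D <= K^2 * eps^2 + 2 * B * eps^2" unfolding Deq by (rule tri[OF _ V2 P1 P2]) simp
 then show ?thesis using der by (auto simp: distrib_right)
qed

text \<open>The averages of \<open>V\<close> over the transported intervals satisfy the equation up to an error of order \<open>eps\<close>; let \<open>eps \<rightarrow> 0\<close>.\<close>

lemma Lagrangian_momentum:
 assumes t: "t \<in> {-T..T}"
 shows "U t \<xi> = V 0 \<xi> - tint (%s. Q s (q s \<xi>)) t"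
proof -
 define g where "g t = U t \<xi> - V 0 \<xi> + tint (%s. Q s (q s \<xi>)) t" for t
 have g0: "g t = 0" if t: "t \<in> {-T<..<T}" for t
 proof -
  have t': "t \<in> {-T..T}" and z: "0 \<in> {-T..T}" "0 \<in> {-T<..<T}" using t by auto
  define C where "C = (K^2 + 2 * B) * T + 2 * K"
  have C: "0 <= C" using K B T by (simp add: C_def)
  have "abs (g t) <= C * eps" if eps: "0 < eps" for eps
  proof -
   let ?f = "%t. (W t (q t \<xi> + eps) - W t (q t \<xi>)) + eps * tint (%s. Q s (q s \<xi>)) t"
   have "\<forall>t\<in>{-T<..<T}. \<exists>D. (?f has_real_derivative D) (at t) & abs D <= (K^2 + 2 * B) * eps^2"
    by (intro ballI transported_average_deriv[OF _ eps])
   from bchoice[OF this] obtain f' where f': "!!t. t \<in> {-T<..<T} ==> (?f has_real_derivative f' t) (at t)" "!!t. t \<in> {-T<..<T} ==> abs (f' t) <= (K^2 + 2 * B) * eps^2"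
    by blast
   have "norm (?f t - ?f 0) <= (K^2 + 2 * B) * eps^2 * norm (t - 0)"
    by (rule field_differentiable_bound[of "{-T<..<T}" ?f f']) (use f' t z in \<open>auto intro: has_field_derivative_at_within\<close>)
   moreover have "(K^2 + 2 * B) * eps^2 * norm (t - 0) <= (K^2 + 2 * B) * eps^2 * T"
    by (rule mult_left_mono) (use t B in auto)
   ultimately have 1: "abs (?f t - ?f 0) <= (K^2 + 2 * B) * eps^2 * T" unfolding real_norm_def by (rule order_trans)
   have 2: "abs (W t (q t \<xi> + eps) - W t (q t \<xi>) - eps * U t \<xi>) <= K * eps^2"
    using W_increment[OF t' t', of 0 "q t \<xi> + eps" "q t \<xi>"] eps by (simp add: U_def power2_eq_square)
   have 3: "abs (W 0 (\<xi> + eps) - W 0 \<xi> - eps * V 0 \<xi>) <= K * eps^2"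
    using W_increment[OF z(1) z(1), of 0 "\<xi> + eps" \<xi>] eps by (simp add: power2_eq_square)
   have tri: "abs (b - c + d) <= p + p' + p''" if "abs ((a + d) - (e + 0)) <= p" "abs (a - b) <= p'" "abs (e - c) <= p''" for a b c d e p p' p'' :: real
    using that by linarith
   have "abs (eps * U t \<xi> - eps * V 0 \<xi> + eps * tint (%s. Q s (q s \<xi>)) t) <= (K^2 + 2 * B) * eps^2 * T + K * eps^2 + K * eps^2"
    by (rule tri[OF _ 2 3]) (use 1 in \<open>simp add: q_0\<close>)
   also have "eps * U t \<xi> - eps * V 0 \<xi> + eps * tint (%s. Q s (q s \<xi>)) t = eps * g t" by (simp add: g_def algebra_simps)
   finally have "eps * abs (g t) <= eps * (C * eps)" using eps by (simp add: abs_mult C_def algebra_simps power2_eq_square)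
   then show ?thesis using eps by simp
  qed
  note b = this
  have "abs (g t) <= 0"
  proof (rule field_le_epsilon)
   fix e :: real assume e: "0 < e"
   have "abs (g t) <= C * (e / (C + 1))" by (rule b) (use e C in simp)
   also have "... <= (C + 1) * (e / (C + 1))" by (rule mult_right_mono) (use e C in auto)
   also have "... = e" by (rule pos_mult_divide_cancel) (use C in simp)
   finally show "abs (g t) <= 0 + e" by simp
  qed
  then show ?thesis by simp
 qed
 have tc: "continuous_on {-T..T} (tint (%s. Q s (q s \<xi>)))"
  by (rule Lipschitz_continuous_on[of _ _ B], rule tint_Lipschitz[OF Q_time_continuous]) (use PQ(1) in auto)
 have gc: "continuous_on {-T..T} g" unfolding g_def by (intro continuous_intros q(1) tc)
 have cl: "closure {-T<..<T} = {-T..T}" using T by simp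
 have "g t = 0" by (rule continuous_constant_on_closure[of "{-T<..<T}" g]) (use gc g0 t cl in auto)
 then show ?thesis by (simp add: g_def)
qed

definition \<beta> :: real where "\<beta> = exp (K * T)"
definition \<Lambda> :: real where "\<Lambda> = max 1 (2 * B)"

lemma \<beta>: "1 <= \<beta>" using K T by (simp add: \<beta>_def)

lemma params: "lag_params T (1 / \<beta>) \<beta> (K * \<beta>) (4 * \<beta>) \<Lambda> (%_. K * \<beta>)"
proof
 show "kconv (1 / \<beta> / 2) (%_. K * \<beta>) x <= 4 * \<beta> * (K * \<beta>)" for x
  using kconv_cmult[of "1 / \<beta> / 2" "K * \<beta>" "%_. 1" x] kconv_one[of "1 / \<beta> / 2" x] \<beta> by simp
 show "weight (K * \<beta>) (%_. K * \<beta>)" by (rule weight_const) (use K \<beta> in simp)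
qed (use T \<beta> in \<open>auto simp: \<Lambda>_def\<close>)

lemma U_Phi:
 assumes t: "t \<in> {-T..T}"
 shows "U t \<xi> = Phi kap (V 0) U t \<xi>"
proof -
 have "Qt kap U s \<xi> = Q s (q s \<xi>)" if "s \<in> {-T..T}" for s
 proof -
  have qs: "qf U s = q s" by (rule ext) (rule q(3)[OF that])
  show ?thesis unfolding Qt_def qs Q_def
   by (rule lag_PQ_euler(2)[OF q_slopes[OF that] _ V_bound(2)[OF that]]) (auto simp: U_def)
 qed
 then have "tint (%s. Qt kap U s \<xi>) t = tint (%s. Q s (q s \<xi>)) t"
  unfolding tint_def using t by (auto intro!: integral_cong)
 then show ?thesis unfolding Phi_def using Lagrangian_momentum[OF t] by simp
qed

text \<open>No decay is available for an arbitrary solution, hence the constant weight.\<close>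

lemma U_traj: "lag_params.traj T (1 / \<beta>) \<beta> \<Lambda> (%_. K * \<beta>) U"
proof -
 have wc: "wbd (%_. K * \<beta>) k h" if "!!x. abs (h x) <= k * (K * \<beta>)" "!!a b. a <= b ==> abs (h b - h a) <= k * (K * \<beta>) * (b - a)" for k h
 proof (unfold wbd_def, intro conjI allI impI)
  show "abs (h x) <= k * (K * \<beta>)" for x by (rule that(1))
  fix a b :: real assume ab: "a <= b"
  show "abs (h b - h a) <= k * seg_int (%_. K * \<beta>) a b"
   unfolding seg_int_const[OF ab] by (subst mult.assoc[symmetric]) (rule that(2)[OF ab])
 qed
 have Kb: "1 <= K * \<beta>" "K <= K * \<beta>" using mult_mono[of 1 K 1 \<beta>] mult_left_mono[of 1 \<beta> K] K \<beta> by auto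
 have sl: "slopes (1 / \<beta>) \<beta> (qf U t)" if "t \<in> {-T..T}" for t
 proof -
  have "qf U t = q t" by (rule ext) (rule q(3)[OF that])
  then show ?thesis using q_slopes[OF that] by (simp add: \<beta>_def)
 qed
 have qb: "abs (q t b - q t a) <= \<beta> * (b - a)" if "t \<in> {-T..T}" "a <= b" for t a b
  using slopes_abs(2)[OF q_slopes[OF that(1)], of b a] that(2) by (simp add: \<beta>_def)
 show ?thesis
  unfolding lag_params.traj_def[OF params]
 proof (intro conjI ballI sl)
  fix t assume t: "t \<in> {-T..T}"
  show "wbd (%_. K * \<beta>) 1 (U t)"
  proof (rule wc)
   show "abs (U t x) <= 1 * (K * \<beta>)" for x using V_bound(1)[OF t, of "q t x"] Kb by (simp add: U_def)
   fix a b :: real assume ab: "a <= b"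
   have "abs (U t b - U t a) <= K * abs (q t b - q t a)" unfolding U_def by (rule V_bound(2)[OF t])
   also have "... <= K * (\<beta> * (b - a))" by (rule mult_left_mono[OF qb[OF t ab]]) (use K in simp)
   finally show "abs (U t b - U t a) <= 1 * (K * \<beta>) * (b - a)" by (simp add: mult.assoc)
  qed
 next
  fix s t assume st: "s \<in> {-T..T}" "t \<in> {-T..T}"
  let ?S = "%x. tint (%s. Q s (q s x))"
  have eq: "U t x - U s x = - (?S x t - ?S x s)" for x using Lagrangian_momentum st by simp
  have L: "2 * B <= \<Lambda>" "1 <= \<Lambda>" by (simp_all add: \<Lambda>_def)
  show "wbd (%_. K * \<beta>) (\<Lambda> * abs (t - s)) (%x. U t x - U s x)"
  proof (rule wc)
   fix x
   have "abs (?S x t - ?S x s) <= B * abs (t - s)" by (rule tint_Lipschitz[OF Q_time_continuous _ st]) (rule PQ(1))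
   also have "... <= \<Lambda> * abs (t - s) * 1" using mult_right_mono[of B \<Lambda> "abs (t - s)"] L B by simp
   also have "... <= \<Lambda> * abs (t - s) * (K * \<beta>)" by (rule mult_left_mono) (use Kb L in auto)
   finally show "abs (U t x - U s x) <= \<Lambda> * abs (t - s) * (K * \<beta>)" unfolding eq by simp
  next
   fix a b :: real assume ab: "a <= b"
   have c: "continuous_on {-T..T} (%s. Q s (q s b) - Q s (q s a))" by (intro continuous_on_diff Q_time_continuous)
   have "abs (tint (%s. Q s (q s b) - Q s (q s a)) t - tint (%s. Q s (q s b) - Q s (q s a)) s) <= 2 * B * (\<beta> * (b - a)) * abs (t - s)"
   proof (rule tint_Lipschitz[OF c _ st])
    fix r assume r: "r \<in> {-T..T}"
    show "abs (Q r (q r b) - Q r (q r a)) <= 2 * B * (\<beta> * (b - a))"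
     by (rule order_trans[OF PQ(3)[OF r] mult_left_mono[OF qb[OF r ab]]]) (use B in simp)
   qed
   also have "2 * B * (\<beta> * (b - a)) * abs (t - s) <= \<Lambda> * (K * \<beta> * (b - a)) * abs (t - s)"
    by (intro mult_right_mono mult_mono) (use L Kb K \<beta> B ab in auto)
   finally have "abs (tint (%s. Q s (q s b) - Q s (q s a)) t - tint (%s. Q s (q s b) - Q s (q s a)) s) <= \<Lambda> * abs (t - s) * (K * \<beta>) * (b - a)"
    by (simp add: algebra_simps)
   then show "abs ((U t b - U s b) - (U t a - U s a)) <= \<Lambda> * abs (t - s) * (K * \<beta>) * (b - a)"
    unfolding eq tint_diff[OF Q_time_continuous Q_time_continuous st(1)] tint_diff[OF Q_time_continuous Q_time_continuous st(2)] by (simp add: abs_le_iff algebra_simps)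
  qed
 qed
qed

end

lemma eulerian_sol_unique:
 assumes V1: "eulerian_sol kap T K V1" and V2: "eulerian_sol kap T K V2" and eq: "V1 0 = V2 0" and t: "t \<in> {-T..T}"
 shows "V1 t = V2 t"
proof -
 note p = eulerian_sol.params[OF V1] and q1 = eulerian_sol.q(3)[OF V1 t] and q2 = eulerian_sol.q(3)[OF V2 t]
 define U1 where "U1 = eulerian_sol.U T V1"
 define U2 where "U2 = eulerian_sol.U T V2"
 note tr1 = eulerian_sol.U_traj[OF V1, folded U1_def] and tr2 = eulerian_sol.U_traj[OF V2, folded U2_def]
 have f1: "U1 s x = Phi kap (V1 0) U1 s x" if "s \<in> {-T..T}" for s x unfolding U1_def by (rule eulerian_sol.U_Phi[OF V1 that])
 have f2: "U2 s x = Phi kap (V1 0) U2 s x" if "s \<in> {-T..T}" for s x unfolding U2_def eq by (rule eulerian_sol.U_Phi[OF V2 that])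
 have UU: "U1 s x = U2 s x" if "s \<in> {-T..T}" for s x
  by (rule lag_params.lag_unique[OF p tr1 tr2 f1 f2 that])
 have "tint (%s. U1 s x) t = tint (%s. U2 s x) t" for x unfolding tint_def using UU t by (auto intro!: integral_cong)
 then have qq: "eulerian_sol.q T V1 t x = eulerian_sol.q T V2 t x" for x
  using q1[of x] q2[of x] by (simp add: qf_def flip: U1_def U2_def)
 show ?thesis
 proof
  fix y
  obtain x where x: "eulerian_sol.q T V1 t x = y" using slopes_surj[OF eulerian_sol.q_slopes[OF V1 t], of y] by auto
  then show "V1 t y = V2 t y" using UU[OF t, of x] qq[of x] by (simp add: U1_def U2_def eulerian_sol.U_def[OF V1] eulerian_sol.U_def[OF V2])
 qed
qed

lemma AE_lborel_interval:
 assumes "AE x in lborel. P x" "a < (b :: real)"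
 shows "\<exists>x. a < x & x < b & P x"
proof (rule ccontr)
 assume n: "\<not> ?thesis"
 have "AE x in lborel. x \<notin> {a<..<b}" using assms(1) n by (auto elim!: eventually_mono)
 then have "emeasure lborel {x. a < x & x < b} = 0" by (subst (asm) AE_iff_measurable[OF _ refl]) auto
 moreover have "{x. a < x & x < b} = {a<..<b}" by auto
 ultimately have "emeasure lborel {a<..<b} = 0" by simp
 then show False using assms(2) by simp
qed

lemma bLip_mono: "bLip K u ==> K <= K' ==> bLip K' u"
 unfolding bLip_def by (meson abs_ge_zero mult_right_mono order_trans)

text \<open>The class bounds the \<open>W\<^sup>1\<^sup>,\<^sup>\<infinity>\<close> norm for almost all times only. Continuity in \<open>H1\<close> extends the bound to all times,
  because a bound on values and slopes survives convergence in \<open>L2\<close>, and the continuous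
  representatives form the required family.\<close>

lemma CH_solution_eulerian:
 assumes sol: "CH_solution kap T u0 v" and T: "0 < T"
 shows "\<exists>V K0. (\<forall>t\<in>{-T..T}. AE x in lborel. v t x = V t x) & (\<forall>K\<ge>K0. eulerian_sol kap T K V)"
proof -
 have C: "v \<in> C_H1 T" "v \<in> Linf_W1inf T" "v \<in> C1_L2 T" using sol by (auto simp: CH_solution_def Z_space_def)
 have H1: "v t \<in> H1_space" if "t \<in> {-T..T}" for t using C(1) that by (simp add: C_H1_def)
 note vH = H1_space_primitive[OF H1]
 define V where "V t = (SOME F. primitive F (wd (v t)) & (AE x in lborel. v t x = F x))" for t
 have V: "primitive (V t) (wd (v t))" "AE x in lborel. v t x = V t x" if "t \<in> {-T..T}" for t
  using someI_ex[OF vH(1)[OF that]] unfolding V_def by auto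
 note Vw = weak_deriv_primitive(4)[OF V(1) V(1)]
 note Vb[measurable] = primitive_borel[OF V(1)]
 have VN: "N2 (V t) < \<infinity>" if "t \<in> {-T..T}" for t using vH(3)[OF that] N2_cong_AE[OF V(2)[OF that]] by simp
 have close': "\<exists>\<delta>>0. \<forall>t\<in>{-T..T}. abs (t - s) < \<delta> -->
   N2 (%x. V t x - V s x) <= ennreal e & N2 (%x. wd (v t) x - wd (v s) x) <= ennreal e" if s: "s \<in> {-T..T}" and e: "0 < e" for s e
 proof -
  have "((%t. H1_norm (%x. v t x - v s x)) \<longlongrightarrow> 0) (at s within {-T..T})" using C(1) s by (simp add: C_H1_def)
  then have "\<forall>\<^sub>F t in at s within {-T..T}. dist (H1_norm (%x. v t x - v s x)) 0 < sqrt e" by (rule tendstoD) (use e in simp)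
  then obtain \<delta> where \<delta>: "0 < \<delta>" "!!t. t \<in> {-T..T} ==> t ~= s ==> dist t s < \<delta> ==> dist (H1_norm (%x. v t x - v s x)) 0 < sqrt e"
   unfolding eventually_at by blast
  show ?thesis
  proof (intro exI[of _ \<delta>] conjI \<delta>(1) ballI impI)
   fix t assume t: "t \<in> {-T..T}" "abs (t - s) < \<delta>"
   have "AE x in lborel. v t x - v s x = V t x - V s x" using V(2)[OF t(1)] V(2)[OF s] by eventually_elim simp
   note H = H1_norm_sq[OF primitive_diff[OF V(1)[OF t(1)] V(1)[OF s]] borel_measurable_diff[OF vH(2)[OF t(1)] vH(2)[OF s]] this]
   have le: "enn2real (N2 (%x. V t x - V s x)) + enn2real (N2 (%x. wd (v t) x - wd (v s) x)) <= e"
   proof (cases "t = s")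
    case True then show ?thesis using e by (simp add: N2_def)
   next
    case False
    then have "H1_norm (%x. v t x - v s x) < sqrt e" using \<delta>(2)[OF t(1)] t(2) H(2) by (simp add: dist_real_def)
    then have "(H1_norm (%x. v t x - v s x))^2 <= (sqrt e)^2" by (intro power_mono H(2)) simp
    then show ?thesis unfolding H(1) using e by simp
   qed
   have f: "N2 (%x. V t x - V s x) < \<infinity>" "N2 (%x. wd (v t) x - wd (v s) x) < \<infinity>"
    by (intro N2_diff_finite Vb VN vH t s)+
   have fin: "N2 f <= ennreal e" if "N2 f < \<infinity>" "enn2real (N2 f) <= e" for f
    using that by (metis ennreal_enn2real ennreal_leI infinity_ennreal_def)
   show "N2 (%x. V t x - V s x) <= ennreal e" "N2 (%x. wd (v t) x - wd (v s) x) <= ennreal e"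
    by (rule fin[OF f(1)] fin[OF f(2)]; use le enn2real_nonneg[of "N2 (%x. V t x - V s x)"] enn2real_nonneg[of "N2 (%x. wd (v t) x - wd (v s) x)"] in linarith)+
  qed
 qed
 obtain M where M: "AE t in lborel. t \<in> {-T..T} --> v t \<in> W1inf_space & W1inf_norm (v t) <= M"
  using C(2) by (auto simp: Linf_W1inf_def)
 have good: "bLip M (V t)" if t: "t \<in> {-T..T}" and g: "v t \<in> W1inf_space" "W1inf_norm (v t) <= M" for t
 proof -
  note w = W1inf_space_primitive[OF g(1)]
  have n: "Linf_norm (v t) <= M" "Linf_norm (wd (v t)) <= M" using w(5,6) g(2) by (auto simp: W1inf_norm_def)
  have "AE x in lborel. abs (V t x) <= M" using w(3) V(2)[OF t] by eventually_elim (use n in simp)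
  moreover have "AE x in lborel. abs (wd (v t) x) <= M" using w(4) by eventually_elim (use n in simp)
  ultimately show ?thesis unfolding bLip_def
   using continuous_AE_abs_le[OF primitive_continuous[OF V(1)[OF t]]] primitive_abs_le[OF V(1)[OF t]] by blast
 qed
 have lipM: "bLip M (V t)" if t: "t \<in> {-T..T}" for t
 proof -
  have near: "\<exists>s. s \<in> {-T..T} & bLip M (V s) & (\<forall>x. abs (V s x - V t x) <= e)" if e: "0 < e" for e
  proof -
   obtain \<delta> where \<delta>: "0 < \<delta>" "!!s. s \<in> {-T..T} ==> abs (s - t) < \<delta> ==> N2 (%x. V s x - V t x) <= ennreal ((e / 2)^2) & N2 (%x. wd (v s) x - wd (v t) x) <= ennreal ((e / 2)^2)"
    using close'[OF t, of "(e / 2)^2"] e by auto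
   obtain s where s: "max (-T) (t - \<delta>) < s" "s < min T (t + \<delta>)" "s \<in> {-T..T} --> v s \<in> W1inf_space & W1inf_norm (v s) <= M"
    using AE_lborel_interval[OF M, of "max (-T) (t - \<delta>)" "min T (t + \<delta>)"] t \<delta>(1) T by auto
   then have si: "s \<in> {-T..T}" "abs (s - t) < \<delta>" by auto
   have "abs (V s x - V t x) <= e" for x
    using Sobolev[OF primitive_diff[OF V(1)[OF si(1)] V(1)[OF t]] \<delta>(2)[OF si, THEN conjunct1] \<delta>(2)[OF si, THEN conjunct2]] e by simp
   then show ?thesis using good[OF si(1)] s(3) si(1) by blast
  qed
  have "abs (V t x) <= M" for x
  proof (rule field_le_epsilon)
   fix e :: real assume "0 < e"
   from near[OF this] obtain s where "bLip M (V s)" "abs (V s x - V t x) <= e" by blast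
   then show "abs (V t x) <= M + e" unfolding bLip_def using abs_triangle_ineq2[of "V t x" "V s x"] by (smt (verit))
  qed
  moreover have "abs (V t b - V t a) <= M * abs (b - a)" for a b
  proof (rule field_le_epsilon)
   fix e :: real assume "0 < e"
   then have "0 < e / 2" by simp
   from near[OF this] obtain s where s: "bLip M (V s)" "\<forall>x. abs (V s x - V t x) <= e / 2" by blast
   have "abs (V s b - V s a) <= M * abs (b - a)" using s(1) by (simp add: bLip_def)
   then show "abs (V t b - V t a) <= M * abs (b - a) + e" using s(2)[rule_format, of a] s(2)[rule_format, of b] by linarith
  qed
  ultimately show ?thesis by (simp add: bLip_def)
 qed
 have "eulerian_sol kap T K V" if K: "max 1 M <= K" for K
 proof
  show "0 < T" "1 <= K" using T K by auto
  show lip: "bLip K (V t)" if "t \<in> {-T..T}" for t by (rule bLip_mono[OF lipM[OF that]]) (use K in simp)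
  show "\<exists>\<delta>>0. \<forall>t\<in>{-T..T}. abs (t - s) < \<delta> -->
   N2 (%x. V t x - V s x) <= ennreal e & N2 (%x. wd (V t) x - wd (V s) x) <= ennreal e" if s: "s \<in> {-T..T}" and e: "0 < e" for s e
  proof -
   have "N2 (%x. wd (V t) x - wd (V s) x) = N2 (%x. wd (v t) x - wd (v s) x)" if t: "t \<in> {-T..T}" for t
    by (rule N2_cong_AE) (use Vw[OF t t] Vw[OF s s] in \<open>eventually_elim, simp\<close>)
   then show ?thesis using close'[OF s e] by auto
  qed
  show "\<exists>\<delta>>0. \<forall>h. h ~= 0 --> abs h < \<delta> --> N2 (%x. (V (t + h) x - V t x) / h - vel kap (V t) x) <= ennreal e"
   if t: "t \<in> {-T<..<T}" and e: "0 < e" for t e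
  proof -
   have t': "t \<in> {-T..T}" using t by simp
   note l = lip[OF t']
   have [measurable]: "v t \<in> Borel" "wd (v t) \<in> Borel" using vH(2,5)[OF t'] .
   have "AE y in lborel. kap * v t y + (v t y)^2 + (wd (v t) y)^2 / 2 = euler_src kap (V t) y"
    using V(2)[OF t'] Vw[OF t' t'] by eventually_elim (simp add: euler_src_def)
   then have ie: "inv_Helmholtz (%y. kap * v t y + (v t y)^2 + (wd (v t) y)^2 / 2) = inv_Helmholtz (euler_src kap (V t))"
    by (intro inv_Helmholtz_cong_AE bLip_deriv(6)[OF l]) measurable
   have "AE x in lborel. time_deriv v t x + v t x * wd (v t) x = - wd (inv_Helmholtz (euler_src kap (V t))) x"
    using sol t unfolding CH_solution_def ie[symmetric] by blast
   then have tv: "AE x in lborel. time_deriv v t x = vel kap (V t) x"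
    using weak_deriv_inv_Helmholtz[OF l, of kap] V(2)[OF t'] Vw[OF t' t'] by eventually_elim (simp add: vel_def)
   have L2: "v s \<in> L2_space" if "abs (s - t) < T - abs t" for s
   proof -
    have "s \<in> {-T<..<T}" using that by auto
    then show ?thesis using C(3) by (simp add: C1_L2_def)
   qed
   have "\<exists>w. has_L2_time_deriv v w t" using C(3) t by (simp add: C1_L2_def)
   then have d: "has_L2_time_deriv v (time_deriv v t) t" using time_deriv_has_deriv by blast
   have r: "0 < T - abs t" using t by auto
   have "null (at 0) (%h x. (v (t + h) x - v t x) / h - time_deriv v t x)"
    using has_L2_time_deriv_iff[of t "T - abs t" v "time_deriv v t"] L2 r d by blast
   from null_D[OF this e] obtain \<delta>0 where \<delta>0: "0 < \<delta>0"
    "!!h. h ~= 0 ==> abs h < \<delta>0 ==> N2 (%x. (v (t + h) x - v t x) / h - time_deriv v t x) <= ennreal e"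
    unfolding eventually_at by auto
   define \<delta> where "\<delta> = min \<delta>0 (T - abs t)"
   have \<delta>: "0 < \<delta>" "\<delta> <= T - abs t"
    "!!h. h ~= 0 ==> abs h < \<delta> ==> N2 (%x. (v (t + h) x - v t x) / h - time_deriv v t x) <= ennreal e"
    using \<delta>0 r by (auto simp: \<delta>_def)
   show ?thesis
   proof (intro exI[of _ \<delta>] conjI \<delta>(1) allI impI)
    fix h :: real assume h: "h ~= 0" "abs h < \<delta>"
    then have th: "t + h \<in> {-T..T}" using \<delta>(2) by auto
    have "N2 (%x. (v (t + h) x - v t x) / h - time_deriv v t x) = N2 (%x. (V (t + h) x - V t x) / h - vel kap (V t) x)"
     by (rule N2_cong_AE) (use tv V(2)[OF th] V(2)[OF t'] in \<open>eventually_elim, simp\<close>)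
    then show "N2 (%x. (V (t + h) x - V t x) / h - vel kap (V t) x) <= ennreal e" using \<delta>(3)[OF h] by simp
   qed
  qed
 qed
 then show ?thesis using V(2) by blast
qed

lemma CH_solution_unique:
 assumes u: "CH_solution kap T u0 u" and v: "CH_solution kap T u0 v" and T: "0 < T" and t: "t \<in> {-T..T}"
 shows "AE x in lborel. u t x = v t x"
proof -
 obtain V1 K1 where V1: "!!t. t \<in> {-T..T} ==> AE x in lborel. u t x = V1 t x" "!!K. K1 <= K ==> eulerian_sol kap T K V1"
  using CH_solution_eulerian[OF u T] by blast
 obtain V2 K2 where V2: "!!t. t \<in> {-T..T} ==> AE x in lborel. v t x = V2 t x" "!!K. K2 <= K ==> eulerian_sol kap T K V2"
  using CH_solution_eulerian[OF v T] by blast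
 have z: "0 \<in> {-T..T}" using T by simp
 note e1 = V1(2)[OF max.cobounded1, of K2] and e2 = V2(2)[OF max.cobounded2, of K1]
 have "AE x in lborel. V1 0 x = V2 0 x"
  using V1(1)[OF z] V2(1)[OF z] u[unfolded CH_solution_def, THEN conjunct2, THEN conjunct1] v[unfolded CH_solution_def, THEN conjunct2, THEN conjunct1]
  by eventually_elim simp
 then have "V1 0 = V2 0"
  by (intro continuous_AE_eq_imp_eq eulerian_sol.V_continuous[OF e1 z] eulerian_sol.V_continuous[OF e2 z])
 then have "V1 t = V2 t" by (rule eulerian_sol_unique[OF e1 e2 _ t])
 then show ?thesis using V1(1)[OF t] V2(1)[OF t] by auto
qed

section \<open>Continuous dependence\<close>

context lag_sol
begin

text \<open>Otherwise there are data tending to that of \<open>U\<close> and times at which the solutions stay apart. A subsequence of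
  the times converges to some \<open>s\<close>, and at these times both \<open>U\<close> and the other solutions converge to \<open>eul U s\<close>.\<close>

lemma continuous_dependence:
 assumes e: "0 < e" and S: "0 <= S"
 shows "\<exists>\<delta>>0. \<forall>d V. close_data S d V --> d < \<delta> --> (\<forall>t\<in>{-T..T}.
  N2 (%x. eul U t x - eul V t x) <= ennreal e & N2 (%x. wd (eul U t) x - wd (eul V t) x) <= ennreal e)"
proof (rule ccontr)
 assume neg: "\<not> ?thesis"
 define near where "near V t \<longleftrightarrow> N2 (%x. eul U t x - eul V t x) <= ennreal e &
  N2 (%x. wd (eul U t) x - wd (eul V t) x) <= ennreal e" for V t
 have neg': "\<not> (\<exists>\<delta>>0. \<forall>d V. close_data S d V --> d < \<delta> --> (\<forall>t\<in>{-T..T}. near V t))"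
  unfolding near_def by (rule neg)
 define P where "P n p \<longleftrightarrow> close_data S (fst p) (fst (snd p)) & fst p < 1 / real (Suc n) & snd (snd p) \<in> {-T..T} &
  \<not> near (fst (snd p)) (snd (snd p))" for n p
 have "\<exists>p. P n p" for n
 proof -
  have "0 < 1 / real (Suc n)" by simp
  then obtain d V t where dVt: "close_data S d V" "d < 1 / real (Suc n)" "t \<in> {-T..T}" "\<not> near V t" using neg' by blast
  have "P n (d, V, t)" unfolding P_def fst_conv snd_conv by (intro conjI dVt)
  then show ?thesis by (rule exI)
 qed
 then have "\<forall>n. \<exists>p. P n p" by (rule allI)
 from choice[OF this] obtain p where p: "\<forall>n. P n (p n)" ..
 define d V t where "d n = fst (p n)" and "V n = fst (snd (p n))" and "t n = snd (snd (p n))" for n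
 note pn = p[unfolded P_def, folded d_def V_def t_def, rule_format]
 have cd: "close_data S (d n) (V n)" and dn: "d n < 1 / real (Suc n)" and t: "t n \<in> {-T..T}" for n
  by (rule pn[THEN conjunct1] pn[THEN conjunct2, THEN conjunct1] pn[THEN conjunct2, THEN conjunct2, THEN conjunct1])+
 note far = pn[THEN conjunct2, THEN conjunct2, THEN conjunct2, unfolded near_def]
 have d0: "0 < d n" for n using cd[of n] by (simp add: close_data_def)
 obtain s r where s: "s \<in> {-T..T}" and r: "strict_mono (r :: nat => nat)" and lim: "(%n. t (r n)) \<longlonglongrightarrow> s"
  using compact_Icc[of "-T" T] t unfolding compact_def comp_def by metis
 have "d \<longlonglongrightarrow> 0"
  by (rule tendsto_sandwich[OF _ _ tendsto_const LIMSEQ_inverse_real_of_nat]) (use d0 dn in \<open>auto intro!: always_eventually less_imp_le simp: inverse_eq_divide\<close>)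
 then have dr: "(%n. d (r n)) \<longlonglongrightarrow> 0" using LIMSEQ_subseq_LIMSEQ[OF _ r] by (simp add: comp_def)
 define S' where "S' = S + enn2real (N2 D)"
 have S': "0 <= S'" "S <= S'" "enn2real (N2 D) <= S'" using S by (auto simp: S'_def)
 have cd': "close_data S' (d n) (V n)" for n
 proof -
  have "N2 X <= ennreal S ==> N2 X <= ennreal S'" "N2 X <= ennreal (S * (d n)^2) ==> N2 X <= ennreal (S' * (d n)^2)" for X
   using S'(2) by (auto elim!: order_trans intro!: ennreal_leI mult_right_mono)
  then show ?thesis using cd[of n] unfolding close_data_def by blast
 qed
 have ev: "\<forall>\<^sub>F n in sequentially. t (r n) \<in> {-T..T} & close_data S' (d (r n)) (V (r n))"
  "\<forall>\<^sub>F n in sequentially. t (r n) \<in> {-T..T} & close_data S' (d (r n)) U"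
  using t cd' close_data_self[OF d0 S'(3)] by auto
 note V = eul_tendsto[OF s S'(1) lim dr ev(1)] and W = eul_tendsto[OF s S'(1) lim dr ev(2)]
 have bV: "bLip Kb (eul (V n) (t n))" for n
 proof -
  obtain D' v0 where L: "lag_sol kap T \<alpha> \<beta> M c \<Lambda> D' (V n) v0" using cd[of n] unfolding close_data_def by blast
  show ?thesis using lag_sol.eul_bLip[OF L t] lag_sol.Kb_def[OF L] by (simp add: Kb_def)
 qed
 note [measurable] = bLip_deriv(3,4)[OF bV] bLip_deriv(3,4)[OF eul_bLip[OF t]] bLip_deriv(3,4)[OF eul_bLip[OF s]]
 have n1: "null sequentially (%n x. eul U (t (r n)) x - eul (V (r n)) (t (r n)) x)"
  by (rule null_sum[OF W(1) V(1)]) (intro always_eventually allI conjI AE_I2; (measurable | linarith))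
 have n2: "null sequentially (%n x. wd (eul U (t (r n))) x - wd (eul (V (r n)) (t (r n))) x)"
  by (rule null_sum[OF W(2) V(2)]) (intro always_eventually allI conjI AE_I2; (measurable | linarith))
 have "\<forall>\<^sub>F n in sequentially. False" using null_D[OF n1 e] null_D[OF n2 e]
 proof eventually_elim
  case (elim n)
  show ?case by (rule notE[OF far conjI[OF elim(1) elim(2)]])
 qed
 then show False by simp
qed

end

section \<open>Data in X\<close>

lemma X_norm_nonneg: assumes "u \<in> X_space" shows "0 <= X_norm u"
 using assms W1inf_space_primitive(5,6)[of u] by (auto simp: X_space_def X_norm_def W1inf_norm_def H1_norm_def)

text \<open>The derivative is truncated at its essential bound so that the weight is bounded everywhere.\<close>

lemma X_space_weight:
 assumes u: "u \<in> X_space"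
 shows "\<exists>F N. (AE x in lborel. u x = F x) & weight (X_norm u) N & N2 N <= ennreal (4 * (X_norm u)^2) & wbd N 1 F"
proof -
 have uH: "u \<in> H1_space" and uW: "u \<in> W1inf_space" using u by (auto simp: X_space_def)
 note h = H1_space_primitive[OF uH] and w = W1inf_space_primitive[OF uW]
 obtain F where F: "primitive F (wd u)" "AE x in lborel. u x = F x" using h(1) by blast
 note sq = H1_norm_sq[OF F(1) h(2) F(2)]
 define m where "m = X_norm u"
 have m: "H1_norm u <= m" "Linf_norm u <= m" "Linf_norm (wd u) <= m" "0 <= m"
  using w(5,6) sq(2) by (auto simp: m_def X_norm_def W1inf_norm_def)
 have "(H1_norm u)^2 <= m^2" by (rule power_mono[OF m(1) sq(2)])
 then have en: "enn2real (N2 F) + enn2real (N2 (wd u)) <= m^2" unfolding sq(1) .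
 have fin: "N2 f <= ennreal (m^2)" if "N2 f < \<infinity>" "enn2real (N2 f) <= m^2" for f
  using that by (metis ennreal_enn2real ennreal_leI infinity_ennreal_def)
 have NF: "N2 F <= ennreal (m^2)" by (rule fin) (use h(3) N2_cong_AE[OF F(2)] en enn2real_nonneg[of "N2 (wd u)"] in \<open>auto simp del: enn2real_nonneg\<close>)
 have Nw: "N2 (wd u) <= ennreal (m^2)" by (rule fin[OF h(4)]) (use en enn2real_nonneg[of "N2 F"] in linarith)
 have [measurable]: "F \<in> Borel" "wd u \<in> Borel" using primitive_borel[OF F(1)] h(5) .
 have "AE x in lborel. abs (F x) <= m" using w(3) F(2) by eventually_elim (use m in simp)
 then have Fb: "abs (F x) <= m" for x by (rule continuous_AE_abs_le[OF primitive_continuous[OF F(1)]])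
 have wb: "AE x in lborel. abs (wd u x) <= m" using w(4) by eventually_elim (use m in simp)
 define N where "N x = max (abs (F x)) (min m (abs (wd u x)))" for x
 have NW: "weight m N" unfolding weight_def
 proof (intro conjI allI)
  show "N \<in> Borel" unfolding N_def by measurable
  show "0 <= N x" "N x <= m" for x using Fb[of x] by (auto simp: N_def)
 qed
 have a: "N2 (%x. abs (f x)) = N2 f" for f by (simp add: N2_def)
 have "N2 N <= N2 (%x. abs (F x) + abs (wd u x))" by (rule N2_mono) (auto simp: N_def)
 also have "... <= ennreal (2 * m^2 + 2 * m^2)"
  by (rule N2_add_le) (use NF Nw in \<open>auto simp: a\<close>)
 finally have NN: "N2 N <= ennreal (4 * m^2)" by simp
 have "wbd N 1 F"
 proof (rule wbd_of_primitive[OF NW F(1)])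
  show "AE x in lborel. abs (wd u x) <= 1 * N x" using wb by eventually_elim (simp add: N_def)
 qed (simp add: N_def)
 then show ?thesis using F(2) NW NN unfolding m_def by blast
qed

lemma X_space_diff:
 assumes "u \<in> X_space" "v \<in> X_space"
 shows "(%x. u x - v x) \<in> X_space"
proof -
 note hu = H1_space_primitive[of u] and hv = H1_space_primitive[of v] and wu = W1inf_space_primitive[of u] and wv = W1inf_space_primitive[of v]
 have H: "u \<in> H1_space" "v \<in> H1_space" "u \<in> W1inf_space" "v \<in> W1inf_space" using assms by (auto simp: X_space_def)
 obtain F G where F: "primitive F (wd u)" "AE x in lborel. u x = F x" and G: "primitive G (wd v)" "AE x in lborel. v x = G x"
  using hu(1) hv(1) H by blast
 have ae: "AE x in lborel. u x - v x = F x - G x" using F(2) G(2) by eventually_elim simp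
 note p = primitive_diff[OF F(1) G(1)] and b = borel_measurable_diff[OF hu(2)[OF H(1)] hv(2)[OF H(2)]]
 have "N2 F < \<infinity>" "N2 G < \<infinity>" using hu(3) hv(3) H N2_cong_AE[OF F(2)] N2_cong_AE[OF G(2)] by auto
 then have "(%x. u x - v x) \<in> H1_space"
  by (intro H1_space_I[OF p b ae] N2_diff_finite primitive_borel[OF F(1)] primitive_borel[OF G(1)] hu hv H)
 moreover have "(%x. u x - v x) \<in> W1inf_space"
 proof (rule W1inf_space_I(1)[OF p b ae])
  show "AE x in lborel. abs (F x - G x) <= Linf_norm u + Linf_norm v"
   using F(2) G(2) wu(3)[OF H(3)] wv(3)[OF H(4)] by eventually_elim linarith
  show "AE x in lborel. abs (wd u x - wd v x) <= Linf_norm (wd u) + Linf_norm (wd v)"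
   using wu(4)[OF H(3)] wv(4)[OF H(4)] by eventually_elim linarith
 qed (use wu(5,6)[OF H(3)] wv(5,6)[OF H(4)] in auto)
 ultimately show ?thesis by (simp add: X_space_def)
qed

text \<open>The rate \<open>1/8\<close> is half of the rate \<open>1/4\<close> at which admissibility is needed, as \<open>kconv_kconv_le\<close> demands.\<close>

definition amp :: "(real => real) => real => real" where
 "amp N x = N x + kconv (1 / 8) N x"

lemma amp:
 assumes N: "weight m N"
 shows "weight (17 * m) (amp N)" "kconv (1 / 4) (amp N) x <= 17 * amp N x" "N x <= amp N x"
  "N2 N <= ennreal a ==> 0 <= a ==> N2 (amp N) <= ennreal (514 * a)"
proof -
 have ae: "amp N = (%x. N x + kconv (1 / 8) N x)" by (rule ext) (simp add: amp_def)
 have k8: "weight (16 * m) (kconv (1 / 8) N)" using weight_kconv[OF _ N, of "1 / 8"] by simp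
 show "weight (17 * m) (amp N)" using weight_add[OF N k8] by (simp add: ae)
 show "N x <= amp N x" using kconv_nonneg[OF N] by (simp add: amp_def)
 have "kconv (1 / 4) (amp N) x = kconv (1 / 4) N x + kconv (1 / 4) (kconv (1 / 8) N) x"
  unfolding ae by (rule kconv_add[OF _ N k8]) simp
 moreover have "kconv (1 / 4) N x <= kconv (1 / 8) N x" by (rule kconv_antimono[OF _ _ N]) simp_all
 moreover have "kconv (1 / 4) (kconv (1 / 8) N) x <= 16 * kconv (1 / 8) N x" using kconv_kconv_le[OF _ N, of "1 / 8" x] by simp
 ultimately show "kconv (1 / 4) (amp N) x <= 17 * amp N x" using weightD(2)[OF N, of x] by (simp add: amp_def)
 assume a: "N2 N <= ennreal a" "0 <= a"
 have "N2 (kconv (1 / 8) N) <= ennreal 256 * ennreal a"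
  using order_trans[OF N2_kconv[OF _ N, of "1 / 8"] mult_left_mono[OF a(1)]] by simp
 then have "N2 (kconv (1 / 8) N) <= ennreal (256 * a)" using a by (simp add: ennreal_mult)
 from N2_add_le[OF weightD(1)[OF N] weightD(1)[OF k8] a(1) this a(2)]
 show "N2 (amp N) <= ennreal (514 * a)" using a unfolding ae by simp
qed

text \<open>The numbers below come from \<open>\<alpha> = 1/2\<close>, \<open>\<beta> = 2\<close>, \<open>c = 17\<close> and \<open>M = 34 r\<close>: then \<open>36 (|kap| + 102 r)\<close> bounds the
  force relative to its weight, and the time is so short that force and velocity each contribute at most \<open>1/2\<close>.\<close>

definition lifespan :: "real => real => real" where
 "lifespan kap r = 1 / (1 + 72 * abs kap + 7344 * r)"

definition lag_speed :: "real => real => real" where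
 "lag_speed kap r = max 1 (36 * (abs kap + 102 * r))"

lemma lifespan: assumes "0 <= r" shows "0 < lifespan kap r" "r <= r' ==> lifespan kap r' <= lifespan kap r"
 "lifespan kap r * (36 * (abs kap + 102 * r)) <= 1 / 2" "lifespan kap r * (34 * r) <= 1 / 2"
proof -
 have pos: "0 < 1 + 72 * abs kap + 7344 * r" using assms by (simp add: add_pos_nonneg)
 show "0 < lifespan kap r" using pos by (simp add: lifespan_def)
 show "r <= r' ==> lifespan kap r' <= lifespan kap r" unfolding lifespan_def by (rule divide_left_mono) (use assms pos in \<open>auto intro!: mult_pos_pos add_pos_nonneg\<close>)
 show "lifespan kap r * (36 * (abs kap + 102 * r)) <= 1 / 2" "lifespan kap r * (34 * r) <= 1 / 2"
  unfolding lifespan_def using pos assms by (simp_all add: field_simps)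
qed

text \<open>The weight is twice \<open>amp N\<close> because Picard iteration asks for data bounded by half of the weight.\<close>

lemma lag_sol_of_data:
 assumes N: "weight m N" and F: "wbd N 1 F" and fin: "N2 N < \<infinity>" and mr: "m <= r"
 shows "\<exists>U. lag_sol kap (lifespan kap r) (1 / 2) 2 (34 * r) 17 (lag_speed kap r) (%x. 2 * amp N x) U F"
proof -
 have m: "0 <= m" by (rule weightD(4)[OF N])
 then have r: "0 <= r" using mr by simp
 have wm: "weight (17 * r) (amp N)" by (rule weight_mono[OF amp(1)[OF N]]) (use mr in simp)
 have D: "weight (34 * r) (%x. 2 * amp N x)" using weight_cmult[OF wm, of 2] by simp
 have k: "kconv (1 / 2 / 2) (%x. 2 * amp N x) x <= 17 * (2 * amp N x)" for x
  using kconv_cmult[of "1 / 4" 2 "amp N" x] amp(2)[OF N, of x] by simp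
 have P: "lag_params (lifespan kap r) (1 / 2) 2 (34 * r) 17 (lag_speed kap r) (%x. 2 * amp N x)"
  by unfold_locales (use D k order_less_imp_le[OF lifespan(1)[OF r, of kap]] in \<open>auto simp: lag_speed_def\<close>)
 have Kq: "lag_params.Kq kap (1 / 2) 2 (34 * r) 17 = 36 * (abs kap + 102 * r)"
  by (simp add: lag_params.Kq_def[OF P] src_const_def power2_eq_square)
 have le: "N x <= 1 / 2 * (2 * amp N x)" for x using amp(3)[OF N, of x] by simp
 have F': "wbd (%x. 2 * amp N x) (1 / 2) F" using wbd_weight_mono[OF N D le F] by simp
 have "\<exists>U. lag_params.traj (lifespan kap r) (1 / 2) 2 (lag_speed kap r) (%x. 2 * amp N x) U &
  (\<forall>t\<in>{-lifespan kap r..lifespan kap r}. \<forall>x. U t x = Phi kap F U t x)"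
  by (rule lag_params.lag_exists[OF P F']) (use lifespan(3,4)[OF r] in \<open>auto simp: Kq lag_speed_def\<close>)
 then obtain U where U: "lag_params.traj (lifespan kap r) (1 / 2) 2 (lag_speed kap r) (%x. 2 * amp N x) U"
  "!!t x. t \<in> {-lifespan kap r..lifespan kap r} ==> U t x = Phi kap F U t x" by blast
 obtain a where a: "N2 N <= ennreal a" "0 <= a" using fin by (cases "N2 N") (auto intro: that[of "enn2real (N2 N)"])
 have "N2 (%x. 2 * amp N x) <= ennreal 4 * ennreal (514 * a)"
  using mult_left_mono[OF amp(4)[OF N a], of "ennreal 4"] by (subst N2_cmult[OF weightD(1)[OF wm]]) simp
 also have "... < \<infinity>" by (simp add: ennreal_mult_less_top)
 finally have "N2 (%x. 2 * amp N x) < \<infinity>" .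
 then have "lag_sol kap (lifespan kap r) (1 / 2) 2 (34 * r) 17 (lag_speed kap r) (%x. 2 * amp N x) U F"
  unfolding lag_sol_def lag_sol_axioms_def using P U by blast
 then show ?thesis by blast
qed

lemma amp_N2:
 assumes "weight m N" "N2 N <= ennreal (4 * m^2)"
 shows "N2 (%x. 2 * amp N x) <= ennreal (8224 * m^2)"
proof -
 have "N2 (amp N) <= ennreal (514 * (4 * m^2))" by (rule amp(4)[OF assms]) simp
 note le = mult_left_mono[OF this, of "ennreal 4"]
 have eq: "ennreal (8224 * m^2) = ennreal 4 * ennreal (514 * (4 * m^2))" by (subst ennreal_mult[symmetric]) auto
 show ?thesis unfolding eq using le by (subst N2_cmult[OF weightD(1)[OF amp(1)[OF assms(1)]]]) simp
qed

lemma CH_solution_restrict: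
 assumes sol: "CH_solution kap T u0 u" and T: "T' <= T"
 shows "CH_solution kap T' u0 u"
proof -
 have sub: "{-T'..T'} \<subseteq> {-T..T}" "{-T'<..<T'} \<subseteq> {-T<..<T}" using T by auto
 have Z: "u \<in> C_H1 T" "u \<in> Linf_W1inf T" "u \<in> C1_L2 T" using sol by (auto simp: CH_solution_def Z_space_def)
 have "u \<in> C_H1 T'" using Z(1) sub(1) unfolding C_H1_def by (blast intro: tendsto_within_subset)
 moreover obtain M where "AE t in lborel. t \<in> {-T..T} --> u t \<in> W1inf_space & W1inf_norm (u t) <= M" using Z(2) by (auto simp: Linf_W1inf_def)
 then have "AE t in lborel. t \<in> {-T'..T'} --> u t \<in> W1inf_space & W1inf_norm (u t) <= M" by eventually_elim (use sub in blast)
 then have "u \<in> Linf_W1inf T'" by (auto simp: Linf_W1inf_def)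
 moreover have "u \<in> C1_L2 T'" using Z(3) sub(2) unfolding C1_L2_def by blast
 ultimately show ?thesis using sol sub(2) unfolding CH_solution_def Z_space_def by blast
qed

text \<open>The weight carries both bounds: its square integral gives \<open>287\<close> times the norm of the datum for the \<open>H1\<close> norm,
  its supremum \<open>204\<close> times for the other one, and \<open>287 + 204 \<le> 500\<close>.\<close>

lemma CH_solution_exists:
 assumes u: "u0 \<in> X_space"
 shows "\<exists>u. CH_solution kap (lifespan kap (X_norm u0)) u0 u &
  (\<forall>t\<in>{-lifespan kap (X_norm u0)..lifespan kap (X_norm u0)}. u t \<in> X_space & X_norm (u t) <= 500 * X_norm u0)"
proof -
 define m where "m = X_norm u0"
 have m: "0 <= m" using X_norm_nonneg[OF u] by (simp add: m_def)
 obtain F N where F: "AE x in lborel. u0 x = F x" "weight m N" "N2 N <= ennreal (4 * m^2)" "wbd N 1 F"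
  using X_space_weight[OF u] unfolding m_def by blast
 have "N2 N < \<infinity>" using le_less_trans[OF F(3) ennreal_less_top] by simp
 from lag_sol_of_data[OF F(2,4) this order_refl]
 obtain U where "lag_sol kap (lifespan kap m) (1 / 2) 2 (34 * m) 17 (lag_speed kap m) (%x. 2 * amp N x) U F" by blast
 note S = lag_sol.eul_CH_solution[OF this F(1)] lag_sol.eul_H1[OF this] lag_sol.eul_W1inf[OF this] lag_sol.eul_N2[OF this]
  lag_sol.eul_bLip[OF this] lag_sol.Kb_def[OF this]
 have Kb: "lag_sol.Kb (1 / 2) (34 * m) = 102 * m" using S(10) by simp
 have X: "eul U t \<in> X_space & X_norm (eul U t) <= 500 * m" if t: "t \<in> {-lifespan kap m..lifespan kap m}" for t
 proof -
  note D = amp_N2[OF F(2,3)]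
  have a: "N2 (eul U t) <= ennreal (2 * (8224 * m^2))"
   using order_trans[OF S(5)[OF t] mult_left_mono[OF D]] by (subst ennreal_mult) auto
  have "N2 (wd (eul U t)) <= ennreal (2 / (1 / 2)^2) * ennreal (8224 * m^2)"
   using order_trans[OF S(6)[OF t] mult_left_mono[OF D]] by simp
  also have "... = ennreal (8 * (8224 * m^2))" by (subst ennreal_mult[symmetric]) (auto simp: power2_eq_square)
  finally have b: "N2 (wd (eul U t)) <= ennreal (8 * (8224 * m^2))" .
  have "H1_norm (eul U t) <= sqrt (2 * (8224 * m^2) + 8 * (8224 * m^2))"
   by (rule H1_norm_le[OF bLip_deriv(1,4)[OF S(9)[OF t]] _ a b]) auto
  also have "... <= 287 * m" by (rule real_le_lsqrt) (use m in \<open>auto simp: power_mult_distrib\<close>)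
  finally have "X_norm (eul U t) <= 287 * m + (102 * m + 102 * m)"
   unfolding X_norm_def using S(4)[OF t] Kb by simp
  then show ?thesis using S(2,3)[OF t] m by (simp add: X_space_def)
 qed
 show ?thesis using S(1) X unfolding m_def by blast
qed

lemma CH_flow_solution:
 assumes "u0 \<in> X_space"
 shows "CH_solution kap (lifespan kap (X_norm u0)) u0 (CH_flow kap (lifespan kap (X_norm u0)) u0)"
 unfolding CH_flow_def by (rule someI_ex[of "CH_solution kap (lifespan kap (X_norm u0)) u0"]) (use CH_solution_exists[OF assms] in blast)

lemma CH_solution_eul:
 assumes w: "CH_solution kap T u0 w" and T: "0 < T" and L: "lag_sol kap T \<alpha> \<beta> M c \<Lambda> D U F" and F: "AE x in lborel. u0 x = F x"
 shows "t \<in> {-T..T} ==> w t \<in> Borel" "t \<in> {-T..T} ==> AE x in lborel. w t x = eul U t x"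
  "t \<in> {-T<..<T} ==> time_deriv w t \<in> Borel" "t \<in> {-T<..<T} ==> AE x in lborel. time_deriv w t x = vel kap (eul U t) x"
proof -
 have Z: "w \<in> C_H1 T" "w \<in> C1_L2 T" using w by (auto simp: CH_solution_def Z_space_def)
 show "w t \<in> Borel" if "t \<in> {-T..T}" using Z(1) that H1_space_primitive(2) by (auto simp: C_H1_def)
 show eq: "AE x in lborel. w t x = eul U t x" if "t \<in> {-T..T}" for t
  by (rule CH_solution_unique[OF w lag_sol.eul_CH_solution[OF L F] T that])
 assume t: "t \<in> {-T<..<T}"
 have "\<exists>v. has_L2_time_deriv w v t" using Z(2) t by (simp add: C1_L2_def)
 then have d: "has_L2_time_deriv w (time_deriv w t) t" using time_deriv_has_deriv by blast
 then show "time_deriv w t \<in> Borel" by (simp add: has_L2_time_deriv_def L2_space_iff)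
 have nb: "s \<in> {-T<..<T}" "s \<in> {-T..T}" if "abs (s - t) < T - abs t" for s using that by auto
 show "AE x in lborel. time_deriv w t x = vel kap (eul U t) x"
  by (rule has_L2_time_deriv_unique[OF d lag_sol.eul_has_time_deriv[OF L t], of "T - abs t"])
   (use nb Z(2) lag_sol.eul_L2[OF L] eq t in \<open>auto simp: C1_L2_def\<close>)
qed

lemma Z_dist_le:
 assumes w1: "CH_solution kap T u0 w1" "AE x in lborel. u0 x = F x" "lag_sol kap T \<alpha> \<beta> M c \<Lambda> D U F"
  and w2: "CH_solution kap T v0 w2" "AE x in lborel. v0 x = G x" "lag_sol kap T \<alpha> \<beta> M c \<Lambda> D' V G"
  and T: "0 < T" and e: "0 <= e" "0 <= \<eta>" "e + e <= \<eta>^2" "vel_const kap (M + M / \<alpha>) * e <= \<eta>^2"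
  and n: "!!t. t \<in> {-T..T} ==> N2 (%x. eul U t x - eul V t x) <= ennreal e & N2 (%x. wd (eul U t) x - wd (eul V t) x) <= ennreal e"
 shows "Z_dist T w1 w2 <= ennreal \<eta> + ennreal \<eta>"
proof -
 note a = CH_solution_eul[OF w1(1) T w1(3,2)] and b = CH_solution_eul[OF w2(1) T w2(3,2)]
 note lu = lag_sol.eul_bLip[OF w1(3), unfolded lag_sol.Kb_def[OF w1(3)]] and lv = lag_sol.eul_bLip[OF w2(3), unfolded lag_sol.Kb_def[OF w2(3)]]
 have "H1_norm (%x. w1 t x - w2 t x) <= \<eta>" if t: "t \<in> {-T..T}" for t
 proof -
  have ae: "AE x in lborel. w1 t x - w2 t x = eul U t x - eul V t x" using a(2)[OF t] b(2)[OF t] by eventually_elim simp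
  have "H1_norm (%x. w1 t x - w2 t x) <= sqrt (e + e)"
   by (rule H1_norm_le[OF Lipschitz_diff_primitive[OF lu[OF t] lv[OF t]] borel_measurable_diff[OF a(1)[OF t] b(1)[OF t]] ae])
    (use n[OF t] e in auto)
  also have "... <= \<eta>" by (rule real_le_lsqrt) (use e in auto)
  finally show ?thesis .
 qed
 moreover have "L2_norm (%x. time_deriv w1 t x - time_deriv w2 t x) <= \<eta>" if t: "t \<in> {-T<..<T}" for t
 proof -
  have t': "t \<in> {-T..T}" using t by simp
  have "AE x in lborel. time_deriv w1 t x - time_deriv w2 t x = vel kap (eul U t) x - vel kap (eul V t) x" using a(4)[OF t] b(4)[OF t] by eventually_elim simp
  then have "N2 (%x. time_deriv w1 t x - time_deriv w2 t x) = N2 (%x. vel kap (eul U t) x - vel kap (eul V t) x)" by (rule N2_cong_AE)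
  also have "... <= ennreal (vel_const kap (M + M / \<alpha>) * e)" by (rule vel_diff(1)[OF lu[OF t'] lv[OF t'] e(1)]) (use n[OF t'] in auto)
  also have "... <= ennreal (\<eta>^2)" by (rule ennreal_leI[OF e(4)])
  finally show ?thesis by (rule L2_norm_le[OF borel_measurable_diff[OF a(3)[OF t] b(3)[OF t]] _ e(2)])
 qed
 ultimately show ?thesis unfolding Z_dist_def by (intro add_mono SUP_least ennreal_leI) auto
qed

text \<open>All data in the ball are launched with the common bound \<open>B\<close>, so their Lagrangian solutions share
  parameters and lifespan; uniqueness identifies them with the flow.\<close>

lemma CH_flow_continuous:
 assumes B: "0 < B" and u: "u0 \<in> X_space" "X_norm u0 <= B" and eps: "0 < eps"
 shows "\<exists>\<delta>>0. \<forall>v0\<in>X_space. X_norm v0 <= B --> X_norm (%x. u0 x - v0 x) < \<delta> -->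
  Z_dist (lifespan kap B) (CH_flow kap (lifespan kap (X_norm u0)) u0) (CH_flow kap (lifespan kap (X_norm v0)) v0) < ennreal eps"
proof -
 define T where "T = lifespan kap B"
 have T: "0 < T" unfolding T_def by (rule lifespan) (use B in simp)
 have flow: "CH_solution kap T v0 (CH_flow kap (lifespan kap (X_norm v0)) v0)" if "v0 \<in> X_space" "X_norm v0 <= B" for v0
  unfolding T_def by (rule CH_solution_restrict[OF CH_flow_solution[OF that(1)] lifespan(2)[OF X_norm_nonneg[OF that(1)] that(2)]])
 have lag: "\<exists>F D U. (AE x in lborel. v0 x = F x) & lag_sol kap T (1 / 2) 2 (34 * B) 17 (lag_speed kap B) D U F & N2 D <= ennreal (8224 * B^2) & continuous_on UNIV F"
  if v: "v0 \<in> X_space" "X_norm v0 <= B" for v0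
 proof -
  obtain F N where F: "AE x in lborel. v0 x = F x" "weight (X_norm v0) N" "N2 N <= ennreal (4 * (X_norm v0)^2)" "wbd N 1 F"
   using X_space_weight[OF v(1)] by blast
  have "N2 N < \<infinity>" using le_less_trans[OF F(3) ennreal_less_top] by simp
  from lag_sol_of_data[OF F(2,4) this v(2)]
  obtain U where U: "lag_sol kap T (1 / 2) 2 (34 * B) 17 (lag_speed kap B) (%x. 2 * amp N x) U F" unfolding T_def by blast
  have "(X_norm v0)^2 <= B^2" by (rule power_mono[OF v(2) X_norm_nonneg[OF v(1)]])
  then have "N2 (%x. 2 * amp N x) <= ennreal (8224 * B^2)" by (intro order_trans[OF amp_N2[OF F(2,3)]] ennreal_leI) simp
  moreover have "continuous_on UNIV F" by (rule primitive_continuous[OF wbd_primitive(1)[OF F(2,4)]]) simp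
  ultimately show ?thesis using F(1) U by blast
 qed
 obtain F D U where F: "AE x in lborel. u0 x = F x" "continuous_on UNIV F" and U: "lag_sol kap T (1 / 2) 2 (34 * B) 17 (lag_speed kap B) D U F"
  using lag[OF u] by blast
 define vc where "vc = vel_const kap (34 * B + 34 * B / (1 / 2))"
 have vc: "0 <= vc" by (simp add: vc_def vel_const_def)
 define \<eta> where "\<eta> = eps / 4"
 have \<eta>: "0 < \<eta>" using eps by (simp add: \<eta>_def)
 define e where "e = \<eta>^2 / (2 + vc)"
 have e: "0 < e" using \<eta> vc by (simp add: e_def)
 have "(2 + vc) * e = \<eta>^2" unfolding e_def by (rule pos_mult_divide_cancel) (use vc in simp)
 then have "e + e + vc * e = \<eta>^2" by (simp add: algebra_simps)
 moreover have "0 <= vc * e" using vc e by simp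
 ultimately have ee: "e + e <= \<eta>^2" "vc * e <= \<eta>^2" using e by linarith+
 define S where "S = 8224 * B^2 + 2056"
 have S: "0 <= S" by (simp add: S_def)
 obtain \<delta> where \<delta>: "0 < \<delta>" and dep: "!!d V. lag_sol.close_data kap T (1 / 2) 2 (34 * B) 17 (lag_speed kap B) F S d V ==> d < \<delta> ==> (\<forall>t\<in>{-T..T}.
  N2 (%x. eul U t x - eul V t x) <= ennreal e & N2 (%x. wd (eul U t) x - wd (eul V t) x) <= ennreal e)"
  using lag_sol.continuous_dependence[OF U e S] by blast
 show ?thesis
  unfolding T_def[symmetric]
 proof (intro exI[of _ "\<delta> / 34"] conjI ballI impI)
  show "0 < \<delta> / 34" using \<delta> by simp
  fix v0 assume v: "v0 \<in> X_space" "X_norm v0 <= B" and uv: "X_norm (%x. u0 x - v0 x) < \<delta> / 34"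
  obtain G D' V where G: "AE x in lborel. v0 x = G x" "continuous_on UNIV G" and V: "lag_sol kap T (1 / 2) 2 (34 * B) 17 (lag_speed kap B) D' V G"
   and D': "N2 D' <= ennreal (8224 * B^2)" using lag[OF v] by blast
  note dX = X_space_diff[OF u(1) v(1)]
  define m where "m = X_norm (%x. u0 x - v0 x)"
  have m: "0 <= m" "m < \<delta> / 34" using X_norm_nonneg[OF dX] uv by (simp_all add: m_def)
  obtain H N where H: "AE x in lborel. u0 x - v0 x = H x" "weight m N" "N2 N <= ennreal (4 * m^2)" "wbd N 1 H"
   using X_space_weight[OF dX] unfolding m_def by blast
  have "AE x in lborel. F x - G x = H x" using F(1) G(1) H(1) by eventually_elim simp
  then have FG: "(%x. F x - G x) = H"
   by (rule continuous_AE_eq_imp_eq[rotated 2]) (intro continuous_on_diff F G primitive_continuous[OF wbd_primitive(1)[OF H(2,4)]]; simp)+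
  define d where "d = \<delta> / 2"
  have d: "0 < d" "d < \<delta>" "17 * m <= d" using \<delta> m by (auto simp: d_def)
  have E: "weight d (amp N)" by (rule weight_mono[OF amp(1)[OF H(2)] d(3)])
  have "m^2 <= d^2" by (rule power_mono) (use d m in auto)
  then have "514 * (4 * m^2) <= 2056 * d^2" by simp
  also have "... <= S * d^2" by (rule mult_right_mono) (simp_all add: S_def)
  finally have EN: "N2 (amp N) <= ennreal (S * d^2)"
   using order_trans[OF amp(4)[OF H(2,3)] ennreal_leI] by simp
  have "wbd (amp N) 1 H" using wbd_weight_mono[OF H(2) E _ H(4), of 1] amp(3)[OF H(2)] by simp
  moreover have "N2 D' <= ennreal S" by (rule order_trans[OF D' ennreal_leI]) (simp add: S_def)
  ultimately have "lag_sol.close_data kap T (1 / 2) 2 (34 * B) 17 (lag_speed kap B) F S d V"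
   unfolding lag_sol.close_data_def[OF U] using d V E EN amp(2)[OF H(2)] unfolding FG[symmetric] by auto
  from dep[OF this d(2)]
  have "Z_dist T (CH_flow kap (lifespan kap (X_norm u0)) u0) (CH_flow kap (lifespan kap (X_norm v0)) v0) <= ennreal \<eta> + ennreal \<eta>"
   by (intro Z_dist_le[OF flow[OF u] F(1) U flow[OF v] G(1) V T _ _ ee(1)]) (use e \<eta> ee in \<open>auto simp: vc_def\<close>)
  also have "... = ennreal (eps / 2)" using eps by (simp add: \<eta>_def flip: ennreal_plus)
  also have "... < ennreal eps" using eps by (simp add: ennreal_less_iff)
  finally show "Z_dist T (CH_flow kap (lifespan kap (X_norm u0)) u0) (CH_flow kap (lifespan kap (X_norm v0)) v0) < ennreal eps" .
 qed
qed

theorem theorem1p1: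
  shows "\<exists>c>0. \<forall>\<kappa>::real. \<exists>T :: real \<Rightarrow> real.
    monotone_on {0..} (\<le>) (\<ge>) T \<and> (\<forall>r\<ge>0. T r > 0) \<and>
    (\<forall>u0\<in>X_space. \<exists>u.
       CH_solution \<kappa> (T (X_norm u0)) u0 u \<and>
       (\<forall>v. CH_solution \<kappa> (T (X_norm u0)) u0 v \<longrightarrow>
          (\<forall>t\<in>{-T (X_norm u0)..T (X_norm u0)}. AE x in lborel. v t x = u t x)) \<and>
       (\<forall>t\<in>{-T (X_norm u0)..T (X_norm u0)}. u t \<in> X_space) \<and>
       (SUP t\<in>{-T (X_norm u0)..T (X_norm u0)}. ennreal (X_norm (u t)))
          \<le> ennreal (c * X_norm u0)) \<and>
    (\<forall>B>0.
       (\<forall>u0\<in>X_space. X_norm u0 \<le> B \<longrightarrow>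
          CH_flow \<kappa> (T (X_norm u0)) u0 \<in> Z_space (T B)) \<and>
       (\<forall>u0\<in>X_space. X_norm u0 \<le> B \<longrightarrow>
          (\<forall>\<epsilon>>0. \<exists>\<delta>>0. \<forall>v0\<in>X_space. X_norm v0 \<le> B \<longrightarrow>
             X_norm (\<lambda>x. u0 x - v0 x) < \<delta> \<longrightarrow>
             Z_dist (T B) (CH_flow \<kappa> (T (X_norm u0)) u0) (CH_flow \<kappa> (T (X_norm v0)) v0)
               < ennreal \<epsilon>)))"
proof (rule exI[of _ "500 :: real"], rule conjI, simp, rule allI, rename_tac kap, rule_tac x = "lifespan kap" in exI,
  intro conjI ballI allI impI)
  fix kap :: real
  show "monotone_on {0..} (<=) (\<ge>) (lifespan kap)" unfolding monotone_on_def using lifespan(2) by simp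
  show "0 < lifespan kap r" if "0 <= r" for r by (rule lifespan(1)[OF that])
 next
  fix kap :: real and u0 assume u: "u0 \<in> X_space"
  let ?T = "lifespan kap (X_norm u0)"
  obtain w where w: "CH_solution kap ?T u0 w" "!!t. t \<in> {-?T..?T} ==> w t \<in> X_space & X_norm (w t) <= 500 * X_norm u0"
   using CH_solution_exists[OF u, of kap] by blast
  show "\<exists>u. CH_solution kap ?T u0 u & (\<forall>v. CH_solution kap ?T u0 v --> (\<forall>t\<in>{-?T..?T}. AE x in lborel. v t x = u t x)) &
   (\<forall>t\<in>{-?T..?T}. u t \<in> X_space) & (SUP t\<in>{-?T..?T}. ennreal (X_norm (u t))) <= ennreal (500 * X_norm u0)"
  proof (intro exI[of _ w] conjI allI ballI impI w(1))
   show "AE x in lborel. v t x = w t x" if "CH_solution kap ?T u0 v" "t \<in> {-?T..?T}" for v t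
    by (rule CH_solution_unique[OF that(1) w(1) lifespan(1)[OF X_norm_nonneg[OF u]] that(2)])
   show "w t \<in> X_space" if "t \<in> {-?T..?T}" for t using w(2)[OF that] by simp
   show "(SUP t\<in>{-?T..?T}. ennreal (X_norm (w t))) <= ennreal (500 * X_norm u0)" by (intro SUP_least ennreal_leI) (use w(2) in blast)
  qed
 next
  fix kap B :: real and u0 assume u: "0 < B" "u0 \<in> X_space" "X_norm u0 <= B"
  show "CH_flow kap (lifespan kap (X_norm u0)) u0 \<in> Z_space (lifespan kap B)"
   using CH_solution_restrict[OF CH_flow_solution[OF u(2)] lifespan(2)[OF X_norm_nonneg[OF u(2)] u(3)]] by (simp add: CH_solution_def)
  fix eps :: real assume "0 < eps"
  then show "\<exists>\<delta>>0. \<forall>v0\<in>X_space. X_norm v0 <= B --> X_norm (%x. u0 x - v0 x) < \<delta> -->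
   Z_dist (lifespan kap B) (CH_flow kap (lifespan kap (X_norm u0)) u0) (CH_flow kap (lifespan kap (X_norm v0)) v0) < ennreal eps"
   by (rule CH_flow_continuous[OF u])
qed

end
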